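(* Let $X$ be a Banach space, $F:\mathbb{R}^{n+1}_+\to X$ strongly measurable and $\alpha\in(0,\infty)$. (a) If $X$ is UMD, $p\in(1,\infty)$ and $q\in(0,\infty)$, then $\|A^{(\alpha)}(F)\|_{L^p(\mathbb{R}^n)}\lesssim\|C^{(\alpha)}_q(F)\|_{L^p(\mathbb{R}^n)}$. (b) For any Banach space $X$ and $0<q<p\le\infty$, $\|C^{(\alpha)}_q(F)\|_{L^p(\mathbb{R}^n)}\lesssim\|A^{(\alpha)}(F)\|_{L^p(\mathbb{R}^n)}$. In particular, if $X$ is UMD and $0<q\le1<p<\infty$, then for all $\alpha,\beta\in(0,\infty)$, $\|A^{(\alpha)}(F)\|_{L^p(\mathbb{R}^n)}\eqsim\|C^{(\beta)}_q(F)\|_{L^p(\mathbb{R}^n)}$.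
   Context: Cones: $\Gamma_\alpha(x):=\{(y,t)\in\mathbb{R}^{n+1}_+:|y-x|<\alpha t\}$, $\Gamma_\alpha^h(x):=\{(y,t)\in\Gamma_\alpha(x):t<h\}$. Gauss norm: $H=L^2(\mathbb{R}^{n+1}_+,\,dy\,dt/t^{n+1})$, $(\gamma_j)$ independent complex standard Gaussians; for $T\in\mathcal{L}(H,X)$, $\|T\|_{\gamma(H,X)}:=\|\sum_j\gamma_jTe_j\|_{L^2(\Omega;X)}$ when this converges for an orthonormal basis $(e_j)$. For strongly measurable weakly-$L^2$ $\Phi:\mathbb{R}^{n+1}_+\to X$, $I_\Phi h:=$ Pettis-$\int\Phi h\,dy\,dt/t^{n+1}$, $\|\Phi\|_{\gamma(X)}:=\|I_\Phi\|_{\gamma(H,X)}$, and $\|\Phi\|_{\gamma(X)}:=\infty$ otherwise. $A^{(\alpha)}(F)(x):=\|F1_{\Gamma_\alpha(x)}\|_{\gamma(X)}$, $A^{(\alpha)}(F|h)(x):=\|F1_{\Gamma_\alpha^h(x)}\|_{\gamma(X)}$, and $C^{(\alpha)}_q(F)(x):=\sup_{B\ni x}\big(\frac1{|B|}\int_BA^{(\alpha)}(F|r(B))(y)^q\,dy\big)^{1/q}$ over open balls $B\ni x$ of radius $r(B)$. A UMD space is a Banach space with the unconditionality property of martingale differences. *)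

theory Defs
  imports "HOL-Analysis.Analysis" "HOL-Probability.Probability"
begin

type_synonym 'n uhs = "(real ^ 'n) \<times> real"

definition uhs_base :: "('n::finite) uhs measure" where
  "uhs_base = restrict_space lborel {z. snd z > 0}"

definition uhs :: "('n::finite) uhs measure" where
  "uhs = density uhs_base (\<lambda>z. ennreal (1 / snd z ^ (CARD('n) + 1)))"

definition strongly_measurable :: "'a measure \<Rightarrow> ('a \<Rightarrow> 'x::real_normed_vector) \<Rightarrow> bool" where
  "strongly_measurable M f \<longleftrightarrow>
     (\<exists>s::nat \<Rightarrow> 'a \<Rightarrow> 'x. (\<forall>i. simple_function M (s i)) \<and>
        (\<forall>x\<in>space M. (\<lambda>i. s i x) \<longlonglongrightarrow> f x))"

section \<open>Complex Banach spaces: a real Banach space with a complex structure J (multiplication by i)\<close>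

definition complex_structure :: "('x::banach \<Rightarrow> 'x) \<Rightarrow> bool" where
  "complex_structure J \<longleftrightarrow> linear J \<and> (\<forall>x. J (J x) = - x) \<and>
     (\<forall>a b x. norm (a *\<^sub>R x + b *\<^sub>R J x) = sqrt (a\<^sup>2 + b\<^sup>2) * norm x)"

definition scaleCJ :: "('x::real_vector \<Rightarrow> 'x) \<Rightarrow> complex \<Rightarrow> 'x \<Rightarrow> 'x" where
  "scaleCJ J z x = Re z *\<^sub>R x + Im z *\<^sub>R J x"

definition cfunctional :: "('x::real_normed_vector \<Rightarrow> 'x) \<Rightarrow> ('x \<Rightarrow> complex) \<Rightarrow> bool" where
  "cfunctional J \<phi> \<longleftrightarrow> bounded_linear \<phi> \<and> (\<forall>x. \<phi> (J x) = \<i> * \<phi> x)"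

definition sq_int :: "'a measure \<Rightarrow> ('a \<Rightarrow> complex) \<Rightarrow> bool" where
  "sq_int M h \<longleftrightarrow> h \<in> borel_measurable M \<and> integrable M (\<lambda>z. (cmod (h z))\<^sup>2)"

definition weakly_L2 :: "('x::real_normed_vector \<Rightarrow> 'x) \<Rightarrow> 'a measure \<Rightarrow> ('a \<Rightarrow> 'x) \<Rightarrow> bool" where
  "weakly_L2 J M \<Phi> \<longleftrightarrow> (\<forall>\<phi>. cfunctional J \<phi> \<longrightarrow> sq_int M (\<lambda>z. \<phi> (\<Phi> z)))"

definition pettis :: "('x::real_normed_vector \<Rightarrow> 'x) \<Rightarrow> 'a measure \<Rightarrow> ('a \<Rightarrow> 'x) \<Rightarrow> 'x \<Rightarrow> bool" where
  "pettis J M g x \<longleftrightarrow> (\<forall>\<phi>. cfunctional J \<phi> \<longrightarrow>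
      integrable M (\<lambda>z. \<phi> (g z)) \<and> \<phi> x = (\<integral>z. \<phi> (g z) \<partial>M))"

definition onb :: "'a measure \<Rightarrow> (nat \<Rightarrow> 'a \<Rightarrow> complex) \<Rightarrow> bool" where
  "onb M e \<longleftrightarrow> (\<forall>j. sq_int M (e j)) \<and>
     (\<forall>i j. (\<integral>z. e i z * cnj (e j z) \<partial>M) = (if i = j then 1 else 0)) \<and>
     (\<forall>h. sq_int M h \<and> (\<forall>j. (\<integral>z. h z * cnj (e j z) \<partial>M) = 0) \<longrightarrow> (AE z in M. h z = 0))"

text \<open>Standard complex Gaussian (E|g|^2 = 1) and a canonical i.i.d. sequence of them
  (the coordinates of the product space).\<close>
definition cgauss :: "complex measure" where
  "cgauss = density lborel (\<lambda>z. ennreal (exp (- (cmod z)\<^sup>2) / pi))"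

definition gspace :: "(nat \<Rightarrow> complex) measure" where
  "gspace = PiM UNIV (\<lambda>_. cgauss)"

definition epowr :: "ennreal \<Rightarrow> real \<Rightarrow> ennreal" where
  "epowr a r = (if a = \<infinity> then \<infinity> else ennreal (enn2real a powr r))"

definition gsum_L2lim :: "('x::real_normed_vector \<Rightarrow> 'x) \<Rightarrow> (nat \<Rightarrow> 'x) \<Rightarrow> ((nat \<Rightarrow> complex) \<Rightarrow> 'x) \<Rightarrow> bool" where
  "gsum_L2lim J x S \<longleftrightarrow> S \<in> borel_measurable gspace \<and>
     (\<integral>\<^sup>+\<omega>. ennreal ((norm (S \<omega>))\<^sup>2) \<partial>gspace) < \<infinity> \<and>
     (\<lambda>N. \<integral>\<^sup>+\<omega>. ennreal ((norm ((\<Sum>j<N. scaleCJ J (\<omega> j) (x j)) - S \<omega>))\<^sup>2) \<partial>gspace)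
        \<longlonglongrightarrow> 0"

definition gamma_op :: "('x::real_normed_vector \<Rightarrow> 'x) \<Rightarrow> 'a measure \<Rightarrow> (('a \<Rightarrow> complex) \<Rightarrow> 'x) \<Rightarrow> ennreal" where
  "gamma_op J M T =
     (if \<exists>e S. onb M e \<and> gsum_L2lim J (\<lambda>j. T (e j)) S
      then epowr (\<integral>\<^sup>+\<omega>. ennreal ((norm (snd (SOME (e, S). onb M e \<and> gsum_L2lim J (\<lambda>j. T (e j)) S) \<omega>))\<^sup>2) \<partial>gspace) (1/2)
      else \<infinity>)"

definition gamma_fun :: "('x::real_normed_vector \<Rightarrow> 'x) \<Rightarrow> 'a measure \<Rightarrow> ('a \<Rightarrow> 'x) \<Rightarrow> ennreal" where
  "gamma_fun J M \<Phi> =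
     (if strongly_measurable M \<Phi> \<and> weakly_L2 J M \<Phi> \<and>
         (\<forall>h. sq_int M h \<longrightarrow> (\<exists>x. pettis J M (\<lambda>z. scaleCJ J (h z) (\<Phi> z)) x))
      then gamma_op J M (\<lambda>h. SOME x. pettis J M (\<lambda>z. scaleCJ J (h z) (\<Phi> z)) x)
      else \<infinity>)"

definition cone :: "real \<Rightarrow> real ^ 'n \<Rightarrow> ('n::finite) uhs set" where
  "cone \<alpha> x = {z. snd z > 0 \<and> dist (fst z) x < \<alpha> * snd z}"

definition tcone :: "real \<Rightarrow> real \<Rightarrow> real ^ 'n \<Rightarrow> ('n::finite) uhs set" where
  "tcone \<alpha> h x = {z \<in> cone \<alpha> x. snd z < h}"

definition Aop :: "('x::real_normed_vector \<Rightarrow> 'x) \<Rightarrow> real \<Rightarrow> (('n::finite) uhs \<Rightarrow> 'x) \<Rightarrow> real ^ 'n \<Rightarrow> ennreal" where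
  "Aop J \<alpha> F x = gamma_fun J uhs (\<lambda>z. if z \<in> cone \<alpha> x then F z else 0)"

definition Atr :: "('x::real_normed_vector \<Rightarrow> 'x) \<Rightarrow> real \<Rightarrow> (('n::finite) uhs \<Rightarrow> 'x) \<Rightarrow> real \<Rightarrow> real ^ 'n \<Rightarrow> ennreal" where
  "Atr J \<alpha> F h x = gamma_fun J uhs (\<lambda>z. if z \<in> tcone \<alpha> h x then F z else 0)"

definition Cq :: "('x::real_normed_vector \<Rightarrow> 'x) \<Rightarrow> real \<Rightarrow> real \<Rightarrow> (('n::finite) uhs \<Rightarrow> 'x) \<Rightarrow> real ^ 'n \<Rightarrow> ennreal" where
  "Cq J \<alpha> q F x =
     (SUP cr \<in> {(c :: real ^ 'n, r :: real). r > 0 \<and> x \<in> ball c r}.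
        epowr ((\<integral>\<^sup>+y. indicator (ball (fst cr) (snd cr)) y * epowr (Atr J \<alpha> F (snd cr) y) q \<partial>lborel)
                 / emeasure lborel (ball (fst cr) (snd cr))) (1 / q))"

definition Lpn :: "ennreal \<Rightarrow> (real ^ 'n::finite \<Rightarrow> ennreal) \<Rightarrow> ennreal" where
  "Lpn p f = (if p = \<infinity> then Inf {c. AE x in lborel. f x \<le> c}
              else epowr (\<integral>\<^sup>+x. epowr (f x) (enn2real p) \<partial>lborel) (1 / enn2real p))"

text \<open>The mean-zero condition E[d_k 1_A] = 0 is tested against all x* in X* (Hahn-Banach),
  because Isabelle's Bochner integral needs separable targets.
  Finite X-valued L^p martingale difference sequence (d_0,...,d_N) w.r.t. a filtration F of M.\<close>
definition mds :: "real \<Rightarrow> 'w measure \<Rightarrow> (nat \<Rightarrow> 'w measure) \<Rightarrow> (nat \<Rightarrow> 'w \<Rightarrow> 'x::banach) \<Rightarrow> nat \<Rightarrow> bool" where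
  "mds p M F d N \<longleftrightarrow>
     (\<forall>i. space (F i) = space M \<and> sets (F i) \<subseteq> sets M) \<and>
     (\<forall>i j. i \<le> j \<longrightarrow> sets (F i) \<subseteq> sets (F j)) \<and>
     (\<forall>k\<le>N. strongly_measurable (F k) (d k) \<and>
             (\<integral>\<^sup>+\<omega>. ennreal (norm (d k \<omega>) powr p) \<partial>M) < \<infinity>) \<and>
     (\<forall>k. 0 < k \<and> k \<le> N \<longrightarrow>
             (\<forall>A\<in>sets (F (k - 1)). \<forall>\<phi>::'x \<Rightarrow> real. bounded_linear \<phi> \<longrightarrow>
                 (\<integral>\<omega>. indicator A \<omega> * \<phi> (d k \<omega>) \<partial>M) = 0))"

definition UMD :: "'x::banach itself \<Rightarrow> bool" where
  "UMD _ \<longleftrightarrow> (\<forall>p::real. 1 < p \<longrightarrow> (\<exists>\<beta>::real.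
     \<forall>(M :: (nat \<Rightarrow> 'x) measure) F (d :: nat \<Rightarrow> (nat \<Rightarrow> 'x) \<Rightarrow> 'x) N (\<epsilon> :: nat \<Rightarrow> real).
        prob_space M \<and> mds p M F d N \<and> (\<forall>k. \<epsilon> k \<in> {-1, 1}) \<longrightarrow>
        epowr (\<integral>\<^sup>+\<omega>. ennreal (norm (\<Sum>k\<le>N. \<epsilon> k *\<^sub>R d k \<omega>) powr p) \<partial>M) (1/p)
          \<le> ennreal \<beta> * epowr (\<integral>\<^sup>+\<omega>. ennreal (norm (\<Sum>k\<le>N. d k \<omega>) powr p) \<partial>M) (1/p)))"

end

(* Rotation invariance of Gaussian sums, extended to contractions by a Gram factorization, turns
 the gamma norm of a weight times F into a functional Q of the weight, monotone in its absolute value.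
 In a UMD space Stein's inequality for dyadic filtrations changes the aperture of the cones: averaging
 the indicators of narrow cones over the cubes of a suitably shifted grid dominates wide ones. On the
 set where A with aperture alpha + 3 exceeds a level, Vitali balls split each cone into a part below
 the radius of the ball, controlled by C_q, and a part inside a larger cone at a point off that set;
 the good lambda inequality is absorbed after truncating F. The converse bound is the maximal theorem
 for a measurable minorant of A. *)
theory Submission
 imports Defs
begin

text \<open>The functional Q is there because the gamma norm itself is hard to handle: it is
  evaluated at a basis picked by choice, it jumps to infinity when a Pettis integral or a Gaussian
  series fails to exist, and nothing is known about measurability of A in the vertex of the cone. Q
  is a supremum of second moments of finite Gaussian sums, so it is lower semicontinuous and
  measurable. That Q controls the gamma norm means that bounded Gaussian series converge; in a UMD
  space this is extracted from a bounded scalar martingale with growing transforms. The space may be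
  nonseparable: vector identities are tested on functionals, and integral operators are limits of
  finite rank ones. Stein's inequality uses a martingale that reveals Gaussians and partitions
  alternately. Since the cube to be averaged over depends on the height of a point, the basis is cut
  along dyadic heights; the pieces are no longer orthonormal, hence frames and Bessel families
  instead of bases. Absorption needs a finite left side; one point with finite C_q suffices, by
  compactness of boxes in the half space.\<close>

abbreviation (input) nn_lborel (binder "LN " 10) where "nn_lborel f \<equiv> nn_integral lborel f"
abbreviation (input) "NI \<equiv> nn_integral"
abbreviation (input) "LI \<equiv> lebesgue_integral"
abbreviation (input) iffa (infixr "<->" 25) where "A <-> B \<equiv> A \<longleftrightarrow> B"
abbreviation (input) lims (infix "~~>" 60) where "f ~~> a \<equiv> f \<longlonglongrightarrow> a"
abbreviation (input) "en \<equiv> ennreal"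
abbreviation (input) "nq v \<equiv> ennreal ((norm v)^2)"
abbreviation (input) "np p v \<equiv> ennreal (norm v powr p)"
abbreviation (input) scR (infixr "*R" 75) where "(a::real) *R v \<equiv> a *\<^sub>R v"
abbreviation (input) pair_m (infixr "\<otimes>" 80) where "M \<otimes> N \<equiv> M \<Otimes>\<^sub>M N"
abbreviation (input) "bm \<equiv> borel_measurable"
abbreviation (input) "cor \<equiv> complex_of_real"
abbreviation (input) ind :: "'a set => 'a => 'b::zero_neq_one" where "ind \<equiv> indicator"
abbreviation (input) sm :: "'a measure => ('a => 'x::real_normed_vector) => bool" where "sm \<equiv> strongly_measurable"

lemmas bint_cong = Bochner_Integration.integral_cong[OF refl]
lemmas bint_bound = Bochner_Integration.integrable_bound
lemmas bm_cont = borel_measurable_continuous_onI continuous_intros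

section \<open>Functionals on normed spaces\<close>

text \<open>Zorn's lemma on graphs: subspaces of pairs whose second entry is dominated by the norm
  of the first. A maximal graph is total, since it could otherwise be extended by one more vector,
  and domination alone makes it single-valued.\<close>

lemma hahn_banach_norming:
 fixes x :: "'x::real_normed_vector"
 shows "EX ph::'x => real. bounded_linear ph & ph x = norm x & (ALL v. \<bar>ph v\<bar> <= norm v)"
proof -
 define \<G> :: "('x \<times> real) set set"
  where "\<G> = {G. subspace G & (x, norm x) : G & (ALL (v,a):G. a <= norm v)}"
 have G0: "span {(x, norm x)} : \<G>"
  unfolding \<G>_def mem_Collect_eq by (intro conjI subspace_span span_base) (auto simp: span_singleton intro!: mult_right_mono)
 have "EX G:\<G>. ALL X:\<G>. G <= X --> X = G"
 proof (rule subset_Zorn_nonempty)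
  show "\<G> ~= {}" using G0 by auto
 next
  fix \<C> assume ne: "\<C> ~= {}" and ch: "subset.chain \<G> \<C>"
  hence sub: "\<C> <= \<G>" and tot: "!!A B. A : \<C> ==> B : \<C> ==> A <= B | B <= A"
   by (auto simp: subset.chain_def)
  have mem: "subspace A" "(x, norm x) : A" "ALL (v,a):A. a <= norm v" if "A : \<C>" for A
   using sub that by (auto simp: \<G>_def)
  have "subspace (\<Union>\<C>)"
   unfolding subspace_def
  proof (intro conjI ballI allI)
   show "0 : \<Union>\<C>" using ne mem(1) subspace_0 by blast
  next
   fix u v assume "u : \<Union>\<C>" "v : \<Union>\<C>"
   then obtain A B where "A : \<C>" "B : \<C>" "u : A" "v : B" by blast
   then obtain D where "D : \<C>" "u : D" "v : D" using tot[of A B] by blast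
   thus "u + v : \<Union>\<C>" using mem(1) subspace_add by blast
  next
   fix c u assume "u : \<Union>\<C>"
   thus "c *R u : \<Union>\<C>" using mem(1) subspace_scale by blast
  qed
  moreover have "(x, norm x) : \<Union>\<C>" using ne mem(2) by blast
  moreover have "ALL (v,a):\<Union>\<C>. a <= norm v" using mem(3) by blast
  ultimately show "\<Union>\<C> : \<G>" unfolding \<G>_def by blast
 qed
 then obtain G where G: "G : \<G>" and Gmax: "!!X. X : \<G> ==> G <= X ==> X = G" by auto
 have sG: "subspace G" and xG: "(x, norm x) : G" and leG: "!!v a. (v,a) : G ==> a <= norm v"
  using G by (auto simp: \<G>_def)
 have dom: "EX a. (y,a) : G" for y
 proof -
  \<comment> \<open>The value at \<open>y\<close> must lie above all \<open>a - norm (v - y)\<close>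
    and below all \<open>norm (v + y) - a\<close>. \<open>key\<close> separates the two families, so
    the supremum of the first is admissible.\<close>
  define c where "c = Sup ((%(v,a). a - norm (v - y)) ` G)"
  have key: "b - norm (w - y) <= norm (v + y) - a" if "(v,a) : G" "(w,b) : G" for v a w b
  proof -
   have "(v + w, a + b) : G" using subspace_add[OF sG that] by simp
   from leG[OF this] have "a + b <= norm (v + w)" .
   also have "... = norm ((v + y) + (w - y))" by simp
   also have "... <= norm (v + y) + norm (w - y)" by (rule norm_triangle_ineq)
   finally show ?thesis by simp
  qed
  have bdd: "bdd_above ((%(v,a). a - norm (v - y)) ` G)"
   using key[OF xG] by (intro bdd_aboveI[of _ "norm (x+y) - norm x"]) auto
  have c1: "c <= norm (v + y) - a" if "(v,a) : G" for v a
   unfolding c_def using xG key[OF that] by (intro cSup_least) auto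
  have c2: "a - norm (v - y) <= c" if "(v,a) : G" for v a
   unfolding c_def by (rule cSup_upper[OF _ bdd]) (use that in force)
  define G' where "G' = span (insert (y,c) G)"
  have "ALL (v,a):G'. a <= norm v"
  proof safe
   fix v a assume "(v,a) : G'"
   then obtain t where t: "(v,a) - t *R (y,c) : span G"
    unfolding G'_def span_insert by auto
   hence tG: "(v - t *R y, a - t * c) : G" using sG by (simp add: span_eq_iff[THEN iffD2])
   show "a <= norm v"
   proof (cases t "0::real" rule: linorder_cases)
    case equal thus ?thesis using leG[OF tG] by simp
   next
    case greater
    have "((1/t) *R (v - t *R y), (1/t) * (a - t * c)) : G"
     using subspace_scale[OF sG tG, of "1/t"] by simp
    from c1[OF this] have "c <= norm ((1/t) *R (v - t *R y) + y) - (1/t) * (a - t * c)" .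
    also have "(1/t) *R (v - t *R y) + y = (1/t) *R v" using greater by (simp add: algebra_simps)
    finally show ?thesis using greater by (simp add: field_simps)
   next
    case less
    have "((1/(-t)) *R (v - t *R y), (1/(-t)) * (a - t * c)) : G"
     using subspace_scale[OF sG tG, of "1/(-t)"] by simp
    from c2[OF this] have "(1/(-t)) * (a - t * c) - norm ((1/(-t)) *R (v - t *R y) - y) <= c" .
    also have "(1/(-t)) *R (v - t *R y) - y = (1/(-t)) *R v" using less by (simp add: algebra_simps)
    finally show ?thesis using less by (simp add: field_simps)
   qed
  qed
  moreover have "subspace G'" by (simp add: G'_def)
  moreover have "G <= G'" unfolding G'_def by (meson span_superset subset_insertI subset_trans)
  ultimately have "G' : \<G>" using xG by (auto simp: \<G>_def)
  with Gmax `G <= G'` have "G' = G" by auto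
  moreover have "(y,c) : G'" unfolding G'_def by (simp add: span_base)
  ultimately show ?thesis by auto
 qed
 have uniq: "a = b" if "(v,a) : G" "(v,b) : G" for v a b
 proof -
  have "(0, a - b) : G" "(0, b - a) : G"
   using subspace_diff[OF sG that] subspace_diff[OF sG that(2,1)] by auto
  from leG[OF this(1)] leG[OF this(2)] show ?thesis by simp
 qed
 define ph where "ph v = (THE a. (v,a) : G)" for v
 have phi: "(v, ph v) : G" for v
  unfolding ph_def using dom[of v] uniq by (metis theI)
 have phi_eq: "ph v = a" if "(v,a) : G" for v a using uniq[OF phi that] .
 have lin: "linear ph"
 proof (rule linearI)
  fix u v show "ph (u + v) = ph u + ph v"
   using subspace_add[OF sG phi[of u] phi[of v]] by (intro phi_eq) simp
  fix c show "ph (c *R u) = c *R ph u"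
   using subspace_scale[OF sG phi[of u], of c] by (intro phi_eq) simp
 qed
 have bd: "\<bar>ph v\<bar> <= norm v" for v
  using leG[OF phi[of v]] leG[OF phi[of "-v"]] linear_neg[OF lin, of v] by auto
 have "bounded_linear ph"
  using lin bd by (intro bounded_linear_intro[where K=1]) (auto simp: linear_add linear_scale)
 thus ?thesis using phi_eq[OF xG] bd by auto
qed

section \<open>Complex scalars and complex functionals\<close>

locale complex_banach =
 fixes J :: "'x::banach => 'x"
 assumes cs: "complex_structure J"
begin

abbreviation scl (infixr ".*" 75) where "scl z x == scaleCJ J z x"

lemma linJ: "linear J" and JJ[simp]: "J (J x) = - x"
 and norm_J: "norm (a *R x + b *R J x) = sqrt (a^2 + b^2) * norm x"
 using cs by (auto simp: complex_structure_def)

lemma Jadd: "J (x + y) = J x + J y" and JscaleR: "J (r *R x) = r *R J x" and J0[simp]: "J 0 = 0"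
 and Jneg: "J (- x) = - J x" and Jdiff: "J (x - y) = J x - J y"
 using linJ by (auto simp: linear_add linear_scale linear_0 linear_neg linear_diff)

lemma norm_scl[simp]: "norm (z .* x) = cmod z * norm x"
 by (simp add: scaleCJ_def norm_J cmod_def)

lemma scl_add_right: "z .* (x + y) = z .* x + z .* y"
 and scl_add_left: "(z + w) .* x = z .* x + w .* x"
 and scl_diff_right: "z .* (x - y) = z .* x - z .* y"
 and scl_diff_left: "(z - w) .* x = z .* x - w .* x"
 and scl_mult: "z .* (w .* x) = (z * w) .* x"
 and scl_zero_left[simp]: "0 .* x = 0" and scl_zero_right[simp]: "z .* 0 = 0"
 and scl_one[simp]: "1 .* x = x" and scl_minus_left: "(- z) .* x = - (z .* x)"
 and scl_minus_right: "z .* (- x) = - (z .* x)"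
 and scl_of_real: "cor r .* x = r *R x"
 by (auto simp: scaleCJ_def Jadd JscaleR Jneg Jdiff algebra_simps)

lemma scl_sum_right: "z .* (SUM i:A. f i) = (SUM i:A. z .* f i)"
 by (induction A rule: infinite_finite_induct) (auto simp: scl_add_right)

lemma scl_scaleR: "z .* (r *R x) = r *R (z .* x)" "(r *R z) .* x = r *R (z .* x)"
 by (auto simp: scaleCJ_def JscaleR algebra_simps)

lemma bounded_linear_scl: "bounded_linear (%x. z .* x)"
 by (rule bounded_linear_intro[where K="cmod z"]) (simp_all add: scl_add_right scl_scaleR mult.commute)

lemma continuous_on_scl[continuous_intros]:
 assumes "continuous_on S f" "continuous_on S g"
 shows "continuous_on S (%x. f x .* g x)"
proof -
 have "bounded_linear J"
  using norm_J[of 0 _ 1] by (intro bounded_linear_intro[where K=1]) (auto simp: Jadd JscaleR)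
 hence "continuous_on S (%x. J (g x))"
  using assms(2) by (rule bounded_linear.continuous_on)
 thus ?thesis unfolding scaleCJ_def
  using assms by (auto intro!: continuous_intros)
qed

lemma cf_scl: "cfunctional J ph ==> ph (z .* x) = z * ph x"
 unfolding cfunctional_def scaleCJ_def
 by (auto simp: linear_add linear_scale bounded_linear.linear complex_eq_iff scaleR_conv_of_real)

lemma cf_linear: "cfunctional J ph ==> linear ph"
 by (auto simp: cfunctional_def bounded_linear.linear)

lemma cf_0: "cfunctional J ph ==> ph 0 = 0"
 by (rule linear_0[OF cf_linear])

lemma cf_bounded_linear: "cfunctional J ph ==> bounded_linear ph"
 by (auto simp: cfunctional_def)

text \<open>The complex functional with real part \<open>py\<close> is
  \<open>py v - i py (J v)\<close>. Rotating \<open>v\<close> by the phase of \<open>ph v\<close>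
  makes the value real, so the real norm bound carries over; at \<open>x\<close> the real part
  already exhausts the bound, so the imaginary part vanishes.\<close>

lemma norming_functional:
 "EX ph. cfunctional J ph & (ALL v. cmod (ph v) <= norm v) & ph x = cor (norm x)"
proof -
 obtain py :: "'x => real" where psi: "bounded_linear py" "py x = norm x" "!!v. \<bar>py v\<bar> <= norm v"
  using hahn_banach_norming[of x] by auto
 define ph where "ph v = Complex (py v) (- py (J v))" for v
 note l = bounded_linear.linear[OF psi(1)]
 have add: "ph (u + v) = ph u + ph v" for u v
  by (simp add: ph_def complex_eq_iff Jadd linear_add[OF l])
 have sc: "ph (r *R v) = r *R ph v" for r v
  by (simp add: ph_def complex_eq_iff JscaleR linear_scale[OF l])
 have phJ: "ph (J v) = \<i> * ph v" for v
  by (simp add: ph_def complex_eq_iff linear_neg[OF l])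
 have ps: "ph (z .* v) = z * ph v" for z v
  by (simp add: scaleCJ_def add sc phJ scaleR_conv_of_real) (simp add: complex_eq_iff algebra_simps)
 have bd: "cmod (ph v) <= norm v" for v
 proof (cases "ph v = 0")
  case False
  define u where "u = cnj (ph v) / cmod (ph v)"
  have "cmod u = 1" using False by (simp add: u_def norm_divide)
  have "ph (u .* v) = cmod (ph v)"
   unfolding ps u_def using False by (simp add: field_simps complex_norm_square[symmetric] power2_eq_square)
  hence "cmod (ph v) = py (u .* v)" by (simp add: ph_def complex_eq_iff)
  also have "... <= norm (u .* v)" using psi(3)[of "u .* v"] by simp
  finally show ?thesis using `cmod u = 1` by simp
 qed auto
 have "bounded_linear ph"
  by (rule bounded_linear_intro[where K=1]) (auto simp: add sc bd)
 moreover have "ph x = cor (norm x)"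
 proof -
  have "sqrt ((norm x)^2 + (py (J x))^2) <= norm x"
   using bd[of x] psi(2) by (simp add: ph_def cmod_def)
  from sqrt_le_D[OF this] have "py (J x) = 0" by simp
  thus ?thesis by (simp add: ph_def psi(2) complex_eq_iff)
 qed
 ultimately show ?thesis using bd phJ unfolding cfunctional_def by blast
qed

lemma norm_le_functionals:
 assumes "!!ph. cfunctional J ph ==> (!!v. cmod (ph v) <= norm v) ==> cmod (ph x) <= K"
 shows "norm x <= K"
 using norming_functional[of x] assms by force

lemma eq_functionals:
 assumes "!!ph. cfunctional J ph ==> ph x = ph y"
 shows "x = y"
proof -
 have "norm (x - y) <= 0"
  by (rule norm_le_functionals) (use assms in "auto simp: linear_diff cf_linear")
 thus ?thesis by simp
qed

end

section \<open>Strong measurability\<close>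

lemma sm_simple: "simple_function M s ==> sm M s"
 unfolding strongly_measurable_def by (intro exI[of _ "%_. s"]) auto

lemma sm_const[simp]: "sm M (%_. c)"
 by (rule sm_simple) simp

lemma sm_compose2:
 fixes f :: "'a => 'b::real_normed_vector" and g :: "'a => 'c::real_normed_vector"
  and h :: "'b => 'c => 'd::real_normed_vector"
 assumes "sm M f" "sm M g"
  and "continuous_on UNIV (%(x,y). h x y)"
 shows "sm M (%x. h (f x) (g x))"
proof -
 obtain s t where s: "!!i. simple_function M (s i)" "!!x. x : space M ==> (%i. s i x) ~~> f x"
  and t: "!!i. simple_function M (t i)" "!!x. x : space M ==> (%i. t i x) ~~> g x"
  using assms unfolding strongly_measurable_def by metis
 show ?thesis unfolding strongly_measurable_def
 proof (intro exI conjI allI ballI)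
  show "simple_function M (%x. h (s i x) (t i x))" for i
   by (rule simple_function_compose2[OF s(1) t(1)])
  show "(%i. h (s i x) (t i x)) ~~> h (f x) (g x)" if "x : space M" for x
   using continuous_on_tendsto_compose[OF assms(3) tendsto_Pair[OF s(2)[OF that] t(2)[OF that]]] by simp
 qed
qed

lemma sm_compose:
 fixes f :: "'a => 'b::real_normed_vector" and h :: "'b => 'd::real_normed_vector"
 assumes "sm M f" "continuous_on UNIV h"
 shows "sm M (%x. h (f x))"
 by (rule sm_compose2[OF assms(1) assms(1), of "%x y. h x"])
  (auto simp: case_prod_beta intro!: continuous_on_compose2[OF assms(2)] continuous_intros)

lemma sm_add: "sm M f ==> sm M g ==> sm M (%x. f x + g x)"
 by (rule sm_compose2) (auto simp: case_prod_beta intro!: continuous_intros)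

lemma sm_diff: "sm M f ==> sm M g ==> sm M (%x. f x - g x)"
 by (rule sm_compose2) (auto simp: case_prod_beta intro!: continuous_intros)

lemma sm_scaleR: "sm M f ==> sm M g ==> sm M (%x. f x *R g x)"
 by (rule sm_compose2) (auto simp: case_prod_beta intro!: continuous_intros)

lemma sm_sum: "(!!i. i : A ==> sm M (f i)) ==> sm M (%x. SUM i:A. f i x)"
 by (induction A rule: infinite_finite_induct) (auto intro!: sm_add)

lemma (in complex_banach) sm_scl:
 "sm M f ==> sm M g ==> sm M (%x. f x .* g x)"
 by (rule sm_compose2) (auto simp: case_prod_beta intro!: continuous_intros)

lemma sm_borel: "sm M f ==> f : bm M"
 unfolding strongly_measurable_def
 by (metis borel_measurable_LIMSEQ_metric borel_measurable_simple_function)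

lemma sm_comp_measurable:
 assumes "sm N f" "g : measurable M N"
 shows "sm M (%x. f (g x))"
proof -
 obtain s where s: "!!i. simple_function N (s i)" "!!x. x : space N ==> (%i. s i x) ~~> f x"
  using assms unfolding strongly_measurable_def by metis
 show ?thesis unfolding strongly_measurable_def
 proof (intro exI conjI allI ballI)
  show "simple_function M (%x. s i (g x))" for i
  proof -
   have sub: "(%x. s i (g x)) ` space M <= s i ` space N"
    using measurable_space[OF assms(2)] by auto
   have "(%x. s i (g x)) -` {v} Int space M : sets M" for v
   proof -
    have "(%x. s i (g x)) -` {v} Int space M = g -` (s i -` {v} Int space N) Int space M"
     using measurable_space[OF assms(2)] by auto
    thus ?thesis
     using measurable_sets[OF assms(2) simple_functionD(2)[OF s(1)]] by simp
   qed
   thus ?thesis unfolding simple_function_def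
    using finite_subset[OF sub simple_functionD(1)[OF s(1)]] by auto
  qed
  show "(%i. s i (g x)) ~~> f (g x)" if "x : space M" for x
   using s(2) measurable_space[OF assms(2) that] by auto
 qed
qed

lemma sm_of_borel:
 fixes f :: "'a => 'b::{real_normed_vector, second_countable_topology}"
 assumes "f : bm M"
 shows "sm M f"
 using borel_measurable_implies_sequence_metric[OF assms] unfolding strongly_measurable_def by metis

text \<open>A Borel function with values in the closure of a countable set is strongly measurable:
 move to the nearest of the first \<open>n\<close> points.\<close>
lemma sm_separable:
 fixes f :: "'a => 'b::real_normed_vector" and d :: "nat => 'b"
 assumes f: "f : bm M" and D: "!!x. x : space M ==> f x : closure (range d)"
 shows "sm M f"
proof -
 define s where "s = rec_nat (%x. d 0)
  (%n s x. if dist (f x) (d (Suc n)) < dist (f x) (s x) then d (Suc n) else s x)"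
 have s0: "s 0 = (%x. d 0)"
  and sS: "s (Suc n) = (%x. if dist (f x) (d (Suc n)) < dist (f x) (s n x) then d (Suc n) else s n x)" for n
  by (auto simp: s_def)
 have simp: "simple_function M (s n)" for n
 proof (induction n)
  case (Suc n)
  have "(%x. dist (f x) (s n x)) : bm M"
  proof -
   have "(%x. dist (f x) v) : bm M" for v
    by (rule measurable_compose[OF f]) (auto intro!: bm_cont)
   hence "(%x. (SUM v:s n ` space M. ind (s n -` {v} Int space M) x * dist (f x) v)) : bm M"
    using simple_functionD(2)[OF Suc, of "{_}"] by (intro borel_measurable_sum borel_measurable_times) auto
   moreover have "(SUM v:s n ` space M. ind (s n -` {v} Int space M) x * dist (f x) v) = dist (f x) (s n x)"
    if "x : space M" for x
   proof -
    have "(SUM v:s n ` space M. ind (s n -` {v} Int space M) x * dist (f x) v)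
      = (SUM v:s n ` space M. if v = s n x then dist (f x) v else 0)"
     using that by (intro sum.cong) (auto simp: indicator_def)
    thus ?thesis using that simple_functionD(1)[OF Suc] by (simp add: sum.delta)
   qed
   ultimately show ?thesis by (simp cong: measurable_cong)
  qed
  moreover have "(%x. dist (f x) (d (Suc n))) : bm M"
   by (rule measurable_compose[OF f]) (auto intro!: bm_cont)
  ultimately have "{x : space M. dist (f x) (d (Suc n)) < dist (f x) (s n x)} : sets M" by measurable
  thus ?case unfolding sS by (intro simple_function_If Suc) auto
 qed (simp add: s0)
 have near: "dist (f x) (s n x) <= dist (f x) (d i)" if "i <= n" for x n i
  using that
 proof (induction n)
  case (Suc n)
  show ?case
  proof (cases "i = Suc n")
   case False
   hence "dist (f x) (s n x) <= dist (f x) (d i)" using Suc by auto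
   thus ?thesis by (auto simp: sS)
  qed (auto simp: sS)
 qed (auto simp: s0)
 have "(%n. s n x) ~~> f x" if "x : space M" for x
 proof (rule metric_LIMSEQ_I, goal_cases)
  case (1 e)
  then obtain i where i: "dist (d i) (f x) < e"
   using D[OF `x : space M`] unfolding closure_approachable by blast
  thus ?case
   using near[of i _ x] by (intro exI[of _ i]) (auto simp: dist_commute intro: le_less_trans[OF _ i])
 qed
 thus ?thesis unfolding strongly_measurable_def using simp by blast
qed

text \<open>The limit is Borel and takes its values in the closure of the countable set of all
  values of all approximating simple functions, so \<open>sm_separable\<close> applies.\<close>

lemma sm_limit:
 fixes f :: "nat => 'a => 'b::real_normed_vector"
 assumes f: "!!i. sm M (f i)" and l: "!!x. x : space M ==> (%i. f i x) ~~> g x"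
 shows "sm M g"
proof -
 have g: "g : bm M"
  by (rule borel_measurable_LIMSEQ_metric[OF sm_borel[OF f] l])
 obtain s where s: "!!i k. simple_function M (s i k)"
  "!!i x. x : space M ==> (%k. s i k x) ~~> f i x"
  using f unfolding strongly_measurable_def by metis
 define D where "D = insert 0 (UN i. UN k. s i k ` space M)"
 have "countable D" unfolding D_def
  by (intro countable_insert countable_UN countableI_type countable_finite[OF simple_functionD(1)[OF s(1)]])
 then obtain d :: "nat => 'b" where d: "range d = D"
  using range_from_nat_into[of D] by (metis D_def insert_not_empty)
 show ?thesis
 proof (rule sm_separable[OF g, of d])
  fix x assume x: "x : space M"
  have "f i x : closure D" for i
  proof (rule closed_sequentially[OF closed_closure _ s(2)[OF x, of i]])
   show "s i k x : closure D" for k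
    using x by (intro subsetD[OF closure_subset]) (force simp: D_def)
  qed
  thus "g x : closure (range d)"
   unfolding d using closed_sequentially[OF closed_closure _ l[OF x]] by blast
 qed
qed

text \<open>\<open>g\<close> is only Borel, and in a nonseparable space differences of Borel
  functions need not be Borel. Approximating \<open>f\<close> by simple functions reduces the claim
  to finitely many fixed vectors at a time.\<close>

lemma sm_norm_diff[measurable]:
 fixes f :: "'a => 'b::real_normed_vector"
 assumes "sm M f" and g: "g : bm M"
 shows "(%x. norm (f x - g x)) : bm M"
proof -
 obtain s where s: "!!i. simple_function M (s i)" "!!x. x : space M ==> (%i. s i x) ~~> f x"
  using assms unfolding strongly_measurable_def by metis
 show ?thesis
 proof (rule borel_measurable_LIMSEQ_real)
  show "(%i. norm (s i x - g x)) ~~> norm (f x - g x)" if "x : space M" for x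
   using s(2)[OF that] by (intro tendsto_intros)
  show "(%x. norm (s i x - g x)) : bm M" for i
  proof -
   have "(%x. norm (v - g x)) : bm M" for v
    by (rule measurable_compose[OF g]) (auto intro!: bm_cont)
   hence "(%x. (SUM v:s i ` space M. ind (s i -` {v} Int space M) x * norm (v - g x))) : bm M"
    using simple_functionD(2)[OF s(1), of i "{_}"] by (intro borel_measurable_sum borel_measurable_times) auto
   moreover have "(SUM v:s i ` space M. ind (s i -` {v} Int space M) x * norm (v - g x)) = norm (s i x - g x)"
    if "x : space M" for x
   proof -
    have "(SUM v:s i ` space M. ind (s i -` {v} Int space M) x * norm (v - g x))
      = (SUM v:s i ` space M. if v = s i x then norm (v - g x) else 0)"
     using that by (intro sum.cong) (auto simp: indicator_def)
    thus ?thesis using that simple_functionD(1)[OF s(1)] by (simp add: sum.delta)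
   qed
   ultimately show ?thesis by (simp cong: measurable_cong)
  qed
 qed
qed

lemma sm_norm[measurable]: "sm M f ==> (%x. norm (f x)) : bm M"
 using sm_norm_diff[of M f "%_. 0"] by simp

lemma (in complex_banach) cf_sm: "cfunctional J ph ==> sm M f ==> (%z. ph (f z)) : bm M"
 by (rule sm_borel[OF sm_compose[OF _ linear_continuous_on[OF cf_bounded_linear]]])

section \<open>Powers of extended nonnegative reals\<close>

lemma epowr_top[simp]: "epowr top r = top" "epowr \<infinity> r = \<infinity>"
 by (auto simp: epowr_def)

lemma epowr_ennreal: "0 <= x ==> epowr (en x) r = en (x powr r)"
 by (simp add: epowr_def)

lemma epowr_0[simp]: "epowr 0 r = 0"
 by (simp add: epowr_def)

lemma epowr_one_left[simp]: "epowr 1 r = 1"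
 using epowr_ennreal[of 1 r] by simp

lemma epowr_one_right[simp]: "epowr a 1 = a"
 by (cases a) (auto simp: epowr_ennreal)

lemma epowr_mono: "a <= b ==> 0 <= r ==> epowr a r <= epowr b r"
 by (cases a; cases b) (auto simp: epowr_ennreal ennreal_leI powr_mono2 top_unique)

lemma epowr_mult: "epowr (a * b) r = epowr a r * epowr b r"
proof (cases a; cases b)
 fix x y assume "0 <= x" "0 <= y" "a = en x" "b = en y"
 thus ?thesis by (simp add: epowr_ennreal ennreal_mult[symmetric] powr_mult)
qed (auto simp: epowr_ennreal ennreal_mult_top ennreal_top_mult)

lemma epowr_epowr: "epowr (epowr a r) s = epowr a (r * s)"
 by (cases a) (auto simp: epowr_ennreal powr_powr)

lemma epowr_inv: "r ~= 0 ==> epowr (epowr a r) (1/r) = a" "r ~= 0 ==> epowr (epowr a (1/r)) r = a"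
 by (auto simp: epowr_epowr)

lemma epowr_le_iff: "0 < r ==> epowr a r <= b <-> a <= epowr b (1/r)"
 using epowr_mono[of "epowr a r" b "1/r"] epowr_mono[of a "epowr b (1/r)" r] by (auto simp: epowr_inv)

lemma le_epowr_iff: "0 < r ==> a <= epowr b r <-> epowr a (1/r) <= b"
 using epowr_le_iff[of "1/r" a b] by simp

lemma epowr_le_epowr_iff: "0 < r ==> epowr a r <= epowr b r <-> a <= b"
 by (simp add: epowr_le_iff epowr_inv)

lemma epowr_nat: "0 < n ==> epowr a (real n) = a ^ n"
 by (cases a) (auto simp: epowr_ennreal ennreal_power powr_realpow' power_0_left top_power_ennreal)

lemma epowr_SUP: "0 < r ==> epowr (SUP i\<in>I. f i) r = (SUP i\<in>I. epowr (f i) r)"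
proof (rule antisym)
 assume r: "0 < r"
 show "epowr (SUP i\<in>I. f i) r <= (SUP i\<in>I. epowr (f i) r)"
  unfolding epowr_le_iff[OF r]
  by (rule SUP_least) (auto simp: epowr_le_iff[OF r, symmetric] intro: SUP_upper)
 show "(SUP i\<in>I. epowr (f i) r) <= epowr (SUP i\<in>I. f i) r"
  using r by (intro SUP_least epowr_mono SUP_upper) auto
qed

lemma epowr_eq_0_iff[simp]: "epowr a r = 0 <-> a = 0"
 by (cases a) (auto simp: epowr_ennreal ennreal_eq_0_iff)

lemma epowr_eq_top_iff[simp]: "epowr a r = top <-> a = top"
 by (cases a) (auto simp: epowr_ennreal)

lemma epowr_less_top_iff[simp]: "epowr a r < top <-> a < top"
 by (simp add: less_top[symmetric])

lemma epowr_add_le: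
 assumes "0 <= r" shows "epowr (a + b) r <= en (2 powr r) * (epowr a r + epowr b r)"
proof -
 have "epowr (a + b) r <= epowr (2 * max a b) r"
  using assms by (intro epowr_mono) (auto simp: mult_2 max_def intro!: add_mono)
 also have "... = en (2 powr r) * epowr (max a b) r"
  using epowr_ennreal[of 2 r] by (simp add: epowr_mult)
 also have "epowr (max a b) r <= epowr a r + epowr b r"
  by (auto simp: max_def)
 finally show ?thesis by (simp add: mult_left_mono)
qed

lemma measurable_epowr[measurable (raw)]:
 assumes [measurable]: "f : bm M"
 shows "(%x. epowr (f x) r) : bm M"
 unfolding epowr_def by measurable

section \<open>Gaussian sums\<close>

text \<open>Each real factor is read off the normalisation of the normal density with variance
  \<open>1 / (2 s)\<close>.\<close>

lemma nn_integral_exp_square: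
 assumes "0 < s"
 shows "(LN (z::complex). en (exp (- s * (cmod z)^2))) = en (pi / s)"
proof -
 have one: "(LN (x::real). en (exp (- s * x^2))) = en (sqrt (pi / s))"
 proof -
  define si where "si = 1 / sqrt (2 * s)"
  have si: "si > 0" "si^2 = 1 / (2 * s)" using assms by (auto simp: si_def power_divide)
  interpret N: prob_space "density lborel (normal_density 0 si)"
   using si(1) by (rule prob_space_normal_density)
  have "(LN x. en (normal_density 0 si x)) = 1"
   using N.emeasure_space_1 by (simp add: emeasure_density)
  moreover have "exp (- s * x^2) = sqrt (pi / s) * normal_density 0 si x" for x :: real
   using assms by (simp add: normal_density_def si(2) real_sqrt_divide real_sqrt_mult field_simps)
  ultimately show ?thesis
   using assms by (simp add: ennreal_mult nn_integral_cmult)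
 qed
 have "(LN (z::complex). en (exp (- s * (cmod z)^2)))
   = (LN (z::complex). (PROD b:Basis. en (exp (- s * (z \<bullet> b)^2))))"
 proof (rule nn_integral_cong, goal_cases)
  case (1 z)
  have "exp (- s * (cmod z)^2) = exp (- s * (Re z)^2) * exp (- s * (Im z)^2)"
   by (simp add: cmod_power2 exp_add[symmetric] algebra_simps)
  thus ?case
   by (simp add: Basis_complex_def inner_complex_def ennreal_mult)
 qed
 also have "... = (PROD b:(Basis::complex set). LN x. en (exp (- s * x^2)))"
  by (rule nn_integral_lborel_prod) auto
 also have "... = en (pi / s)"
  unfolding one using assms by (simp add: Basis_complex_def ennreal_mult[symmetric])
 finally show ?thesis .
qed

lemma sets_cgauss[simp, measurable_cong]: "sets cgauss = sets borel"
 and space_cgauss[simp]: "space cgauss = UNIV"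
 by (auto simp: cgauss_def)

lemma nn_integral_cgauss:
 "f : bm borel ==>
  (NI cgauss (%z. f z)) = (LN z. en (exp (- (cmod z)\<^sup>2) / pi) * f z)"
 unfolding cgauss_def by (subst nn_integral_density) auto

interpretation cgauss: prob_space cgauss
proof
 have "emeasure cgauss (space cgauss) = (LN z. en (1/pi) * en (exp (- 1 * (cmod z)^2)))"
  by (simp add: cgauss_def emeasure_density ennreal_mult[symmetric] mult.commute)
 also have "... = 1"
  using nn_integral_exp_square[of 1] by (subst nn_integral_cmult) (auto simp: ennreal_mult[symmetric])
 finally show "emeasure cgauss (space cgauss) = 1" .
qed

interpretation gspace: sequence_space cgauss
 by unfold_locales

lemma gspace_eq: "gspace = gspace.S" by (simp add: gspace_def)

interpretation gs: prob_space gspace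
 unfolding gspace_eq by unfold_locales

lemma space_gspace[simp]: "space gspace = UNIV"
 by (simp add: gspace_def space_PiM)

lemmas gs1 = gs.emeasure_space_1[simplified]
lemmas cgauss1 = cgauss.emeasure_space_1[simplified]

lemma measurable_gspace_component: "(%om. om j) : bm gspace"
proof -
 have "(%om. om j) : measurable gspace cgauss"
  unfolding gspace_def by (rule measurable_component_singleton) auto
 thus ?thesis by (simp cong: measurable_cong_sets)
qed

definition gauss_m2 :: ennreal where "gauss_m2 = NI cgauss (%z. nq z)"

lemma gauss_m2_finite: "gauss_m2 < \<infinity>"
proof -
 have "(LN (z::complex). en (exp (- (cmod z)\<^sup>2) / pi) * nq z)
   <= (LN (z::complex). en (2 / pi) * en (exp (- (1/2) * (cmod z)^2)))"
 proof (rule nn_integral_mono)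
  fix z :: complex
  \<comment> \<open>Half of the Gaussian decay is spent on the square.\<close>
  have "(cmod z)^2 <= 2 * exp ((1/2) * (cmod z)^2)"
   using exp_ge_add_one_self[of "(1/2) * (cmod z)^2"] by linarith
  hence "exp (- (cmod z)\<^sup>2) * (cmod z)^2 <= exp (- (cmod z)\<^sup>2) * (2 * exp ((1/2) * (cmod z)^2))"
   by (intro mult_left_mono) auto
  also have "... = 2 * exp (- (1/2) * (cmod z)^2)"
   by (simp add: exp_add[symmetric])
  finally show "en (exp (- (cmod z)\<^sup>2) / pi) * nq z
    <= en (2 / pi) * en (exp (- (1/2) * (cmod z)^2))"
   by (simp add: ennreal_mult[symmetric] divide_simps)
 qed
 also have "... < \<infinity>"
  using nn_integral_exp_square[of "1/2"]
  by (subst nn_integral_cmult) (auto simp: ennreal_mult[symmetric])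
 finally show ?thesis
  unfolding gauss_m2_def by (subst nn_integral_cgauss) auto
qed

lemma gauss_m2_pos: "0 < gauss_m2"
proof -
 have "gauss_m2 ~= 0"
 proof
  assume "gauss_m2 = 0"
  hence "AE z in lborel. en (exp (- (cmod z)\<^sup>2) / pi) * nq z = 0"
   unfolding gauss_m2_def
   by (subst (asm) nn_integral_cgauss) (auto simp: nn_integral_0_iff_AE)
  hence "AE z in (lborel :: complex measure). z = 0"
   by eventually_elim (use pi_gt_zero in "auto simp: ennreal_mult[symmetric] ennreal_eq_0_iff divide_le_0_iff mult_le_0_iff simp del: pi_gt_zero")
  moreover have "AE z in (lborel :: complex measure). z ~= 0" by (rule AE_lborel_singleton)
  ultimately have "AE z in (lborel :: complex measure). False" by eventually_elim auto
  hence "emeasure (lborel :: complex measure) UNIV = 0"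
   by (subst (asm) AE_iff_measurable[OF _ refl]) auto
  thus False by (simp add: emeasure_lborel_UNIV)
 qed
 thus ?thesis by (simp add: zero_less_iff_neq_zero)
qed

lemma nn_integral_lborel_shift:
 fixes f :: "complex => ennreal"
 assumes [measurable]: "f : bm borel"
 shows "(LN z. f (z + a)) = (LN z. f z)"
 by (subst lborel_distr_plus[of a, symmetric]) (simp add: nn_integral_distr add.commute)

lemma shear_fst:
 fixes g :: "complex \<times> complex => ennreal"
 assumes [measurable]: "g : bm (borel \<otimes> borel)"
 shows "(LN w. LN z. g (z + u * w, w)) = (LN w. LN z. g (z, w))"
 by (intro nn_integral_cong nn_integral_lborel_shift) auto

text \<open>A rotation in SU(2) with nonzero off-diagonal entry is a product of three shears.\<close>
lemma lborel_rotate: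
 fixes g :: "complex \<times> complex => ennreal" and c :: real and s :: complex
 assumes [measurable]: "g : bm (borel \<otimes> borel)" and s: "s ~= 0" "c^2 + (cmod s)^2 = 1"
 shows "(LN (w::complex). LN (z::complex). g (c * z + s * w, c * w - cnj s * z))
  = (LN (w::complex). LN (z::complex). g (z, w))"
proof -
 \<comment> \<open>The shears add \<open>u w\<close> to \<open>z\<close>, then \<open>v z\<close> to
   \<open>w\<close>, then \<open>u w\<close> to \<open>z\<close> again; \<open>u\<close> and
   \<open>v\<close> solve \<open>1 + u v = c\<close> and \<open>u + u c = s\<close>.\<close>
 define u where "u = (1 - c) / cnj s"
 define v where "v = - cnj s"
 let ?v = "%z w. g ((z + u * w) + u * (w + v * (z + u * w)), w + v * (z + u * w))"
 have swap: "(LN w. LN z. h (z, w)) = (LN z. LN w. h (z, w))"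
  if [measurable]: "h : bm (borel \<otimes> borel)" for h :: "complex \<times> complex => ennreal"
  by (rule lborel_pair.Fubini) measurable
 have shear2: "(LN w. LN z. h (z, w + v * z)) = (LN w. LN z. h (z, w))"
  if [measurable]: "h : bm (borel \<otimes> borel)" for h :: "complex \<times> complex => ennreal"
  using swap[of "%(z,w). h (z, w + v * z)"] swap[of h] shear_fst[of "%(z,w). h (w,z)" v] by simp
 have 1: "1 + u * v = c" using s by (simp add: u_def v_def)
 have 2: "u + u * c = s"
 proof -
  have "u + u * c = (1 - c) * (1 + c) / cnj s" by (simp add: u_def add_divide_distrib diff_divide_distrib algebra_simps)
  also have "(1 - c) * (1 + c) = (cmod s)^2" using s(2) by (simp add: algebra_simps power2_eq_square)
  also have "cor ((cmod s)^2) / cnj s = s"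
   using s(1) complex_norm_square[of s] by (simp add: field_simps)
  finally show ?thesis by simp
 qed
 have 3: "u * (z + u * w) * v + (z + u * w) + u * w = c * z + s * w" for z w :: complex
 proof -
  have "u * (z + u * w) * v + (z + u * w) + u * w = (1 + u * v) * z + (u + u * (1 + u * v)) * w"
   by (simp add: algebra_simps)
  thus ?thesis by (simp add: 1 2)
 qed
 have 4: "w + v * (z + u * w) = c * w - cnj s * z" for z w :: complex
 proof -
  have "w + v * (z + u * w) = (1 + u * v) * w + v * z" by (simp add: algebra_simps)
  thus ?thesis unfolding 1 by (simp add: v_def)
 qed
 have "(LN w. LN z. g (z, w)) = (LN w. LN z. g (z + u * w, w))"
  by (rule shear_fst[symmetric]) auto
 also have "... = (LN w. LN z. g (z + u * (w + v * z), w + v * z))"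
  using shear2[of "%(z,w). g (z + u * w, w)"] by simp
 also have "... = (LN w. LN z. (?v z w))"
  using shear_fst[of "%(z,w). g (z + u * (w + v * z), w + v * z)" u] by simp
 finally have 7: "(LN w. LN z. g (z, w))
   = (LN w. LN z. (?v z w))" .
 have 5: "(z + u * w) + u * (w + v * (z + u * w)) = c * z + s * w" for z w :: complex
  using 3[of z w] by (simp add: algebra_simps)
 have 6: "(LN w. LN z. (?v z w))
   = (LN (w::complex). LN (z::complex). g (c * z + s * w, c * w - cnj s * z))"
  unfolding 5 unfolding 4 ..
 thus ?thesis using 7 by simp
qed

text \<open>The rotation preserves the sum of the squared moduli, hence the product density, and it
  preserves Lebesgue measure by \<open>lborel_rotate\<close>.\<close>

lemma cgauss_rotate:
 fixes g :: "complex \<times> complex => ennreal" and c :: real and s :: complex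
 assumes [measurable]: "g : bm (borel \<otimes> borel)" and s: "s ~= 0" "c^2 + (cmod s)^2 = 1"
 shows "NI cgauss (%(w::complex). NI cgauss (%(z::complex). g (c * z + s * w, c * w - cnj s * z)))
  = NI cgauss (%(w::complex). NI cgauss (%(z::complex). g (z, w)))"
proof -
 define e :: "complex => ennreal" where "e z = en (exp (- (cmod z)\<^sup>2) / pi)" for z
 have [measurable]: "e : bm borel" unfolding e_def by measurable
 have nn: "NI cgauss (%w. NI cgauss (%z. h (z, w))) = (LN w. LN z. e z * e w * h (z, w))"
  if [measurable]: "h : bm (borel \<otimes> borel)" for h :: "complex \<times> complex => ennreal"
 proof -
  have "NI cgauss (%w. NI cgauss (%z. h (z, w))) = NI cgauss (%w. LN z. e z * h (z, w))"
   by (intro nn_integral_cong) (simp add: nn_integral_cgauss e_def)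
  also have "... = (LN w. e w * (LN z. e z * h (z, w)))"
   by (subst nn_integral_cgauss) (auto simp: e_def)
  also have "... = (LN w. LN z. e z * e w * h (z, w))"
   by (subst nn_integral_cmult[symmetric]) (auto simp: ac_simps)
  finally show ?thesis .
 qed
 have ee: "e (c * z + s * w) * e (c * w - cnj s * z) = e z * e w" for z w :: complex
 proof -
  have "(cmod (c * z + s * w))^2 + (cmod (c * w - cnj s * z))^2 = (c^2 + (cmod s)^2) * ((cmod z)^2 + (cmod w)^2)"
   unfolding cmod_power2 by (simp add: power2_eq_square algebra_simps)
  hence "(cmod (c * z + s * w))^2 + (cmod (c * w - cnj s * z))^2 = (cmod z)^2 + (cmod w)^2"
   using s by simp
  hence "exp (- (cmod (c * z + s * w))\<^sup>2) * exp (- (cmod (c * w - cnj s * z))\<^sup>2)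
    = exp (- (cmod z)\<^sup>2) * exp (- (cmod w)\<^sup>2)"
   unfolding exp_add[symmetric] by simp
  thus ?thesis unfolding e_def by (simp add: ennreal_mult[symmetric] field_simps)
 qed
 show ?thesis
  using nn[of "%(z,w). g (c * z + s * w, c * w - cnj s * z)"] nn[of g]
   lborel_rotate[of "%(z,w). e z * e w * g (z, w)" s c] s
  by (simp add: ee)
qed

text \<open>The rotation with zero diagonal and off-diagonal entry \<open>c\<close> turns the first
  coordinate into \<open>c w\<close>; the other variable integrates out.\<close>

lemma cgauss_phase:
 fixes g :: "complex => ennreal"
 assumes [measurable]: "g : bm borel" and c: "cmod c = 1"
 shows "NI cgauss (%z. g (c * z)) = NI cgauss (%z. g z)"
proof -
 have c0: "c ~= 0" using c by auto
 show ?thesis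
  using cgauss_rotate[of "%(z,w). g z" c 0] c c0 by (simp add: cgauss1)
qed

section \<open>Finite Gaussian sums and their rotation invariance\<close>

context complex_banach
begin

definition gsum :: "(nat => complex) => 'x list => 'x" where
 "gsum om xs = (SUM j<length xs. om j .* xs ! j)"

text \<open>Lists index the vectors so that \<open>GE_Cons\<close> can split off one Gaussian by
  Fubini; the free test function \<open>ph\<close> lets inductions shift the argument.\<close>

definition GE :: "('x => ennreal) => 'x list => ennreal" where
 "GE ph xs = NI gspace (%om. ph (gsum om xs))"

lemma gsum_Nil[simp]: "gsum om [] = 0"
 by (simp add: gsum_def)

lemma gsum_Cons: "gsum (case_nat z om) (x # xs) = z .* x + gsum om xs"
 unfolding gsum_def by (simp add: sum.lessThan_Suc_shift del: sum.lessThan_Suc)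

lemma sm_gsum: "sm gspace (%om. gsum om xs)"
 unfolding gsum_def by (intro sm_sum sm_scl sm_of_borel sm_const measurable_gspace_component)

lemma borel_comp_add[measurable (raw)]: "ph : bm borel ==> (%v. ph (w + v)) : bm borel"
 for ph :: "'x => ennreal"
 by (rule measurable_compose[of "%v. w + v" borel borel ph])
  (auto intro!: bm_cont)

lemma GE_Nil[simp]: "GE ph [] = ph 0"
 by (simp add: GE_def gs1)

lemma sm_gsum_pair: "sm (cgauss \<otimes> gspace) (%(z,om). z .* x + gsum om xs)"
proof -
 have "sm (cgauss \<otimes> gspace) (%p. fst p .* x + gsum (snd p) xs)"
  by (intro sm_add sm_scl sm_const sm_of_borel sm_comp_measurable[OF sm_gsum]) measurable
 thus ?thesis by (simp only: case_prod_unfold)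
qed

lemma measurable_gsum_pair:
 assumes "ph : bm borel"
 shows "(%(z,om). ph (z .* x + gsum om xs)) : bm (cgauss \<otimes> gspace)"
 using measurable_compose[OF sm_borel[OF sm_gsum_pair] assms] by (simp add: case_prod_beta)

text \<open>A sequence of Gaussians is one Gaussian followed by an independent sequence.\<close>

lemma GE_Cons:
 assumes ph: "ph : bm borel"
 shows "GE ph (x # xs) = NI cgauss (%z. GE (%v. ph (z .* x + v)) xs)"
proof -
 have m1: "(%om. ph (gsum om (x # xs))) : bm gspace"
  by (rule measurable_compose[OF sm_borel[OF sm_gsum] ph])
 have "GE ph (x # xs) = (NI (distr (cgauss \<otimes> gspace) gspace (%(s, om). case_nat s om)) (%om. ph (gsum om (x # xs))))"
  unfolding GE_def gspace_eq gspace.PiM_iter ..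
 also have "... = NI (cgauss \<otimes> gspace) (%p. ph (gsum (case p of (s, om) => case_nat s om) (x # xs)))"
 proof (rule nn_integral_distr)
  show "(%(s, om). case_nat s om) : cgauss \<otimes> gspace \<rightarrow>\<^sub>M gspace"
   unfolding gspace_def by measurable
 qed (use m1 in auto)
 also have "... = NI (cgauss \<otimes> gspace) (%p. (%(z,om). ph (z .* x + gsum om xs)) p)"
  by (intro nn_integral_cong) (auto simp: gsum_Cons)
 also have "... = NI cgauss (%z. NI gspace (%om. ph (z .* x + gsum om xs)))"
  using gs.nn_integral_fst[OF measurable_gsum_pair[OF ph, of x xs]] by simp
 finally show ?thesis by (simp add: GE_def)
qed

lemma measurable_GE_shift:
 assumes "ph : bm borel"
 shows "(%z. GE (%v. ph (z .* x + v)) xs) : bm cgauss"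
 using gs.borel_measurable_nn_integral_fst[OF measurable_gsum_pair[OF assms, of x xs]]
 by (simp add: GE_def)

lemma GE_cong_Cons:
 assumes "!!ph. ph : bm borel ==> GE ph xs = GE ph ys" and "ph : bm borel"
 shows "GE ph (x # xs) = GE ph (x # ys)"
 using assms by (simp add: GE_Cons)

lemma GE_mono: "(!!v. ph v <= py v) ==> GE ph xs <= GE py xs"
 unfolding GE_def by (intro nn_integral_mono)

text \<open>The unitary matrix is moved from the two Gaussian coefficients to the two
  vectors.\<close>

lemma GE_rotate:
 assumes ph[measurable]: "ph : bm borel" and s: "s ~= (0::complex)" "c^2 + (cmod s)^2 = 1"
 shows "GE ph (x # y # L) = GE ph ((cor c .* x - cnj s .* y) # (s .* x + cor c .* y) # L)"
proof -
 have two: "GE ph (a # b # L) = NI cgauss (%z. NI cgauss (%w. GE (%v. ph ((z .* a + w .* b) + v)) L))" for a b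
  by (simp add: GE_Cons add.assoc)
 define g where "g = (%(w,z). GE (%v. ph ((z .* x + w .* y) + v)) L)"
 have [measurable]: "g : bm (borel \<otimes> borel)"
 proof -
  have "sm ((borel \<otimes> borel) \<otimes> gspace) (%p. (snd (fst p) .* x + fst (fst p) .* y) + gsum (snd p) L)"
   by (intro sm_add sm_scl sm_const sm_of_borel sm_comp_measurable[OF sm_gsum]) measurable
  hence "(%p. ph ((snd (fst p) .* x + fst (fst p) .* y) + gsum (snd p) L)) : bm ((borel \<otimes> borel) \<otimes> gspace)"
   by (intro measurable_compose[OF sm_borel ph])
  from gs.borel_measurable_nn_integral_fst[OF this] show ?thesis
   by (simp add: g_def GE_def case_prod_beta)
 qed
 have "GE ph (x # y # L) = NI cgauss (%z. NI cgauss (%w. g (w, z)))"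
  by (simp add: two g_def)
 also have "... = NI cgauss (%z. NI cgauss (%w. g (c * w + (- cnj s) * z, c * z - cnj (- cnj s) * w)))"
  using s by (intro cgauss_rotate[symmetric]) auto
 also have "... = GE ph ((cor c .* x - cnj s .* y) # (s .* x + cor c .* y) # L)"
 proof -
  have "(c * z + s * w) .* x + (c * w - cnj s * z) .* y
    = z .* (cor c .* x - cnj s .* y) + w .* (s .* x + cor c .* y)" for z w :: complex
   by (simp add: scl_add_left scl_diff_left scl_add_right scl_diff_right scl_mult ac_simps)
  thus ?thesis by (simp add: two g_def)
 qed
 finally show ?thesis .
qed

lemma GE_phase:
 assumes ph[measurable]: "ph : bm borel" and c: "cmod c = 1"
 shows "GE ph ((c .* x) # L) = GE ph (x # L)"
proof -
 have "(%z. GE (%v. ph (z .* x + v)) L) : bm borel"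
  using measurable_GE_shift[OF ph] by (simp cong: measurable_cong_sets)
 from cgauss_phase[OF this c] show ?thesis
  by (simp add: GE_Cons scl_mult mult.commute)
qed

lemma GE_uminus:
 assumes "ph : bm borel"
 shows "GE (%v. ph (- v)) xs = GE ph xs"
proof -
 have 1: "GE (%v. ph (- v)) xs = GE ph (map uminus xs)"
  unfolding GE_def gsum_def by (auto simp: sum_negf[symmetric] scl_minus_right intro!: nn_integral_cong arg_cong[where f=ph] sum.cong)
 have "GE ph (map uminus xs) = GE ph xs" using assms
 proof (induction xs arbitrary: ph)
  case (Cons x xs)
  have "GE ph (map uminus (x # xs)) = GE ph ((- x) # xs)"
   using GE_cong_Cons[of "map uminus xs" xs] Cons by simp
  also have "... = GE ph (x # xs)"
   using GE_phase[OF Cons.prems, of "-1" x xs] by (simp add: scl_minus_left)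
  finally show ?case .
 qed simp
 with 1 show ?thesis by simp
qed

text \<open>The squared gamma norm of the finite rank operator that sends unit vectors to the
  entries of the list.\<close>

definition GN :: "'x list => ennreal" where "GN xs = GE (%v. nq v) xs"

lemma borel_norm_shift[measurable]: "(%v. nq (w + v)) : bm borel" for w :: 'x
 by (intro measurable_compose[OF _ measurable_ennreal] bm_cont)

lemma borel_norm_sq[measurable]: "(%v::'x. nq v) : bm borel"
 by (intro measurable_compose[OF _ measurable_ennreal] bm_cont)

lemma GE_jensen: "nq w <= GE (%v. nq (w + v)) xs"
proof -
 let ?G = "GE (%v. nq (w + v)) xs"
 have m: "(%om. nq (w + gsum om xs)) : bm gspace"
  by (rule measurable_compose[OF sm_borel[OF sm_gsum]]) measurable
 have m': "(%om. nq (w - gsum om xs)) : bm gspace"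
  by (rule measurable_compose[OF sm_borel[OF sm_gsum]])
   (intro measurable_compose[OF _ measurable_ennreal] bm_cont)
 have "2 * nq w = NI gspace (%om. 2 * nq w)"
  by (simp add: gs1)
 also have "... <= NI gspace (%om. nq (w + gsum om xs) + nq (w - gsum om xs))"
 proof (rule nn_integral_mono)
  fix om
  let ?v = "gsum om xs"
  have "2 * norm w = norm ((w + ?v) + (w - ?v))" by (simp add: scaleR_2[symmetric])
  also have "... <= norm (w + ?v) + norm (w - ?v)" by (rule norm_triangle_ineq)
  finally have "(2 * norm w)^2 <= (norm (w + ?v) + norm (w - ?v))^2" by (intro power_mono) auto
  also have "... <= 2 * ((norm (w + ?v))^2 + (norm (w - ?v))^2)"
   using sum_squares_bound[of "norm (w + ?v)" "norm (w - ?v)"] by (simp add: power2_sum)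
  finally have "2 * (norm w)^2 <= (norm (w + ?v))^2 + (norm (w - ?v))^2" by simp
  from ennreal_leI[OF this] show "2 * nq w <= nq (w + ?v) + nq (w - ?v)"
   by (simp add: ennreal_mult)
 qed
 also have "... = ?G + GE (%v. nq (w - v)) xs"
  unfolding GE_def by (rule nn_integral_add[OF m m'])
 also have "GE (%v. nq (w - v)) xs = ?G"
  using GE_uminus[OF borel_norm_shift, of w xs] by simp
 finally have "2 * nq w <= 2 * ?G" by (simp add: mult_2)
 thus ?thesis by (simp add: ennreal_mult_le_mult_iff)
qed

end

section \<open>Contractions of Gaussian sums\<close>

text \<open>Cholesky factorisation: the last index is eliminated through the Schur complement
  \<open>p'\<close>. If the last pivot \<open>d\<close> is 0, its whole column vanishes, and
  division by 0 giving 0 keeps the formulas for \<open>p'\<close> and \<open>b'\<close>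
  valid.\<close>

lemma psd_gram:
 fixes p :: "nat => nat => complex"
 assumes "!!i j. p j i = cnj (p i j)"
  and "!!c. 0 <= Re (SUM i<m. SUM j<m. c i * cnj (c j) * p i j)"
 shows "EX b::nat => nat => complex. ALL i<m. ALL j<m. p i j = (SUM k<m. b i k * cnj (b j k))"
 using assms
proof (induction m arbitrary: p)
 case 0
 show ?case by simp
next
 case (Suc m)
 note herm = Suc.prems(1) and psd = Suc.prems(2)
 let ?S = "%c. SUM i<m. SUM j<m. c i * cnj (c j) * p i j"
 define d where "d = Re (p m m)"
 have pmm: "p m m = cor d"
  using herm[of m m] by (simp add: d_def complex_eq_iff)
 have Q: "(SUM i<Suc m. SUM j<Suc m. c i * cnj (c j) * p i j)
   = (?S c) + c m * cnj (SUM i<m. c i * p i m)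
    + cnj (c m) * (SUM i<m. c i * p i m) + c m * cnj (c m) * d" for c
 proof -
  have "(SUM j<m. c m * cnj (c j) * p m j) = c m * cnj (SUM i<m. c i * p i m)"
   unfolding cnj_sum sum_distrib_left
   by (intro sum.cong refl) (simp add: herm[of _ m])
  moreover have "(SUM i<m. c i * cnj (c m) * p i m) = cnj (c m) * (SUM i<m. c i * p i m)"
   by (simp add: sum_distrib_left ac_simps)
  ultimately show ?thesis by (simp add: sum.distrib pmm)
 qed
 have d0: "0 <= d"
  using psd[of "%i. if i = m then 1 else 0"] unfolding Q by simp
 have pz: "p i m = 0" if "d = 0" "i < m" for i
 proof (rule ccontr)
  assume nz: "p i m ~= 0"
  \<comment> \<open>With \<open>t\<close> at position \<open>i\<close> and 1 at position
    \<open>m\<close> the form equals \<open>e |p i m|^2 (e p i i - 2)\<close>. This \<open>e\<close>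
    keeps \<open>e p i i\<close> at most 1, so the value is negative.\<close>
  define e where "e = 1 / (\<bar>Re (p i i)\<bar> + 1)"
  have e: "e > 0" "e * Re (p i i) <= 1" by (auto simp: e_def divide_simps)
  define t where "t = - e * cnj (p i m)"
  let ?c = "%k. if k = i then t else if k = m then 1 else 0"
  have s: "(SUM k<m. ?c k * f k) = t * f i" for f
  proof -
   have "(SUM k<m. ?c k * f k) = (SUM k<m. if k = i then t * f i else 0)"
    using that by (intro sum.cong) auto
   thus ?thesis using that by (simp add: sum.delta)
  qed
  have s2: "(SUM k<m. f k * cnj (?c k)) = f i * cnj t" for f
  proof -
   have "(SUM k<m. f k * cnj (?c k)) = (SUM k<m. if k = i then f i * cnj t else 0)"
    using that by (intro sum.cong) auto
   thus ?thesis using that by (simp add: sum.delta)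
  qed
  have "(SUM k<m. SUM j<m. ?c k * cnj (?c j) * p k j) = (SUM k<m. ?c k * (SUM j<m. p k j * cnj (?c j)))"
   by (simp only: sum_distrib_left ac_simps)
  also have "... = t * (p i i * cnj t)" unfolding s2 s ..
  finally have 1: "(SUM k<m. SUM j<m. ?c k * cnj (?c j) * p k j) = t * cnj t * p i i" by simp
  have "0 <= Re (t * cnj t * p i i + cnj (t * p i m) + t * p i m)"
   using psd[of ?c] unfolding Q 1 s using that by simp
  also have "t * p i m = cor (- e * (cmod (p i m))^2)"
   unfolding t_def of_real_mult complex_norm_square by simp
  also have "t * cnj t = cor (e^2 * (cmod (p i m))^2)"
   unfolding t_def of_real_mult complex_norm_square by (simp add: power2_eq_square)
  finally have "0 <= e^2 * (cmod (p i m))^2 * Re (p i i) - 2 * (e * (cmod (p i m))^2)" by simp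
  also have "... = (e * (cmod (p i m))^2) * (e * Re (p i i) - 2)"
   by (simp add: algebra_simps power2_eq_square)
  finally have "0 <= (e * (cmod (p i m))^2) * (e * Re (p i i) - 2)" .
  moreover have "e * (cmod (p i m))^2 > 0" using e nz by simp
  ultimately show False using e(2) by (simp add: zero_le_mult_iff)
 qed
 define p' where "p' i j = p i j - p i m * p m j / d" for i j
 have "EX b::nat => nat => complex. ALL i<m. ALL j<m. p' i j = (SUM k<m. b i k * cnj (b j k))"
 proof (rule Suc.IH)
  show "p' j i = cnj (p' i j)" for i j
   using herm[of i j] herm[of i m] herm[of m j] by (simp add: p'_def)
  fix c :: "nat => complex"
  define s where "s = (SUM i<m. c i * p i m)"
  \<comment> \<open>The last coordinate \<open>- s / d\<close> minimises the form of
    \<open>p\<close>, and the minimum is the form of \<open>p'\<close> at \<open>c\<close>.\<close>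
  define c' where "c' i = (if i < m then c i else - s / d)" for i
  have s': "(SUM i<m. c' i * p i m) = s"
   unfolding s_def c'_def by (intro sum.cong) auto
  have "(SUM i<m. SUM j<m. c i * cnj (c j) * (p i m * p m j / d)) = (SUM i<m. c i * p i m) * (SUM j<m. cnj (c j * p j m)) / d"
   unfolding sum_product by (simp add: sum_divide_distrib herm[of _ m] ac_simps)
  hence cc: "(SUM i<m. SUM j<m. c i * cnj (c j) * p' i j) = (?S c) - s * cnj s / d"
   by (simp add: p'_def s_def right_diff_distrib sum_subtractf)
  have "0 <= Re ((?S c') + c' m * cnj s + cnj (c' m) * s + c' m * cnj (c' m) * d)"
   using psd[of c'] unfolding Q s' .
  also have "(?S c') = (?S c)"
   unfolding c'_def by (intro sum.cong) auto
  also have "... + c' m * cnj s + cnj (c' m) * s + c' m * cnj (c' m) * d = ... - s * cnj s / d"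
   by (cases "d = 0") (auto simp: c'_def field_simps)
  finally show "0 <= Re (SUM i<m. SUM j<m. c i * cnj (c j) * p' i j)" unfolding cc .
 qed
 then obtain b where b: "!!i j. i < m ==> j < m ==> p' i j = (SUM k<m. b i k * cnj (b j k))" by blast
 define r where "r = cor (sqrt d)"
 have sq: "r * r = cor d"
  unfolding r_def of_real_mult[symmetric] using d0 by simp
 have rc: "cnj r = r" and r0: "r = 0 <-> d = 0"
  by (simp_all add: r_def)
 define b' where "b' i k = (if k = m then (if i = m then r else p i m / r)
  else if i = m then 0 else b i k)" for i k
 have "p i j = (SUM k<Suc m. b' i k * cnj (b' j k))" if ij: "i < Suc m" "j < Suc m" for i j
 proof -
  have E: "(SUM k<Suc m. b' i k * cnj (b' m k)) = p i m" if "i < m" for i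
  proof -
   have z: "(SUM k<m. b' i k * cnj (b' m k)) = 0" by (intro sum.neutral) (auto simp: b'_def)
   have "(p i m / r) * cnj r = p i m"
    unfolding rc using pz[OF _ that] r0 by (cases "d = 0") simp_all
   moreover have "b' i m * cnj (b' m m) = (p i m / r) * cnj r" using that by (simp add: b'_def)
   ultimately show ?thesis unfolding sum.lessThan_Suc z by simp
  qed
  consider "i < m" "j < m" | "i = m" "j < m" | "i < m" "j = m" | "i = m" "j = m"
   using ij unfolding less_Suc_eq by blast
  thus ?thesis
  proof cases
   case 1
   have "(SUM k<m. b' i k * cnj (b' j k)) = p' i j"
    unfolding b[OF 1] using 1 by (intro sum.cong) (auto simp: b'_def)
   moreover have "b' i m * cnj (b' j m) = p i m * p m j / d"
   proof -
    have "b' i m * cnj (b' j m) = p i m * cnj (p j m) / (r * r)"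
     using 1 by (simp add: b'_def rc)
    thus ?thesis unfolding sq using herm[of j m] by simp
   qed
   ultimately show ?thesis by (simp add: p'_def)
  next
   case 2
   have "(SUM k<Suc m. b' i k * cnj (b' j k)) = cnj (SUM k<Suc m. b' j k * cnj (b' i k))"
    unfolding cnj_sum by (simp add: mult.commute)
   thus ?thesis unfolding 2(1) E[OF 2(2)] herm[of m j, symmetric] by (rule sym)
  next
   case 3
   show ?thesis unfolding 3(2) by (rule E[OF 3(1), symmetric])
  next
   case 4
   hence z: "(SUM k<m. b' i k * cnj (b' j k)) = 0" by (intro sum.neutral) (auto simp: b'_def)
   have "b' m m * cnj (b' m m) = p m m" by (simp add: b'_def pmm rc sq)
   hence "(SUM k<Suc m. b' i k * cnj (b' j k)) = p m m" unfolding sum.lessThan_Suc z unfolding 4 by simp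
   thus ?thesis unfolding 4 by (rule sym)
  qed
 qed
 thus ?case by (intro exI[of _ b'] allI impI)
qed

section \<open>Orthonormal families of coefficient vectors\<close>

definition vip :: "nat => (nat => complex) => (nat => complex) => complex" where
 "vip L u v = (SUM k<L. u k * cnj (v k))"

fun vspan :: "(nat => complex) list => (nat => complex) set" where
 "vspan [] = {%_. 0}"
| "vspan (u # us) = {(%k. a * u k + g k) | a g. g : vspan us}"

fun orthonormal :: "nat => (nat => complex) list => bool" where
 "orthonormal L [] = True"
| "orthonormal L (u # us) = (vip L u u = 1 & (ALL v:set us. vip L u v = 0) & orthonormal L us)"

lemma vip_add_left: "vip L (%k. a * u k + b * v k) w = a * vip L u w + b * vip L v w"
 by (simp add: vip_def sum.distrib sum_distrib_left algebra_simps)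

lemma vip_add_right: "vip L w (%k. a * u k + b * v k) = cnj a * vip L w u + cnj b * vip L w v"
 by (simp add: vip_def sum.distrib sum_distrib_left algebra_simps)

lemma vip_cnj: "vip L u v = cnj (vip L v u)"
 by (simp add: vip_def mult.commute)

lemma vip_self: "vip L u u = cor (SUM k<L. (cmod (u k))^2)"
 unfolding vip_def of_real_sum complex_norm_square ..

lemma vspan_lin: "f : vspan us ==> g : vspan us ==> (%k. a * f k + b * g k) : vspan us"
proof (induction us arbitrary: f g)
 case (Cons u us)
 obtain c f' d g' where "f = (%k. c * u k + f' k)" "g = (%k. d * u k + g' k)"
  "f' : vspan us" "g' : vspan us" using Cons.prems by auto
 thus ?case
  using Cons.IH[of f' g'] by (auto intro!: exI[of _ "a * c + b * d"] exI[of _ "%k. a * f' k + b * g' k"] simp: algebra_simps)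
qed auto

lemma vspan_zero: "(%_. 0) : vspan us"
 by (induction us) (auto intro!: exI[of _ 0] exI[of _ "%_. 0"])

lemma vspan_tl: "g : vspan us ==> g : vspan (u # us)"
 by (auto intro!: exI[of _ 0] exI[of _ g])

lemma vspan_hd: "u : vspan (u # us)"
 using vspan_zero by (auto intro!: exI[of _ 1] exI[of _ "%_. 0"])

lemma vip_vspan_zero: "ALL v:set us. vip L u v = 0 ==> g : vspan us ==> vip L u g = 0"
proof (induction us arbitrary: g)
 case (Cons v us)
 then obtain a h where g: "g = (%k. a * v k + 1 * h k)" "h : vspan us" by auto
 show ?case unfolding g(1) vip_add_right using Cons g(2) by auto
qed (auto simp: vip_def)

context complex_banach
begin

lemma GE_swap:
 assumes ph: "ph : bm borel"
 shows "GE ph (x # y # L) = GE ph (y # x # L)"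
 using GE_rotate[OF ph, of 1 0 x y L] GE_phase[OF ph, of "-1" y "x # L"]
 by (simp add: scl_minus_left)

definition lcomb :: "'x list => (nat => complex) => 'x" where
 "lcomb ys c = (SUM k<length ys. c k .* ys ! k)"

lemma lcomb_add: "lcomb ys (%k. a * u k + b * v k) = a .* lcomb ys u + b .* lcomb ys v"
 by (simp add: lcomb_def scl_add_left sum.distrib scl_sum_right scl_mult)

text \<open>Basis exchange without change of law. Write \<open>f = a u + rh g'\<close> with a unit
  vector \<open>g'\<close> in the span of the other vectors: the induction hypothesis brings
  \<open>g'\<close> to the front of these, and one rotation in the plane of \<open>u\<close> and
  \<open>g'\<close> produces \<open>f\<close> and a partner \<open>w\<close>. If the component off
  \<open>u\<close> has norm 0, a phase is enough.\<close>

lemma exchange: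
 assumes "orthonormal L us" "f : vspan us" "vip L f f = 1" "L = length ys"
 shows "EX rest. orthonormal L (f # rest) & vspan us <= vspan (f # rest) & set rest <= vspan us
  & (ALL ph. ph : bm borel --> GE ph (map (lcomb ys) (f # rest)) = GE ph (map (lcomb ys) us))"
 using assms(1-3)
proof (induction us arbitrary: f)
 case Nil
 thus ?case by (auto simp: vip_def)
next
 case (Cons u us)
 obtain a g where f: "f = (%k. a * u k + g k)" and g: "g : vspan us"
  using Cons.prems by auto
 have uu: "vip L u u = 1" and uo: "ALL v:set us. vip L u v = 0" and ous: "orthonormal L us"
  using Cons.prems by auto
 have ug: "vip L u g = 0" using vip_vspan_zero[OF uo g] .
 have gu: "vip L g u = 0" using ug vip_cnj[of L g u] by simp
 define rh where "rh = sqrt (SUM k<L. (cmod (g k))^2)"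
 have rh0: "rh >= 0" by (simp add: rh_def sum_nonneg)
 have gg: "vip L g g = cor (rh^2)"
  by (simp add: vip_self rh_def sum_nonneg)
 have "vip L f f = a * cnj a + rh^2"
  using vip_add_left[of L a u 1 g f] vip_add_right[of L u a u 1 g] vip_add_right[of L g a u 1 g]
  by (simp add: f[symmetric] uu ug gu gg)
 hence a1: "a * cnj a + cor (rh^2) = 1" using Cons.prems by simp
 hence a1': "(cmod a)^2 + rh^2 = 1"
  unfolding complex_norm_square[symmetric] of_real_add[symmetric] by (simp only: of_real_eq_1_iff)
 show ?case
 proof (cases "rh = 0")
  case True
  hence g0: "g k = 0" if "k < L" for k
  proof -
   have "(SUM k<L. (cmod (g k))^2) = 0" using True by (simp add: rh_def)
   hence "(cmod (g k))^2 = 0" using that by (subst (asm) sum_nonneg_eq_0_iff) auto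
   thus ?thesis by simp
  qed
  have ca: "cmod a = 1" using a1' True norm_ge_zero[of a] by (auto simp: power2_eq_1_iff)
  have fv: "vip L f v = a * vip L u v" for v
   unfolding vip_def f sum_distrib_left by (intro sum.cong) (auto simp: g0)
  have Tf: "lcomb ys f = a .* lcomb ys u"
   unfolding lcomb_def f scl_sum_right
   by (intro sum.cong) (auto simp: g0 assms(4) scl_mult)
  have "vspan (u # us) <= vspan (f # us)"
  proof
   fix h assume "h : vspan (u # us)"
   then obtain b h' where h: "h = (%k. b * u k + h' k)" "h' : vspan us" by auto
   \<comment> \<open>\<open>vip\<close> sees only the indices below \<open>L\<close>, so
     \<open>f\<close> and \<open>a u\<close> may differ at later ones; the term in \<open>g\<close>,
     which lies in \<open>vspan us\<close>, corrects this.\<close>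
   have eq: "h = (%k. (b / a) * f k + (1 * h' k + (- (b / a)) * g k))"
   proof -
    have "a ~= 0" using ca by auto
    thus ?thesis unfolding h f by (intro ext) (simp add: field_simps)
   qed
   show "h : vspan (f # us)"
    unfolding vspan.simps by (rule CollectI, rule exI, rule exI, rule conjI[OF eq], rule vspan_lin[OF h(2) g])
  qed
  moreover have "set us <= vspan (u # us)"
  proof -
   have "v : vspan ws" if "v : set ws" for v ws
    using that by (induction ws) (auto intro: vspan_tl vspan_hd simp del: vspan.simps)
   thus ?thesis by (auto intro: vspan_tl simp del: vspan.simps)
  qed
  moreover have "orthonormal L (f # us)" using Cons.prems fv by auto
  moreover have "GE ph (map (lcomb ys) (f # us)) = GE ph (map (lcomb ys) (u # us))"
   if "ph : bm borel" for ph
   using GE_phase[OF that ca] by (simp add: Tf)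
  ultimately show ?thesis by blast
 next
  case False
  define g' where "g' = (%k. (1 / rh) * g k + 0 * g k)"
  have g': "g' : vspan us" unfolding g'_def by (rule vspan_lin[OF g g])
  have gg': "g = (%k. rh * g' k)" using False by (auto simp: g'_def)
  have ug': "vip L u g' = 0" and gu': "vip L g' u = 0"
   unfolding g'_def vip_add_left vip_add_right by (auto simp: ug gu)
  have g'g': "vip L g' g' = 1"
   unfolding g'_def vip_add_left vip_add_right using False by (simp add: gg power2_eq_square)
  obtain rest where r: "orthonormal L (g' # rest)" "vspan us <= vspan (g' # rest)" "set rest <= vspan us"
   and rG: "!!ph. ph : bm borel ==> GE ph (map (lcomb ys) (g' # rest)) = GE ph (map (lcomb ys) us)"
   using Cons.IH[OF ous g' g'g'] by blast
  have f': "f = (%k. a * u k + rh * g' k)" using f gg' by auto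
  \<comment> \<open>The pair \<open>f\<close>, \<open>w\<close> is the image of \<open>g'\<close>,
    \<open>u\<close> under the matrix of \<open>GE_rotate\<close> with entries \<open>rh\<close> and
    \<open>- cnj a\<close>.\<close>
  define w where "w = (%k. (- cnj a) * g' k + rh * u k)"
  have r0: "vip L u v = 0" "vip L g' v = 0" if "v : set rest" for v
   using that r vip_vspan_zero[OF uo, of v] by auto
  have fw: "vip L f w = 0"
   unfolding f' w_def vip_add_left vip_add_right by (simp add: uu ug' gu' g'g')
  have ww: "vip L w w = 1"
   unfolding w_def vip_add_left vip_add_right using a1
   by (simp add: uu ug' gu' g'g' power2_eq_square algebra_simps)
  have fwr: "vip L f v = 0" "vip L w v = 0" if "v : set rest" for v
   unfolding f' w_def vip_add_left using r0[OF that] by auto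
  have "orthonormal L (f # w # rest)"
   using Cons.prems(3) fw ww fwr r(1) by auto
  moreover have "vspan (u # us) <= vspan (f # w # rest)"
  proof
   fix h assume "h : vspan (u # us)"
   then obtain b h' where h: "h = (%k. b * u k + h' k)" "h' : vspan us" by auto
   then obtain bt t where t: "h' = (%k. bt * g' k + t k)" "t : vspan rest" using r(2) by auto
   have uk: "u k = cnj a * f k + rh * w k" for k
   proof -
    have "cnj a * f k + rh * w k = (a * cnj a + rh^2) * u k"
     unfolding f' w_def by (simp add: algebra_simps power2_eq_square)
    thus ?thesis using a1 by simp
   qed
   have gk: "g' k = rh * f k - a * w k" for k
   proof -
    have "rh * f k - a * w k = (a * cnj a + rh^2) * g' k"
     unfolding f' w_def by (simp add: algebra_simps power2_eq_square)
    thus ?thesis using a1 by simp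
   qed
   have eq: "h = (%k. (b * cnj a + bt * rh) * f k + ((b * rh - bt * a) * w k + t k))"
    unfolding h(1) t(1) uk gk by (auto simp: algebra_simps)
   show "h : vspan (f # w # rest)"
    unfolding vspan.simps
    by (rule CollectI, rule exI, rule exI, rule conjI[OF eq], rule CollectI, rule exI, rule exI,
      rule conjI[OF refl t(2)])
  qed
  moreover have "set (w # rest) <= vspan (u # us)"
  proof -
   have eq: "w = (%k. rh * u k + ((- cnj a) * g' k + 0 * g' k))" by (auto simp: w_def)
   have "w : vspan (u # us)"
    unfolding vspan.simps by (rule CollectI, rule exI, rule exI, rule conjI[OF eq], rule vspan_lin[OF g' g'])
   thus ?thesis using r(3) by (auto intro: vspan_tl simp del: vspan.simps)
  qed
  moreover have "GE ph (map (lcomb ys) (f # w # rest)) = GE ph (map (lcomb ys) (u # us))"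
   if m: "ph : bm borel" for ph
  proof -
   let ?R = "map (lcomb ys) rest"
   have "GE ph (map (lcomb ys) (u # us)) = GE ph (lcomb ys u # lcomb ys g' # ?R)"
    using GE_cong_Cons[OF rG m, of "lcomb ys u"] by simp
   also have "... = GE ph (lcomb ys g' # lcomb ys u # ?R)" by (rule GE_swap[OF m])
   also have "... = GE ph (lcomb ys f # lcomb ys w # ?R)"
   proof (cases "a = 0")
    case True
    hence "rh = 1" using a1' rh0 by (simp add: power2_eq_1_iff)
    thus ?thesis using True by (simp add: f' w_def)
   next
    case False
    have "lcomb ys f = cor rh .* lcomb ys g' - cnj (- cnj a) .* lcomb ys u"
     unfolding f' lcomb_add by (simp add: scl_minus_left)
    moreover have "lcomb ys w = (- cnj a) .* lcomb ys g' + cor rh .* lcomb ys u"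
     unfolding w_def lcomb_add ..
    ultimately show ?thesis
     using GE_rotate[OF m, of "- cnj a" rh "lcomb ys g'" "lcomb ys u" ?R] False a1'
     by (simp add: add.commute)
   qed
   finally show ?thesis by simp
  qed
  ultimately show ?thesis by (intro exI[of _ "w # rest"] conjI allI impI)
 qed
qed

text \<open>The first vector of \<open>fs\<close> is exchanged into \<open>us\<close>. With its
  Gaussian fixed it becomes part of the shift \<open>w\<close>, and the remaining vectors of
  \<open>fs\<close> lie in the span of the rest because they are orthogonal to it. Gaussians of
  \<open>us\<close> left at the end are discarded by \<open>GE_jensen\<close>.\<close>

lemma GE_orthonormal_le:
 assumes "orthonormal L fs" "set fs <= vspan us" "orthonormal L us" "L = length ys"
 shows "GE (%v. nq (w + v)) (map (lcomb ys) fs)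
  <= GE (%v. nq (w + v)) (map (lcomb ys) us)"
 using assms(1-3)
proof (induction fs arbitrary: us w)
 case Nil
 thus ?case using GE_jensen[of w] by simp
next
 case (Cons f fs)
 obtain rest where r: "orthonormal L (f # rest)" "vspan us <= vspan (f # rest)"
  and rG: "!!ph. ph : bm borel ==> GE ph (map (lcomb ys) (f # rest)) = GE ph (map (lcomb ys) us)"
  using exchange[OF Cons.prems(3) _ _ assms(4), of f] Cons.prems by auto
 have sub: "set fs <= vspan rest"
 proof
  fix g assume g: "g : set fs"
  hence "g : vspan (f # rest)" using Cons.prems r by auto
  then obtain al h where h: "g = (%k. al * f k + 1 * h k)" "h : vspan rest" by auto
  have "vip L f h = 0" using vip_vspan_zero[OF _ h(2), of L f] r(1) by auto
  moreover have "vip L f g = 0" using Cons.prems g by auto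
  ultimately have "al = 0" using r(1) unfolding h(1) vip_add_right by simp
  thus "g : vspan rest" using h by simp
 qed
 have "GE (%v. nq (w + v)) (map (lcomb ys) (f # fs))
   = NI cgauss (%z. GE (%v. nq ((w + z .* lcomb ys f) + v)) (map (lcomb ys) fs))"
  by (simp add: GE_Cons[OF borel_norm_shift] add.assoc)
 also have "... <= NI cgauss (%z. GE (%v. nq ((w + z .* lcomb ys f) + v)) (map (lcomb ys) rest))"
  by (intro nn_integral_mono Cons.IH) (use Cons.prems r sub in auto)
 also have "... = GE (%v. nq (w + v)) (map (lcomb ys) (f # rest))"
  by (simp add: GE_Cons[OF borel_norm_shift] add.assoc)
 finally show ?case unfolding rG[OF borel_norm_shift] .
qed

definition unitv :: "nat => nat => complex" where "unitv i k = (if k = i then 1 else 0)"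

lemma unitv_basis:
 assumes "n <= L"
 shows "orthonormal L (map unitv [n..<L])"
  and "(!!k. k < n | L <= k ==> f k = 0) ==> f : vspan (map unitv [n..<L])"
proof -
 have "orthonormal L (map unitv [n..<L]) &
  ((ALL k. k < n | L <= k --> f k = 0) --> f : vspan (map unitv [n..<L]))" for f
  using assms
 proof (induction n arbitrary: f rule: inc_induct)
  case base
  thus ?case by (auto simp: not_less) (metis not_le_imp_less)
 next
  case (step n)
  have u: "[n..<L] = n # [Suc n..<L]" using step.hyps by (simp add: upt_conv_Cons)
  have "vip L (unitv n) (unitv n) = (SUM k<L. if k = n then 1 else 0)"
   unfolding vip_def by (intro sum.cong) (auto simp: unitv_def)
  hence v1: "vip L (unitv n) (unitv n) = 1"
   using step.hyps by (simp add: sum.delta)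
  have v2: "vip L (unitv n) (unitv j) = 0" if "j > n" for j
   using that unfolding vip_def by (intro sum.neutral) (auto simp: unitv_def)
  have "f : vspan (map unitv [n..<L])" if "ALL k. k < n | L <= k --> f k = 0"
  proof -
   have "(%k. if k = n then 0 else f k) : vspan (map unitv [Suc n..<L])"
    using step.IH[of "%k. if k = n then 0 else f k"] that by (auto simp: less_Suc_eq)
   moreover have "f = (%k. f n * unitv n k + (if k = n then 0 else f k))"
    by (auto simp: unitv_def)
   ultimately show ?thesis unfolding u by auto
  qed
  thus ?case using step.IH[of f] v1 v2 unfolding u by auto
 qed
 thus "orthonormal L (map unitv [n..<L])"
  and "(!!k. k < n | L <= k ==> f k = 0) ==> f : vspan (map unitv [n..<L])" by blast+
qed

lemma map_lcomb_unitv: "map (lcomb ys) (map unitv [0..<length ys]) = ys"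
proof -
 have "lcomb ys (unitv i) = ys ! i" if "i < length ys" for i
 proof -
  have "lcomb ys (unitv i) = (SUM k<length ys. if k = i then ys ! i else 0)"
   unfolding lcomb_def unitv_def by (intro sum.cong) auto
  thus ?thesis using that by (simp add: sum.delta)
 qed
 thus ?thesis by (intro nth_equalityI) auto
qed

lemma gsum_append_zero: "gsum om (ys @ replicate m 0) = gsum om ys"
proof -
 have "gsum om (ys @ replicate m 0) = (SUM j:{..<length ys}. om j .* (ys @ replicate m 0) ! j)"
  unfolding gsum_def by (rule sum.mono_neutral_right) (auto simp: nth_append)
 thus ?thesis by (simp add: gsum_def nth_append)
qed

lemma orthonormalI:
 assumes "!!i j. i < length fs ==> j < length fs ==> vip L (fs ! i) (fs ! j) = (if i = j then 1 else 0)"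
 shows "orthonormal L fs"
 using assms
proof (induction fs)
 case (Cons f fs)
 have "orthonormal L fs"
  using Cons.prems[of "Suc i" "Suc j" for i j] by (intro Cons.IH) auto
 moreover have "vip L f v = 0" if "v : set fs" for v
  using that Cons.prems[of 0 "Suc j" for j] by (auto simp: in_set_conv_nth)
 ultimately show ?case using Cons.prems[of 0 0] by auto
qed simp

text \<open>\<open>p\<close> is the defect of the contraction. Its Gram factor \<open>b\<close>,
  placed below \<open>a\<close>, makes the columns \<open>f j\<close> orthonormal in dimension
  \<open>L\<close>. The new rows act on zero vectors appended to \<open>ys\<close>, so the
  combinations stay the same, and \<open>GE_orthonormal_le\<close> compares them with the unit
  vectors.\<close>

theorem GN_contraction:
 assumes "!!c. (SUM k<length ys. (cmod (SUM j<m. a k j * c j))^2) <= (SUM j<m. (cmod (c j))^2)"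
 shows "GN (map (%j. SUM k<length ys. a k j .* ys ! k) [0..<m]) <= GN ys"
proof -
 let ?K = "length ys"
 define p where "p i j = (if i = j then 1 else 0) - (SUM k<?K. a k i * cnj (a k j))" for i j
 have "EX b::nat => nat => complex. ALL i<m. ALL j<m. p i j = (SUM k<m. b i k * cnj (b j k))"
 proof (rule psd_gram)
  show "p j i = cnj (p i j)" for i j by (simp add: p_def mult.commute)
  fix c :: "nat => complex"
  have 1: "(SUM i<m. SUM j<m. c i * cnj (c j) * (if i = j then 1 else 0)) = (SUM i<m. cor ((cmod (c i))^2))"
   unfolding complex_norm_square
   by (intro sum.cong refl) (simp add: if_distrib sum.delta cong: if_cong)
  have "(SUM i<m. SUM j<m. c i * cnj (c j) * (SUM k<?K. a k i * cnj (a k j)))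
    = (SUM k<?K. SUM i<m. SUM j<m. (a k i * c i) * cnj (a k j * c j))"
   unfolding sum_distrib_left
   by (subst (2) sum.swap, subst sum.swap) (simp add: ac_simps)
  also have "... = (SUM k<?K. cor ((cmod (SUM j<m. a k j * c j))^2))"
   unfolding complex_norm_square cnj_sum sum_product ..
  finally have 2: "(SUM i<m. SUM j<m. c i * cnj (c j) * (SUM k<?K. a k i * cnj (a k j)))
   = (SUM k<?K. cor ((cmod (SUM j<m. a k j * c j))^2))" .
  show "0 <= Re (SUM i<m. SUM j<m. c i * cnj (c j) * p i j)"
   unfolding p_def right_diff_distrib sum_subtractf 1 2 using assms[of c]
   by (simp flip: of_real_sum)
 qed
 then obtain b where b: "!!i j. i < m ==> j < m ==> p i j = (SUM k<m. b i k * cnj (b j k))" by blast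
 define ys' where "ys' = ys @ replicate m 0"
 define L where "L = ?K + m"
 have L: "L = length ys'" by (simp add: L_def ys'_def)
 define f where "f j k = (if k < ?K then a k j else if k < L then b j (k - ?K) else 0)" for j k
 have split: "(SUM k<L. h k) = (SUM k<?K. h k) + (SUM k<m. h (?K + k))" for h :: "nat => 'b::comm_monoid_add"
  unfolding L_def by (induction m) (auto simp: add.assoc)
 have ff: "vip L (f i) (f j) = (if i = j then 1 else 0)" if "i < m" "j < m" for i j
 proof -
  have "vip L (f i) (f j) = (SUM k<?K. a k i * cnj (a k j)) + (SUM k<m. b i k * cnj (b j k))"
   unfolding vip_def split by (intro arg_cong2[where f="(+)"] sum.cong) (auto simp: f_def L_def)
  thus ?thesis unfolding b[OF that, symmetric] p_def by simp
 qed
 have lc: "lcomb ys' (f j) = (SUM k<?K. a k j .* ys ! k)" for j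
  unfolding lcomb_def L[symmetric] split
  by (simp add: ys'_def nth_append f_def)
 have "GE (%v. nq (0 + v)) (map (lcomb ys') (map f [0..<m]))
   <= GE (%v. nq (0 + v)) (map (lcomb ys') (map unitv [0..<L]))"
 proof (rule GE_orthonormal_le[OF _ _ _ L])
  show "orthonormal L (map f [0..<m])" using ff by (intro orthonormalI) auto
  show "set (map f [0..<m]) <= vspan (map unitv [0..<L])"
   by (auto intro!: unitv_basis(2) simp: f_def L_def)
  show "orthonormal L (map unitv [0..<L])" by (rule unitv_basis(1)) simp
 qed
 also have "map (lcomb ys') (map unitv [0..<L]) = ys'"
  unfolding L by (rule map_lcomb_unitv)
 finally have "GN (map (lcomb ys') (map f [0..<m])) <= GN ys'" by (simp add: GN_def)
 also have "GN ys' = GN ys" by (simp add: GN_def GE_def ys'_def gsum_append_zero)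
 finally show ?thesis by (simp add: lc comp_def)
qed

end

section \<open>Square integrable functions\<close>

lemma sq_int_nn: "sq_int M f <-> f : bm M & (NI M (%z. nq (f z))) < \<infinity>"
 unfolding sq_int_def by (auto simp: integrable_iff_bounded)

lemma sq_int_measurable[measurable_dest]: "sq_int M f ==> f : bm M"
 by (simp add: sq_int_def)

lemma sq_int_mono:
 assumes "sq_int M g" "f : bm M" "!!z. z : space M ==> cmod (f z) <= c * cmod (g z)"
 shows "sq_int M f"
 unfolding sq_int_def
proof
 have "integrable M (%z. c^2 * (cmod (g z))^2)" using assms(1) by (simp add: sq_int_def)
 thus "integrable M (%z. (cmod (f z))^2)"
 proof (rule bint_bound)
  have "(cmod (f z))^2 <= c^2 * (cmod (g z))^2" if "z : space M" for z
   using power_mono[OF assms(3)[OF that], of 2] by (simp add: power_mult_distrib)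
  thus "AE z in M. norm ((cmod (f z))^2) <= norm (c^2 * (cmod (g z))^2)" by auto
 qed (use assms(2) in measurable)
qed fact

lemma sq_int_zero[simp]: "sq_int M (%_. 0)"
 by (simp add: sq_int_def)

lemma sq_int_add:
 assumes [measurable]: "sq_int M f" "sq_int M g" shows "sq_int M (%z. f z + g z)"
 unfolding sq_int_def
proof
 have "integrable M (%z. 2 * (cmod (f z))^2 + 2 * (cmod (g z))^2)" using assms by (simp add: sq_int_def)
 thus "integrable M (%z. (cmod (f z + g z))^2)"
 proof (rule bint_bound)
  have "(cmod (f z + g z))^2 <= 2 * (cmod (f z))^2 + 2 * (cmod (g z))^2" for z
   using power_mono[OF norm_triangle_ineq[of "f z" "g z"], of 2] sum_squares_bound[of "cmod (f z)" "cmod (g z)"]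
   by (simp add: power2_sum)
  thus "AE z in M. norm ((cmod (f z + g z))^2) <= norm (2 * (cmod (f z))^2 + 2 * (cmod (g z))^2)" by auto
 qed measurable
qed measurable

lemma sq_int_cmult: "sq_int M f ==> sq_int M (%z. c * f z)"
 by (rule sq_int_mono[where c="cmod c"]) (auto simp: norm_mult)

lemma sq_int_diff: "sq_int M f ==> sq_int M g ==> sq_int M (%z. f z - g z)"
 using sq_int_add[of M f "%z. (-1) * g z"] sq_int_cmult[of M g "-1"] by simp

lemma sq_int_sum: "(!!i. i : A ==> sq_int M (f i)) ==> sq_int M (%z. SUM i:A. c i * f i z)"
 by (induction A rule: infinite_finite_induct) (auto intro!: sq_int_add sq_int_cmult)

lemma sq_int_times:
 "sq_int M f ==> u : bm M ==> (!!z. z : space M ==> cmod (u z) <= c) ==> sq_int M (%z. u z * f z)"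
 by (rule sq_int_mono[where c=c]) (auto simp: norm_mult intro!: mult_right_mono)

lemma sq_int_integrable_mult:
 assumes [measurable]: "sq_int M f" "sq_int M g"
 shows "integrable M (%z. f z * g z)"
proof (rule bint_bound)
 show "integrable M (%z. (cmod (f z))^2 + (cmod (g z))^2)" using assms by (simp add: sq_int_def)
 have "cmod (f z * g z) <= (cmod (f z))^2 + (cmod (g z))^2" for z
 proof -
  have "0 <= cmod (f z) * cmod (g z)" by simp
  thus ?thesis
   using sum_squares_bound[of "cmod (f z)" "cmod (g z)"] unfolding norm_mult by linarith
 qed
 thus "AE z in M. norm (f z * g z) <= norm ((cmod (f z))^2 + (cmod (g z))^2)" by auto
qed measurable

lemma measurable_cnj[measurable (raw)]: "f : bm M ==> (%z. cnj (f z)) : bm M"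
 by (rule measurable_compose[of f M borel cnj]) (auto intro!: bm_cont)

lemma sq_int_cnj: "sq_int M f ==> sq_int M (%z. cnj (f z))"
 by (rule sq_int_mono[where c=1]) auto

definition ip :: "'a measure => ('a => complex) => ('a => complex) => complex" where
 "ip M f g = LI M (%z. f z * cnj (g z))"

definition nsq :: "'a measure => ('a => complex) => real" where
 "nsq M f = LI M (%z. (cmod (f z))^2)"

lemma nsq_nonneg[simp]: "0 <= nsq M f"
 by (simp add: nsq_def)

lemma nsq_ennreal: "sq_int M f ==> ennreal (nsq M f) = NI M (%z. nq (f z))"
 unfolding nsq_def sq_int_def by (auto simp: nn_integral_eq_integral)

lemma ip_self: "ip M f f = cor (nsq M f)"
proof -
 have "ip M f f = LI M (%z. cor ((cmod (f z))^2))"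
  unfolding ip_def complex_norm_square ..
 thus ?thesis by (simp only: nsq_def integral_complex_of_real)
qed

lemma ip_integrable: "sq_int M f ==> sq_int M g ==> integrable M (%z. f z * cnj (g z))"
 by (intro sq_int_integrable_mult sq_int_cnj)

lemma ip_cnj: "ip M f g = cnj (ip M g f)"
proof -
 have "cnj (ip M g f) = LI M (%z. cnj (g z * cnj (f z)))" by (simp only: ip_def Bochner_Integration.integral_cnj)
 thus ?thesis by (simp add: ip_def mult.commute)
qed

lemma ip_add_left:
 assumes "sq_int M f" "sq_int M g" "sq_int M h"
 shows "ip M (%z. a * f z + b * g z) h = a * ip M f h + b * ip M g h"
proof -
 have "ip M (%z. a * f z + b * g z) h = LI M (%z. a * (f z * cnj (h z)) + b * (g z * cnj (h z)))"
  by (simp add: ip_def algebra_simps)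
 also have "... = a * ip M f h + b * ip M g h"
  unfolding ip_def using ip_integrable[OF assms(1,3)] ip_integrable[OF assms(2,3)] by simp
 finally show ?thesis .
qed

lemma ip_sum_left:
 assumes "!!i. i : A ==> sq_int M (f i)" "sq_int M h"
 shows "ip M (%z. SUM i:A. c i * f i z) h = (SUM i:A. c i * ip M (f i) h)"
 using assms(1)
proof (induction A rule: infinite_finite_induct)
 case (insert i A)
 have "ip M (%z. SUM i:insert i A. c i * f i z) h = ip M (%z. c i * f i z + 1 * (SUM i:A. c i * f i z)) h"
  using insert by simp
 also have "... = c i * ip M (f i) h + 1 * ip M (%z. SUM i:A. c i * f i z) h"
  by (rule ip_add_left) (use insert assms(2) in "auto intro: sq_int_sum")
 finally show ?case using insert by simp
qed (auto simp: ip_def)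

lemma nsq_cong_AE: "AE z in M. f z = g z ==> f : bm M ==> g : bm M ==> nsq M f = nsq M g"
 unfolding nsq_def by (intro integral_cong_AE) auto

lemma nsq_cmult: "nsq M (%z. c * f z) = (cmod c)^2 * nsq M f"
 by (simp add: nsq_def norm_mult power_mult_distrib)

lemma nsq_mono:
 assumes "sq_int M g" "f : bm M" "!!z. z : space M ==> cmod (f z) <= cmod (g z)"
 shows "nsq M f <= nsq M g"
 unfolding nsq_def
proof (rule integral_mono)
 show "integrable M (%z. (cmod (f z))^2)"
  using sq_int_mono[where c=1, OF assms(1,2)] assms(3) by (simp add: sq_int_def)
qed (use assms in "auto simp: sq_int_def intro: power_mono")

text \<open>Positivity of \<open>nsq\<close> at \<open>f - t (ip M f g) g\<close> for every real
  \<open>t\<close>, optimised at \<open>t = 1 / nsq M g\<close>.\<close>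

lemma cauchy_schwarz:
 assumes "sq_int M f" "sq_int M g"
 shows "(cmod (ip M f g))^2 <= nsq M f * nsq M g"
proof -
 have *: "0 <= nsq M f - (cmod (ip M f g))\<^sup>2 * (2 * t - t\<^sup>2 * nsq M g)" for t :: real
 proof -
  let ?c = "- t * ip M f g"
  let ?h = "%z. 1 * f z + ?c * g z"
  have s: "sq_int M ?h" by (intro sq_int_add sq_int_cmult assms)
  have "cor (nsq M ?h) = ip M ?h ?h"
   by (rule ip_self[symmetric])
  also have "... = 1 * ip M f ?h + ?c * ip M g ?h"
   by (rule ip_add_left[OF assms s])
  also have "... = cnj (ip M f f + ?c * ip M g f) + ?c * cnj (ip M f g + ?c * ip M g g)"
   unfolding ip_cnj[of M f "%z. 1 * f z + ?c * g z"] ip_cnj[of M g "%z. 1 * f z + ?c * g z"]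
   by (subst (1 2) ip_add_left) (use assms in auto)
  also have "... = ip M f f - 2 * t * (ip M f g * cnj (ip M f g)) + t^2 * (ip M f g * cnj (ip M f g)) * nsq M g"
   using ip_cnj[of M f g] by (simp add: ip_self algebra_simps power2_eq_square)
  also have "... = cor (nsq M f - (cmod (ip M f g))\<^sup>2 * (2 * t - t\<^sup>2 * nsq M g))"
   unfolding complex_norm_square[symmetric] ip_self by (simp add: algebra_simps)
  finally have "nsq M ?h = nsq M f - (cmod (ip M f g))\<^sup>2 * (2 * t - t\<^sup>2 * nsq M g)"
   by (simp only: of_real_eq_iff)
  thus ?thesis using nsq_nonneg by metis
 qed
 show ?thesis
 proof (cases "nsq M g = 0")
  case True
  have "ip M f g = 0"
  proof (rule ccontr)
   assume "ip M f g ~= 0"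
   hence "(cmod (ip M f g))^2 > 0" by simp
   thus False
    using *[of "(nsq M f + 1) / (2 * (cmod (ip M f g))^2)"] True by (simp add: field_simps)
  qed
  thus ?thesis by simp
 next
  case False
  hence p: "nsq M g > 0" using nsq_nonneg[of M g] by linarith
  thus ?thesis using *[of "1 / nsq M g"] by (simp add: field_simps power2_eq_square)
 qed
qed

text \<open>Riesz-Fischer with values in a Banach space that may be nonseparable. A fast subsequence
  converges wherever the series \<open>g\<close> is finite, the limit is set to 0 on the remaining
  null set, and Fatou's lemma turns the Cauchy condition into convergence.\<close>

theorem L2_complete:
 fixes s :: "nat => 'a => 'b::banach"
 assumes s: "!!n. sm M (s n)"
  and C: "!!ep::real. ep > 0 ==> EX N. ALL m>=N. ALL n>=N. (NI M (%x. nq (s m x - s n x))) <= en ep"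
 shows "EX S. sm M S & (%n. NI M (%x. nq (s n x - S x))) ~~> 0"
proof -
 have [measurable]: "(%x. norm (s m x - s n x)) : bm M" for m n
  by (intro sm_norm sm_diff s)
 have "EX N. ALL k. ALL m>=N k. ALL n>=N k. (NI M (%x. nq (s m x - s n x))) <= en ((1/8)^k)"
  using C[of "(1/8)^k" for k] by (intro choice) auto
 then obtain N where N: "!!k m n. N k <= m ==> N k <= n ==>
  (NI M (%x. nq (s m x - s n x))) <= en ((1/8)^k)" by blast
 define r where "r k = k + Max (N ` {..k})" for k
 have rN: "N k <= r k" for k by (auto simp: r_def intro!: trans_le_add2)
 have rm: "r k <= r (Suc k)" for k unfolding r_def by (intro add_mono Max_mono) auto
 have rk: "k <= r k" for k by (simp add: r_def)
 have rS: "N k <= r (Suc k)" for k using rN rm by (meson order_trans)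
 let ?d = "%k x. s (r (Suc k)) x - s (r k) x"
 let ?e = "%k x. 4^k * (norm (?d k x))^2"
 \<comment> \<open>The weight \<open>4^k\<close> against squared distances of at most
   \<open>(1/8)^k\<close> leaves \<open>(1/2)^k\<close> for the integral of \<open>g\<close>, while
   finiteness of \<open>g x\<close> forces increments of order \<open>(1/2)^k\<close>.\<close>
 define g where "g x = (\<Sum>k. en (?e k x))" for x
 have [measurable]: "g : bm M" unfolding g_def by measurable
 have "NI M (%x. g x) = (\<Sum>k. NI M (%x. en (?e k x)))"
  unfolding g_def by (intro nn_integral_suminf) measurable
 also have "... <= (\<Sum>k. en ((1/2)^k))"
 proof (rule suminf_le, goal_cases)
  case (1 k)
  have "NI M (%x. en (?e k x))
    = en (4^k) * NI M (%x. nq (?d k x))"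
   by (simp add: ennreal_mult nn_integral_cmult)
  also have "... <= en (4^k) * en ((1/8)^k)"
   by (intro mult_left_mono N rS rN) auto
  also have "... = en ((1/2)^k)"
   by (simp add: ennreal_mult[symmetric] power_mult_distrib[symmetric])
  finally show ?case .
 qed auto
 also have "... = en (\<Sum>k. (1/2)^k)" by (rule suminf_ennreal2) (auto intro: summable_geometric)
 also have "... < \<infinity>" by simp
 finally have "AE x in M. g x ~= \<infinity>" by (intro nn_integral_PInf_AE) auto
 have conv: "convergent (%k. s (r k) x)" if gx: "g x ~= \<infinity>" for x
 proof -
  obtain c where c: "g x = en c" "c >= 0" using gx by (cases "g x") auto
  have "norm (?d k x) <= sqrt c * (1/2)^k" for k
  proof -
   have "en (?e k x) <= g x"
    unfolding g_def using sum_le_suminf[OF summableI, of "{k}"] by (auto simp: g_def)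
   hence "4^k * (norm (?d k x))^2 <= c" using c by simp
   hence "sqrt (?e k x) <= sqrt c" by simp
   also have "sqrt (?e k x) = 2^k * norm (?d k x)"
    by (simp add: real_sqrt_mult real_sqrt_power)
   finally show ?thesis by (simp add: field_simps)
  qed
  note bound = this
  have "summable (%k. sqrt c * (1/2::real)^k)" by (intro summable_mult summable_geometric) auto
  from this bound have "summable (%k. s (r (Suc k)) x - s (r k) x)" by (rule summable_comparison_test'[where N=0])
  hence "convergent (%n. SUM k<n. s (r (Suc k)) x - s (r k) x)" by (simp add: summable_iff_convergent)
  hence "convergent (%n. s (r n) x - s (r 0) x)"
   by (simp add: sum_lessThan_telescope[of "%k. s (r k) x"])
  from convergent_add[OF this convergent_const[of "s (r 0) x"]]
  have "convergent (%n. (s (r n) x - s (r 0) x) + s (r 0) x)" .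
  thus ?thesis by simp
 qed
 define S where "S x = (if g x = \<infinity> then 0 else lim (%k. s (r k) x))" for x
 have lim: "(%k. s (r k) x) ~~> S x" if "g x ~= \<infinity>" for x
  using conv[OF that] that by (simp add: S_def convergent_LIMSEQ_iff)
 have "sm M (%x. ind {x. g x ~= \<infinity>} x *R s (r k) x)" for k
  by (intro sm_scaleR s sm_of_borel) measurable
 hence smS: "sm M S"
 proof (rule sm_limit)
  fix x
  show "(%k. ind {x. g x ~= \<infinity>} x *R s (r k) x) ~~> S x"
   using lim[of x] by (cases "g x = \<infinity>") (auto simp: S_def)
 qed
 have [measurable]: "(%x. norm (s n x - S x)) : bm M" for n
  by (intro sm_norm sm_diff s smS)
 have "(%n. NI M (%x. nq (s n x - S x))) ~~> 0"
 proof (rule order_tendstoI)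
  fix a :: ennreal assume "0 < a"
  then obtain b where b: "0 < b" "b < a" using dense by blast
  then obtain ep where ep': "b = en ep" "0 <= ep" by (cases b) auto
  with b have ep: "ep > 0" "en ep < a" by auto
  obtain n0 where n0: "!!m n. n0 <= m ==> n0 <= n ==> (NI M (%x. nq (s m x - s n x))) <= en ep"
   using C[OF ep(1)] by blast
  have "NI M (%x. nq (s n x - S x)) <= en ep" if "n0 <= n" for n
  proof -
   have "NI M (%x. nq (s n x - S x))
     <= NI M (%x. liminf (%k. nq (s n x - s (r k) x)))"
   proof (rule nn_integral_mono_AE)
    show "AE x in M. nq (s n x - S x) <= liminf (%k. nq (s n x - s (r k) x))"
     using `AE x in M. g x ~= \<infinity>`
    proof eventually_elim
     case (elim x)
     have "(%k. nq (s n x - s (r k) x)) ~~> nq (s n x - S x)"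
      by (intro tendsto_intros lim[OF elim])
     from lim_imp_Liminf[OF sequentially_bot this] show ?case by simp
    qed
   qed
   also have "... <= liminf (%k. NI M (%x. nq (s n x - s (r k) x)))"
    by (rule nn_integral_liminf) measurable
   also have "... <= en ep"
   proof (rule Liminf_le[of sequentially])
    show "\<forall>\<^sub>F k in sequentially. (NI M (%x. nq (s n x - s (r k) x))) <= en ep"
     unfolding eventually_sequentially
     by (intro exI[of _ n0] allI impI n0 that order_trans[OF _ rk])
   qed simp
   finally show ?thesis .
  qed
  thus "\<forall>\<^sub>F n in sequentially. (NI M (%x. nq (s n x - S x))) < a"
   using ep(2) by (auto simp: eventually_sequentially intro!: exI[of _ n0] intro: le_less_trans)
 qed auto
 with smS show ?thesis by blast
qed

section \<open>Frames and radonifying operators\<close>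

text \<open>Finite lists that obey Bessel's inequality and reproduce every square integrable
  function in the limit. Initial segments of a basis qualify (\<open>onb_frame\<close>), and so does
  a basis cut along level sets (\<open>frame_fsp\<close>), which in general is not
  orthonormal.\<close>

definition frame :: "'a measure => (nat => ('a => complex) list) => bool" where
 "frame M Ls <-> (ALL n. ALL g:set (Ls n). sq_int M g) &
   (ALL f n. sq_int M f --> (SUM k<length (Ls n). (cmod (ip M f (Ls n ! k)))^2) <= nsq M f) &
   (ALL f. sq_int M f -->
    (%n. nsq M (%z. f z - (SUM k<length (Ls n). ip M f (Ls n ! k) * (Ls n ! k) z))) ~~> 0)"

text \<open>The synthesis map from coefficients to functions is a contraction.\<close>

definition bessel :: "'a measure => ('a => complex) list => bool" where
 "bessel M fs <-> (ALL f:set fs. sq_int M f) &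
   (ALL c. nsq M (%z. SUM j<length fs. c j * (fs ! j) z) <= (SUM j<length fs. (cmod (c j))^2))"

lemma nsq_diff:
 assumes "sq_int M f" "sq_int M g"
 shows "nsq M (%z. f z - g z) = nsq M f - 2 * Re (ip M f g) + nsq M g"
proof -
 have pt: "(cmod (f z - g z))^2 = (cmod (f z))^2 - 2 * Re (f z * cnj (g z)) + (cmod (g z))^2" for z
  unfolding cmod_power2 by (simp add: power2_eq_square algebra_simps)
 have i: "integrable M (%z. (cmod (f z))^2)" "integrable M (%z. (cmod (g z))^2)"
   "integrable M (%z. Re (f z * cnj (g z)))"
  using assms integrable_Re[OF ip_integrable[OF assms]] by (simp_all add: sq_int_def)
 have lin: "LI M (%z. (cmod (f z))^2 - 2 * h z + (cmod (g z))^2)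
   = nsq M f - 2 * LI M (%z. h z) + nsq M g" if "integrable M h" for h :: "'a => real"
  unfolding nsq_def using i that by simp
 have "nsq M (%z. f z - g z) = LI M (%z. (cmod (f z))^2 - 2 * Re (f z * cnj (g z)) + (cmod (g z))^2)"
  unfolding nsq_def pt ..
 also have "... = nsq M f - 2 * LI M (%z. Re (f z * cnj (g z))) + nsq M g"
  by (rule lin[OF i(3)])
 also have "LI M (%z. Re (f z * cnj (g z))) = Re (ip M f g)"
  unfolding ip_def by (rule integral_Re[OF ip_integrable[OF assms]])
 finally show ?thesis .
qed

lemma onb_sq_int: "onb M e ==> sq_int M (e j)"
 and onb_ip: "onb M e ==> ip M (e i) (e j) = (if i = j then 1 else 0)"
 by (auto simp: onb_def ip_def)

lemma onb_nsq_sum: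
 assumes "onb M e" "finite A"
 shows "nsq M (%z. SUM j:A. c j * e j z) = (SUM j:A. (cmod (c j))^2)"
proof -
 let ?P = "%z. SUM j:A. c j * e j z"
 have s: "sq_int M ?P" by (intro sq_int_sum onb_sq_int assms)
 have Pe: "ip M ?P (e i) = c i" if "i : A" for i
  using that assms by (simp add: ip_sum_left onb_sq_int onb_ip sum.delta if_distrib cong: if_cong)
 have "cor (nsq M ?P) = (SUM j:A. c j * ip M (e j) ?P)"
  unfolding ip_self[symmetric] by (rule ip_sum_left) (use s assms in "auto intro: onb_sq_int")
 also have "... = (SUM j:A. cor ((cmod (c j))^2))"
  unfolding complex_norm_square by (intro sum.cong refl) (subst ip_cnj, simp add: Pe)
 finally show ?thesis by (simp only: of_real_sum[symmetric] of_real_eq_iff)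
qed

lemma onb_pythagoras:
 assumes "onb M e" "sq_int M f" "finite A"
 shows "nsq M (%z. f z - (SUM j:A. ip M f (e j) * e j z)) = nsq M f - (SUM j:A. (cmod (ip M f (e j)))^2)"
proof -
 let ?P = "%z. SUM j:A. ip M f (e j) * e j z"
 have s: "sq_int M ?P" by (intro sq_int_sum onb_sq_int assms)
 have "ip M f ?P = cnj (ip M ?P f)" by (rule ip_cnj)
 also have "ip M ?P f = (SUM j:A. ip M f (e j) * ip M (e j) f)"
  by (rule ip_sum_left) (use assms in "auto intro: onb_sq_int")
 also have "... = (SUM j:A. cor ((cmod (ip M f (e j)))^2))"
  unfolding complex_norm_square by (intro sum.cong refl) (subst (2) ip_cnj, simp)
 finally have "ip M f ?P = cor (SUM j:A. (cmod (ip M f (e j)))^2)"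
  by (simp only: of_real_sum[symmetric] complex_cnj_complex_of_real)
 thus ?thesis
  unfolding nsq_diff[OF assms(2) s] onb_nsq_sum[OF assms(1,3)] by simp
qed

lemma onb_bessel_ineq:
 assumes "onb M e" "sq_int M f" "finite A"
 shows "(SUM j:A. (cmod (ip M f (e j)))^2) <= nsq M f"
 using onb_pythagoras[OF assms] nsq_nonneg[of M "%z. f z - (SUM j:A. ip M f (e j) * e j z)"] by simp

text \<open>The partial sums are Cauchy by Bessel's inequality; the difference of \<open>f\<close>
  and their limit is orthogonal to every \<open>e j\<close>, hence null by the completeness clause
  of \<open>onb\<close>.\<close>

lemma onb_expansion:
 assumes e: "onb M e" and f: "sq_int M f"
 shows "(%n. nsq M (%z. f z - (SUM j<n. ip M f (e j) * e j z))) ~~> 0"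
proof -
 define c where "c j = ip M f (e j)" for j
 define P where "P n z = (SUM j<n. c j * e j z)" for n z
 have P: "sq_int M (P n)" for n unfolding P_def[abs_def] by (intro sq_int_sum onb_sq_int e)
 have summ: "summable (%j. (cmod (c j))^2)"
  by (rule summableI_nonneg_bounded[where x="nsq M f"])
   (use onb_bessel_ineq[OF e f, of "{..<n}" for n] in "auto simp: c_def")
 have PP: "nsq M (%z. P m z - P n z) = (SUM j:{n..<m}. (cmod (c j))^2)" if "n <= m" for m n
 proof -
  have "P m z - P n z = (SUM j:{n..<m}. c j * e j z)" for z
   unfolding P_def lessThan_atLeast0 by (rule sum_diff_nat_ivl) (use that in auto)
  thus ?thesis using onb_nsq_sum[OF e, of "{n..<m}" c] by simp
 qed
 have PPs: "nsq M (%z. P m z - P n z) = nsq M (%z. P n z - P m z)" for m n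
  unfolding nsq_def by (simp add: norm_minus_commute)
 have "EX S. sm M S & (%n. NI M (%x. nq (P n x - S x))) ~~> 0"
 proof (rule L2_complete)
  show "sm M (P n)" for n by (intro sm_of_borel sq_int_measurable P)
  fix ep :: real assume "ep > 0"
  from summ[unfolded summable_Cauchy, rule_format, OF this]
  obtain N where N: "!!m n. m >= N ==> norm (SUM j:{m..<n}. (cmod (c j))^2) < ep" by blast
  have "nsq M (%z. P m z - P n z) <= ep" if "N <= m" "N <= n" for m n
  proof (cases "n <= m")
   case True
   thus ?thesis using PP[OF True] N[OF that(2), of m] by simp
  next
   case False
   thus ?thesis using PP[of m n] PPs[of m n] N[OF that(1), of n] by simp
  qed
  hence "NI M (%x. nq (P m x - P n x)) <= en ep" if "N <= m" "N <= n" for m n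
   using that by (subst nsq_ennreal[symmetric]) (auto intro: sq_int_diff P ennreal_leI)
  thus "EX N. ALL m>=N. ALL n>=N. (NI M (%x. nq (P m x - P n x))) <= en ep" by blast
 qed
 then obtain S where S: "sm M S" "(%n. NI M (%x. nq (P n x - S x))) ~~> 0"
  by blast
 have [measurable]: "S : bm M" by (rule sm_borel[OF S(1)])
 have [measurable]: "P n : bm M" for n by (rule sq_int_measurable[OF P])
 have "\<forall>\<^sub>F n in sequentially. (NI M (%x. nq (P n x - S x))) < 1"
  using order_tendstoD(2)[OF S(2), of 1] by simp
 then obtain n0 where "NI M (%x. nq (P n0 x - S x)) < 1"
  by (auto simp: eventually_sequentially)
 hence "sq_int M (%x. P n0 x - S x)" unfolding sq_int_nn by (auto intro: less_trans)
 from sq_int_diff[OF P[of n0] this] have sS: "sq_int M S" by simp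
 have nS: "(%n. nsq M (%z. S z - P n z)) ~~> 0"
 proof -
  have "(%n. en (nsq M (%z. S z - P n z))) ~~> en 0"
   using S(2) by (subst nsq_ennreal) (auto intro: sq_int_diff sS P simp: norm_minus_commute)
  thus ?thesis by (subst (asm) tendsto_ennreal_iff) auto
 qed
 have orth: "ip M (%z. f z - S z) (e j) = 0" for j
 proof -
  have "(cmod (ip M (%z. f z - S z) (e j)))^2 <= nsq M (%z. S z - P n z)" if "j < n" for n
  proof -
   have "ip M (%z. f z - S z) (e j) = ip M (%z. 1 * (%z. f z - P n z) z + (-1) * (%z. S z - P n z) z) (e j)"
    by simp
   also have "... = 1 * ip M (%z. f z - P n z) (e j) + (-1) * ip M (%z. S z - P n z) (e j)"
    by (intro ip_add_left sq_int_diff f P sS onb_sq_int e)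
   also have "ip M (%z. f z - P n z) (e j) = ip M (%z. 1 * f z + (-1) * P n z) (e j)" by simp
   also have "... = 1 * ip M f (e j) + (-1) * ip M (P n) (e j)"
    by (intro ip_add_left f P onb_sq_int e)
   also have "ip M (P n) (e j) = c j"
    unfolding P_def[abs_def] using that e
    by (simp add: ip_sum_left onb_sq_int onb_ip sum.delta if_distrib cong: if_cong)
   finally have "ip M (%z. f z - S z) (e j) = - ip M (%z. S z - P n z) (e j)" by (simp add: c_def)
   moreover have "(cmod (ip M (%z. S z - P n z) (e j)))^2 <= nsq M (%z. S z - P n z) * nsq M (e j)"
    by (intro cauchy_schwarz sq_int_diff sS P onb_sq_int e)
   moreover have "nsq M (e j) = 1"
    using onb_ip[OF e, of j j] ip_self[of M "e j"] by simp
   ultimately show ?thesis by simp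
  qed
  hence "(cmod (ip M (%z. f z - S z) (e j)))^2 <= 0"
   by (intro LIMSEQ_le_const[OF nS]) (auto intro!: exI[of _ "Suc j"])
  thus ?thesis by simp
 qed
 have "AE z in M. f z - S z = 0"
  using e orth sq_int_diff[OF f sS] unfolding onb_def ip_def by blast
 hence "nsq M (%z. f z - P n z) = nsq M (%z. S z - P n z)" for n
  using f by (intro nsq_cong_AE) auto
 thus ?thesis using nS by (simp add: P_def c_def)
qed

lemma onb_frame:
 assumes "onb M e" shows "frame M (%n. map e [0..<n])"
 unfolding frame_def using assms onb_expansion[OF assms] onb_bessel_ineq[OF assms, of _ "{..<n}" for n]
 by (auto simp: onb_sq_int)

lemma bessel_sq_int: "bessel M fs ==> f : set fs ==> sq_int M f"
 by (simp add: bessel_def)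

lemma sum_nth_map_upt: "(SUM k<length (map e [n..<m]). h k (map e [n..<m] ! k)) = (SUM k:{n..<m}. h (k - n) (e k))"
 for e :: "nat => 'b"
 by (rule sum.reindex_bij_witness[of _ "%k. k - n" "%k. k + n"]) (auto simp: add.commute)

lemma onb_bessel: "onb M e ==> bessel M (map e [n..<m])"
 unfolding bessel_def
proof safe
 fix c assume e: "onb M e"
 show "nsq M (%z. SUM j<length (map e [n..<m]). c j * (map e [n..<m] ! j) z)
  <= (SUM j<length (map e [n..<m]). (cmod (c j))^2)"
  using sum_nth_map_upt[of "%k g. c k * g z" e n m for z]
   sum_nth_map_upt[of "%k g. (cmod (c k))^2" e n m]
   onb_nsq_sum[OF e, of "{n..<m}" "%k. c (k - n)"] by simp
qed (auto simp: onb_sq_int)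

lemma bessel_mult:
 assumes b: "bessel M fs" and u: "u : bm M" "!!z. z : space M ==> cmod (u z) <= 1"
 shows "bessel M (map (%f z. u z * f z) fs)"
 unfolding bessel_def
proof safe
 show "sq_int M f" if "f : set (map (%f z. u z * f z) fs)" for f
  using that bessel_sq_int[OF b] sq_int_times[OF _ u] by auto
 fix c
 have s: "sq_int M (%z. SUM j<length fs. c j * (fs ! j) z)"
  by (intro sq_int_sum bessel_sq_int[OF b]) auto
 have "(SUM j<length (map (%f z. u z * f z) fs). c j * (map (%f z. u z * f z) fs ! j) z)
   = u z * (SUM j<length fs. c j * (fs ! j) z)" for z
  by (simp add: sum_distrib_left ac_simps)
 hence "nsq M (%z. SUM j<length (map (%f z. u z * f z) fs). c j * (map (%f z. u z * f z) fs ! j) z)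
   = nsq M (%z. u z * (SUM j<length fs. c j * (fs ! j) z))" by simp
 also have "... <= nsq M (%z. SUM j<length fs. c j * (fs ! j) z)"
  using s u by (intro nsq_mono) (auto simp: norm_mult mult_left_le_one_le)
 also have "... <= (SUM j<length fs. (cmod (c j))^2)" using b by (simp add: bessel_def)
 finally show "nsq M (%z. SUM j<length (map (%f z. u z * f z) fs). c j * (map (%f z. u z * f z) fs ! j) z)
  <= (SUM j<length (map (%f z. u z * f z) fs). (cmod (c j))^2)" by simp
qed

text \<open>The adjoint of the synthesis map is a contraction as well: pair \<open>g\<close> with
  the synthesis of its own coefficients.\<close>

lemma bessel_dual:
 assumes b: "bessel M fs" and g: "sq_int M g"
 shows "(SUM j<length fs. (cmod (ip M g (fs ! j)))^2) <= nsq M g"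
proof -
 define c where "c j = ip M g (fs ! j)" for j
 let ?s = "SUM j<length fs. (cmod (c j))^2"
 let ?P = "%z. SUM j<length fs. c j * (fs ! j) z"
 have sP: "sq_int M ?P" by (intro sq_int_sum bessel_sq_int[OF b]) auto
 have "ip M ?P g = (SUM j<length fs. c j * ip M (fs ! j) g)"
  by (rule ip_sum_left) (use g bessel_sq_int[OF b] in auto)
 also have "... = (SUM j<length fs. cor ((cmod (c j))^2))"
  unfolding complex_norm_square by (intro sum.cong refl) (subst ip_cnj[of M _ g], simp add: c_def)
 finally have eq: "ip M ?P g = cor ?s" by (simp only: of_real_sum)
 have "?s^2 <= nsq M ?P * nsq M g"
  using cauchy_schwarz[OF sP g] unfolding eq norm_of_real power2_abs .
 also have "... <= ?s * nsq M g"
  using b by (intro mult_right_mono) (auto simp: bessel_def)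
 finally have "?s * ?s <= ?s * nsq M g" by (simp add: power2_eq_square)
 moreover have "?s >= 0" by (simp add: sum_nonneg)
 ultimately show ?thesis
  unfolding c_def[symmetric] by (cases "?s = 0") (auto simp: mult_le_cancel_left)
qed

section \<open>Gaussian sums of operators along families of functions\<close>

context complex_banach
begin

lemma GN_Cons_zero: "GN (0 # L) = GN L"
 unfolding GN_def by (subst GE_Cons) (auto simp: cgauss1)

lemma GN_zeros: "GN (replicate n 0 @ L) = GN L"
 by (induction n) (auto simp: GN_Cons_zero)

lemma GN_Nil[simp]: "GN [] = 0" by (simp add: GN_def)

lemma GE_rotate1: "ph : bm borel ==> GE ph (x # ys) = GE ph (ys @ [x])"
proof (induction ys arbitrary: ph)
 case (Cons y ys)
 have "GE ph (x # y # ys) = GE ph (y # x # ys)" by (rule GE_swap[OF Cons.prems])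
 also have "... = GE ph (y # (ys @ [x]))" by (rule GE_cong_Cons[OF Cons.IH Cons.prems])
 finally show ?case by simp
qed simp

lemma GE_append_mono:
 "GE (%v. nq (w + v)) xs <= GE (%v. nq (w + v)) (xs @ ys)"
proof (induction xs arbitrary: w)
 case Nil
 thus ?case using GE_jensen[of w ys] by simp
next
 case (Cons x xs)
 thus ?case
  by (simp add: GE_Cons[OF borel_norm_shift] add.assoc[symmetric] nn_integral_mono)
qed

lemma GN_append_mono: "GN xs <= GN (xs @ ys)"
 using GE_append_mono[of 0 xs ys] by (simp add: GN_def)

lemma GN_append_mono2: "GN ys <= GN (xs @ ys)"
proof (induction xs)
 case (Cons x xs)
 have "GN (xs @ ys) <= GN ((xs @ ys) @ [x])" by (rule GN_append_mono)
 also have "... = GN (x # xs @ ys)" unfolding GN_def by (rule GE_rotate1[symmetric]) simp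
 finally show ?case using Cons by simp
qed simp

lemma GN_upt_mono: "n' <= n ==> m <= m' ==> GN (map x [n..<m]) <= GN (map x [n'..<m'])"
proof (cases "n <= m")
 case True
 assume "n' <= n" "m <= m'"
 hence "[n'..<m'] = [n'..<n] @ [n..<m] @ [m..<m']"
  using True by (metis le_add_diff_inverse le_trans upt_add_eq_append)
 thus ?thesis
  using GN_append_mono2[of "map x ([n..<m] @ [m..<m'])" "map x [n'..<n]"] GN_append_mono[of "map x [n..<m]" "map x [m..<m']"]
  by simp
qed simp

lemma measurable_norm_gsum[measurable]: "(%om. norm (gsum om xs)) : bm gspace"
 by (intro sm_norm sm_gsum)

lemma GN_eq: "GN xs = NI gspace (%om. nq (gsum om xs))"
 by (simp add: GN_def GE_def)

lemma sq_norm_add_le: "nq (a + b) <= 2 * nq a + 2 * nq b"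
 for a b :: "'y::real_normed_vector"
proof -
 have "(norm (a + b))^2 <= 2 * (norm a)^2 + 2 * (norm b)^2"
  using power_mono[OF norm_triangle_ineq[of a b], of 2] sum_squares_bound[of "norm a" "norm b"]
  by (simp add: power2_sum)
 from ennreal_leI[OF this] show ?thesis by (simp add: ennreal_mult)
qed

lemma gsum_map_add: "gsum om (map (%j. x j + y j) js) = gsum om (map x js) + gsum om (map y js)"
 by (simp add: gsum_def scl_add_right sum.distrib)

lemma GN_add_le: "GN (map (%j. x j + y j) js) <= 2 * GN (map x js) + 2 * GN (map y js)"
proof -
 have "GN (map (%j. x j + y j) js)
   <= NI gspace (%om. 2 * nq (gsum om (map x js)) + 2 * nq (gsum om (map y js)))"
  unfolding GN_eq gsum_map_add by (intro nn_integral_mono sq_norm_add_le)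
 also have "... = 2 * GN (map x js) + 2 * GN (map y js)"
  unfolding GN_eq by (subst nn_integral_add) (auto simp: nn_integral_cmult)
 finally show ?thesis .
qed

lemma GN_single: "GN [x] = nq x * gauss_m2"
proof -
 have "GN [x] = NI cgauss (%z. nq x * nq z)"
  by (simp add: GN_def GE_Cons[OF borel_norm_sq] power_mult_distrib ennreal_mult mult.commute)
 also have "... = nq x * gauss_m2"
  unfolding gauss_m2_def by (rule nn_integral_cmult) measurable
 finally show ?thesis .
qed

text \<open>Fatou's lemma on the Gaussian space.\<close>

lemma GN_lsc:
 assumes "!!j. j < length xs ==> (%n. ys n ! j) ~~> xs ! j" "!!n. length (ys n) = length xs"
 shows "GN xs <= liminf (%n. GN (ys n))"
proof -
 have lim: "(%n. gsum om (ys n)) ~~> gsum om xs" for om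
  unfolding gsum_def assms(2) using assms(1)
  by (intro tendsto_sum bounded_linear.tendsto[OF bounded_linear_scl]) auto
 have "GN xs <= NI gspace (%om. liminf (%n. nq (gsum om (ys n))))"
  unfolding GN_eq
 proof (rule nn_integral_mono, goal_cases)
  case (1 om)
  have "(%n. nq (gsum om (ys n))) ~~> nq (gsum om xs)"
   by (intro tendsto_intros lim)
  from lim_imp_Liminf[OF sequentially_bot this]
  show ?case by simp
 qed
 also have "... <= liminf (%n. GN (ys n))"
  unfolding GN_eq by (rule nn_integral_liminf) measurable
 finally show ?thesis .
qed

lemma GN_scale: "GN (map (%x. c .* x) xs) = nq c * GN xs"
proof -
 have "gsum om (map (%x. c .* x) xs) = c .* gsum om xs" for om
  by (simp add: gsum_def scl_sum_right scl_mult mult.commute)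
 thus ?thesis
  by (simp add: GN_eq power_mult_distrib ennreal_mult nn_integral_cmult)
qed

text \<open>A row of coefficients normalised in square sum is a contraction onto a single Gaussian;
  \<open>GN_scl_vec\<close> does the same for a column.\<close>

lemma GN_lin_le:
 "GN [(SUM k<length ys. c k .* ys ! k)] <= en (SUM k<length ys. (cmod (c k))^2) * GN ys"
proof -
 define s where "s = sqrt (SUM k<length ys. (cmod (c k))^2)"
 have s2: "s^2 = (SUM k<length ys. (cmod (c k))^2)" and s0: "s >= 0" by (auto simp: s_def sum_nonneg)
 show ?thesis
 proof (cases "s = 0")
  case True
  hence "(cmod (c k))^2 = 0" if "k < length ys" for k
   using s2 that by (simp add: sum_nonneg_eq_0_iff)
  hence "(SUM k<length ys. c k .* ys ! k) = 0" by (intro sum.neutral) auto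
  thus ?thesis by (simp add: GN_single)
 next
  case False
  have "GN (map (%j. SUM k<length ys. (c k / s) .* ys ! k) [0..<1]) <= GN ys"
  proof (rule GN_contraction, goal_cases)
   case (1 d)
   have "(SUM k<length ys. (cmod (SUM j<1. c k / s * d j))^2) = (SUM k<length ys. (cmod (c k))^2 * ((cmod (d 0))^2 / s^2))"
    by (simp add: norm_mult norm_divide power_mult_distrib power_divide)
   also have "... = (cmod (d 0))^2"
    unfolding sum_distrib_right[symmetric] s2[symmetric] using False by simp
   finally show ?case by simp
  qed
  hence 1: "GN [(SUM k<length ys. (c k / s) .* ys ! k)] <= GN ys" by simp
  have "[(SUM k<length ys. c k .* ys ! k)] = map (%x. cor s .* x) [(SUM k<length ys. (c k / s) .* ys ! k)]"
   using False by (simp add: scl_sum_right scl_mult)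
  hence "GN [(SUM k<length ys. c k .* ys ! k)] = en (s^2) * GN [(SUM k<length ys. (c k / s) .* ys ! k)]"
   using GN_scale[of "cor s" "[(SUM k<length ys. (c k / s) .* ys ! k)]"] by simp
  also have "... <= en (s^2) * GN ys" by (intro mult_left_mono 1) auto
  finally show ?thesis by (simp add: s2)
 qed
qed

lemma GN_scl_vec:
 "GN (map (%j. c j .* y) [0..<m]) <= en (SUM j<m. (cmod (c j))^2) * (nq y * gauss_m2)"
proof -
 define s where "s = sqrt (SUM j<m. (cmod (c j))^2)"
 have s2: "s^2 = (SUM j<m. (cmod (c j))^2)" and s0: "s >= 0" by (auto simp: s_def sum_nonneg)
 show ?thesis
 proof (cases "s = 0")
  case True
  hence "(cmod (c k))^2 = 0" if "k < m" for k
   using s2 that by (simp add: sum_nonneg_eq_0_iff)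
  hence "map (%j. c j .* y) [0..<m] = replicate m 0 @ []" by (intro nth_equalityI) auto
  thus ?thesis using GN_zeros[of m "[]"] by simp
 next
  case False
  have "GN (map (%j. SUM k<length [cor s .* y]. (c j / s) .* [cor s .* y] ! k) [0..<m])
   <= GN [cor s .* y]"
  proof (rule GN_contraction, goal_cases)
   case (1 d)
   have "cmod (SUM j<m. c j / s * d j) <= (SUM j<m. cmod (c j) * cmod (d j)) / s"
    unfolding sum_divide_distrib using s0 by (intro sum_norm_le) (simp add: norm_mult norm_divide)
   hence "(cmod (SUM j<m. c j / s * d j))^2 <= ((SUM j<m. cmod (c j) * cmod (d j)) / s)^2"
    by (intro power_mono) auto
   also have "... <= ((SUM j<m. (cmod (c j))^2) * (SUM j<m. (cmod (d j))^2)) / s^2"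
    unfolding power_divide by (intro divide_right_mono Cauchy_Schwarz_ineq_sum) auto
   also have "... = (SUM j<m. (cmod (d j))^2)" using False unfolding s2[symmetric] by simp
   finally show ?case
    by simp
  qed
  hence "GN (map (%j. c j .* y) [0..<m]) <= GN [cor s .* y]"
   using False by (simp add: scl_mult)
  also have "... = en (SUM j<m. (cmod (c j))^2) * (nq y * gauss_m2)"
   using s0 by (simp add: GN_single power_mult_distrib s2 ennreal_mult sum_nonneg mult.assoc)
  finally show ?thesis .
 qed
qed

text \<open>Cauchy criterion, phrased by blocks, for convergence in square mean of the Gaussian
  series with coefficients \<open>x j\<close>.\<close>

definition gcauchy :: "(nat => 'x) => bool" where
 "gcauchy x <-> (ALL ep>0. EX N. ALL n>=N. ALL m. GN (map x [n..<m]) <= en ep)"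

lemma gcauchy_add: "gcauchy x ==> gcauchy y ==> gcauchy (%j. x j + y j)"
 unfolding gcauchy_def
proof safe
 fix ep :: real assume e: "ep > 0"
  and x: "ALL ep>0. EX N. ALL n>=N. ALL m. GN (map x [n..<m]) <= en ep"
  and y: "ALL ep>0. EX N. ALL n>=N. ALL m. GN (map y [n..<m]) <= en ep"
 obtain N1 where N1: "!!n m. N1 <= n ==> GN (map x [n..<m]) <= en (ep/4)" using x[rule_format, of "ep/4"] e by auto
 obtain N2 where N2: "!!n m. N2 <= n ==> GN (map y [n..<m]) <= en (ep/4)" using y[rule_format, of "ep/4"] e by auto
 have "GN (map (%j. x j + y j) [n..<m]) <= en ep" if "max N1 N2 <= n" for n m
 proof -
  have "GN (map (%j. x j + y j) [n..<m]) <= 2 * GN (map x [n..<m]) + 2 * GN (map y [n..<m])" by (rule GN_add_le)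
  also have "... <= 2 * en (ep/4) + 2 * en (ep/4)"
   using that by (intro add_mono mult_left_mono N1 N2) auto
  also have "... = en (2 * (ep/4) + 2 * (ep/4))"
   using e by (simp only: ennreal_plus ennreal_mult) simp
  finally show ?thesis by simp
 qed
 thus "EX N. ALL n>=N. ALL m. GN (map (%j. x j + y j) [n..<m]) <= en ep" by blast
qed

lemma gcauchy_sum: "(!!k. k < K ==> gcauchy (x k)) ==> gcauchy (%j. SUM k<K. x k j)" for K :: nat
proof (induction K)
 case 0
 have "map (%j. 0) [n..<m] = replicate (m - n) (0::'x) @ []" for n m :: nat by (intro nth_equalityI) auto
 thus ?case unfolding gcauchy_def using GN_zeros[of _ "[]"] by simp
qed (auto intro!: gcauchy_add)

lemma gcauchy_scl:
 assumes "summable (%j. (cmod (c j))^2)"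
 shows "gcauchy (%j. c j .* y)"
 unfolding gcauchy_def
proof safe
 fix ep :: real assume e: "ep > 0"
 define K where "K = (norm y)^2 * enn2real gauss_m2 + 1"
 have K: "K > 0" by (simp add: K_def add_nonneg_pos)
 obtain N where N: "!!m n. m >= N ==> norm (SUM j:{m..<n}. (cmod (c j))^2) < ep / K"
  using assms[unfolded summable_Cauchy, rule_format, of "ep / K"] e K by auto
 have "GN (map (%j. c j .* y) [n..<m]) <= en ep" if "N <= n" for n m
 proof -
  have "map (%j. c j .* y) [n..<m] = map (%j. c (j + n) .* y) [0..<m - n]"
   by (intro nth_equalityI) (auto simp: add.commute)
  hence "GN (map (%j. c j .* y) [n..<m])
   <= en (SUM j<m - n. (cmod (c (j + n)))^2) * (nq y * gauss_m2)"
   using GN_scl_vec[of "%j. c (j + n)" y "m - n"] by simp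
  also have "(SUM j<m - n. (cmod (c (j + n)))^2) = (SUM j:{n..<m}. (cmod (c j))^2)"
   by (rule sum.reindex_bij_witness[of _ "%k. k - n" "%k. k + n"]) auto
  also have "en (SUM j:{n..<m}. (cmod (c j))^2) * (nq y * gauss_m2) <= en (ep / K) * en K"
  proof (rule mult_mono)
   show "nq y * gauss_m2 <= en K"
  proof -
   have "gauss_m2 = en (enn2real gauss_m2)" using gauss_m2_finite by simp
   hence "nq y * gauss_m2 = en ((norm y)^2 * enn2real gauss_m2)"
    by (metis enn2real_nonneg ennreal_mult zero_le_power2)
   also have "... <= en K" by (intro ennreal_leI) (simp add: K_def)
   finally show ?thesis .
  qed
   show "en (SUM j:{n..<m}. (cmod (c j))^2) <= en (ep / K)"
    using N[OF that, of m] by (intro ennreal_leI) simp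
  qed auto
  finally show ?thesis using K e by (simp add: ennreal_mult[symmetric])
 qed
 thus "EX N. ALL n>=N. ALL m. GN (map (%j. c j .* y) [n..<m]) <= en ep" by blast
qed

definition bdl :: "'a measure => (('a => complex) => 'x) => bool" where
 "bdl M T <-> (ALL f g a b. sq_int M f --> sq_int M g --> T (%z. a * f z + b * g z) = a .* T f + b .* T g) &
   (EX C>=0. ALL f. sq_int M f --> (norm (T f))^2 <= C * nsq M f)"

lemma bdl_lin: "bdl M T ==> sq_int M f ==> sq_int M g ==> T (%z. a * f z + b * g z) = a .* T f + b .* T g"
 by (simp add: bdl_def)

lemma bdl_zero: "bdl M T ==> T (%_. 0) = 0"
 using bdl_lin[of M T "%_. 0" "%_. 0" 0 0] by simp

lemma bdl_diff: "bdl M T ==> sq_int M f ==> sq_int M g ==> T (%z. f z - g z) = T f - T g"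
 using bdl_lin[of M T f g 1 "-1"] by (simp add: scl_minus_left)

lemma bdl_sum:
 assumes "bdl M T" "!!i. i : A ==> sq_int M (f i)"
 shows "T (%z. SUM i:A. c i * f i z) = (SUM i:A. c i .* T (f i))"
 using assms(2)
proof (induction A rule: infinite_finite_induct)
 case (insert i A)
 have "T (%z. SUM i:insert i A. c i * f i z) = T (%z. c i * f i z + 1 * (SUM i:A. c i * f i z))"
  using insert by simp
 also have "... = c i .* T (f i) + 1 .* T (%z. SUM i:A. c i * f i z)"
  by (rule bdl_lin[OF assms(1)]) (use insert in "auto intro: sq_int_sum")
 finally show ?case using insert by simp
qed (auto simp: bdl_zero[OF assms(1)])

lemma bdl_tendsto:
 assumes T: "bdl M T" and s: "sq_int M f" "!!n. sq_int M (g n)"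
  and l: "(%n. nsq M (%z. f z - g n z)) ~~> 0"
 shows "(%n. T (g n)) ~~> T f"
proof -
 obtain C where C: "C >= 0" "!!f. sq_int M f ==> (norm (T f))^2 <= C * nsq M f" using T by (auto simp: bdl_def)
 have "(%n. (norm (T f - T (g n)))^2) ~~> 0"
 proof (rule tendsto_sandwich[OF _ _ tendsto_const])
  show "(%n. C * nsq M (%z. f z - g n z)) ~~> 0" using tendsto_mult_right_zero[OF l] by simp
  show "\<forall>\<^sub>F n in sequentially. (norm (T f - T (g n)))^2 <= C * nsq M (%z. f z - g n z)"
   using C(2)[OF sq_int_diff[OF s]] bdl_diff[OF T s] by simp
 qed auto
 hence "(%n. sqrt ((norm (T f - T (g n)))^2)) ~~> sqrt 0" by (rule tendsto_real_sqrt)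
 hence "(%n. norm (T (g n) - T f)) ~~> 0" by (simp add: norm_minus_commute)
 thus ?thesis by (simp add: tendsto_norm_zero_iff LIM_zero_iff)
qed

text \<open>This makes the choice of basis immaterial. Each member of \<open>fs\<close> is expanded
  along \<open>Ls n\<close>; the coefficient matrix is synthesis of \<open>fs\<close> followed by
  analysis along \<open>Ls n\<close>, both contractions, so \<open>GN_contraction\<close> applies
  before \<open>GN_lsc\<close> takes the limit in \<open>n\<close>.\<close>

theorem GN_bessel_frame:
 assumes T: "bdl M T" and fs: "bessel M fs" and Ls: "frame M Ls"
 shows "GN (map T fs) <= (SUP n. GN (map T (Ls n)))"
proof -
 define g where "g n j = (%z. SUM k<length (Ls n). ip M (fs ! j) (Ls n ! k) * (Ls n ! k) z)" for n j
 have sL: "sq_int M (Ls n ! k)" if "k < length (Ls n)" for n k using Ls nth_mem[OF that] by (simp add: frame_def)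
 have sf: "sq_int M (fs ! j)" if "j < length fs" for j using bessel_sq_int[OF fs] that by auto
 have sg: "sq_int M (g n j)" for n j unfolding g_def by (intro sq_int_sum sL) auto
 have "(%n. T (g n j)) ~~> T (fs ! j)" if "j < length fs" for j
 proof (rule bdl_tendsto[OF T sf[OF that] sg])
  show "(%n. nsq M (%z. (fs ! j) z - g n j z)) ~~> 0"
   unfolding g_def using Ls sf[OF that] unfolding frame_def by blast
 qed
 hence "GN (map T fs) <= liminf (%n. GN (map (%j. T (g n j)) [0..<length fs]))"
  by (intro GN_lsc) auto
 also have "... <= (SUP n. GN (map T (Ls n)))"
 proof (rule Liminf_le[of sequentially])
  have "GN (map (%j. T (g n j)) [0..<length fs]) <= GN (map T (Ls n))" for n
  proof -
   have Tg: "T (g n j) = (SUM k<length (map T (Ls n)). ip M (fs ! j) (Ls n ! k) .* (map T (Ls n)) ! k)" for j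
    unfolding g_def by (subst bdl_sum[OF T]) (auto simp: sL)
   have "GN (map (%j. SUM k<length (map T (Ls n)). ip M (fs ! j) (Ls n ! k) .* (map T (Ls n)) ! k) [0..<length fs])
    <= GN (map T (Ls n))"
   proof (rule GN_contraction)
    fix c :: "nat => complex"
    let ?P = "%z. SUM j<length fs. c j * (fs ! j) z"
    have sP: "sq_int M ?P" by (intro sq_int_sum sf) auto
    have "(SUM j<length fs. ip M (fs ! j) (Ls n ! k) * c j) = ip M ?P (Ls n ! k)" if "k < length (Ls n)" for k
     by (subst ip_sum_left) (auto simp: sf sL that mult.commute)
    hence "(SUM k<length (map T (Ls n)). (cmod (SUM j<length fs. ip M (fs ! j) (Ls n ! k) * c j))^2)
     = (SUM k<length (Ls n). (cmod (ip M ?P (Ls n ! k)))^2)" by simp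
    also have "... <= nsq M ?P" using Ls sP by (auto simp: frame_def)
    also have "... <= (SUM j<length fs. (cmod (c j))^2)" using fs by (simp add: bessel_def)
    finally show "(SUM k<length (map T (Ls n)). (cmod (SUM j<length fs. ip M (fs ! j) (Ls n ! k) * c j))^2)
     <= (SUM j<length fs. (cmod (c j))^2)" .
   qed
   thus ?thesis unfolding Tg .
  qed
  thus "\<forall>\<^sub>F n in sequentially. GN (map (%j. T (g n j)) [0..<length fs]) <= (SUP n. GN (map T (Ls n)))"
   by (intro always_eventually allI) (meson SUP_upper UNIV_I order_trans)
 qed simp
 finally show ?thesis .
qed

lemma sum_eq_gsum: "(SUM j<N. om j .* x j) = gsum om (map x [0..<N])"
 by (simp add: gsum_def)

lemma gsum_diff:
 assumes "n <= m"
 shows "gsum om (map x [0..<m]) - gsum om (map x [0..<n]) = gsum om (replicate n 0 @ map x [n..<m])"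
proof -
 have "gsum om (replicate n 0 @ map x [n..<m]) = (SUM j:{n..<m}. om j .* x j)"
  unfolding gsum_def using assms
  by (intro sum.mono_neutral_cong_right) (auto simp: nth_append)
 also have "... = (SUM j<m. om j .* x j) - (SUM j<n. om j .* x j)"
  unfolding lessThan_atLeast0 using assms by (intro sum_diff_nat_ivl[symmetric]) auto
 finally show ?thesis by (simp add: sum_eq_gsum)
qed

lemma GN_upt_eq:
 assumes "n <= m"
 shows "GN (map x [n..<m]) = NI gspace (%om. nq (gsum om (map x [0..<m]) - gsum om (map x [0..<n])))"
 unfolding gsum_diff[OF assms] GN_eq[symmetric] by (simp add: GN_zeros)

context
 fixes x S
 assumes L: "gsum_L2lim J x S"
begin

lemma L2lim_measurable: "(%om. norm (gsum om ys - S om)) : bm gspace"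
 using L by (intro sm_norm_diff sm_gsum) (simp add: gsum_L2lim_def)

lemma L2lim_norm_measurable: "(%om. norm (S om)) : bm gspace"
 using L2lim_measurable[of "[]"] by simp

lemma L2lim_tendsto:
 "(%N. NI gspace (%om. nq (gsum om (map x [0..<N]) - S om))) ~~> 0"
 using L unfolding gsum_L2lim_def sum_eq_gsum by blast

lemma L2lim_gcauchy: "gcauchy x"
 unfolding gcauchy_def
proof safe
 note [measurable] = L2lim_measurable
 let ?d = "%N. NI gspace (%om. nq (gsum om (map x [0..<N]) - S om))"
 fix ep :: real assume "ep > 0"
 hence "\<forall>\<^sub>F N in sequentially. ?d N < en (ep/4)" by (intro order_tendstoD(2)[OF L2lim_tendsto]) simp
 then obtain N where N: "!!n. n >= N ==> ?d n < en (ep/4)" by (auto simp: eventually_sequentially)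
 have "GN (map x [n..<m]) <= en ep" if "n >= N" for n m
 proof (cases "n <= m")
  case True
  have "GN (map x [n..<m]) <= NI gspace (%om. 2 * nq (gsum om (map x [0..<m]) - S om)
    + 2 * nq (gsum om (map x [0..<n]) - S om))"
   unfolding GN_upt_eq[OF True]
  proof (rule nn_integral_mono)
   fix om
   show "nq (gsum om (map x [0..<m]) - gsum om (map x [0..<n]))
     <= 2 * nq (gsum om (map x [0..<m]) - S om) + 2 * nq (gsum om (map x [0..<n]) - S om)"
    using sq_norm_add_le[of "gsum om (map x [0..<m]) - S om" "- (gsum om (map x [0..<n]) - S om)"]
    by (simp del: minus_diff_eq add: norm_minus_cancel) 
  qed
  also have "... = 2 * ?d m + 2 * ?d n"
   by (subst nn_integral_add) (auto simp: nn_integral_cmult)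
  also have "... <= 2 * en (ep/4) + 2 * en (ep/4)"
   using N[of n] N[of m] True that by (intro add_mono mult_left_mono) auto
  also have "... = en (2 * (ep/4) + 2 * (ep/4))"
   using `ep > 0` by (simp only: ennreal_plus ennreal_mult) simp
  finally show ?thesis by simp
 qed simp
 thus "EX N. ALL n>=N. ALL m. GN (map x [n..<m]) <= en ep" by blast
qed

text \<open>The factors 2 here and in \<open>L2lim_upper\<close> stem from splitting the squared
  norm of a sum; they are carried into the constants below.\<close>

lemma L2lim_lower: "GN (map x [0..<n]) <= 2 * NI gspace (%om. nq (S om))"
proof -
 note [measurable] = L2lim_measurable L2lim_norm_measurable
 let ?d = "%N. NI gspace (%om. nq (gsum om (map x [0..<N]) - S om))"
 let ?I = "NI gspace (%om. nq (S om))"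
 have "GN (map x [0..<n]) <= 2 * ?d m + 2 * ?I" if "n <= m" for m
 proof -
  have "GN (map x [0..<n]) <= GN (map x [0..<m])" using that by (intro GN_upt_mono) auto
  also have "... <= NI gspace (%om. 2 * nq (gsum om (map x [0..<m]) - S om) + 2 * nq (S om))"
   unfolding GN_eq using sq_norm_add_le[of "gsum om (map x [0..<m]) - S om" "S om" for om]
   by (intro nn_integral_mono) simp
  also have "... = 2 * ?d m + 2 * ?I"
   by (subst nn_integral_add) (auto simp: nn_integral_cmult)
  finally show ?thesis .
 qed
 moreover have "(%m. 2 * ?d m + 2 * ?I) ~~> 2 * 0 + 2 * ?I"
  by (intro tendsto_add tendsto_const ennreal_tendsto_cmult L2lim_tendsto) simp
 ultimately show ?thesis
  by (intro LIMSEQ_le_const[of "%m. 2 * ?d m + 2 * ?I"]) auto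
qed

lemma L2lim_upper: "NI gspace (%om. nq (S om)) <= 2 * (SUP n. GN (map x [0..<n]))"
proof -
 note [measurable] = L2lim_measurable L2lim_norm_measurable
 let ?d = "%N. NI gspace (%om. nq (gsum om (map x [0..<N]) - S om))"
 let ?I = "NI gspace (%om. nq (S om))"
 let ?G = "SUP n. GN (map x [0..<n])"
 have "?I <= 2 * ?d m + 2 * ?G" for m
 proof -
  have "?I <= NI gspace (%om. 2 * nq (gsum om (map x [0..<m]) - S om) + 2 * nq (gsum om (map x [0..<m])))"
  proof (rule nn_integral_mono, goal_cases)
   case (1 om)
   show ?case
    using sq_norm_add_le[of "- (gsum om (map x [0..<m]) - S om)" "gsum om (map x [0..<m])"]
    unfolding norm_minus_cancel by simp
  qed
  also have "... = 2 * ?d m + 2 * GN (map x [0..<m])"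
   unfolding GN_eq by (subst nn_integral_add) (auto simp: nn_integral_cmult)
  also have "... <= 2 * ?d m + 2 * ?G" by (intro add_left_mono mult_left_mono SUP_upper) auto
  finally show ?thesis .
 qed
 moreover have "(%m. 2 * ?d m + 2 * ?G) ~~> 2 * 0 + 2 * ?G"
  by (intro tendsto_add tendsto_const ennreal_tendsto_cmult L2lim_tendsto) simp
 ultimately show ?thesis
  by (intro LIMSEQ_le_const[of "%m. 2 * ?d m + 2 * ?G"]) auto
qed

end

lemma gcauchy_L2lim:
 assumes "gcauchy x" shows "EX S. gsum_L2lim J x S"
proof -
 have "EX S. sm gspace S &
  (%n. NI gspace (%om. nq (gsum om (map x [0..<n]) - S om))) ~~> 0"
 proof (rule L2_complete[OF sm_gsum], goal_cases)
  case (1 ep)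
  then obtain N where N: "!!n m. n >= N ==> GN (map x [n..<m]) <= en ep"
   using assms unfolding gcauchy_def by blast
  have "NI gspace (%om. nq (gsum om (map x [0..<m]) - gsum om (map x [0..<n]))) <= en ep"
   if "N <= m" "N <= n" for m n
  proof (cases "n <= m")
   case True
   thus ?thesis using N[OF that(2), of m] GN_upt_eq[OF True, of x] by simp
  next
   case False
   thus ?thesis using N[OF that(1), of n] GN_upt_eq[of m n x] by (simp add: norm_minus_commute)
  qed
  thus ?case
   by blast
 qed
 then obtain S where S: "sm gspace S"
  "(%n. NI gspace (%om. nq (gsum om (map x [0..<n]) - S om))) ~~> 0" by blast
 let ?d = "%N. NI gspace (%om. nq (gsum om (map x [0..<N]) - S om))"
 have mS[measurable]: "S : bm gspace" by (rule sm_borel[OF S(1)])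
 have [measurable]: "(%om. norm (gsum om ys - S om)) : bm gspace" for ys
  by (intro sm_norm_diff sm_gsum mS)
 have "\<forall>\<^sub>F N in sequentially. ?d N < 1" using order_tendstoD(2)[OF S(2), of 1] by simp
 then obtain n1 where n1: "!!n. n >= n1 ==> ?d n < 1" by (auto simp: eventually_sequentially)
 obtain n2 where n2: "!!n m. n >= n2 ==> GN (map x [n..<m]) <= en 1"
  using assms[unfolded gcauchy_def, rule_format, of 1] by auto
 define n where "n = max n1 n2"
 have fin: "GN (map x [0..<k]) < \<infinity>" for k
 proof (induction k)
  case (Suc k)
  have "GN (map x [0..<Suc k]) = GN (map (%j. (if j < k then x j else 0) + (if j = k then x k else 0)) [0..<Suc k])"
   by (intro arg_cong[where f=GN] map_cong) auto
  also have "... <= 2 * GN (map (%j. if j < k then x j else 0) [0..<Suc k]) + 2 * GN (map (%j. if j = k then x k else 0) [0..<Suc k])"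
   by (rule GN_add_le)
  also have "map (%j. if j < k then x j else 0) [0..<Suc k] = map x [0..<k] @ replicate 1 0"
   by (intro nth_equalityI) (auto simp: nth_append less_Suc_eq)
  also have "GN (map x [0..<k] @ replicate 1 0) = GN (map x [0..<k])" by (simp only: GN_eq gsum_append_zero)
  also have "map (%j. if j = k then x k else 0) [0..<Suc k] = replicate k 0 @ [x k]"
   by (intro nth_equalityI) (auto simp: nth_append less_Suc_eq)
  also have "2 * GN (map x [0..<k]) + 2 * GN (replicate k 0 @ [x k]) < \<infinity>"
   using Suc gauss_m2_finite by (simp add: GN_zeros GN_single ennreal_mult_less_top)
  finally show ?case .
 qed simp
 have "NI gspace (%om. nq (S om))
   <= NI gspace (%om. 2 * nq (gsum om (map x [0..<n]) - S om) + 2 * nq (gsum om (map x [0..<n])))"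
 proof (rule nn_integral_mono, goal_cases)
  case (1 om)
  show ?case
   using sq_norm_add_le[of "- (gsum om (map x [0..<n]) - S om)" "gsum om (map x [0..<n])"]
   unfolding norm_minus_cancel by simp
 qed
 also have "... = 2 * ?d n + 2 * GN (map x [0..<n])"
  unfolding GN_eq by (subst nn_integral_add) (auto simp: nn_integral_cmult)
 also have "... < \<infinity>"
  using n1[of n] fin[of n] by (auto simp: n_def ennreal_mult_less_top intro: less_trans)
 finally have "gsum_L2lim J x S"
  unfolding gsum_L2lim_def sum_eq_gsum using S(2) by auto
 thus ?thesis by blast
qed

lemma epowr_half_2: "epowr (epowr a (1/2)) 2 = a"
 by (simp add: epowr_epowr)

text \<open>\<open>gamma_op\<close> is evaluated at a basis and a limit selected by choice. This
  records what is known of them, so that estimates can be made for an arbitrary admissible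
  pair.\<close>

lemma gamma_op_value:
 assumes "EX e S. onb M e & gsum_L2lim J (%j. T (e j)) S"
 shows "EX e S. onb M e & gsum_L2lim J (%j. T (e j)) S &
  epowr (gamma_op J M T) 2 = NI gspace (%om. nq (S om))"
proof -
 define P where "P = (%(e, S). onb M e & gsum_L2lim J (%j. T (e j)) S)"
 have "EX q. P q" using assms by (auto simp: P_def)
 hence "P (SOME q. P q)" by (rule someI_ex)
 moreover have "epowr (gamma_op J M T) 2 = NI gspace (%om. nq (snd (SOME q. P q) om))"
  using assms unfolding gamma_op_def P_def by (simp add: epowr_half_2)
 ultimately show ?thesis
  by (intro exI[of _ "fst (SOME q. P q)"] exI[of _ "snd (SOME q. P q)"]) (auto simp: P_def split_beta)
qed

lemma gamma_op_lower:
 assumes "gamma_op J M T < \<infinity>"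
 shows "EX e. onb M e & gcauchy (%j. T (e j)) & (ALL n. GN (map T (map e [0..<n])) <= 2 * epowr (gamma_op J M T) 2)"
proof -
 have "EX e S. onb M e & gsum_L2lim J (%j. T (e j)) S"
  using assms unfolding gamma_op_def by (auto split: if_splits)
 from gamma_op_value[OF this] obtain e S where "onb M e" "gsum_L2lim J (%j. T (e j)) S"
  "epowr (gamma_op J M T) 2 = NI gspace (%om. nq (S om))" by blast
 thus ?thesis using L2lim_gcauchy L2lim_lower by (auto simp: comp_def intro!: exI[of _ e])
qed

text \<open>The basis inside \<open>gamma_op\<close> may differ from \<open>e\<close>;
  \<open>GN_bessel_frame\<close> compares the two.\<close>

lemma gamma_op_upper:
 assumes "bdl M T" "onb M e" "gcauchy (%j. T (e j))"
 shows "epowr (gamma_op J M T) 2 <= 2 * (SUP n. GN (map T (map e [0..<n])))"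
proof -
 have "EX e S. onb M e & gsum_L2lim J (%j. T (e j)) S"
  using assms gcauchy_L2lim by blast
 from gamma_op_value[OF this] obtain e' S where e': "onb M e'" "gsum_L2lim J (%j. T (e' j)) S"
  "epowr (gamma_op J M T) 2 = NI gspace (%om. nq (S om))" by blast
 have "(SUP n. GN (map (%j. T (e' j)) [0..<n])) <= (SUP n. GN (map T (map e [0..<n])))"
 proof (rule SUP_least, goal_cases)
  case (1 n)
  have "GN (map T (map e' [0..<n])) <= (SUP n. GN (map T (map e [0..<n])))"
   by (rule GN_bessel_frame[OF assms(1) onb_bessel[OF e'(1)] onb_frame[OF assms(2)]])
  thus ?case by (simp add: comp_def)
 qed
 thus ?thesis
  unfolding e'(3) by (intro order_trans[OF L2lim_upper[OF e'(2)]] mult_left_mono) auto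
qed

text \<open>Convergence along one basis passes to any Bessel sequence \<open>f\<close>. With
  \<open>P\<close> the projection onto the first \<open>K\<close> basis functions, \<open>T1\<close>
  (the operator after removal of \<open>P\<close>) has small sums on all Bessel families at once,
  and \<open>T P\<close> contributes finitely many series whose coefficients are square summable by
  \<open>bessel_dual\<close>.\<close>

lemma GN_tail:
 assumes T: "bdl M T" and e: "onb M e" and g: "gcauchy (%j. T (e j))" and f: "!!n m. bessel M (map f [n..<m])"
 shows "gcauchy (%j. T (f j))"
 unfolding gcauchy_def
proof safe
 fix ep :: real assume ep: "ep > 0"
 then obtain K where K: "!!n m. n >= K ==> GN (map (%j. T (e j)) [n..<m]) <= en (ep/4)"
  using g[unfolded gcauchy_def, rule_format, of "ep/4"] by auto
 define P where "P h z = (SUM k<K. ip M h (e k) * e k z)" for h z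
 have sP: "sq_int M (P h)" for h unfolding P_def[abs_def] by (intro sq_int_sum onb_sq_int e)
 have sf: "sq_int M (f j)" for j using bessel_sq_int[OF f[of j "Suc j"]] by simp
 define T1 where "T1 h = T (%z. h z - P h z)" for h
 have TP: "T (P h) = (SUM k<K. ip M h (e k) .* T (e k))" for h
  unfolding P_def[abs_def] by (rule bdl_sum[OF T]) (rule onb_sq_int[OF e])
 have T1eq: "T1 h = T h - T (P h)" if "sq_int M h" for h
  unfolding T1_def by (rule bdl_diff[OF T that sP])
 have bT1: "bdl M T1"
 proof -
  obtain C where C: "C >= 0" "!!f. sq_int M f ==> (norm (T f))^2 <= C * nsq M f" using T by (auto simp: bdl_def)
  have "(norm (T1 h))^2 <= C * nsq M h" if "sq_int M h" for h
  proof -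
   have "(norm (T1 h))^2 <= C * nsq M (%z. h z - P h z)" unfolding T1_def by (intro C sq_int_diff that sP)
   also have "... <= C * nsq M h" unfolding P_def onb_pythagoras[OF e that finite_lessThan]
    using C(1) by (intro mult_left_mono) (auto simp: sum_nonneg)
   finally show ?thesis .
  qed
  moreover have "T1 (%z. a * h z + b * k z) = a .* T1 h + b .* T1 k" if "sq_int M h" "sq_int M k" for a b h k
  proof -
   have "sq_int M (%z. a * h z + b * k z)" by (intro sq_int_add sq_int_cmult that)
   thus ?thesis
    by (simp add: T1eq that bdl_lin[OF T that] TP ip_add_left[OF that onb_sq_int[OF e]] scl_add_left
     scl_sum_right scl_mult scl_diff_right sum.distrib)
  qed
  ultimately show ?thesis unfolding bdl_def using C(1) by blast
 qed
 have T1e: "T1 (e k) = (if k < K then 0 else T (e k))" for k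
  by (simp add: T1eq onb_sq_int[OF e] TP onb_ip[OF e] if_distrib[of "%c. c .* _"] sum.delta cong: if_cong)
 have T1small: "GN (map T1 (map f [n..<m])) <= en (ep/4)" for n m
 proof -
  have "GN (map T1 (map f [n..<m])) <= (SUP l. GN (map T1 (map e [0..<l])))"
   by (rule GN_bessel_frame[OF bT1 f onb_frame[OF e]])
  also have "... <= en (ep/4)"
  proof (rule SUP_least, goal_cases)
   case (1 l)
   have "map T1 (map e [0..<l]) = replicate (min K l) 0 @ map (%j. T (e j)) [K..<l]"
    by (intro nth_equalityI) (auto simp: nth_append T1e)
   thus ?case using K[of K l] by (simp add: GN_zeros)
  qed
  finally show ?thesis .
 qed
 have gc: "gcauchy (%j. SUM k<K. ip M (f j) (e k) .* T (e k))"
 proof (intro gcauchy_sum gcauchy_scl, goal_cases)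
  case (1 k)
  show ?case
  proof (rule summableI_nonneg_bounded[where x="nsq M (e k)"], goal_cases)
   case (2 n)
   have "(SUM j<n. (cmod (ip M (f j) (e k)))^2) = (SUM j<length (map f [0..<n]). (cmod (ip M (e k) (map f [0..<n] ! j)))^2)"
    by (intro sum.cong) (auto simp: ip_cnj[of M "e k"])
   also have "... <= nsq M (e k)" by (rule bessel_dual[OF f onb_sq_int[OF e]])
   finally show ?case .
  qed auto
 qed
 obtain N where N: "!!n m. n >= N ==> GN (map (%j. SUM k<K. ip M (f j) (e k) .* T (e k)) [n..<m]) <= en (ep/4)"
  using gc[unfolded gcauchy_def, rule_format, of "ep/4"] ep by auto
 have "GN (map (%j. T (f j)) [n..<m]) <= en ep" if "n >= N" for n m
 proof -
  have "map (%j. T (f j)) [n..<m] = map (%j. T1 (f j) + (SUM k<K. ip M (f j) (e k) .* T (e k))) [n..<m]"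
   by (intro map_cong refl) (simp add: T1eq[OF sf] TP)
  hence "GN (map (%j. T (f j)) [n..<m]) <= 2 * GN (map (%j. T1 (f j)) [n..<m])
    + 2 * GN (map (%j. SUM k<K. ip M (f j) (e k) .* T (e k)) [n..<m])"
   by (simp only: GN_add_le)
  also have "... <= 2 * en (ep/4) + 2 * en (ep/4)"
   using T1small[of n m] that by (intro add_mono mult_left_mono N) (auto simp: comp_def)
  also have "... = en (2 * (ep/4) + 2 * (ep/4))"
   using ep by (simp only: ennreal_plus ennreal_mult) simp
  finally show ?thesis by simp
 qed
 thus "EX N. ALL n>=N. ALL m. GN (map (%j. T (f j)) [n..<m]) <= en ep" by blast
qed

text \<open>\<open>T\<close> represents the Pettis integral operator with kernel \<open>Ph\<close>.\<close>
definition wrep :: "'a measure => ('a => 'x) => (('a => complex) => 'x) => bool" where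
 "wrep M Ph T <-> (ALL ph. cfunctional J ph --> sq_int M (%z. ph (Ph z)) &
   (ALL h. sq_int M h --> ph (T h) = LI M (%z. h z * ph (Ph z))))"

lemma pettis_iff:
 "pettis J M (%z. h z .* Ph z) x <-> (ALL ph. cfunctional J ph -->
   integrable M (%z. h z * ph (Ph z)) & ph x = LI M (%z. h z * ph (Ph z)))"
 unfolding pettis_def by (auto simp: cf_scl)

lemma wrep_pettis: "wrep M Ph T ==> sq_int M h ==> pettis J M (%z. h z .* Ph z) (T h)"
 unfolding pettis_iff wrep_def by (auto intro: sq_int_integrable_mult)

text \<open>Any representing operator shows that the Pettis integrals exist; the operator chosen
  inside \<open>gamma_fun\<close> is then another representative of the same kernel.\<close>

lemma gamma_fun_wrep:
 assumes "sm M Ph" "wrep M Ph T"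
 shows "EX T'. wrep M Ph T' & gamma_fun J M Ph = gamma_op J M T'"
proof -
 define T' where "T' h = (SOME x. pettis J M (%z. h z .* Ph z) x)" for h
 have w: "weakly_L2 J M Ph" using assms(2) by (auto simp: wrep_def weakly_L2_def)
 have ex: "EX x. pettis J M (%z. h z .* Ph z) x" if "sq_int M h" for h
  using wrep_pettis[OF assms(2) that] by blast
 have "pettis J M (%z. h z .* Ph z) (T' h)" if "sq_int M h" for h
  unfolding T'_def by (rule someI_ex[OF ex[OF that]])
 hence "wrep M Ph T'" using w unfolding wrep_def weakly_L2_def pettis_iff by blast
 moreover have "gamma_fun J M Ph = gamma_op J M T'"
  unfolding gamma_fun_def T'_def using w ex assms(1) by auto
 ultimately show ?thesis by blast
qed

lemma gamma_fun_finite_wrep: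
 assumes "gamma_fun J M Ph < \<infinity>"
 shows "sm M Ph" "EX T. wrep M Ph T"
proof -
 have *: "sm M Ph & weakly_L2 J M Ph &
     (ALL h. sq_int M h --> (EX x. pettis J M (%z. h z .* Ph z) x))"
  using assms unfolding gamma_fun_def by (auto split: if_splits)
 thus "sm M Ph" by blast
 from * obtain T where T: "!!h. sq_int M h ==> pettis J M (%z. h z .* Ph z) (T h)" by metis
 show "EX T. wrep M Ph T"
  using * T unfolding wrep_def weakly_L2_def pettis_iff by (intro exI[of _ T]) blast
qed

lemma wrep_lin:
 assumes w: "wrep M Ph T" and f: "sq_int M f" and g: "sq_int M g"
 shows "T (%z. a * f z + b * g z) = a .* T f + b .* T g"
proof (rule eq_functionals, goal_cases)
 case ph: (1 ph)
 have s: "sq_int M (%z. ph (Ph z))" and r: "!!h. sq_int M h ==> ph (T h) = LI M (%z. h z * ph (Ph z))"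
  using w ph by (auto simp: wrep_def)
 have "ph (T (%z. a * f z + b * g z)) = LI M (%z. a * (f z * ph (Ph z)) + b * (g z * ph (Ph z)))"
  unfolding r[OF sq_int_add[OF sq_int_cmult[OF f] sq_int_cmult[OF g]]] by (simp add: algebra_simps)
 also have "... = a * ph (T f) + b * ph (T g)"
  using sq_int_integrable_mult[OF f s] sq_int_integrable_mult[OF g s] by (simp add: r f g)
 finally show ?case
  by (simp add: linear_add[OF cf_linear[OF ph]] cf_scl[OF ph])
qed

lemma wrep_unique: "wrep M Ph T ==> wrep M Ph T' ==> sq_int M h ==> T h = T' h"
 by (rule eq_functionals) (auto simp: wrep_def)

text \<open>On partial sums of the expansion the bound is \<open>GN_lin_le\<close>. For general
  \<open>f\<close> the operator is not yet known to be continuous, but its compositions with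
  functionals are, by Cauchy-Schwarz against the square integrable scalar kernel.\<close>

lemma wrep_bdl:
 assumes w: "wrep M Ph T" and e: "onb M e" and B: "!!n. GN (map T (map e [0..<n])) <= B" "B < \<infinity>"
 shows "bdl M T"
proof -
 define m2 where "m2 = enn2real gauss_m2"
 have m2: "gauss_m2 = en m2" "m2 > 0"
  using gauss_m2_finite gauss_m2_pos by (auto simp: m2_def enn2real_positive_iff)
 obtain b where b: "B = en b" "b >= 0" using B(2) by (cases B) auto
 define C where "C = b / m2"
 have C0: "C >= 0" using b m2 by (simp add: C_def)
 have lin_sum: "T (%z. SUM k<n. c k * e k z) = (SUM k<n. c k .* T (e k))" for c and n :: nat
 proof (induction n)
  case 0
  have "T (%z. 0 * 0 + 0 * 0) = 0" using wrep_lin[OF w, of "%_. 0" "%_. 0" 0 0] by simp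
  thus ?case by simp
 next
  case (Suc n)
  have "T (%z. 1 * (SUM k<n. c k * e k z) + c n * e n z) = 1 .* T (%z. SUM k<n. c k * e k z) + c n .* T (e n)"
   by (rule wrep_lin[OF w]) (auto intro: sq_int_sum onb_sq_int e)
  thus ?case using Suc by simp
 qed
 have fin: "(norm (T (%z. SUM k<n. ip M f (e k) * e k z)))^2 <= C * nsq M f" if f: "sq_int M f" for f n
 proof -
  let ?v = "SUM k<n. ip M f (e k) .* T (e k)"
  have "nq ?v * gauss_m2 = GN [?v]" by (simp add: GN_single)
  also have "GN [?v] <= en (SUM k<n. (cmod (ip M f (e k)))^2) * GN (map T (map e [0..<n]))"
   using GN_lin_le[of "%k. ip M f (e k)" "map T (map e [0..<n])"] by simp
  also have "... <= en (nsq M f) * B"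
   by (intro mult_mono B ennreal_leI onb_bessel_ineq e f) auto
  finally have "en ((norm ?v)^2 * m2) <= en (nsq M f * b)"
   unfolding m2(1) b(1) using b(2) m2(2) by (simp only: ennreal_mult nsq_nonneg zero_le_power2 less_imp_le)
  hence "(norm ?v)^2 * m2 <= nsq M f * b" using b(2) by simp
  thus ?thesis unfolding lin_sum C_def using m2 by (simp add: field_simps)
 qed
 have "(norm (T f))^2 <= C * nsq M f" if f: "sq_int M f" for f
 proof -
  have "norm (T f) <= sqrt (C * nsq M f)"
  proof (rule norm_le_functionals)
   fix ph assume ph: "cfunctional J ph" and ph1: "!!v. cmod (ph v) <= norm v"
   have s: "sq_int M (%z. ph (Ph z))" and r: "!!h. sq_int M h ==> ph (T h) = LI M (%z. h z * ph (Ph z))"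
    using w ph by (auto simp: wrep_def)
   define P where "P n z = (SUM k<n. ip M f (e k) * e k z)" for n z
   let ?q = "%f n ph. nsq M (%z. f z - P n z) * nsq M (%z. ph (Ph z))"
   have sP: "sq_int M (P n)" for n unfolding P_def[abs_def] by (intro sq_int_sum onb_sq_int e)
   have conv: "(%n. cmod (ph (T f) - ph (T (P n)))) ~~> 0"
   proof (rule tendsto_sandwich[OF _ _ tendsto_const])
    have "cmod (ph (T f) - ph (T (P n))) <= sqrt (?q f n ph)" for n
    proof -
     have "ph (T f) - ph (T (P n)) = ip M (%z. f z - P n z) (%z. cnj (ph (Ph z)))"
      unfolding r[OF f] r[OF sP] ip_def
      using sq_int_integrable_mult[OF f s] sq_int_integrable_mult[OF sP s] by (simp add: left_diff_distrib)
     moreover have "nsq M (%z. cnj (ph (Ph z))) = nsq M (%z. ph (Ph z))" by (simp add: nsq_def)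
     ultimately show ?thesis
      using cauchy_schwarz[OF sq_int_diff[OF f sP[of n]] sq_int_cnj[OF s]] by (simp add: real_le_rsqrt)
    qed
    thus "\<forall>\<^sub>F n in sequentially. cmod (ph (T f) - ph (T (P n))) <= sqrt (?q f n ph)"
     by simp
    have "(%n. sqrt (?q f n ph)) ~~> sqrt (0 * nsq M (%z. ph (Ph z)))"
     unfolding P_def by (intro tendsto_intros onb_expansion e f)
    thus "(%n. sqrt (?q f n ph)) ~~> 0" by simp
   qed auto
   have "cmod (ph (T f)) <= cmod (ph (T f) - ph (T (P n))) + sqrt (C * nsq M f)" for n
   proof -
    have "cmod (ph (T (P n))) <= norm (T (P n))" by (rule ph1)
    also have "... <= sqrt (C * nsq M f)" using fin[OF f, of n] by (intro real_le_rsqrt) (simp add: P_def[abs_def])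
    finally show ?thesis using norm_triangle_sub[of "ph (T f)" "ph (T (P n))"] by linarith
   qed
   thus "cmod (ph (T f)) <= sqrt (C * nsq M f)"
    using LIMSEQ_le_const[OF tendsto_add[OF conv tendsto_const[of "sqrt (C * nsq M f)"]]] by auto
  qed
  hence "(norm (T f))^2 <= (sqrt (C * nsq M f))^2" by (intro power_mono) auto
  thus ?thesis using C0 by simp
 qed
 thus ?thesis unfolding bdl_def using wrep_lin[OF w] C0 by blast
qed

text \<open>One half of the interface to the gamma norm: finiteness yields a bounded representing
  operator with uniformly bounded Gaussian sums. \<open>gamma_fun_upper\<close> goes back once the
  Gaussian series along some basis converges.\<close>

theorem gamma_fun_lower:
 assumes "gamma_fun J M Ph < \<infinity>"
 shows "EX T e. wrep M Ph T & bdl M T & onb M e & gcauchy (%j. T (e j)) &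
  (ALL n. GN (map T (map e [0..<n])) <= 2 * epowr (gamma_fun J M Ph) 2)"
proof -
 obtain T0 where "wrep M Ph T0" using gamma_fun_finite_wrep[OF assms] by blast
 from gamma_fun_wrep[OF gamma_fun_finite_wrep(1)[OF assms] this]
 obtain T where T: "wrep M Ph T" "gamma_fun J M Ph = gamma_op J M T" by blast
 obtain e where e: "onb M e" "gcauchy (%j. T (e j))" "!!n. GN (map T (map e [0..<n])) <= 2 * epowr (gamma_fun J M Ph) 2"
  using gamma_op_lower[of M T] assms unfolding T(2) by blast
 have "bdl M T"
  by (rule wrep_bdl[OF T(1) e(1,3)]) (use assms in "auto simp: ennreal_mult_less_top")
 with T e show ?thesis by blast
qed

theorem gamma_fun_upper:
 assumes "sm M Ph" "wrep M Ph T" "bdl M T" "onb M e" "gcauchy (%j. T (e j))"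
 shows "epowr (gamma_fun J M Ph) 2 <= 2 * (SUP n. GN (map T (map e [0..<n])))"
proof -
 obtain T' where T': "wrep M Ph T'" "gamma_fun J M Ph = gamma_op J M T'"
  using gamma_fun_wrep[OF assms(1,2)] by blast
 have eq: "T h = T' h" if "sq_int M h" for h by (rule wrep_unique[OF assms(2) T'(1) that])
 have "bdl M T'"
  using assms(3) unfolding bdl_def by (auto simp: eq[symmetric] sq_int_add sq_int_cmult)
 moreover have "gcauchy (%j. T' (e j))" using assms(5) by (simp add: eq onb_sq_int[OF assms(4)])
 ultimately have "epowr (gamma_op J M T') 2 <= 2 * (SUP n. GN (map T' (map e [0..<n])))"
  using assms(4) by (intro gamma_op_upper)
 also have "(%n. GN (map T' (map e [0..<n]))) = (%n. GN (map T (map e [0..<n])))"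
  by (simp add: comp_def eq onb_sq_int[OF assms(4)])
 finally show ?thesis by (simp add: T'(2))
qed

text \<open>Ideal property for scalar multipliers, valid in every Banach space. The functions
  \<open>u e_j\<close> form a Bessel sequence, so \<open>GN_tail\<close> supplies the convergence
  and \<open>GN_bessel_frame\<close> the bound. Each passage between the gamma norm and its finite
  sums costs a factor 2.\<close>

theorem gamma_fun_mult_le:
 assumes u[measurable]: "u : bm M" and u1: "!!z. z : space M ==> \<bar>u z\<bar> <= 1"
 shows "epowr (gamma_fun J M (%z. u z *R Ph z)) 2 <= 4 * epowr (gamma_fun J M Ph) 2"
proof (cases "gamma_fun J M Ph < \<infinity>")
 case True
 obtain T e where T: "wrep M Ph T" "bdl M T" and e: "onb M e" and g: "gcauchy (%j. T (e j))"
  and B: "!!n. GN (map T (map e [0..<n])) <= 2 * epowr (gamma_fun J M Ph) 2"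
  using gamma_fun_lower[OF True] by blast
 define T' where "T' h = T (%z. cor (u z) * h z)" for h
 have uh: "sq_int M (%z. cor (u z) * h z)" if "sq_int M h" for h
  by (rule sq_int_times[OF that]) (use u1 in auto)
 have "wrep M (%z. u z *R Ph z) T'"
  unfolding wrep_def
 proof (intro allI impI conjI)
  fix ph assume ph: "cfunctional J ph"
  have s: "sq_int M (%z. ph (Ph z))" and r: "!!h. sq_int M h ==> ph (T h) = LI M (%z. h z * ph (Ph z))"
   using T ph by (auto simp: wrep_def)
  have l: "ph (u z *R Ph z) = cor (u z) * ph (Ph z)" for z
   by (simp add: linear_scale[OF cf_linear[OF ph]] scaleR_conv_of_real)
  show "sq_int M (%z. ph (u z *R Ph z))" unfolding l by (rule uh[OF s])
  show "ph (T' h) = LI M (%z. h z * ph (u z *R Ph z))" if "sq_int M h" for h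
   unfolding T'_def l r[OF uh[OF that]] by (simp add: ac_simps)
 qed
 moreover have "bdl M T'"
 proof -
  obtain C where C: "C >= 0" "!!f. sq_int M f ==> (norm (T f))^2 <= C * nsq M f" using T by (auto simp: bdl_def)
  have "(norm (T' h))^2 <= C * nsq M h" if "sq_int M h" for h
  proof -
   have "(norm (T' h))^2 <= C * nsq M (%z. cor (u z) * h z)" unfolding T'_def by (intro C uh that)
   also have "... <= C * nsq M h"
    using C(1) that u1 by (intro mult_left_mono nsq_mono) (auto simp: norm_mult mult_left_le_one_le)
   finally show ?thesis .
  qed
  moreover have "T' (%z. a * h z + b * k z) = a .* T' h + b .* T' k" if "sq_int M h" "sq_int M k" for a b h k
   unfolding T'_def using bdl_lin[OF T(2) uh[OF that(1)] uh[OF that(2)]] by (simp add: algebra_simps)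
  ultimately show ?thesis unfolding bdl_def using C(1) by blast
 qed
 moreover have bes: "bessel M (map (%j z. cor (u z) * e j z) [n..<m])" for n m
  using bessel_mult[OF onb_bessel[OF e, of n m], of "%z. cor (u z)"] u1 by (simp add: comp_def)
 moreover have "gcauchy (%j. T' (e j))"
  unfolding T'_def by (rule GN_tail[OF T(2) e g bes])
 ultimately have "epowr (gamma_fun J M (%z. u z *R Ph z)) 2 <= 2 * (SUP n. GN (map T' (map e [0..<n])))"
  using gamma_fun_finite_wrep(1)[OF True] e
  by (intro gamma_fun_upper) (auto intro!: sm_scaleR sm_of_borel)
 also have "(SUP n. GN (map T' (map e [0..<n]))) <= 2 * epowr (gamma_fun J M Ph) 2"
 proof (rule SUP_least, goal_cases)
  case (1 n)
  have "GN (map T (map (%j z. cor (u z) * e j z) [0..<n])) <= (SUP n. GN (map T (map e [0..<n])))"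
   by (rule GN_bessel_frame[OF T(2) bes onb_frame[OF e]])
  also have "... <= 2 * epowr (gamma_fun J M Ph) 2" by (rule SUP_least) (rule B)
  finally show ?case by (simp add: T'_def[abs_def] comp_def)
 qed
 hence "2 * (SUP n. GN (map T' (map e [0..<n]))) <= 2 * (2 * epowr (gamma_fun J M Ph) 2)"
  by (rule mult_left_mono) simp
 also have "... = 4 * epowr (gamma_fun J M Ph) 2" by (simp add: mult.assoc[symmetric])
 finally show ?thesis .
next
 case False
 hence "gamma_fun J M Ph = top" by (simp add: less_top[symmetric])
 thus ?thesis by (simp add: ennreal_mult_top)
qed

end

section \<open>Layer cakes, lower integrals and the maximal function\<close>

text \<open>The derivative of \<open>t powr r\<close> on the positive half line, which is the weight
  of the layer cake formula.\<close>

definition lw :: "real => real => ennreal" where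
 "lw r t = en (r * t powr (r - 1)) * ind {0<..} t"

lemma measurable_lw[measurable]: "lw r : bm borel"
 unfolding lw_def[abs_def] by measurable

lemma powr_layer:
 assumes r: "0 < r"
 shows "(LN t. lw r t * ind {t. en t < a} t) = epowr a r"
proof -
 let ?L = "%a. LN t. lw r t * ind {t. en t < a} t"
 have fin: "(LN t. lw r t * ind {t. en t < en c} t) = en (c powr r)" if c: "0 <= c" for c
 proof -
  have "((%t. r * t powr (r - 1)) has_integral (r * (c powr (r - 1 + 1) / (r - 1 + 1)))) {0..c}"
   by (intro has_integral_mult_right has_integral_powr_from_0) (use r c in auto)
  hence "((%t. if t : {0..c} then r * t powr (r - 1) else 0) has_integral (c powr r)) UNIV"
   using r unfolding has_integral_restrict_UNIV by simp
  hence "(LN t. en (if t : {0..c} then r * t powr (r - 1) else 0)) = en (c powr r)"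
   using r by (intro nn_integral_has_integral_lborel) auto
  also have "(LN t. en (if t : {0..c} then r * t powr (r - 1) else 0))
    = (LN t. lw r t * ind {t. en t < en c} t)"
  proof (rule nn_integral_cong_AE)
   have "AE t in lborel. t ~= 0 & t ~= c"
    using AE_lborel_singleton[of 0] AE_lborel_singleton[of c] by eventually_elim auto
   thus "AE t in lborel. en (if t : {0..c} then r * t powr (r - 1) else 0) = lw r t * ind {t. en t < en c} t"
    by eventually_elim (use c in "auto simp: lw_def indicator_def ennreal_less_iff split: if_splits")
  qed
  finally show ?thesis .
 qed
 show ?thesis
 proof (cases a)
  case (real c)
  thus ?thesis using fin by (simp add: epowr_ennreal)
 next
  case top
  have "en n <= (?L a)" for n :: nat
  proof -
   have "en n = en ((real n powr (1 / r)) powr r)" using r by (cases "n = 0") (auto simp: powr_powr)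
   also have "... = (LN t. lw r t * ind {t. en t < en (real n powr (1 / r))} t)"
    by (rule fin[symmetric]) simp
   also have "... <= (?L a)"
    using top by (intro nn_integral_mono mult_left_mono) (auto simp: indicator_def)
   finally show ?thesis .
  qed
  note ge = this
  have "(?L a) = top"
  proof (rule ccontr)
   assume "(?L a) ~= top"
   then obtain c where c: "(?L a) = en c" "0 <= c"
    by (cases "(?L a)") auto
   obtain n :: nat where "c < real n" using reals_Archimedean2 by blast
   thus False using ge[of n] c by simp
  qed
  thus ?thesis using top by simp
 qed
qed

lemma layer_cake:
 assumes "sigma_finite_measure M" and f[measurable]: "f : bm M" and r: "0 < r"
 shows "NI M (%x. epowr (f x) r) = (LN t. lw r t * emeasure M {x : space M. en t < f x})"
proof -
 interpret M: sigma_finite_measure M by fact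
 interpret P: pair_sigma_finite M "lborel :: real measure" by unfold_locales
 have "NI M (%x. epowr (f x) r) = NI M (%x. LN t. lw r t * ind {t. en t < f x} t)"
  by (simp add: powr_layer[OF r])
 also have "... = NI M (%x. LN t. lw r t * ind {p : space (M \<otimes> lborel). en (snd p) < f (fst p)} (x, t))"
  by (intro nn_integral_cong) (auto simp: indicator_def space_pair_measure)
 also have "... = (LN t. NI M (%x. lw r t * ind {p : space (M \<otimes> lborel). en (snd p) < f (fst p)} (x, t)))"
  by (rule P.Fubini'[symmetric]) measurable
 also have "... = (LN t. lw r t * emeasure M {x : space M. en t < f x})"
 proof (rule nn_integral_cong)
  fix t
  have "NI M (%x. lw r t * ind {p : space (M \<otimes> lborel). en (snd p) < f (fst p)} (x, t))
    = NI M (%x. lw r t * ind {x : space M. en t < f x} x)"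
   by (intro nn_integral_cong) (auto simp: indicator_def space_pair_measure)
  thus "NI M (%x. lw r t * ind {p : space (M \<otimes> lborel). en (snd p) < f (fst p)} (x, t))
    = lw r t * emeasure M {x : space M. en t < f x}"
   by (simp add: nn_integral_cmult)
 qed
 finally show ?thesis .
qed

lemma inverse_one_plus_strict_antimono: "a < b ==> inverse (1 + b) < inverse (1 + (a::ennreal))"
proof (cases a; cases b)
 fix x y assume x: "0 <= x" and y: "0 <= y" and ab: "a = en x" "b = en y" "a < b"
 have e: "inverse (1 + en x) = en (inverse (1 + x))" if "0 <= x" for x
  using inverse_ennreal[of "1 + x"] that by simp
 have "inverse (1 + y) < inverse (1 + x)"
  using x y ab by (intro less_imp_inverse_less) (auto simp: ennreal_less_iff)
 thus ?thesis unfolding ab e[OF x] e[OF y] using x y by (intro ennreal_lessI) (auto simp: add_pos_nonneg)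
qed (auto simp: ennreal_inverse_positive)

lemma inverse_one_plus_antimono: "a <= b ==> inverse (1 + b) <= inverse (1 + (a::ennreal))"
 using inverse_one_plus_strict_antimono[of a b] by (cases "a = b") (auto intro: less_imp_le)

text \<open>A function that need not be measurable has a largest measurable minorant up to null sets; the
 (lower) integrals of the two agree on all measurable sets.\<close>
lemma measurable_minorant:
 fixes f :: "'a => ennreal"
 assumes "sigma_finite_measure M"
 shows "EX g:bm M. (ALL x. g x <= f x) &
  (ALL h:bm M. (ALL x:space M. h x <= f x) --> (AE x in M. h x <= g x))"
proof -
 interpret M: sigma_finite_measure M by fact
 obtain w where w[measurable]: "w : bm M" and wf: "integral\<^sup>N M w ~= \<infinity>"
  and w0: "!!x. x : space M ==> 0 < w x & w x < \<infinity>"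
  using M.Ex_finite_integrable_function by auto
 \<comment> \<open>\<open>I\<close> decreases strictly in \<open>g\<close> and is finite because
   \<open>w\<close> is integrable. A countable supremum that minimises it over the measurable
   minorants therefore cannot be enlarged on a set of positive measure.\<close>
 define I where "I g = NI M (%x. w x * inverse (1 + g x))" for g :: "'a => ennreal"
 define G where "G = {g : bm M. ALL x. g x <= f x}"
 have "(%_. 0) : G" by (simp add: G_def)
 hence "I ` G ~= {}" by auto
 from ennreal_Inf_countable_INF[OF this] obtain s :: "nat => ennreal" where s: "range s <= I ` G" "Inf (I ` G) = (INF i. s i)"
  by blast
 hence "ALL i. EX g:G. s i = I g" by (auto simp: image_iff)
 then obtain g where g: "!!i. g i : G" "!!i. s i = I (g i)" by metis
 define g0 where "g0 x = (SUP i. g i x)" for x :: 'a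
 have [measurable]: "g i : bm M" for i using g(1) by (simp add: G_def)
 have [measurable]: "g0 : bm M" unfolding g0_def[abs_def] by measurable
 have g0f: "g0 x <= f x" for x unfolding g0_def using g(1) by (intro SUP_least) (auto simp: G_def)
 have I_anti: "I h <= I k" if "!!x. k x <= h x" for h k
  unfolding I_def using that by (intro nn_integral_mono mult_left_mono) (auto intro: inverse_one_plus_antimono)
 have Imin: "I g0 <= I h" if "h : G" for h
 proof -
  have "I g0 <= (INF i. s i)"
   unfolding g(2) by (intro INF_greatest I_anti) (auto simp: g0_def intro: SUP_upper)
  also have "... <= I h" unfolding s(2)[symmetric] using that by (intro Inf_lower) auto
  finally show ?thesis .
 qed
 have "AE x in M. h x <= g0 x" if h[measurable]: "h : bm M" and hf: "ALL x:space M. h x <= f x" for h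
 proof -
  define k where "k x = max (g0 x) (if x : space M then h x else 0)" for x
  have "k : bm M <-> (%x. max (g0 x) (h x)) : bm M"
   by (rule measurable_cong) (simp add: k_def)
  hence km[measurable]: "k : bm M" by simp
  have kG: "k : G" using g0f hf km by (auto simp: G_def k_def)
  have le: "inverse (1 + k x) <= inverse (1 + g0 x)" for x
   by (intro inverse_one_plus_antimono) (simp add: k_def)
  have inv_le: "inverse (1 + a) <= (1::ennreal)" for a
   using inverse_one_plus_antimono[of 0 a] by simp
  have "I k <= integral\<^sup>N M w"
   unfolding I_def using inv_le by (intro nn_integral_mono) (metis mult.right_neutral mult_left_mono zero_le)
  hence fin: "I k ~= \<infinity>" using wf by (auto simp: top_unique)
  have "NI M (%x. w x * inverse (1 + g0 x) - w x * inverse (1 + k x)) = I g0 - I k"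
   unfolding I_def by (intro nn_integral_diff) (use fin le in "auto simp: I_def intro!: mult_left_mono")
  also have "... = 0" using Imin[OF kG] fin by (simp add: diff_eq_0_iff_ennreal less_top)
  finally have "AE x in M. w x * inverse (1 + g0 x) - w x * inverse (1 + k x) = 0"
   by (subst (asm) nn_integral_0_iff_AE) auto
  thus ?thesis
  proof (elim AE_mp, intro AE_I2 impI)
   fix x assume x: "x : space M" and *: "w x * inverse (1 + g0 x) - w x * inverse (1 + k x) = 0"
   show "h x <= g0 x"
   proof (rule ccontr)
   assume n: "~ h x <= g0 x"
   have "w x * inverse (1 + g0 x) <= w x * inverse (1 + k x)"
    using * by (simp add: diff_eq_0_iff_ennreal)
   moreover have "w x * inverse (1 + k x) < w x * inverse (1 + g0 x)"
    using w0[OF x] n x by (intro ennreal_mult_strict_left_mono inverse_one_plus_strict_antimono) (auto simp: k_def max_def)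
   ultimately show False by simp
   qed
  qed
 qed
 thus ?thesis using g0f by (intro bexI[of _ g0]) auto
qed

text \<open>By definition the integral of a nonmeasurable function is a supremum over the simple
  functions below it, and each of these is a measurable minorant of \<open>f\<close>.\<close>

lemma lower_integral_le:
 assumes A: "A : sets M" and g[measurable]: "g : bm M"
  and min: "!!h. h : bm M ==> (!!x. x : space M ==> h x <= f x) ==> AE x in M. h x <= g x"
 shows "NI M (%x. ind A x * f x) <= NI M (%x. ind A x * g x)"
 unfolding nn_integral_def[of M "%x. ind A x * f x"]
proof (rule SUP_least, goal_cases)
 case s: (1 s)
 hence sm[measurable]: "s : bm M" by (auto intro: borel_measurable_simple_function)
 have sA: "s x <= ind A x * f x" for x using s by (auto simp: le_fun_def)
 have "AE x in M. s x <= g x"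
 proof (rule min[OF sm])
  show "s x <= f x" for x using sA[of x] by (cases "x : A") auto
 qed
 hence "AE x in M. s x <= ind A x * g x"
 proof eventually_elim
  case (elim x)
  thus ?case using sA[of x] by (auto simp: indicator_def split: if_splits)
 qed
 hence "integral\<^sup>N M s <= NI M (%x. ind A x * g x)" by (rule nn_integral_mono_AE)
 thus ?case
  using s by (simp add: nn_integral_eq_simple_integral)
qed

section \<open>The uncentred Hardy-Littlewood maximal function\<close>

definition maxf :: "('n::euclidean_space => ennreal) => 'n => ennreal" where
 "maxf g x = (SUP cr\<in>{(c, r). r > 0 & x : ball c r}.
   (LN y. ind (ball (fst cr) (snd cr)) y * g y) / emeasure lborel (ball (fst cr) (snd cr)))"

lemma emeasure_ball_pos:
 fixes c :: "'n::euclidean_space" assumes "0 < r"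
 shows "0 < emeasure lborel (ball c r)" "emeasure lborel (ball c r) < top"
 using assms by (auto simp: emeasure_ball unit_ball_vol_pos)

text \<open>A ball that works for one point works for all its points, so superlevel sets are unions
  of balls. Hence suprema such as \<open>maxf\<close> and \<open>Cq\<close> are Borel whatever is
  integrated over the balls.\<close>

lemma open_SUP_balls:
 fixes G :: "'n::euclidean_space \<times> real => ennreal"
 shows "open {x. t < (SUP cr\<in>{(c, r). r > 0 & x : ball c r}. G cr)}"
proof -
 have "{x. t < (SUP cr\<in>{(c, r). r > 0 & x : ball c r}. G cr)} = (UN cr:{(c, r). r > 0 & t < G (c, r)}. ball (fst cr) (snd cr))"
  by (force simp: less_SUP_iff)
 thus ?thesis by (auto intro!: open_UN)
qed

lemma measurable_SUP_balls:
 fixes G :: "'n::euclidean_space \<times> real => ennreal"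
 shows "(%x. SUP cr\<in>{(c, r). r > 0 & x : ball c r}. G cr) : bm borel"
 by (rule borel_measurableI_greater) (use open_SUP_balls[of _ G] in auto)

lemma emeasure_ball_scale:
 fixes c c' :: "'n::euclidean_space"
 assumes "0 <= r" "0 <= k"
 shows "emeasure lborel (ball c (k * r)) = en (k ^ DIM('n)) * emeasure lborel (ball c' r)"
 using assms by (simp add: emeasure_ball power_mult_distrib ennreal_mult[symmetric] ac_simps)

text \<open>Bounds on the sets \<open>X i\<close> add up over disjoint \<open>B i\<close>. The
  measure \<open>M\<close> and the density \<open>g\<close> are kept general to serve two cases:
  dilated balls in the weak type estimate, and level sets of truncated cones in the good lambda
  inequality.\<close>

lemma vitali_sum:
 fixes X B :: "'i => 'n::euclidean_space set"
 assumes C: "countable C" and sets[measurable]: "!!i. i : C ==> X i : sets borel" "!!i. i : C ==> B i : sets borel"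
  and M[measurable_cong]: "sets M = sets borel" and g[measurable]: "g : bm borel" and dis: "disjoint_family_on B C"
  and le: "!!i. i : C ==> emeasure M (X i) <= ka * (LN x. ind (B i) x * g x)"
 shows "emeasure M (UN i:C. X i) <= ka * (LN x. ind (UN i:C. B i) x * g x)"
proof -
 have mUN[measurable]: "(UN i:C. X i) : sets borel" "(UN i:C. B i) : sets borel"
  using C sets by (auto intro!: sets.countable_UN')
 have "emeasure M (UN i:C. X i) = NI M (%x. ind (UN i:C. X i) x)"
  using M by simp
 also have "... <= NI M (%x. NI (count_space C) (%i. ind (X i) x))"
 proof (rule nn_integral_mono, goal_cases)
  case (1 x)
  show ?case
  proof (cases "x : (UN i:C. X i)")
   case True
   then obtain i where "i : C" "x : X i" by auto
   thus ?thesis using nn_integral_ge_point[of i C "%i. ind (X i) x"] by (auto simp: indicator_def)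
  qed auto
 qed
 also have "... = NI (count_space C) (%i. NI M (%x. ind (X i) x))"
  using nn_integral_count_space_nn_integral[of C "%i x. ind (X i) x" M] C by simp
 also have "... <= NI (count_space C) (%i. ka * emeasure (density lborel g) (B i))"
  using le by (intro nn_integral_mono) (simp add: emeasure_density M mult.commute)
 also have "... = ka * NI (count_space C) (%i. emeasure (density lborel g) (B i))"
  by (rule nn_integral_cmult) simp
 also have "NI (count_space C) (%i. emeasure (density lborel g) (B i)) = emeasure (density lborel g) (UN i:C. B i)"
  by (rule emeasure_UN_countable[symmetric]) (use C dis in auto)
 also have "... = (LN x. ind (UN i:C. B i) x * g x)"
  by (simp add: emeasure_density mult.commute)
 finally show ?thesis .
qed

lemma maxf_weak:
 fixes g :: "'n::euclidean_space => ennreal"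
 assumes g[measurable]: "g : bm borel" and t: "0 < t"
 shows "en t * emeasure lborel {x. en t < maxf g x} <= 5 ^ DIM('n) * (LN x. g x)"
proof (cases "(LN x. g x) = \<infinity>")
 case True
 thus ?thesis by (simp add: ennreal_mult_top)
next
 case False
 then obtain I where I: "(LN x. g x) = en I" "I >= 0" by (cases "(LN x. g x)") auto
 let ?m = "%c r. (LN y. ind (ball c r) y * g y)"
 define K where "K = {(c::'n, r). r > 0 & en t * emeasure lborel (ball c r) < ?m c r}"
 define V where "V = unit_ball_vol (real DIM('n))"
 have V: "V > 0" by (simp add: V_def)
 have cover: "{x. en t < maxf g x} <= (UN cr:K. ball (fst cr) (snd cr))"
 proof
  fix x assume "x : {x. en t < maxf g x}"
  then obtain c r where cr: "r > 0" "x : ball c r" "en t < ?m c r / emeasure lborel (ball c r)"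
   by (auto simp: maxf_def less_SUP_iff)
  have "en t * emeasure lborel (ball c r) < ?m c r"
  proof (rule ccontr)
   assume "~ en t * emeasure lborel (ball c r) < ?m c r"
   hence "?m c r / emeasure lborel (ball c r) <= en t"
    using emeasure_ball_pos[OF cr(1), of c]
    by (intro divide_le_posI_ennreal) (auto simp: not_less mult.commute)
   thus False using cr(3) by simp
  qed
  thus "x : (UN cr:K. ball (fst cr) (snd cr))" using cr by (force simp: K_def)
 qed
 \<comment> \<open>Vitali's lemma asks for bounded radii: \<open>t\<close> times the volume of a
   selected ball is at most the integral of \<open>g\<close>.\<close>
 define B where "B = root DIM('n) (I / (t * V)) + 1"
 have rB: "0 < snd cr & snd cr <= B" if crK: "cr : K" for cr
 proof -
  obtain c r where cr: "cr = (c, r)" "r > 0" "en t * emeasure lborel (ball c r) < ?m c r"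
   using crK by (auto simp: K_def)
  have "?m c r <= en I" unfolding I(1)[symmetric]
   by (intro nn_integral_mono) (auto simp: indicator_def)
  with cr(3) have "en t * emeasure lborel (ball c r) <= en I" by simp
  hence "t * (V * r ^ DIM('n)) <= I"
   using cr(2) t V I by (simp add: emeasure_ball V_def[symmetric] ennreal_mult[symmetric])
  hence "r ^ DIM('n) <= I / (t * V)" using t V by (simp add: field_simps)
  hence "root DIM('n) (r ^ DIM('n)) <= root DIM('n) (I / (t * V))" by simp
  hence "r <= root DIM('n) (I / (t * V))" using cr(2) by (simp add: real_root_power_cancel)
  thus ?thesis using cr by (simp add: B_def)
 qed
 obtain C where C: "countable C" "C <= K"
  "pairwise (%i j. disjnt (ball (fst i) (snd i)) (ball (fst j) (snd j))) C"
  "{x. en t < maxf g x} <= (UN i:C. ball (fst i) (5 * snd i))"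
  using Vitali_covering_lemma_balls[OF cover rB] by blast
 have "en t * emeasure lborel {x. en t < maxf g x}
   <= en t * emeasure lborel (UN i:C. ball (fst i) (5 * snd i))"
  using C by (intro mult_left_mono emeasure_mono) (auto intro!: sets.countable_UN')
 also have "... = emeasure (density lborel (%_. en t)) (UN i:C. ball (fst i) (5 * snd i))"
  using C(1) by (subst emeasure_density_const) (auto intro!: sets.countable_UN')
 also have "... <= 5 ^ DIM('n) * (LN x. ind (UN i:C. ball (fst i) (snd i)) x * g x)"
 proof (rule vitali_sum[OF C(1)])
  fix i assume "i : C"
  hence "i : K" using C by auto
  hence i: "snd i > 0" "en t * emeasure lborel (ball (fst i) (snd i)) <= ?m (fst i) (snd i)"
   by (auto simp: K_def less_imp_le)
  have "emeasure lborel (ball (fst i) (5 * snd i)) = 5 ^ DIM('n) * emeasure lborel (ball (fst i) (snd i))"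
   using emeasure_ball_scale[of "snd i" 5 "fst i" "fst i"] i(1) by (simp flip: ennreal_power)
  hence "en t * emeasure lborel (ball (fst i) (5 * snd i)) = 5 ^ DIM('n) * (en t * emeasure lborel (ball (fst i) (snd i)))"
   by (simp add: ac_simps)
  also have "... <= 5 ^ DIM('n) * ?m (fst i) (snd i)" by (intro mult_left_mono i) auto
  finally show "emeasure (density lborel (%_. en t)) (ball (fst i) (5 * snd i)) <= 5 ^ DIM('n) * ?m (fst i) (snd i)"
   by (subst emeasure_density_const) auto
 qed (use C(3) in "auto simp: disjoint_family_on_def pairwise_def disjnt_def")
 also have "(LN x. ind (UN i:C. ball (fst i) (snd i)) x * g x) <= (LN x. g x)"
  by (intro nn_integral_mono) (auto simp: indicator_def)
 finally show ?thesis by (simp add: mult_left_mono)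
qed

lemma ennreal_two_times_half: "2 * (a / 2) = (a::ennreal)"
proof (cases a)
 case (real r)
 hence "2 * (a / 2) = en 2 * en (r / 2)" by (simp add: ennreal_divide_numeral)
 thus ?thesis using real by (simp add: ennreal_mult[symmetric] del: ennreal_numeral)
qed (simp add: ennreal_mult_top ennreal_top_divide)

text \<open>The part of \<open>g\<close> that is at most \<open>t/2\<close> raises no average above
  \<open>t/2\<close>.\<close>

lemma maxf_mono_add:
 fixes g :: "'n::euclidean_space => ennreal"
 assumes [measurable]: "g : bm borel" and t: "0 < t" and x: "en t < maxf g x"
 shows "en (t/2) < maxf (%x. ind {x. en (t/2) < g x} x * g x) x"
proof -
 define g' where "g' x = ind {x. en (t/2) < g x} x * g x" for x
 have [measurable]: "g' : bm borel" unfolding g'_def[abs_def] by measurable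
 obtain c r where cr: "r > 0" "x : ball c r"
  "en t < (LN y. ind (ball c r) y * g y) / emeasure lborel (ball c r)"
  using x by (auto simp: maxf_def less_SUP_iff)
 let ?b = "emeasure lborel (ball c r)"
 have [measurable]: "ball c r : sets borel" by simp
 have "(LN y. ind (ball c r) y * g y)
   <= (LN y. ind (ball c r) y * g' y + en (t/2) * ind (ball c r) y)"
  by (intro nn_integral_mono) (auto simp: g'_def indicator_def not_less)
 also have "... = (LN y. ind (ball c r) y * g' y) + en (t/2) * ?b"
  by (subst nn_integral_add) (auto simp: nn_integral_cmult)
 finally have "(LN y. ind (ball c r) y * g y) / ?b
   <= ((LN y. ind (ball c r) y * g' y) + en (t/2) * ?b) / ?b"
  by (rule divide_right_mono_ennreal)
 also have "... = (LN y. ind (ball c r) y * g' y) / ?b + en (t/2)"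
  using emeasure_ball_pos[OF cr(1), of c] by (simp add: add_divide_distrib_ennreal mult_divide_eq_ennreal)
 also have "... <= maxf g' x + en (t/2)"
  unfolding maxf_def using cr by (intro add_right_mono SUP_upper2[of "(c, r)"]) auto
 finally have "en t < maxf g' x + en (t/2)" using cr(3) by simp
 also have "en t = en (t/2) + en (t/2)" using t by (simp flip: ennreal_plus)
 finally show ?thesis unfolding g'_def by (simp add: add.commute ennreal_add_left_cancel_less)
qed

lemma epowr_mult_one: "0 < r ==> a * epowr a r = epowr a (r + 1)"
 by (cases a) (auto simp: epowr_ennreal ennreal_mult[symmetric] powr_mult_base add.commute)

text \<open>At height \<open>t\<close> the weak bound is applied only to the part of
  \<open>g\<close> above \<open>t/2\<close>; integrating in \<open>t\<close> and exchanging the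
  integrals returns a power of \<open>g\<close>.\<close>

theorem hardy_littlewood:
 fixes g :: "'n::euclidean_space => ennreal"
 assumes g[measurable]: "g : bm borel" and s: "1 < s"
 shows "(LN x. epowr (maxf g x) s)
  <= en (2 * 5 ^ DIM('n) * (s / (s - 1)) * 2 powr (s - 1)) * (LN x. epowr (g x) s)"
proof -
 let ?n = "DIM('n)"
 let ?k = "%x t. ind {t. en t < 2 * g x} t * g x"
 let ?c = "2 * 5 ^ ?n * (s / (s - 1))"
 have m[measurable]: "maxf g : bm borel"
  unfolding maxf_def[abs_def] by (rule measurable_SUP_balls)
 have "(LN x. epowr (maxf g x) s) = (LN t. lw s t * emeasure lborel {x : space lborel. en t < maxf g x})"
  by (rule layer_cake) (use s sigma_finite_lborel in auto)
 also have "... <= (LN t. en ?c * NI (lborel :: 'n measure) (%x. lw (s - 1) t * (?k x t)))"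
 proof (rule nn_integral_mono)
  fix t :: real
  show "lw s t * emeasure lborel {x : space lborel. en t < maxf g x}
   <= en ?c * (LN x. lw (s - 1) t * (?k x t))"
  proof (cases "t > 0")
   case True
   define g' where "g' x = ind {x. en (t/2) < g x} x * g x" for x
   have [measurable]: "g' : bm borel" unfolding g'_def[abs_def] by measurable
   have mg': "{x. en (t/2) < maxf g' x} : sets borel"
    unfolding maxf_def by (intro borel_open open_SUP_balls)
   \<comment> \<open>One factor \<open>t\<close> is split off the weight to match the left side of
     \<open>maxf_weak\<close>.\<close>
   have lws: "lw s t = en (s / (s - 1) * t) * lw (s - 1) t"
    using True s powr_mult_base[of t "s - 2"] by (simp add: lw_def ennreal_mult[symmetric] field_simps)
   have "en t * emeasure lborel {x : space lborel. en t < maxf g x} <= en t * emeasure lborel {x. en (t/2) < maxf g' x}"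
    using maxf_mono_add[OF g True] mg' by (intro mult_left_mono emeasure_mono) (auto simp: g'_def[abs_def])
   also have "... = 2 * (en (t/2) * emeasure lborel {x. en (t/2) < maxf g' x})"
    using True by (simp add: mult.assoc[symmetric] ennreal_mult'[symmetric] flip: ennreal_numeral)
   also have "... <= 2 * (5 ^ ?n * (LN x. g' x))"
    using True by (intro mult_left_mono maxf_weak) auto
   also have "(LN x. g' x) = (LN x. ind {t. en t < 2 * g x} t * g x)"
   proof (rule nn_integral_cong, goal_cases)
    case (1 x)
    show ?case
   proof -
    have "en t = 2 * en (t/2)" using True by (simp add: ennreal_mult'[symmetric] flip: ennreal_numeral)
    hence "en (t/2) < g x <-> en t < 2 * g x"
     using True by (cases "g x") (auto simp: ennreal_less_iff ennreal_mult'[symmetric] ennreal_mult_top simp flip: ennreal_numeral)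
    thus ?thesis by (simp add: g'_def indicator_def)
   qed
   qed
   finally have 1: "en t * emeasure lborel {x : space lborel. en t < maxf g x}
    <= 2 * (5 ^ ?n * (LN x. ind {t. en t < 2 * g x} t * g x))" .
   have "lw s t * emeasure lborel {x : space lborel. en t < maxf g x}
    = (en (s / (s - 1)) * lw (s - 1) t) * (en t * emeasure lborel {x : space lborel. en t < maxf g x})"
   proof -
    have "en (s / (s - 1) * t) = en (s / (s - 1)) * en t"
     using s True by (intro ennreal_mult) auto
    thus ?thesis unfolding lws by (simp only: ac_simps)
   qed
   also have "... <= (en (s / (s - 1)) * lw (s - 1) t) * (2 * (5 ^ ?n * (LN x. ind {t. en t < 2 * g x} t * g x)))"
    by (intro mult_left_mono 1) auto
   also have "... = en ?c * (lw (s - 1) t * (LN x. ind {t. en t < 2 * g x} t * g x))"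
   proof -
    have "en ?c = en (2 * 5 ^ ?n) * en (s / (s - 1))"
     using s by (intro ennreal_mult) auto
    also have "en (2 * 5 ^ ?n) = 2 * 5 ^ ?n" by (simp add: ennreal_mult flip: ennreal_power)
    finally show ?thesis by (simp only: ac_simps)
   qed
   finally show ?thesis by (subst nn_integral_cmult) auto
  qed (simp add: lw_def)
 qed
 also have "... = en ?c * (LN t. NI (lborel :: 'n measure) (%x. lw (s - 1) t * (?k x t)))"
 proof (rule nn_integral_cmult)
  have "(%(t, x). lw (s - 1) t * (ind {p. en (fst p) < 2 * g (snd p)} (t, x) * g x)) : bm (lborel \<otimes> lborel)"
   by measurable
  from lborel.borel_measurable_nn_integral_fst[OF this]
  show "(%t. NI (lborel :: 'n measure) (%x. lw (s - 1) t * (?k x t))) : bm lborel"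
   by (simp add: indicator_def)
 qed
 also have "(LN t. NI (lborel :: 'n measure) (%x. lw (s - 1) t * (?k x t)))
   = NI (lborel :: 'n measure) (%x. LN t. lw (s - 1) t * (?k x t))"
 proof -
  have "(%(x, t). lw (s - 1) t * (ind {p. en (snd p) < 2 * g (fst p)} (x, t) * g x)) : bm (lborel \<otimes> lborel)"
   by measurable
  from lborel_pair.Fubini'[OF this] show ?thesis by (simp add: indicator_def)
 qed
 also have "... = NI (lborel :: 'n measure) (%x. en (2 powr (s - 1)) * epowr (g x) s)"
 proof (rule nn_integral_cong, goal_cases)
  case (1 x)
  have "(LN t. lw (s - 1) t * (?k x t))
    = (LN t. g x * (lw (s - 1) t * ind {t. en t < 2 * g x} t))"
   by (simp add: ac_simps)
  also have "... = g x * epowr (2 * g x) (s - 1)"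
   using s by (subst nn_integral_cmult) (auto simp: powr_layer)
  also have "... = en (2 powr (s - 1)) * (g x * epowr (g x) (s - 1))"
   using epowr_ennreal[of 2 "s - 1"] by (simp add: epowr_mult ac_simps)
  also have "g x * epowr (g x) (s - 1) = epowr (g x) s" using epowr_mult_one[of "s - 1" "g x"] s by simp
  finally show ?case .
 qed
 also have "... = en (2 powr (s - 1)) * (LN x. epowr (g x) s)"
  by (rule nn_integral_cmult) measurable
 finally have "(LN x. epowr (maxf g x) s)
  <= (en ?c * en (2 powr (s - 1))) * (LN x. epowr (g x) s)"
  by (simp only: mult.assoc)
 also have "en ?c * en (2 powr (s - 1)) = en (2 * 5 ^ ?n * (s / (s - 1)) * 2 powr (s - 1))"
  using s by (intro ennreal_mult[symmetric]) auto
 finally show ?thesis .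
qed

section \<open>The bound of the Carleson functional by the conical square function\<close>

lemma sets_uhs_base: "sets uhs_base = sets (restrict_space borel {z. snd z > 0})"
 unfolding uhs_base_def by (rule sets_restrict_space_cong[OF sets_lborel])

lemma space_uhs[simp]: "space uhs = {z. snd z > 0}"
 by (simp add: uhs_def uhs_base_def space_restrict_space)

lemma sets_uhs: "sets uhs = sets (restrict_space borel {z. snd z > 0})"
 by (simp add: uhs_def sets_uhs_base)

lemma measurable_uhs[measurable (raw)]:
 assumes "f : measurable borel N" shows "f : measurable uhs N"
proof -
 have "f : measurable (restrict_space borel {z. snd z > 0}) N" by (rule measurable_restrict_space1[OF assms])
 thus ?thesis by (simp cong: measurable_cong_sets add: sets_uhs)
qed

context complex_banach
begin

text \<open>Truncating the cone is multiplication by an indicator; the factor 4 of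
  \<open>gamma_fun_mult_le\<close> becomes 2 after the square root.\<close>

lemma Atr_le_Aop: "Atr J al F h x <= 2 * Aop J al F x"
 for F :: "('n::finite) uhs => 'x"
proof -
 let ?u = "%z::'n uhs. ind {z. snd z < h} z :: real"
 have "{z::'n uhs. snd z < h} : sets borel" by (intro borel_open open_Collect_less continuous_intros)
 hence "?u : bm borel" by simp
 hence "?u : bm uhs" by (rule measurable_uhs)
 hence "epowr (gamma_fun J uhs (%z. ?u z *R (if z : cone al x then F z else 0))) 2
   <= 4 * epowr (gamma_fun J uhs (%z. if z : cone al x then F z else 0)) 2"
  by (rule gamma_fun_mult_le) (auto simp: indicator_def)
 also have "(%z. ?u z *R (if z : cone al x then F z else 0)) = (%z. if z : tcone al h x then F z else 0)"
  by (auto simp: tcone_def indicator_def)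
 finally have "epowr (Atr J al F h x) 2 <= 4 * epowr (Aop J al F x) 2" by (simp add: Atr_def Aop_def)
 also have "... = epowr (2 * Aop J al F x) 2"
  using epowr_nat[of 2 "2::ennreal"] by (simp add: epowr_mult power2_eq_square)
 finally show ?thesis by (simp add: epowr_le_epowr_iff)
qed

text \<open>For finite \<open>p\<close> the maximal theorem is used for \<open>g\<close> to the
  power \<open>q\<close>, at the exponent \<open>s\<close>, the quotient of \<open>p\<close> and
  \<open>q\<close>, which exceeds 1. For infinite \<open>p\<close> an essential bound on
  \<open>Aop\<close> passes directly to all averages.\<close>

theorem Lpn_Cq_le_Aop:
 assumes q: "0 < q" "en q < p"
 shows "EX C::real. C > 0 & (ALL F :: ('n::finite) uhs => 'x. Lpn p (Cq J al q F) <= en C * Lpn p (Aop J al F))"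
proof (cases "p = \<infinity>")
 let ?I = "%(F :: 'n uhs => 'x) z r. LN y. ind (ball z r) y * epowr (Atr J al F r y) q"
 case True
 have "Lpn p (Cq J al q F) <= en 2 * Lpn p (Aop J al F)" for F :: "'n uhs => 'x"
 proof -
  let ?S = "{c. AE x in lborel. Aop J al F x <= c}"
  have *: "Lpn p (Cq J al q F) <= 2 * c" if c: "c : ?S" for c
  proof -
   have "Cq J al q F x <= 2 * c" for x
    unfolding Cq_def
   proof (rule SUP_least, clarify)
    fix z :: "real ^ 'n" and r :: real assume r: "r > 0"
    have "(?I F z r)
     <= (LN y. epowr (2 * c) q * ind (ball z r) y)"
    proof (rule nn_integral_mono_AE)
     show "AE y in lborel. ind (ball z r) y * epowr (Atr J al F r y) q <= epowr (2 * c) q * ind (ball z r) y"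
      using c unfolding mem_Collect_eq
     proof eventually_elim
      case (elim y)
      have "Atr J al F r y <= 2 * c" by (rule order_trans[OF Atr_le_Aop]) (intro mult_left_mono elim, simp)
      thus ?case using q by (auto simp: indicator_def intro: epowr_mono)
     qed
    qed
    also have "... = epowr (2 * c) q * emeasure lborel (ball z r)" by (rule nn_integral_cmult_indicator) simp
    finally have "(?I F z r) / emeasure lborel (ball z r) <= epowr (2 * c) q"
     using emeasure_ball_pos[OF r, of z] by (intro divide_le_posI_ennreal) (auto simp: mult.commute)
    thus "epowr ((LN y. ind (ball (fst (z, r)) (snd (z, r))) y * epowr (Atr J al F (snd (z, r)) y) q) /
      emeasure lborel (ball (fst (z, r)) (snd (z, r)))) (1 / q) <= 2 * c"
     using q by (simp add: le_epowr_iff[of "q", symmetric])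
   qed
   thus ?thesis using True unfolding Lpn_def by (auto intro!: Inf_lower)
  qed
  have "Lpn p (Cq J al q F) / 2 <= Inf ?S"
   by (rule Inf_greatest) (intro divide_le_posI_ennreal *, auto)
  hence "2 * (Lpn p (Cq J al q F) / 2) <= 2 * Inf ?S" by (rule mult_left_mono) simp
  also have "2 * (Lpn p (Cq J al q F) / 2) = Lpn p (Cq J al q F)"
   by (rule ennreal_two_times_half)
  also have "Inf ?S = Lpn p (Aop J al F)" using True by (simp add: Lpn_def)
  finally show ?thesis by simp
 qed
 thus ?thesis by (intro exI[of _ 2]) auto
next
 let ?I = "%(F :: 'n uhs => 'x) z r. LN y. ind (ball z r) y * epowr (Atr J al F r y) q"
 case False
 then obtain p' where p': "p = en p'" "0 <= p'" by (cases p) auto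
 define s where "s = p' / q"
 have pq: "q < p'" "0 < p'" using q p' by (auto simp: ennreal_less_iff)
 have s: "1 < s" using pq q by (simp add: s_def)
 define K where "K = 2 powr p' * (2 * 5 ^ CARD('n) * (s / (s - 1)) * 2 powr (s - 1))"
 have K: "K > 0" using s by (simp add: K_def)
 have "Lpn p (Cq J al q F) <= en (K powr (1 / p')) * Lpn p (Aop J al F)" for F :: "'n uhs => 'x"
 proof -
  obtain g where g[measurable]: "g : bm lborel" and gle: "!!x. g x <= Aop J al F x"
   and gmin: "!!h. h : bm lborel ==> (!!x. h x <= Aop J al F x) ==> AE x in lborel. h x <= g x"
   using measurable_minorant[OF sigma_finite_lborel, of "Aop J al F"] by auto
   let ?M = "%x. maxf (%y. epowr (g y) q) x"
  have low: "(LN y. ind B y * epowr (Aop J al F y) q) <= (LN y. ind B y * epowr (g y) q)"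
   if "B : sets borel" for B
  proof (rule lower_integral_le)
   fix h :: "real ^ 'n => ennreal" assume h[measurable]: "h : bm lborel"
    and le: "!!x. x : space lborel ==> h x <= epowr (Aop J al F x) q"
   have "AE x in lborel. epowr (h x) (1/q) <= g x"
    using le q by (intro gmin) (auto simp: le_epowr_iff)
   thus "AE x in lborel. h x <= epowr (g x) q"
    by eventually_elim (use q in "simp add: le_epowr_iff")
  qed (use that in auto)
  have Cle: "Cq J al q F x <= 2 * epowr (?M x) (1/q)" for x
   unfolding Cq_def
  proof (rule SUP_least, clarify)
   fix z :: "real ^ 'n" and r :: real assume r: "r > 0" "x : ball z r"
   have [measurable]: "ball z r : sets borel" by simp
   have "(?I F z r)
    <= (LN y. ind (ball z r) y * (epowr 2 q * epowr (g y) q))"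
   proof -
    have "(?I F z r)
     <= (LN y. ind (ball z r) y * (epowr 2 q * epowr (Aop J al F y) q))"
     using q unfolding epowr_mult[symmetric] by (intro nn_integral_mono mult_left_mono epowr_mono Atr_le_Aop) auto
    also have "... <= (LN y. ind (ball z r) y * (epowr 2 q * epowr (g y) q))"
    proof (rule lower_integral_le)
     fix h :: "real ^ 'n => ennreal" assume h[measurable]: "h : bm lborel"
      and le: "!!x. x : space lborel ==> h x <= epowr 2 q * epowr (Aop J al F x) q"
     \<comment> \<open>Maximality of \<open>g\<close> concerns minorants of \<open>Aop\<close>
       itself, so a minorant of the \<open>q\<close>-th power of \<open>2 Aop\<close> is first
       brought back by a root and division by 2.\<close>
     have "AE x in lborel. epowr (h x) (1/q) / 2 <= g x"
      using le q by (intro gmin divide_le_posI_ennreal) (auto simp: le_epowr_iff epowr_mult[symmetric])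
     thus "AE x in lborel. h x <= epowr 2 q * epowr (g x) q"
     proof eventually_elim
      case (elim y)
      have "epowr (h y) (1/q) = 2 * (epowr (h y) (1/q) / 2)"
       by (rule ennreal_two_times_half[symmetric])
      also have "... <= 2 * g y" by (intro mult_left_mono elim) auto
      finally show ?case using q by (simp add: le_epowr_iff epowr_mult[symmetric])
     qed
    qed auto
    finally show ?thesis .
   qed
   also have "... = epowr 2 q * (LN y. ind (ball z r) y * epowr (g y) q)"
    by (subst nn_integral_cmult[symmetric]) (auto simp: ac_simps)
   finally have "(?I F z r) / emeasure lborel (ball z r)
     <= epowr 2 q * (LN y. ind (ball z r) y * epowr (g y) q) / emeasure lborel (ball z r)"
    by (rule divide_right_mono_ennreal)
   also have "... <= epowr 2 q * maxf (%y. epowr (g y) q) x"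
    unfolding maxf_def ennreal_times_divide[symmetric] using r
    by (intro mult_left_mono SUP_upper2[of "(z, r)"]) auto
   finally have "epowr ((?I F z r) / emeasure lborel (ball z r)) (1/q)
     <= epowr (epowr 2 q * maxf (%y. epowr (g y) q) x) (1/q)"
    using q by (intro epowr_mono) auto
   also have "... = 2 * epowr (?M x) (1/q)"
    using q by (simp add: epowr_mult epowr_inv)
   finally show "epowr ((LN y. ind (ball (fst (z, r)) (snd (z, r))) y * epowr (Atr J al F (snd (z, r)) y) q) /
      emeasure lborel (ball (fst (z, r)) (snd (z, r)))) (1 / q) <= 2 * epowr (?M x) (1/q)"
    by simp
  qed
  have [measurable]: "maxf (%y. epowr (g y) q) : bm borel"
   unfolding maxf_def[abs_def] by (rule measurable_SUP_balls)
  have "(LN x. epowr (Cq J al q F x) p') <= (LN x. en (2 powr p') * epowr (?M x) s)"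
  proof (rule nn_integral_mono, goal_cases)
   case (1 x)
   have "epowr (Cq J al q F x) p' <= epowr (2 * epowr (?M x) (1/q)) p'"
    using pq by (intro epowr_mono Cle) auto
   thus ?case
    using epowr_ennreal[of 2 p'] by (simp add: epowr_mult epowr_epowr s_def)
  qed
  also have "... = en (2 powr p') * (LN x. epowr (?M x) s)"
   by (rule nn_integral_cmult) measurable
  also have "... <= en (2 powr p') * (en (2 * 5 ^ CARD('n) * (s / (s - 1)) * 2 powr (s - 1)) * (LN x. epowr (epowr (g x) q) s))"
   using hardy_littlewood[of "%y. epowr (g y) q" s] s by (intro mult_left_mono) auto
  also have "... = en K * (LN x. epowr (g x) p')"
  proof -
   have "en K = en (2 powr p') * en (2 * 5 ^ CARD('n) * (s / (s - 1)) * 2 powr (s - 1))"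
    unfolding K_def using s by (intro ennreal_mult) auto
   moreover have "epowr (epowr (g x) q) s = epowr (g x) p'" for x
    using q by (simp add: epowr_epowr s_def)
   ultimately show ?thesis by (simp only: mult.assoc)
  qed
  also have "... <= en K * (LN x. epowr (Aop J al F x) p')"
   using pq gle by (intro mult_left_mono nn_integral_mono epowr_mono) auto
  finally have "epowr (LN x. epowr (Cq J al q F x) p') (1/p') <= epowr (en K * (LN x. epowr (Aop J al F x) p')) (1/p')"
   using pq by (intro epowr_mono) auto
  thus ?thesis using K pq by (simp add: Lpn_def p' epowr_mult epowr_ennreal)
 qed
 thus ?thesis using K by (intro exI[of _ "K powr (1 / p')"]) auto
qed

end

section \<open>Moments of Gaussian sums\<close>

context complex_banach
begin

lemma GN_finite: "GN xs < \<infinity>"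
proof (induction xs)
 case (Cons x xs)
 have "GN (x # xs) <= NI cgauss (%z. 2 * (nq x * nq z) + 2 * GN xs)"
  unfolding GN_def GE_Cons[OF borel_norm_sq]
 proof (rule nn_integral_mono, goal_cases)
  case (1 z)
  have "GE (%v. nq (z .* x + v)) xs
   <= NI gspace (%om. 2 * nq (z .* x) + 2 * nq (gsum om xs))"
   unfolding GE_def by (intro nn_integral_mono sq_norm_add_le)
  also have "... = 2 * nq (z .* x) + 2 * GN xs"
   unfolding GN_eq by (subst nn_integral_add) (auto simp: nn_integral_cmult gs1)
  also have "nq (z .* x) = nq x * nq z"
   by (simp add: power_mult_distrib ennreal_mult mult.commute)
  finally show ?case
   by (simp add: GN_def)
 qed
 also have "... = 2 * (nq x * gauss_m2) + 2 * GN xs"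
  by (subst nn_integral_add) (auto simp: nn_integral_cmult gauss_m2_def cgauss1)
 also have "... < \<infinity>" using Cons gauss_m2_finite by (simp add: ennreal_mult_less_top)
 finally show ?case .
qed simp

text \<open>In the product space two independent copies of a Gaussian sum become one Gaussian sum,
  to which rotation invariance applies.\<close>

definition J2 :: "'x \<times> 'x => 'x \<times> 'x" where "J2 p = (J (fst p), J (snd p))"

lemma complex_structure_J2: "complex_structure J2"
 unfolding complex_structure_def
proof (intro conjI allI)
 show "linear J2" unfolding J2_def by (intro linearI) (auto simp: Jadd JscaleR)
 show "J2 (J2 p) = - p" for p by (cases p) (simp add: J2_def)
 fix a b p
 have "norm (a *R p + b *R J2 p) = sqrt ((sqrt (a^2 + b^2) * norm (fst p))^2 + (sqrt (a^2 + b^2) * norm (snd p))^2)"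
  by (simp add: norm_prod_def J2_def norm_J)
 also have "... = sqrt ((a^2 + b^2) * ((norm (fst p))^2 + (norm (snd p))^2))"
  by (simp add: power_mult_distrib distrib_left)
 also have "... = sqrt (a^2 + b^2) * norm p"
  by (simp add: real_sqrt_mult norm_prod_def)
 finally show "norm (a *R p + b *R J2 p) = sqrt (a^2 + b^2) * norm p" .
qed

interpretation P: complex_banach J2
 by unfold_locales (rule complex_structure_J2)

lemma P_scl: "scaleCJ J2 z (x, y) = (z .* x, z .* y)"
 by (simp add: scaleCJ_def J2_def)

text \<open>\<open>(x, 0)\<close> and \<open>(0, x)\<close> stand next to each other so that
  \<open>GE_rotate\<close> can act on the pair; the two coordinates of the resulting sum are
  independent copies (\<open>GE_interleave\<close>).\<close>

fun interleave :: "'x list => ('x \<times> 'x) list" where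
 "interleave [] = []"
| "interleave (x # xs) = (x, 0) # (0, x) # interleave xs"

lemma borel_prod_fun:
 fixes f g :: "'x => ennreal"
 assumes "f : bm borel" "g : bm borel"
 shows "(%p. f (fst p) * g (snd p)) : bm borel"
 by (intro borel_measurable_times_ennreal measurable_compose[OF _ assms(1)] measurable_compose[OF _ assms(2)]
   bm_cont)

lemma GE_interleave:
 fixes f g :: "'x => ennreal"
 assumes "f : bm borel" "g : bm borel"
 shows "P.GE (%p. f (fst p) * g (snd p)) (interleave xs) = GE f xs * GE g xs"
 using assms
proof (induction xs arbitrary: f g)
 case (Cons x xs)
 note m = Cons.prems borel_prod_fun[OF Cons.prems]
 have "P.GE (%p. f (fst p) * g (snd p)) (interleave (x # xs))
  = NI cgauss (%z. NI cgauss (%w. P.GE (%p. f (z .* x + fst p) * g (w .* x + snd p)) (interleave xs)))"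
 proof -
  have "P.GE (%p. f (z .* x + fst p) * g (snd p)) ((0, x) # interleave xs)
   = NI cgauss (%w. P.GE (%p. f (z .* x + fst p) * g (w .* x + snd p)) (interleave xs))" for z
   using P.GE_Cons[OF borel_prod_fun[OF borel_comp_add[OF m(1)] m(2)]] by (simp add: P_scl)
  thus ?thesis using P.GE_Cons[OF m(3)] by (simp add: P_scl)
 qed
 also have "... = NI cgauss (%z. NI cgauss (%w. GE (%v. f (z .* x + v)) xs * GE (%v. g (w .* x + v)) xs))"
  using m by (intro nn_integral_cong Cons.IH borel_comp_add)
 also have "... = NI cgauss (%z. GE (%v. f (z .* x + v)) xs * GE g (x # xs))"
  using m by (subst nn_integral_cmult) (auto simp: GE_Cons measurable_GE_shift)
 also have "... = GE f (x # xs) * GE g (x # xs)"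
  using m by (subst nn_integral_multc) (auto simp: GE_Cons[of f] measurable_GE_shift)
 finally show ?case .
qed simp

definition rot :: "'x \<times> 'x => 'x \<times> 'x" where
 "rot p = ((1 / sqrt 2) *R (fst p + snd p), (1 / sqrt 2) *R (snd p - fst p))"

lemma rot_add: "rot (p + q) = rot p + rot q"
 by (simp add: rot_def algebra_simps)

lemma rot_scl: "rot (scaleCJ J2 z p) = scaleCJ J2 z (rot p)"
 by (cases p) (simp add: rot_def P_scl scl_scaleR scl_add_right scl_diff_right)

lemma rot_gsum: "rot (P.gsum om ps) = P.gsum om (map rot ps)"
proof -
 have "rot (SUM j:A. f j) = (SUM j:A. rot (f j))" for A and f :: "nat => 'x \<times> 'x"
  by (induction A rule: infinite_finite_induct) (auto simp: rot_add, auto simp: rot_def zero_prod_def)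
 thus ?thesis by (simp add: P.gsum_def rot_scl)
qed

text \<open>Rotating the value of the sum by 45 degrees rotates every adjacent pair of vectors,
  which leaves the law unchanged.\<close>

lemma GE_rot:
 fixes ph :: "'x \<times> 'x => ennreal"
 assumes "ph : bm borel"
 shows "P.GE (%p. ph (rot p)) (interleave xs) = P.GE ph (interleave xs)"
proof -
 have "P.GE ph (map rot (interleave xs)) = P.GE ph (interleave xs)" using assms
 proof (induction xs arbitrary: ph)
  case (Cons x xs)
  define c where "c = 1 / sqrt (2::real)"
  have c: "cor c ~= 0" "c^2 + (cmod (cor c))^2 = 1"
  proof -
   have "cmod (cor c) = c" "c > 0" "c^2 = 1 / 2"
    unfolding norm_of_real by (auto simp: c_def power_divide)
   thus "cor c ~= 0" "c^2 + (cmod (cor c))^2 = 1" by auto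
  qed
  have r: "rot (x, 0) = scaleCJ J2 (cor c) (x, 0) - scaleCJ J2 (cnj (cor c)) (0, x)"
   "rot (0, x) = scaleCJ J2 (cor c) (x, 0) + scaleCJ J2 (cor c) (0, x)"
   unfolding rot_def P_scl scl_of_real complex_cnj_complex_of_real c_def[symmetric]
   by (auto simp: scl_of_real)
  have "P.GE ph (map rot (interleave (x # xs))) = P.GE ph (rot (x, 0) # rot (0, x) # interleave xs)"
   unfolding interleave.simps list.map by (intro P.GE_cong_Cons Cons.IH Cons.prems)
  also have "... = P.GE ph (interleave (x # xs))"
   unfolding r interleave.simps by (rule P.GE_rotate[OF Cons.prems c, symmetric])
  finally show ?case .
 qed simp
 thus ?thesis by (simp add: P.GE_def rot_gsum)
qed

definition GM :: "nat => 'x list => ennreal" where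
 "GM n xs = GE (%v. en (norm v ^ n)) xs"

lemma borel_norm_comp: "f : bm borel ==> (%v::'x. f (norm v) :: ennreal) : bm borel"
 by (rule measurable_compose[where f=norm]) (auto intro!: bm_cont)

text \<open>Chebyshev's inequality, with \<open>s\<close> chosen so that the exceptional event has
  probability at most one half.\<close>

lemma prob_norm_le:
 assumes s: "s > 0" "s^2 = 2 * m" "GN xs = en m"
 shows "1 / 2 <= GE (%v. ind {..s} (norm v)) xs"
proof -
 have m0: "m > 0" using zero_less_power[OF s(1), of 2] unfolding s(2) by simp
 have "1 = NI gspace (%om. 1)" by (simp add: gs1)
 also have "... <= NI gspace (%om. ind {..s} (norm (gsum om xs)) + en (1 / s^2) * nq (gsum om xs))"
 proof (rule nn_integral_mono, goal_cases)
  case (1 om)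
  have "1 <= en (1 / s^2) * nq (gsum om xs)" if "~ norm (gsum om xs) <= s"
  proof -
   have "s^2 <= (norm (gsum om xs))^2" using that s(1) by (intro power_mono) auto
   hence "1 <= (1 / s^2) * (norm (gsum om xs))^2" using s(1) by simp
   hence "en 1 <= en ((1 / s^2) * (norm (gsum om xs))^2)" by (rule ennreal_leI)
   thus ?thesis by (simp add: ennreal_mult[symmetric])
  qed
  thus ?case
   by (cases "norm (gsum om xs) <= s") auto
 qed
 also have "... = GE (%v. ind {..s} (norm v)) xs + en (1 / s^2) * GN xs"
  unfolding GN_eq GE_def by (subst nn_integral_add) (auto simp: nn_integral_cmult)
 also have "en (1 / s^2) * GN xs = en (1/2)"
  unfolding s(3) s(2) using m0 by (simp add: ennreal_mult[symmetric])
 finally have "1 <= GE (%v. ind {..s} (norm v)) xs + en (1/2)" .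
 thus ?thesis
 proof (cases "GE (%v. ind {..s} (norm v)) xs")
  case (real r)
  have "en r + en (1/2) = en (r + 1/2)" using real by (intro ennreal_plus[symmetric]) auto
  hence "en 1 <= en (r + 1/2)"
   using `1 <= GE (%v. ind {..s} (norm v)) xs + en (1/2)` unfolding real(2) by (simp only: ennreal_1)
  hence "1 <= r + 1/2" using real by (subst (asm) ennreal_le_iff) auto
  hence "en (1/2) <= en r" by (intro ennreal_leI) simp
  moreover have "en (1/2) = 1/2" by (simp add: divide_ennreal_def)
  ultimately show ?thesis unfolding real(2) by (simp only:)
 qed simp
qed

text \<open>Rotating the pair \<open>(G, G')\<close> by 45 degrees shows that if \<open>G\<close> is large while its independent copy
 \<open>G'\<close> is not, then two further independent copies are both large.\<close>
lemma GM_double: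
 assumes s: "s > 0" "s^2 = 2 * m" "GN xs = en m"
 shows "GM (2 * n) xs <= en (2 ^ (2 * n) * 2 ^ (n + 1)) * (GM n xs)^2 + en (2 ^ (2 * n) * s ^ (2 * n))"
proof -
 define f where "f = (%v::'x. en (max 0 (norm v - s) ^ (2 * n)))"
 define g where "g = (%v::'x. ind {..s} (norm v) :: ennreal)"
 define ph where "ph = (%p::'x \<times> 'x. en (norm (fst p) ^ n) * en (norm (snd p) ^ n))"
 have f: "f : bm borel" unfolding f_def by (rule borel_norm_comp) measurable
 have g: "g : bm borel" unfolding g_def by (rule borel_norm_comp) measurable
 have h: "(%v::'x. en (norm v ^ n)) : bm borel" by (rule borel_norm_comp) measurable
 have ph: "ph : bm borel" unfolding ph_def by (rule borel_prod_fun[OF h h])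
 \<comment> \<open>If the second component has norm at most \<open>s\<close>, both components of
   \<open>rot p\<close> have norm at least \<open>(norm (fst p) - s) / sqrt 2\<close>.\<close>
 have pt: "f (fst p) * g (snd p) <= en (2 ^ n) * ph (rot p)" for p
 proof (cases "norm (snd p) <= s")
  case True
  let ?a = "max 0 (norm (fst p) - s)"
  have r: "?a <= sqrt 2 * norm (fst (rot p))" "?a <= sqrt 2 * norm (snd (rot p))"
   using True norm_diff_ineq[of "fst p" "snd p"] norm_triangle_ineq2[of "fst p" "snd p"]
   by (auto simp: rot_def norm_minus_commute)
  have "?a^2 <= (sqrt 2 * norm (fst (rot p))) * (sqrt 2 * norm (snd (rot p)))"
   unfolding power2_eq_square using r by (intro mult_mono) auto
  also have "... = 2 * (norm (fst (rot p)) * norm (snd (rot p)))" by simp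
  finally have "(?a^2) ^ n <= (2 * (norm (fst (rot p)) * norm (snd (rot p)))) ^ n" by (intro power_mono) auto
  hence "?a ^ (2 * n) <= 2 ^ n * (norm (fst (rot p)) ^ n * norm (snd (rot p)) ^ n)"
   by (simp add: power_mult[symmetric] power_mult_distrib)
  from ennreal_leI[OF this] show ?thesis
   using True by (simp add: f_def g_def ph_def ennreal_mult)
 qed (simp add: g_def)
 have "GE f xs * GE g xs = P.GE (%p. f (fst p) * g (snd p)) (interleave xs)"
  by (rule GE_interleave[OF f g, symmetric])
 also have "... <= P.GE (%p. en (2 ^ n) * ph (rot p)) (interleave xs)"
  by (rule P.GE_mono[OF pt])
 also have "... = en (2 ^ n) * P.GE (%p. ph (rot p)) (interleave xs)"
 proof -
  have "continuous_on UNIV rot" unfolding rot_def by (intro continuous_intros)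
  hence "(%p. ph (rot p)) : bm borel"
   using measurable_compose[OF borel_measurable_continuous_onI ph] by blast
  from measurable_compose[OF sm_borel[OF P.sm_gsum] this]
  show ?thesis unfolding P.GE_def by (rule nn_integral_cmult)
 qed
 also have "P.GE (%p. ph (rot p)) (interleave xs) = P.GE ph (interleave xs)" by (rule GE_rot[OF ph])
 also have "P.GE ph (interleave xs) = (GM n xs)^2"
  unfolding ph_def GE_interleave[OF h h] GM_def by (simp add: power2_eq_square)
 finally have 1: "GE f xs * GE g xs <= en (2 ^ n) * (GM n xs)^2" .
 \<comment> \<open>Independence has factored the left side of \<open>1\<close>, and the event in
   \<open>g\<close> has probability at least one half, so it can be divided out.\<close>
 have "GE f xs = 2 * (GE f xs * (1/2))"
  by (simp add: ennreal_times_divide ennreal_two_times_half[unfolded ennreal_times_divide] ennreal_two_times_half)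
 also have "... <= 2 * (GE f xs * GE g xs)"
  unfolding g_def by (intro mult_left_mono prob_norm_le[OF s]) auto
 also have "... <= 2 * (en (2 ^ n) * (GM n xs)^2)" by (intro mult_left_mono 1) auto
 finally have 2: "GE f xs <= en (2 ^ (n + 1)) * (GM n xs)^2"
  by (simp add: mult.assoc ennreal_mult)
 have mf: "(%om. f (gsum om xs)) : bm gspace"
  by (rule measurable_compose[OF sm_borel[OF sm_gsum] f])
 have "GM (2 * n) xs <= NI gspace (%om. en (2 ^ (2 * n)) * f (gsum om xs) + en (2 ^ (2 * n) * s ^ (2 * n)))"
  unfolding GM_def GE_def
 proof (rule nn_integral_mono, goal_cases)
  case (1 om)
  let ?N = "norm (gsum om xs)" and ?a = "max 0 (norm (gsum om xs) - s)"
  have "?N <= 2 * max ?a s" using s(1) by (auto simp: max_def)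
  hence "?N ^ (2 * n) <= (2 * max ?a s) ^ (2 * n)" by (intro power_mono) auto
  also have "... = 2 ^ (2 * n) * max ?a s ^ (2 * n)" by (simp only: power_mult_distrib)
  also have "... <= 2 ^ (2 * n) * (?a ^ (2 * n) + s ^ (2 * n))"
   using s(1) by (intro mult_left_mono) (auto simp: max_def)
  finally have "en (?N ^ (2 * n)) <= en (2 ^ (2 * n) * ?a ^ (2 * n) + 2 ^ (2 * n) * s ^ (2 * n))"
   by (intro ennreal_leI) (simp add: distrib_left)
  also have "... = en (2 ^ (2 * n)) * f (gsum om xs) + en (2 ^ (2 * n) * s ^ (2 * n))"
   using s(1) by (simp add: f_def ennreal_mult)
  finally show ?case .
 qed
 also have "... = en (2 ^ (2 * n)) * GE f xs + en (2 ^ (2 * n) * s ^ (2 * n))"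
  unfolding GE_def using mf by (subst nn_integral_add) (auto simp: nn_integral_cmult gs1)
 also have "... <= en (2 ^ (2 * n)) * (en (2 ^ (n + 1)) * (GM n xs)^2) + en (2 ^ (2 * n) * s ^ (2 * n))"
  by (intro add_right_mono mult_left_mono 2) auto
 finally show ?thesis by (simp add: ennreal_mult mult.assoc)
qed

text \<open>Each application of \<open>GM_double\<close> doubles the order of the moment, starting
  from the second.\<close>

lemma GM_upper: "EX C::real>=1. ALL xs m. m > 0 --> GN xs = en m --> GM (2 ^ (k + 1)) xs <= en (C * sqrt m ^ (2 ^ (k + 1)))"
proof (induction k)
 case 0
 have "GM (2 ^ (0 + 1)) xs <= en (1 * sqrt m ^ (2 ^ (0 + 1)))" if "m > 0" "GN xs = en m" for xs m
  using that by (simp add: GM_def GN_def)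
 thus ?case by (intro exI[of _ 1]) auto
next
 case (Suc k)
 define n where "n = (2::nat) ^ (k + 1)"
 obtain C where C: "C >= 1" "!!xs m. m > 0 ==> GN xs = en m ==> GM n xs <= en (C * sqrt m ^ n)"
  using Suc unfolding n_def by blast
 define C' where "C' = 2 ^ (2 * n) * 2 ^ (n + 1) * C^2 + 2 ^ (2 * n) * 2 ^ n"
 have "GM (2 * n) xs <= en (C' * sqrt m ^ (2 * n))" if m: "m > 0" "GN xs = en m" for xs m
 proof -
  define s where "s = sqrt (2 * m)"
  have s: "s > 0" "s^2 = 2 * m" using m by (auto simp: s_def)
  have "GM (2 * n) xs <= en (2 ^ (2 * n) * 2 ^ (n + 1)) * (GM n xs)^2 + en (2 ^ (2 * n) * s ^ (2 * n))"
   by (rule GM_double[OF s m(2)])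
  also have "... <= en (2 ^ (2 * n) * 2 ^ (n + 1)) * (en (C * sqrt m ^ n))^2 + en (2 ^ (2 * n) * s ^ (2 * n))"
   by (intro add_right_mono mult_left_mono power_mono C m) auto
  also have "... = en (2 ^ (2 * n) * 2 ^ (n + 1) * (C * sqrt m ^ n)^2 + 2 ^ (2 * n) * s ^ (2 * n))"
  proof -
   have "(en (C * sqrt m ^ n))^2 = en ((C * sqrt m ^ n)^2)" using C m by (intro ennreal_power) auto
   moreover have "en (2 ^ (2 * n) * 2 ^ (n + 1)) * en ((C * sqrt m ^ n)^2) = en (2 ^ (2 * n) * 2 ^ (n + 1) * (C * sqrt m ^ n)^2)"
    by (intro ennreal_mult[symmetric]) auto
   ultimately show ?thesis using s(1) by (simp only:) (intro ennreal_plus[symmetric], auto)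
  qed
  also have "2 ^ (2 * n) * 2 ^ (n + 1) * (C * sqrt m ^ n)^2 + 2 ^ (2 * n) * s ^ (2 * n) = C' * sqrt m ^ (2 * n)"
  proof -
   have "s ^ (2 * n) = (2 * m) ^ n" by (simp add: power_mult s(2))
   also have "... = 2 ^ n * sqrt m ^ (2 * n)" using m by (simp add: power_mult_distrib power_mult)
   finally show ?thesis unfolding C'_def by (simp add: power_mult_distrib algebra_simps power_mult[symmetric] mult.commute)
  qed
  finally show ?thesis .
 qed
 moreover have "C' >= 1"
 proof -
  have "(1::real) <= 2 ^ (2 * n) * 2 ^ n" by (simp add: power_add[symmetric] one_le_power)
  moreover have "0 <= 2 ^ (2 * n) * 2 ^ (n + 1) * C^2" by simp
  ultimately show ?thesis unfolding C'_def by linarith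
 qed
 moreover have "2 ^ (Suc k + 1) = 2 * n" by (simp add: n_def)
 ultimately show ?case by (intro exI[of _ C']) auto
qed

lemma GN_zero_GE:
 assumes "GN xs = 0" "0 < p" shows "GE (np p) xs = 0"
proof -
 have "AE om in gspace. nq (gsum om xs) = 0"
  using assms(1) unfolding GN_eq by (subst (asm) nn_integral_0_iff_AE) auto
 hence "AE om in gspace. np p (gsum om xs) = 0"
  by eventually_elim (use assms(2) in auto)
 thus ?thesis unfolding GE_def by (subst nn_integral_0_iff_AE) auto
qed

text \<open>After division by \<open>a = sqrt m\<close> the bound is the integral of
  \<open>r^p <= 1 + r^n\<close>, with \<open>n\<close> a power of two that is at least
  \<open>p\<close>.\<close>

theorem kahane_upper:
 assumes p: "0 < p"
 shows "EX C::real>0. ALL xs. GE (np p) xs <= en C * epowr (GN xs) (p / 2)"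
proof -
 obtain k where k: "p < real k" using reals_Archimedean2 by blast
 define n where "n = (2::nat) ^ (k + 1)"
 have n: "p <= real n" using k less_exp[of "k+1"] unfolding n_def by linarith
 obtain C where C: "C >= 1" "!!xs m. m > 0 ==> GN xs = en m ==> GM n xs <= en (C * sqrt m ^ n)"
  using GM_upper[of k] unfolding n_def by blast
 have "GE (np p) xs <= en (1 + C) * epowr (GN xs) (p / 2)" for xs
 proof (cases "GN xs = 0")
  case True
  thus ?thesis using GN_zero_GE[OF True p] by simp
 next
  case False
  then obtain m where m: "GN xs = en m" "m > 0" using GN_finite[of xs] by (cases "GN xs") auto
  define a where "a = sqrt m"
  have a: "a > 0" using m by (simp add: a_def)
  have "GE (np p) xs
   <= NI gspace (%om. en (a powr p) * (1 + en (1 / a ^ n) * en (norm (gsum om xs) ^ n)))"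
   unfolding GE_def
  proof (rule nn_integral_mono, goal_cases)
   case (1 om)
   let ?r = "norm (gsum om xs) / a"
   have "?r powr p <= 1 + ?r ^ n"
   proof (cases "?r <= 1")
    case True
    hence "?r powr p <= 1 powr p" using a p by (intro powr_mono2) auto
    thus ?thesis using a by (simp add: add_increasing2)
   next
    case False
    hence "?r powr p <= ?r powr (real n)" using n by (intro powr_mono) auto
    also have "... = ?r ^ n" using False by (intro powr_realpow) auto
    finally show ?thesis by simp
   qed
   hence "a powr p * ?r powr p <= a powr p * (1 + ?r ^ n)" by (intro mult_left_mono) auto
   moreover have "a powr p * ?r powr p = norm (gsum om xs) powr p"
    using a by (simp add: powr_mult[symmetric])
   ultimately have "np p (gsum om xs) <= en (a powr p * (1 + (1 / a ^ n) * norm (gsum om xs) ^ n))"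
    by (intro ennreal_leI) (simp add: power_divide)
   also have "... = en (a powr p) * en (1 + (1 / a ^ n) * norm (gsum om xs) ^ n)"
    using a by (intro ennreal_mult) auto
   also have "en (1 + (1 / a ^ n) * norm (gsum om xs) ^ n) = 1 + en (1 / a ^ n) * en (norm (gsum om xs) ^ n)"
    using a by (subst ennreal_plus) (auto simp: ennreal_mult[symmetric])
   finally show ?case .
  qed
  also have "... = en (a powr p) * (1 + en (1 / a ^ n) * GM n xs)"
   unfolding GM_def GE_def
   by (subst nn_integral_cmult, measurable, subst nn_integral_add)
    (auto simp: nn_integral_cmult gs1)
  also have "... <= en (a powr p) * (1 + en (1 / a ^ n) * en (C * a ^ n))"
   unfolding a_def by (intro mult_left_mono add_left_mono C m) auto
  also have "en (1 / a ^ n) * en (C * a ^ n) = en C"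
   using a C by (simp add: ennreal_mult[symmetric])
  also have "1 + en C = en (1 + C)" using C by simp
  also have "en (a powr p) = epowr (GN xs) (p / 2)"
   using m by (simp add: a_def epowr_ennreal powr_half_sqrt[symmetric] powr_powr)
  finally show ?thesis by (simp add: mult.commute)
 qed
 thus ?thesis using C by (intro exI[of _ "1 + C"]) auto
qed

text \<open>\<open>r^2\<close> is bounded by a constant plus multiples of \<open>r^4\<close> and
  \<open>r^p\<close>. After scaling and integration the first two terms take at most half of the
  second moment, the fourth moment being controlled by \<open>GM_upper\<close>, and are
  absorbed.\<close>

theorem kahane_lower:
 assumes p: "0 < p"
 shows "EX C::real>0. ALL xs. epowr (GN xs) (p / 2) <= en C * GE (np p) xs"
proof -
 obtain C4 where C4: "C4 >= 1" "!!xs m. m > 0 ==> GN xs = en m ==> GM 4 xs <= en (C4 * sqrt m ^ 4)"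
  using GM_upper[of 1] by auto
 \<comment> \<open>\<open>K^2 = 4 C4\<close> turns the bound on the fourth moment into
   \<open>m / 4\<close>. \<open>D\<close> then bounds \<open>r powr (2 - p)\<close> between 1/2 and
   \<open>K\<close>, whichever sign the exponent has.\<close>
 define K where "K = 2 * sqrt C4"
 have K: "K > 0" "K^2 = 4 * C4" using C4 by (auto simp: K_def power_mult_distrib)
 define D where "D = (1/2) powr (2 - p) + K powr (2 - p)"
 have D: "D > 0" using K by (simp add: D_def add_pos_pos)
 have "epowr (GN xs) (p / 2) <= en (2 * D) * GE (np p) xs" for xs
 proof (cases "GN xs = 0")
  case False
  then obtain m where m: "GN xs = en m" "m > 0" using GN_finite[of xs] by (cases "GN xs") auto
  define a where "a = sqrt m"
  have a: "a > 0" "a^2 = m" using m by (auto simp: a_def)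
  let ?E = "GE (np p) xs"
  have pt: "r^2 <= 1/4 + r ^ 4 / K^2 + D * r powr p" if r: "r >= 0" for r :: real
  proof -
   consider "r <= 1/2" | "r >= K" | "1/2 < r" "r < K" by linarith
   thus ?thesis
   proof cases
    case 1
    hence "r^2 <= (1/2)^2" using r by (intro power_mono) auto
    moreover have "0 <= r ^ 4 / K^2 + D * r powr p" using r D by simp
    ultimately show ?thesis by (simp add: power2_eq_square)
   next
    case 2
    have "r^2 * K^2 <= r^2 * r^2" using 2 K by (intro mult_left_mono power_mono) auto
    moreover have "r^2 * r^2 = r ^ 4" by (simp add: power4_eq_xxxx power2_eq_square)
    ultimately have "r^2 <= r ^ 4 / K^2" using K(1) by (subst pos_le_divide_eq) auto
    moreover have "0 <= D * r powr p" using D by simp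
    ultimately show ?thesis by simp
   next
    case 3
    have "r powr (2 - p) <= D"
    proof (cases "p <= 2")
     case True
     hence "r powr (2 - p) <= K powr (2 - p)" using 3 by (intro powr_mono2) auto
     thus ?thesis by (simp add: D_def add_increasing)
    next
     case False
     hence "r powr (2 - p) <= (1/2) powr (2 - p)" using 3 by (intro powr_mono2') auto
     thus ?thesis by (simp add: D_def add_increasing2)
    qed
    hence "r powr (2 - p) * r powr p <= D * r powr p" by (intro mult_right_mono) auto
    also have "r powr (2 - p) * r powr p = r^2" using 3 by (simp add: powr_add[symmetric] powr_realpow[of r 2, simplified])
    finally have "r^2 <= D * r powr p" .
    moreover have "0 <= r ^ 4 / K^2" by simp
    ultimately show ?thesis by linarith
   qed
  qed
  have "en m <= NI gspace (%om. en (m / 4) + (en (1 / (m * K^2)) * en (norm (gsum om xs) ^ 4)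
    + en (m * D / a powr p) * np p (gsum om xs)))"
   unfolding m(1)[symmetric] GN_eq
  proof (rule nn_integral_mono)
   fix om
   let ?x = "norm (gsum om xs)"
   have "a^2 * (?x / a)^2 <= a^2 * (1/4 + (?x / a) ^ 4 / K^2 + D * (?x / a) powr p)"
    using a by (intro mult_left_mono pt) auto
   also have "... = m / 4 + ((1 / (m * K^2)) * ?x ^ 4 + (m * D / a powr p) * ?x powr p)"
    using a K by (simp add: power_divide powr_divide field_simps) (simp add: a(2)[symmetric] power4_eq_xxxx power2_eq_square)
   finally have "?x^2 <= m / 4 + ((1 / (m * K^2)) * ?x ^ 4 + (m * D / a powr p) * ?x powr p)"
    using a m by (simp add: power_divide)
   from ennreal_leI[OF this] show "en (?x^2) <= en (m / 4) + (en (1 / (m * K^2)) * en (?x ^ 4)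
    + en (m * D / a powr p) * en (?x powr p))"
    using m D by (simp add: ennreal_mult[symmetric] del: ennreal_plus add: ennreal_plus[symmetric])
  qed
  also have "... = en (m / 4) + (en (1 / (m * K^2)) * GM 4 xs + en (m * D / a powr p) * ?E)"
   unfolding GM_def GE_def
   by (subst nn_integral_add, measurable, subst nn_integral_add)
    (auto simp: nn_integral_cmult gs1)
  also have "... <= en (m / 4) + (en (1 / (m * K^2)) * en (C4 * sqrt m ^ 4) + en (m * D / a powr p) * ?E)"
   by (intro add_left_mono add_right_mono mult_left_mono C4 m) auto
  also have "en (1 / (m * K^2)) * en (C4 * sqrt m ^ 4) = en (m / 4)"
  proof -
   have "sqrt m ^ 4 = m * m" using m by (simp add: power4_eq_xxxx)
   hence "(1 / (m * K^2)) * (C4 * sqrt m ^ 4) = m / 4" using m K C4 by simp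
   moreover have "en (1 / (m * K^2)) * en (C4 * sqrt m ^ 4) = en ((1 / (m * K^2)) * (C4 * sqrt m ^ 4))"
    using m C4 by (intro ennreal_mult[symmetric]) auto
   ultimately show ?thesis by (simp only:)
  qed
  finally have le: "en m <= en (m / 4) + (en (m / 4) + en (m * D / a powr p) * ?E)" .
  show ?thesis
  proof (cases ?E)
   case (real e)
   have "en m <= en (m / 4 + (m / 4 + m * D / a powr p * e))"
    using le real m D by (simp add: ennreal_mult[symmetric] ennreal_plus[symmetric] del: ennreal_plus)
   hence "m <= m / 4 + (m / 4 + m * D / a powr p * e)"
    using m D real by (subst (asm) ennreal_le_iff) auto
   hence "m / 2 <= m * D / a powr p * e" by linarith
   hence "m * (1/2) <= m * (D / a powr p * e)" by simp
   hence "1/2 <= D / a powr p * e" using m by (subst (asm) mult_le_cancel_left_pos) auto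
   moreover have "a powr p > 0" using a by simp
   ultimately have "a powr p <= 2 * D * e" by (simp add: field_simps)
   moreover have "a powr p = m powr (p / 2)" using m by (simp add: a_def powr_half_sqrt[symmetric] powr_powr)
   ultimately show ?thesis using m D real by (simp add: epowr_ennreal ennreal_mult[symmetric] ennreal_leI)
  next
   case top
   thus ?thesis using D by (simp add: ennreal_mult_top)
  qed
 qed simp
 thus ?thesis using D by (intro exI[of _ "2 * D"]) auto
qed

end

section \<open>Martingale transforms\<close>

definition umd_const :: "'x::banach itself => real => real => bool" where
 "umd_const _ p bt <-> 0 <= bt & (ALL (M :: (nat => 'x) measure) F (d :: nat => (nat => 'x) => 'x) N (ep :: nat => real).
   prob_space M & mds p M F d N & (ALL k. ep k : {-1, 1}) -->
   epowr (NI M (%om. np p (SUM k<=N. ep k *R d k om))) (1/p)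
    <= en bt * epowr (NI M (%om. np p (SUM k<=N. d k om))) (1/p))"

lemma UMD_const:
 assumes "UMD TYPE('x::banach)" "1 < p"
 shows "EX bt>=0. umd_const TYPE('x) p bt"
proof -
 have e: "en (max bt 0) = en bt" for bt by (simp add: max_def ennreal_neg)
 show ?thesis using spec[OF assms(1)[unfolded UMD_def], THEN mp, OF assms(2)]
 proof (elim exE, goal_cases)
  case (1 bt)
  thus ?case unfolding umd_const_def by (intro exI[of _ "max bt 0"]) (simp only: e max.cobounded2 simp_thms)
 qed
qed

lemma sm_embed:
 fixes f :: "'b => 'x::real_normed_vector"
 assumes f: "sm M f" and inj: "inj_on io (space M)"
 shows "sm (embed_measure M io) (%w. f (the_inv_into (space M) io w))"
proof (rule sm_comp_measurable[OF f])
 show "the_inv_into (space M) io : embed_measure M io \<rightarrow>\<^sub>M M"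
  by (rule measurable_embed_measure1)
   (use inj in "auto simp: the_inv_into_f_f cong: measurable_cong")
qed

text \<open>The UMD inequality is only postulated on probability spaces carried by \<open>nat => 'x\<close>; every
 probability space that injects into real sequences can be moved there.\<close>
theorem umd_transfer:
 fixes M :: "'b measure" and d :: "nat => 'b => 'x::banach" and io :: "'b => nat => real"
 assumes U: "umd_const TYPE('x) p bt" and p: "1 < p" and io: "inj io"
  and M: "prob_space M" and m: "mds p M F d N" and ep: "!!k. ep k : {-1, 1}"
 shows "NI M (%om. np p (SUM k<=N. ep k *R d k om))
    <= en (bt powr p) * NI M (%om. np p (SUM k<=N. d k om))"
proof (cases "EX v::'x. v ~= 0")
 case False
 hence "norm (SUM k<=N. ep k *R d k om) = 0" for om by (metis norm_zero)
 thus ?thesis by simp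
next
 case True
 then obtain v :: 'x where v: "v ~= 0" by blast
 \<comment> \<open>A nonzero vector embeds the reals into \<open>'x\<close>, hence real sequences
   into the sample space on which \<open>UMD\<close> speaks.\<close>
 define e :: "'b => nat => 'x" where "e b = (%i. io b i *R v)" for b
 have "inj e"
 proof (rule injI)
  fix a b assume "e a = e b"
  hence "io a i *R v = io b i *R v" for i unfolding e_def by meson
  hence "io a = io b" using v by (auto simp: fun_eq_iff)
  thus "a = b" using io by (simp add: inj_eq)
 qed
 hence inj: "inj_on e A" for A by (rule inj_on_subset) auto
 interpret M: prob_space M by fact
 define M' where "M' = embed_measure M e"
 define F' where "F' i = embed_measure (F i) e" for i
 define r where "r = the_inv_into (space M) e"
 define d' where "d' k w = d k (r w)" for k w
 have re: "r (e x) = x" if "x : space M" for x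
  unfolding r_def by (rule the_inv_into_f_f[OF inj that])
 have spF: "space (F i) = space M" and seF: "sets (F i) <= sets M" for i using m by (auto simp: mds_def)
 have M'd: "M' = distr M M' e" unfolding M'_def by (rule embed_measure_eq_distr'[OF inj])
 have em: "e : M \<rightarrow>\<^sub>M M'" unfolding M'_def by (rule measurable_embed_measure2'[OF inj])
 have "prob_space M'" by (subst M'd) (rule M.prob_space_distr[OF em])
 have smd: "sm (F k) (d k)" if "k <= N" for k using m that by (auto simp: mds_def)
 have sm_sub: "sm M f" if "sm (F k) f" for k and f :: "'b => 'x"
 proof -
  have "(%x. x) : M \<rightarrow>\<^sub>M F k"
   by (rule measurableI) (use spF[of k] seF[of k] in "auto simp: Int_absorb2 sets.sets_into_space subset_iff")
  from sm_comp_measurable[OF that this] show ?thesis .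
 qed
 have smd': "sm (F' k) (d' k)" if "k <= N" for k
  unfolding F'_def d'_def r_def spF[of k, symmetric] by (rule sm_embed[OF smd[OF that] inj])
 have smdM': "sm M' (%w. f (r w))" if "sm M f" for f :: "'b => 'x"
  unfolding M'_def r_def by (rule sm_embed[OF that inj])
 have nn: "NI M' (%w. np p (f (r w))) = NI M (%x. np p (f x))"
  if "sm M f" for f :: "'b => 'x"
 proof -
  have [measurable]: "(%w. norm (f (r w))) : bm M'" by (rule sm_norm[OF smdM'[OF that]])
  have "NI M' (%w. np p (f (r w))) = NI M (%x. np p (f (r (e x))))"
   by (subst M'd, rule nn_integral_distr[OF em]) measurable
  also have "... = NI M (%x. np p (f x))"
   by (intro nn_integral_cong) (simp add: re)
  finally show ?thesis .
 qed
 have "mds p M' F' d' N"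
  unfolding mds_def
 proof (intro conjI allI impI ballI)
  show "space (F' i) = space M'" for i by (simp add: F'_def M'_def space_embed_measure spF)
  show "sets (F' i) <= sets M'" for i
   using seF[of i] unfolding F'_def M'_def sets_embed_measure'[OF inj] by blast
  show "sets (F' i) <= sets (F' j)" if "i <= j" for i j
  proof -
   have "sets (F i) <= sets (F j)" using m that by (auto simp: mds_def)
   thus ?thesis unfolding F'_def sets_embed_measure'[OF inj] by blast
  qed
  show "sm (F' k) (d' k)" if "k <= N" for k by (rule smd'[OF that])
  show "NI M' (%om. np p (d' k om)) < \<infinity>" if "k <= N" for k
   unfolding d'_def nn[OF sm_sub[OF smd[OF that]]] using m that by (auto simp: mds_def)
  fix k A and ph :: "'x => real"
  assume k: "0 < k & k <= N" and A: "A : sets (F' (k - 1))" and ph: "bounded_linear ph"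
  obtain B where B: "B : sets (F (k - 1))" "A = e ` B"
   using A unfolding F'_def sets_embed_measure'[OF inj] by blast
  have AM: "A : sets M'" using A seF[of "k-1"] unfolding F'_def M'_def sets_embed_measure'[OF inj] by blast
  have phc: "continuous_on UNIV ph" using ph by (rule linear_continuous_on)
  have "sm M' (d' k)" unfolding d'_def using k by (intro smdM' sm_sub[OF smd]) auto
  hence [measurable]: "(%w. ph (d' k w)) : bm M'" by (intro sm_borel sm_compose[OF _ phc])
  have "LI M' (%w. ind A w * ph (d' k w)) = LI M (%x. ind A (e x) * ph (d' k (e x)))"
   by (subst M'd, rule integral_distr[OF em]) (use AM in measurable)
  also have "... = LI M (%x. ind B x * ph (d k x))"
   using `inj e` B(2) by (intro bint_cong) (auto simp: d'_def re indicator_def inj_image_mem_iff)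
  also have "... = 0" using m k B(1) ph by (auto simp: mds_def)
  finally show "LI M' (%w. ind A w * ph (d' k w)) = 0" .
 qed
 hence "epowr (NI M' (%om. np p (SUM k<=N. ep k *R d' k om))) (1/p)
    <= en bt * epowr (NI M' (%om. np p (SUM k<=N. d' k om))) (1/p)"
  by (intro U[unfolded umd_const_def, THEN conjunct2, rule_format] conjI allI ep `prob_space M'`)
 hence "NI M' (%om. np p (SUM k<=N. ep k *R d' k om))
    <= en (bt powr p) * NI M' (%om. np p (SUM k<=N. d' k om))"
  using p U by (subst (asm) epowr_le_iff) (auto simp: epowr_mult epowr_inv epowr_ennreal umd_const_def)
 moreover have "sm M (%x. SUM k<=N. ep k *R d k x)" "sm M (%x. SUM k<=N. d k x)"
  by (intro sm_sum sm_scaleR sm_const sm_sub[OF smd]; simp)+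
 note nn[OF this(1)] nn[OF this(2)]
 ultimately show ?thesis by (simp add: d'_def)
qed

text \<open>Encodes the information available at a stage: the events are the measurable sets that do
  not separate points related by \<open>R\<close>.\<close>

definition inv_algebra :: "'a measure => ('a => 'a => bool) => 'a measure" where
 "inv_algebra M R = sigma (space M) {A : sets M. ALL x:space M. ALL y:space M. R x y --> (x : A <-> y : A)}"

lemma space_inv_algebra[simp]: "space (inv_algebra M R) = space M"
 unfolding inv_algebra_def by (rule space_measure_of) (use sets.sets_into_space in blast)

lemma sets_inv_algebra:
 "sets (inv_algebra M R) = {A : sets M. ALL x:space M. ALL y:space M. R x y --> (x : A <-> y : A)}"
proof -
 let ?S = "{A : sets M. ALL x:space M. ALL y:space M. R x y --> (x : A <-> y : A)}"
 have "sigma_algebra (space M) ?S"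
  unfolding sigma_algebra_iff2
 proof (intro conjI ballI allI impI)
  show "?S <= Pow (space M)" using sets.sets_into_space by blast
  fix A :: "nat => 'a set" assume "range A <= ?S"
  hence "A i : sets M" "!!x y. x : space M ==> y : space M ==> R x y ==> (x : A i <-> y : A i)" for i by blast+
  thus "(UN i. A i) : ?S" by auto
 qed auto
 thus ?thesis unfolding inv_algebra_def by (simp add: sigma_algebra.sets_measure_of_eq)
qed

lemma sm_separable_range:
 fixes f :: "'a => 'b::real_normed_vector"
 assumes "sm M f"
 shows "EX d::nat => 'b. ALL x:space M. f x : closure (range d)"
proof -
 obtain s where s: "!!i. simple_function M (s i)" "!!x. x : space M ==> (%i. s i x) ~~> f x"
  using assms unfolding strongly_measurable_def by metis
 define D where "D = insert 0 (UN i. s i ` space M)"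
 have "countable D" unfolding D_def
  by (intro countable_insert countable_UN countableI_type countable_finite[OF simple_functionD(1)[OF s(1)]])
 then obtain d :: "nat => 'b" where d: "range d = D"
  using range_from_nat_into[of D] by (metis D_def insert_not_empty)
 have "f x : closure D" if x: "x : space M" for x
 proof (rule closed_sequentially[OF closed_closure _ s(2)[OF x]])
  show "s i x : closure D" for i
   using x by (intro subsetD[OF closure_subset]) (force simp: D_def)
 qed
 thus ?thesis using d by (intro exI[of _ d]) auto
qed

text \<open>Invariance gives Borel measurability for the smaller algebra; the separable range
  inherited from \<open>M\<close> turns it into strong measurability.\<close>

lemma sm_inv_algebra:
 fixes f :: "'a => 'b::real_normed_vector"
 assumes f: "sm M f" and R: "!!x y. x : space M ==> y : space M ==> R x y ==> f x = f y"
 shows "sm (inv_algebra M R) f"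
proof -
 obtain d :: "nat => 'b" where d: "!!x. x : space M ==> f x : closure (range d)"
  using sm_separable_range[OF f] by blast
 have "f : bm (inv_algebra M R)"
 proof (rule measurableI)
  fix A :: "'b set" assume A: "A : sets borel"
  have "f -` A Int space M : sets M" using measurable_sets[OF sm_borel[OF f] A] .
  thus "f -` A Int space (inv_algebra M R) : sets (inv_algebra M R)"
   using R unfolding sets_inv_algebra by auto
 qed auto
 thus ?thesis using d by (intro sm_separable) auto
qed

section \<open>Bounded Gaussian sums in UMD spaces converge\<close>

text \<open>A scalar martingale with values in \<open>[-1, 1]\<close>: along the path of ones it oscillates between \<open>0\<close> and
 \<open>1/2\<close>, and it stops at the first \<open>-1\<close>. Its alternating transform reaches \<open>n/2\<close>.\<close>
definition osc :: "nat => (nat => real) => real" where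
 "osc k t = (if ALL j<k. t j = 1 then t k * (1/2) * (-1) ^ k else 0)"

lemma osc_sum:
 assumes "!!k. k < n ==> t k : {-1, 1}"
 shows "if ALL j<n. t j = 1 then (SUM k<n. osc k t) = (if odd n then 1/2 else 0) else \<bar>SUM k<n. osc k t\<bar> <= 1"
 using assms
proof (induction n)
 case (Suc n)
 note IH = Suc.IH[OF Suc.prems[OF less_SucI]]
 show ?case
 proof (cases "ALL j<n. t j = 1")
  case True
  hence o: "osc n t = t n * (1/2) * (-1) ^ n" by (simp add: osc_def)
  have s: "(SUM k<n. osc k t) = (if odd n then 1/2 else 0)" using IH True by simp
  consider "t n = 1" | "t n = -1" using Suc.prems[of n] by auto
  thus ?thesis
  proof cases
   case 1
   hence "ALL j<Suc n. t j = 1" using True by (auto simp: less_Suc_eq)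
   thus ?thesis using 1 o s by (cases "odd n") auto
  next
   case 2
   hence "~ (ALL j<Suc n. t j = 1)" by auto
   thus ?thesis using 2 o s by (cases "odd n") auto
  qed
 next
  case False
  hence o: "osc n t = 0" and s: "~ (ALL j<Suc n. t j = 1)" unfolding osc_def by (auto dest: less_SucI)
  show ?thesis using IH[unfolded if_not_P[OF False]] o unfolding if_not_P[OF s] by simp
 qed
qed simp

lemma osc_sum_le: "(!!k. k < n ==> t k : {-1, 1}) ==> \<bar>SUM k<n. osc k t\<bar> <= 1"
 using osc_sum[of n t] by (auto split: if_splits)

definition cube :: "nat => (nat => real) set" where "cube n = {..<n} \<rightarrow>\<^sub>E {-1, 1}"

lemma finite_cube[simp]: "finite (cube n)" and cube_nonempty: "cube n ~= {}" and cube_mem: "s : cube n ==> k < n ==> s k : {-1, 1}"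
 by (auto simp: cube_def PiE_eq_empty_iff intro!: finite_PiE)

text \<open>For each vertex \<open>i\<close> the path \<open>s j * i j\<close> stays at 1 as long as
  \<open>s\<close> follows \<open>i\<close>. The UMD inequality is applied to the superposition of
  these oscillating martingales with coefficients \<open>y i\<close>, for the signs
  \<open>(-1)^k\<close>.\<close>

lemma cube_umd:
 fixes y :: "(nat => real) => 'x::banach"
 assumes U: "umd_const TYPE('x) 2 bt" and bt: "0 <= bt"
 shows "(SUM s:cube (Suc N). (norm (SUM i:cube (Suc N). (SUM k<=N. (-1) ^ k * osc k (%j. s j * i j)) *R y i))^2)
  <= bt^2 * (SUM s:cube (Suc N). (norm (SUM i:cube (Suc N). (SUM k<=N. osc k (%j. s j * i j)) *R y i))^2)"
proof -
 let ?C = "cube (Suc N)"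
 define M where "M = uniform_count_measure ?C"
 interpret M: prob_space M unfolding M_def by (rule prob_space_uniform_count_measure) (auto simp: cube_nonempty)
 have sM: "space M = ?C" "sets M = Pow ?C" by (auto simp: M_def space_uniform_count_measure sets_uniform_count_measure)
 have C0: "0 < card ?C" by (simp add: card_gt_0_iff cube_nonempty)
 have nn: "NI M (%s. en (f s)) = en ((SUM s:?C. f s) / card ?C)" if "!!s. 0 <= f s" for f
  unfolding M_def uniform_count_measure_def nn_integral_point_measure_finite[OF finite_cube] using that
  by (simp add: ennreal_mult[symmetric] sum_ennreal sum_distrib_left[symmetric] sum_divide_distrib[symmetric])
 define d where "d k s = (SUM i:?C. osc k (%j. s j * i j) *R y i)" for k s
 define F where "F k = inv_algebra M (%s t. ALL j<=k. s j = t j)" for k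
 have sm: "sm M f" for f :: "(nat => real) => 'x"
  by (intro sm_simple) (auto simp: simple_function_def sM)
 have osc_cong: "osc k t = osc k t'" if "!!j. j <= k ==> t j = t' j" for k t t'
  using that by (auto simp: osc_def)
 have "mds 2 M F d N"
  unfolding mds_def
 proof (intro conjI allI impI ballI)
  show "space (F i) = space M" "sets (F i) <= sets M" for i by (auto simp: F_def sets_inv_algebra)
  show "sets (F i) <= sets (F j)" if "i <= j" for i j
  proof
   fix A assume A: "A : sets (F i)"
   hence "A : sets M" unfolding F_def sets_inv_algebra by blast
   moreover have "x : A <-> y : A" if "x : space M" "y : space M" "ALL l<=j. x l = y l" for x y
   proof -
    have "ALL l<=i. x l = y l" using that(3) `i <= j` by (meson order_trans)
    thus ?thesis using A that unfolding F_def sets_inv_algebra by blast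
   qed
   ultimately show "A : sets (F j)" unfolding F_def sets_inv_algebra by blast
  qed
  show "sm (F k) (d k)" for k
   unfolding F_def
  proof (rule sm_inv_algebra[OF sm])
   fix s t :: "nat => real" assume "ALL j<=k. s j = t j"
   thus "d k s = d k t" unfolding d_def by (intro sum.cong refl arg_cong2[where f=scaleR] osc_cong) auto
  qed
  show "NI M (%om. en (norm (d k om) powr 2)) < \<infinity>" for k
   by (subst nn) auto
  fix k A and ph :: "'x => real"
  assume k: "0 < k & k <= N" and A: "A : sets (F (k - 1))" and ph: "bounded_linear ph"
  \<comment> \<open>Flipping the \<open>k\<close>-th sign reverses \<open>d k\<close> and preserves
    every event of \<open>F (k - 1)\<close>, so the integral equals its own negative.\<close>
  define fl where "fl s = s(k := - s k)" for s :: "nat => real"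
  have fl: "fl s : ?C" if "s : ?C" for s
   using that k by (auto simp: cube_def fl_def PiE_iff extensional_def)
  have ff: "fl (fl s) = s" for s by (simp add: fl_def)
  have odd: "d k (fl s) = - d k s" for s
  proof -
   have "osc k (%j. fl s j * i j) = - osc k (%j. s j * i j)" for i by (auto simp: osc_def fl_def)
   thus ?thesis by (simp add: d_def sum_negf)
  qed
  have inv: "fl s : A <-> s : A" if "s : ?C" for s
  proof -
   have "ALL j<=k - 1. fl s j = s j" using k by (auto simp: fl_def)
   thus ?thesis using A that fl[OF that] unfolding F_def sets_inv_algebra sM by blast
  qed
  have "(SUM s:?C. ind A s * ph (d k s)) = (SUM s:?C. ind A (fl s) * ph (d k (fl s)))"
   by (rule sum.reindex_bij_witness[of _ fl fl]) (auto simp: fl ff)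
  also have "... = - (SUM s:?C. ind A s * ph (d k s))"
   unfolding sum_negf[symmetric]
   by (intro sum.cong refl) (simp add: odd inv indicator_def linear_neg[OF bounded_linear.linear[OF ph]])
  finally have "(SUM s:?C. ind A s * ph (d k s)) = 0" by simp
  thus "LI M (%om. ind A om * ph (d k om)) = 0"
   unfolding M_def by (subst integral_uniform_count_measure) auto
 qed
 hence "NI M (%s. en (norm (SUM k<=N. (-1) ^ k *R d k s) powr 2))
    <= en (bt powr 2) * NI M (%s. en (norm (SUM k<=N. d k s) powr 2))"
  by (intro umd_transfer[OF U, where io="%s. s"] M.prob_space_axioms)
   (auto simp: power_one_over intro: injI, metis neg_one_even_power neg_one_odd_power)
 note 1 = this
 have "(SUM k<=N. c k *R d k s) = (SUM i:?C. (SUM k<=N. c k * osc k (%j. s j * i j)) *R y i)" for c s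
  unfolding d_def scaleR_sum_right scaleR_sum_left by (subst sum.swap) simp
 from this[of "%k. (-1) ^ k"] this[of "%k. 1"]
 have e: "(SUM k<=N. (-1) ^ k *R d k s) = (SUM i:?C. (SUM k<=N. (-1) ^ k * osc k (%j. s j * i j)) *R y i)"
  "(SUM k<=N. d k s) = (SUM i:?C. (SUM k<=N. osc k (%j. s j * i j)) *R y i)" for s by simp_all
 have pw: "norm v powr 2 = (norm v)^2" for v :: 'x by (simp add: powr_numeral)
 have b2: "bt powr 2 = bt^2" using bt by (simp add: powr_numeral)
 show ?thesis
  using 1 C0 unfolding e pw b2
  by (simp add: nn ennreal_mult[symmetric] sum_nonneg divide_le_cancel)
qed

context complex_banach
begin

lemma GN_mult_le:
 assumes "!!j. j < M ==> cmod (r j) <= 1"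
 shows "GN (map (%j. r j .* x j) [0..<M]) <= GN (map x [0..<M])"
proof -
 let ?ys = "map x [0..<M]"
 define a where "a k j = (if k = j then r j else 0)" for k j
 have "GN (map (%j. SUM k<length ?ys. a k j .* ?ys ! k) [0..<M]) <= GN ?ys"
 proof (rule GN_contraction, goal_cases)
  case (1 c)
  have "(SUM j<M. a k j * c j) = r k * c k" if "k < M" for k
  proof -
   have "(SUM j<M. a k j * c j) = (SUM j<M. if k = j then r j * c j else 0)"
    by (intro sum.cong) (auto simp: a_def)
   thus ?thesis using that by simp
  qed
  hence "(SUM k<length ?ys. (cmod (SUM j<M. a k j * c j))^2) = (SUM k<M. (cmod (r k))^2 * (cmod (c k))^2)"
   by (simp add: norm_mult power_mult_distrib)
  also have "... <= (SUM k<M. 1 * (cmod (c k))^2)"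
   using assms by (intro sum_mono mult_right_mono) (auto simp: power_le_one)
  finally show ?case by simp
 qed
 also have "map (%j. SUM k<length ?ys. a k j .* ?ys ! k) [0..<M] = map (%j. r j .* x j) [0..<M]"
 proof (intro map_cong refl, goal_cases)
  case j: (1 j)
  have "(SUM k<length ?ys. a k j .* ?ys ! k) = (SUM k<M. if k = j then r j .* x j else 0)"
   by (intro sum.cong) (auto simp: a_def scaleCJ_def)
  thus ?case using j by simp
 qed
 finally show ?thesis .
qed

lemma not_gcauchy_blocks:
 assumes "~ gcauchy x"
 shows "EX ep>0. EX lo hi :: nat => nat. (ALL i. lo i <= hi i & hi i <= lo (Suc i) & en ep < GN (map x [lo i..<hi i]))"
proof -
 obtain ep where ep: "ep > 0" "!!N. EX n>=N. EX m. en ep < GN (map x [n..<m])"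
  using assms unfolding gcauchy_def by (auto simp: not_le)
 have "EX f :: nat => nat \<times> nat. ALL i. (case f i of (l, h) => l <= h & en ep < GN (map x [l..<h])) & snd (f i) <= fst (f (Suc i))"
 proof (rule dependent_nat_choice)
  fix p :: "nat \<times> nat" and i :: nat
  obtain l h where lh: "l >= snd p" "en ep < GN (map x [l..<h])" using ep(2) by blast
  hence "l <= h" by (cases "l <= h") auto
  thus "EX q. (case q of (l, h) => l <= h & en ep < GN (map x [l..<h])) & snd p <= fst q"
   using lh by (intro exI[of _ "(l, h)"]) auto
 next
  obtain l h where lh: "en ep < GN (map x [l..<h])" using ep(2) by blast
  hence "l <= h" by (cases "l <= h") auto
  thus "EX q. case q of (l, h) => l <= h & en ep < GN (map x [l..<h])"
   using lh by (intro exI[of _ "(l, h)"]) auto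
 qed
 then obtain f :: "nat => nat \<times> nat" where f: "ALL i. (case f i of (l, h) => l <= h & en ep < GN (map x [l..<h])) & snd (f i) <= fst (f (Suc i))"
  by (rule exE)
 hence "fst (f i) <= snd (f i) & snd (f i) <= fst (f (Suc i)) & en ep < GN (map x [fst (f i)..<snd (f i)])" for i
  using f[rule_format, of i] by (simp add: case_prod_beta)
 thus ?thesis using ep(1) 
  by (intro exI[of _ ep] conjI exI[of _ "%i. fst (f i)"] exI[of _ "%i. snd (f i)"] allI) auto
qed

lemma osc_diag: "s : cube (Suc N) ==> (SUM k<=N. (-1) ^ k * osc k (%j. s j * s j)) = real (Suc N) / 2"
proof -
 assume s: "s : cube (Suc N)"
 have o: "(-1) ^ k * osc k (%j. s j * s j) = 1 / 2" if "k <= N" for k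
 proof -
  have "s j * s j = 1" if "j <= k" for j using cube_mem[OF s, of j] that `k <= N` by auto
  hence "osc k (%j. s j * s j) = (1/2) * (-1) ^ k" unfolding osc_def by simp
  thus ?thesis by (cases "even k") auto
 qed
 have "(SUM k<=N. (-1) ^ k * osc k (%j. s j * s j)) = (SUM k<=N. 1 / 2)" by (intro sum.cong refl o) auto
 thus ?thesis by simp
qed

text \<open>Each vertex of the cube owns one block of indices. Without signs the weights
  \<open>g s\<close> are bounded by 1, so the sums stay below \<open>B\<close>. With signs the
  weight on the block of \<open>s\<close> itself is \<open>(N + 1) / 2\<close> by
  \<open>osc_diag\<close>, so that block alone contributes the left side. \<open>cube_umd\<close>
  compares the two for every \<open>om\<close>, summed over \<open>s\<close>.\<close>

lemma GN_blocks_bound: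
 fixes x :: "nat => 'x"
 assumes U: "umd_const TYPE('x) 2 bt" "0 <= bt"
  and B: "!!n. GN (map x [0..<n]) <= en B" "0 <= B"
  and bl: "!!i. lo i <= hi i" "!!i. hi i <= lo (Suc i)" "!!i. en ep < GN (map x [lo i..<hi i])" "0 < ep"
 shows "(real (Suc N) / 2)^2 * ep <= bt^2 * B"
proof -
 let ?m = "%ep. (real (Suc N) / 2)^2 * ep"
 let ?C = "cube (Suc N)"
 obtain h where h: "inj_on h ?C" "h ` ?C <= (UNIV :: nat set)"
  using finite_imp_inj_to_nat_seg[OF finite_cube[of "Suc N"]] by blast
 have lohi: "lo i <= lo j" "hi i <= hi j" if "i <= j" for i j
 proof -
  have "lo k <= lo (Suc k)" "hi k <= hi (Suc k)" for k using bl(1)[of k] bl(2)[of k] bl(1)[of "Suc k"] by linarith+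
  thus "lo i <= lo j" "hi i <= hi j" using lift_Suc_mono_le[OF _ that] by blast+
 qed
 have sep: "hi i <= lo j" if "i < j" for i j
  using bl(2)[of i] lohi(1)[of "Suc i" j] that by linarith
 define I where "I i = {lo (h i)..<hi (h i)}" for i
 have dis: "i = i'" if "i : ?C" "i' : ?C" "j : I i" "j : I i'" for i i' j
 proof -
  have "h i = h i'"
   using that(3,4) sep[of "h i" "h i'"] sep[of "h i'" "h i"] by (cases "h i" "h i'" rule: linorder_cases) (auto simp: I_def)
  thus ?thesis using h that by (auto dest: inj_onD)
 qed
 define M where "M = Max ((%i. hi (h i)) ` ?C)"
 have IM: "hi (h i) <= M" if "i : ?C" for i using that by (auto simp: M_def)
 define w where "w c j = (SUM i:?C. if j : I i then c i else 0)" for c :: "(nat => real) => real" and j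
 define W where "W c = map (%j. cor (w c j) .* x j) [0..<M]" for c
 define y where "y om i = (SUM j<M. if j : I i then om j .* x j else 0)" for om i
 have w_eq: "w c j = c i" if "i : ?C" "j : I i" for c i j
 proof -
  have "w c j = (SUM i':?C. if i' = i then c i else 0)"
   unfolding w_def using that dis by (intro sum.cong refl) auto
  thus ?thesis using that by simp
 qed
 have w_le: "\<bar>w c j\<bar> <= 1" if c: "!!i. i : ?C ==> \<bar>c i\<bar> <= 1" for c j
 proof (cases "EX i:?C. j : I i")
  case True thus ?thesis using w_eq c by auto
 next
  case False
  hence "w c j = 0" unfolding w_def by (intro sum.neutral) auto
  thus ?thesis by simp
 qed
 have gs: "gsum om (W c) = (SUM i:?C. c i *R y om i)" for c om
 proof -
  have "gsum om (W c) = (SUM j<M. om j .* (cor (w c j) .* x j))"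
   unfolding W_def by (rule sum_eq_gsum[symmetric])
  also have "... = (SUM j<M. w c j *R (om j .* x j))"
   by (intro sum.cong refl) (simp add: scl_mult scl_of_real[symmetric] mult.commute)
  also have "... = (SUM j<M. SUM i:?C. c i *R (if j : I i then om j .* x j else 0))"
   unfolding w_def scaleR_sum_left by (intro sum.cong refl) auto
  also have "... = (SUM i:?C. c i *R y om i)"
   unfolding y_def scaleR_sum_right by (rule sum.swap)
  finally show ?thesis .
 qed
 define b where "b s i = (SUM k<=N. (-1) ^ k * osc k (%j. s j * i j))" for s i
 define g where "g s i = (SUM k<=N. osc k (%j. s j * i j))" for s i
 have lower: "en (?m ep) <= GN (W (b s))" if s: "s : ?C" for s
 proof -
  let ?c = "cor (b s s)"
  have "en (?m ep) <= nq ?c * GN (map x [lo (h s)..<hi (h s)])"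
  proof -
   have "(cmod ?c)^2 = (real (Suc N) / 2)^2" unfolding b_def osc_diag[OF s] by (simp only: norm_of_real power2_abs)
   thus ?thesis using bl(3)[of "h s"] bl(4) by (simp add: ennreal_mult mult_left_mono del: of_nat_Suc)
  qed
  also have "... = GN (map (%x. ?c .* x) (map x [lo (h s)..<hi (h s)]))" by (rule GN_scale[symmetric])
  also have "map (%x. ?c .* x) (map x [lo (h s)..<hi (h s)]) = map (%j. cor (w (b s) j) .* x j) [lo (h s)..<hi (h s)]"
   using w_eq[OF s, of _ "b s"] by (auto simp: I_def)
  also have "GN ... <= GN (W (b s))" unfolding W_def by (rule GN_upt_mono) (use IM[OF s] in auto)
  finally show ?thesis .
 qed
 have upper: "GN (W (g s)) <= en B" if s: "s : ?C" for s
 proof -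
  have "\<bar>g s i\<bar> <= 1" if i: "i : ?C" for i
  proof -
   have "\<bar>SUM k<Suc N. osc k (%j. s j * i j)\<bar> <= 1"
    using cube_mem[OF s] cube_mem[OF i] by (intro osc_sum_le) force
   thus ?thesis by (simp add: g_def lessThan_Suc_atMost)
  qed
  hence "GN (W (g s)) <= GN (map x [0..<M])"
   unfolding W_def by (intro GN_mult_le) (simp add: w_le)
  also have "... <= en B" by (rule B)
  finally show ?thesis .
 qed
 have "of_nat (card ?C) * en (?m ep) = (SUM s:?C. en (?m ep))" by simp
 also have "... <= (SUM s:?C. GN (W (b s)))" by (intro sum_mono lower)
 also have "... = NI gspace (%om. (SUM s:?C. nq (gsum om (W (b s)))))"
  unfolding GN_eq by (rule nn_integral_sum[symmetric]) measurable
 also have "... <= NI gspace (%om. en (bt^2) * (SUM s:?C. nq (gsum om (W (g s)))))"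
 proof (rule nn_integral_mono, goal_cases)
  case (1 om)
  have "(SUM s:?C. (norm (gsum om (W (b s))))^2) <= bt^2 * (SUM s:?C. (norm (gsum om (W (g s))))^2)"
   unfolding gs b_def g_def by (rule cube_umd[OF U])
  thus ?case
   by (simp add: sum_nonneg ennreal_mult[symmetric] ennreal_leI)
 qed
 also have "... = en (bt^2) * (SUM s:?C. GN (W (g s)))"
  unfolding GN_eq by (subst nn_integral_cmult, measurable) (subst nn_integral_sum, auto)
 also have "... <= en (bt^2) * (SUM s:?C. en B)" by (intro mult_left_mono sum_mono upper) auto
 finally have "en (real (card ?C)) * en (?m ep) <= en (bt^2) * (en (real (card ?C)) * en B)"
  by (simp add: ennreal_of_nat_eq_real_of_nat)
 hence "real (card ?C) * (?m ep) <= bt^2 * (real (card ?C) * B)"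
  using B(2) bl(4) by (simp add: ennreal_mult[symmetric] del: of_nat_Suc)
 moreover have "0 < card ?C" by (simp add: card_gt_0_iff cube_nonempty)
 ultimately have "real (card ?C) * (?m ep) <= real (card ?C) * (bt^2 * B)"
  by (simp only: mult.left_commute)
 thus ?thesis using `0 < card ?C` by (subst (asm) mult_le_cancel_left_pos) auto
qed

text \<open>Bounded Gaussian series converge in every Banach space without a copy of
  \<open>c_0\<close>. Here UMD forces it directly: the left side of \<open>GN_blocks_bound\<close>
  grows with \<open>N\<close> and the right side does not. This is what lets a supremum of finite
  sums replace the gamma norm.\<close>

theorem GN_bounded_gcauchy:
 fixes x :: "nat => 'x"
 assumes U: "UMD TYPE('x)" and B: "!!n. GN (map x [0..<n]) <= B" "B < \<infinity>"
 shows "gcauchy x"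
proof (rule ccontr)
 assume "~ gcauchy x"
 then obtain ep lo hi where bl: "ep > 0" "!!i. lo i <= hi i" "!!i. hi i <= lo (Suc i)" "!!i. en ep < GN (map x [lo i..<hi i])"
  using not_gcauchy_blocks by blast
 obtain bt where bt: "0 <= bt" "umd_const TYPE('x) 2 bt" using UMD_const[OF U, of 2] by auto
 obtain b where b: "B = en b" "0 <= b" using B(2) by (cases B) auto
 have *: "(real (Suc N) / 2)^2 * ep <= bt^2 * b" for N
  by (rule GN_blocks_bound[where x=x and lo=lo and hi=hi, OF bt(2,1) B(1)[unfolded b(1)] b(2) bl(2,3,4,1)])
 have "real (Suc N) <= 4 * (bt^2 * b) / ep" for N
 proof -
  have "real (Suc N) * 1 * ep <= real (Suc N) * real (Suc N) * ep" using bl(1) by (intro mult_right_mono mult_left_mono) auto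
  also have "... = 4 * ((real (Suc N) / 2)^2 * ep)" by (simp add: power2_eq_square del: of_nat_Suc)
  also have "... <= 4 * (bt^2 * b)" by (intro mult_left_mono *) auto
  finally show ?thesis using bl(1) by (simp add: pos_le_divide_eq del: of_nat_Suc)
 qed
 moreover obtain n where "4 * (bt^2 * b) / ep < real n" using reals_Archimedean2 by blast
 moreover have "real n <= real (Suc n)" by simp
 ultimately show False by (meson le_less_trans not_less)
qed

end

section \<open>Stein's inequality\<close>

lemma sum_even_odd: "(SUM k<=2 * N. f k) = (SUM j<=N. f (2 * j)) + (SUM j<N. f (2 * j + 1))" for f :: "nat => 'b::comm_monoid_add"
 by (induction N) (simp_all add: algebra_simps)

lemma gspace_flip: "distr gspace gspace (%om. fun_upd om j (- om j)) = gspace"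
proof -
 let ?f = "%om. fun_upd om j (- om j)"
 have m: "?f : measurable gspace gspace"
  unfolding gspace_def
 proof (rule measurable_PiM_single', goal_cases)
  case (1 i)
  show ?case
   using measurable_gspace_component[of i] measurable_gspace_component[of j]
   unfolding gspace_def by (cases "i = j") (simp_all cong: measurable_cong_sets)
 qed (auto simp: space_PiM)
 have neg: "emeasure cgauss (uminus -` A) = emeasure cgauss A" if A: "A : sets borel" for A
 proof -
  have [measurable]: "A : sets borel" by fact
  have u: "uminus -` A : sets borel" using measurable_sets_borel[of uminus borel A] A by simp
  have "emeasure cgauss (uminus -` A) = NI cgauss (%z. ind (uminus -` A) z)"
   using u by simp
  also have "... = NI cgauss (%z. ind A ((-1) * z))"
   by (intro nn_integral_cong) (auto simp: indicator_def)
  also have "... = NI cgauss (%z. ind A z)"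
   by (rule cgauss_phase) auto
  also have "... = emeasure cgauss A" by simp
  finally show ?thesis .
 qed
 show ?thesis
  unfolding gspace_eq
 proof (rule gspace.PiM_eq)
  fix I :: "nat set" and E assume I: "finite I" "I <= UNIV" "!!i. i : I ==> E i : sets cgauss"
  define E' where "E' i = (if i = j then uminus -` E i else E i)" for i
  have E': "E' i : sets cgauss" if "i : I" for i
   using I(3)[OF that] measurable_sets_borel[of uminus borel "E i"] by (auto simp: E'_def)
  have "emeasure (distr gspace.S gspace.S ?f) (prod_emb UNIV (%_. cgauss) I (Pi\<^sub>E I E))
   = emeasure gspace.S (?f -` prod_emb UNIV (%_. cgauss) I (Pi\<^sub>E I E) Int space gspace.S)"
   using I m unfolding gspace_eq by (intro emeasure_distr) (auto intro!: sets_PiM_I)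
  also have "?f -` prod_emb UNIV (%_. cgauss) I (Pi\<^sub>E I E) Int space gspace.S
   = prod_emb UNIV (%_. cgauss) I (Pi\<^sub>E I E')"
  proof -
   have "prod_emb UNIV (%_. cgauss) I (Pi\<^sub>E I D) = {om. ALL i:I. om i : D i}" for D :: "nat => complex set"
    by (auto simp: prod_emb_def PiE_iff)
   thus ?thesis by (auto simp: space_PiM E'_def)
  qed
  also have "emeasure gspace.S ... = (PROD i:I. emeasure cgauss (E' i))"
   using I(1) E' by (intro gspace.emeasure_PiM_emb) auto
  also have "... = (PROD i:I. emeasure cgauss (E i))"
   using I(3) neg by (intro prod.cong refl) (auto simp: E'_def)
  finally show "emeasure (distr gspace.S gspace.S ?f) (prod_emb UNIV (%_. cgauss) I (Pi\<^sub>E I E))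
   = (PROD i:I. emeasure cgauss (E i))" .
 qed simp
qed

lemma (in complex_banach) GN_le_bound:
 assumes "!!v. v : set xs ==> norm v <= R" "0 <= R"
 shows "GN xs <= en (real (length xs) * real (length xs) * R^2) * gauss_m2"
proof -
 let ?n = "length xs"
 have "(norm (gsum om xs))^2 <= real ?n * R^2 * (SUM j<?n. (cmod (om j))^2)" for om
 proof -
  have "norm (gsum om xs) <= (SUM j<?n. cmod (om j) * R)"
   unfolding gsum_def using assms by (intro sum_norm_le) (auto simp: norm_scl intro!: mult_left_mono)
  hence "(norm (gsum om xs))^2 <= (SUM j<?n. cmod (om j) * R)^2"
   by (intro power_mono) auto
  also have "... = R^2 * (SUM j<?n. cmod (om j))^2" by (simp add: sum_distrib_right[symmetric] power_mult_distrib)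
  also have "... <= R^2 * (real ?n * (SUM j<?n. (cmod (om j))^2))"
   using sum_squared_le_sum_of_squares[of "%j. cmod (om j)" "{..<?n}"]
   by (intro mult_left_mono) (auto simp: mult.commute)
  finally show ?thesis by (simp add: algebra_simps)
 qed
 hence "GN xs <= NI gspace (%om. en (real ?n * R^2) * (SUM j<?n. nq (om j)))"
  unfolding GN_eq by (intro nn_integral_mono) (simp add: ennreal_mult[symmetric] sum_nonneg ennreal_leI)
 also have "... = en (real ?n * R^2) * (SUM j<?n. (NI gspace (%om. nq (om j))))"
 proof -
  note [measurable] = measurable_gspace_component
  show ?thesis by (subst nn_integral_cmult, measurable) (subst nn_integral_sum, auto)
 qed
 also have "... = en (real ?n * R^2) * (SUM j<?n. gauss_m2)"
 proof -
  have "gauss_m2 = (NI (distr gspace cgauss (%om. om j)) (%z. nq z))" for j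
   unfolding gauss_m2_def gspace_eq by (subst gspace.PiM_component) auto
  moreover have "(NI (distr gspace cgauss (%om. om j)) (%z. nq z)) = NI gspace (%om. nq (om j))" for j
   using measurable_gspace_component[of j] by (intro nn_integral_distr) (auto cong: measurable_cong_sets)
  ultimately show ?thesis by simp
 qed
 also have "... = en (real ?n * real ?n * R^2) * gauss_m2"
  by (simp add: ennreal_of_nat_eq_real_of_nat ennreal_mult mult.assoc mult.left_commute)
 finally show ?thesis .
qed

text \<open>\<open>b i j\<close> plays the conditional expectation of \<open>a i\<close> given the
  finite partition \<open>pr j\<close>. It is specified by its integrals over cells against
  functionals (\<open>ce\<close>); the partitions get finer by \<open>nest\<close>, and the bound
  \<open>R\<close> takes care of integrability.\<close>

locale stein = complex_banach J + prob_space mu for J :: "'x::banach => 'x" and mu :: "'a measure" +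
 fixes pr :: "nat => 'a => 'q" and N :: nat and a :: "nat => 'a => 'x" and b :: "nat => nat => 'a => 'x" and R :: real
 assumes fin: "!!k. k < N ==> finite (pr k ` space mu)"
  and ms: "!!k c. k < N ==> {x:space mu. pr k x = c} : sets mu"
  and nest: "!!i j x y. i <= j ==> j < N ==> x : space mu ==> y : space mu ==> pr j x = pr j y ==> pr i x = pr i y"
  and sma: "!!i. i < N ==> sm mu (a i)"
  and smb: "!!i j. i <= j ==> j < N ==> sm mu (b i j)"
  and binv: "!!i j x y. i <= j ==> j < N ==> x : space mu ==> y : space mu ==> pr j x = pr j y ==> b i j x = b i j y"
  and bda: "!!i x. i < N ==> x : space mu ==> norm (a i x) <= R"
  and bdb: "!!i j x. i <= j ==> j < N ==> x : space mu ==> norm (b i j x) <= R"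
  and ce: "!!i j c ph. i <= j ==> j < N ==> bounded_linear (ph :: 'x => real) ==>
   (LI mu (%x. ind {x:space mu. pr j x = c} x * ph (b i j x))) = LI mu (%x. ind {x:space mu. pr j x = c} x * ph (a i x))"
begin

text \<open>Past the last partition everything is known, and the conditional expectation is
  \<open>a i\<close> itself.\<close>

definition B :: "nat => nat => 'a => 'x" where "B i j = (if j < N then b i j else a i)"

text \<open>Gaussians and partitions are revealed alternately. The odd stage \<open>2 i + 1\<close>
  brings in the Gaussian \<open>i\<close> with the coefficient \<open>b i i\<close>; the even stage
  \<open>2 j\<close> refines the coefficients of the Gaussians \<open>i < j\<close> from partition
  \<open>j - 1\<close> to \<open>j\<close>.\<close>

definition V :: "nat => nat => 'a => 'x" where
 "V k i x = (if odd k then (if i = k div 2 then B i i x else 0)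
  else (if i < k div 2 then B i (k div 2) x - B i (k div 2 - 1) x else 0))"

definition dd :: "nat => 'a \<times> (nat => complex) => 'x" where
 "dd k z = gsum (snd z) (map (%i. V k i (fst z)) [0..<N])"

text \<open>What is known at stage \<open>k\<close>: for \<open>k = 2 j\<close> the partition
  \<open>j\<close> and the Gaussians below \<open>j\<close>, for \<open>k = 2 j + 1\<close> also the
  Gaussian \<open>j\<close>. From \<open>j = N\<close> on the point of \<open>mu\<close> itself is
  known.\<close>

definition rel :: "nat => 'a \<times> (nat => complex) => 'a \<times> (nat => complex) => bool" where
 "rel k z w <-> (if k div 2 < N then pr (k div 2) (fst z) = pr (k div 2) (fst w) else fst z = fst w)
   & (ALL i<(k + 1) div 2. snd z i = snd w i)"

abbreviation "Om == mu \<otimes> gspace"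
definition FF :: "nat => ('a \<times> (nat => complex)) measure" where "FF k = inv_algebra Om (rel k)"

lemma smB: "i < N ==> i <= j ==> sm mu (B i j)"
 by (auto simp: B_def intro: sma smb)

lemma bdB: "i < N ==> i <= j ==> x : space mu ==> norm (B i j x) <= R"
 by (auto simp: B_def intro: bda bdb)

lemma R_nonneg: "0 < N ==> 0 <= R"
 using bda[of 0] not_empty norm_ge_zero order_trans by (metis all_not_in_conv)

lemma smV: "i < N ==> sm mu (V k i)"
 unfolding V_def by (cases "odd k"; cases "i = k div 2"; cases "i < k div 2") (auto intro!: sm_diff smB)

lemma bdV: "i < N ==> x : space mu ==> norm (V k i x) <= 2 * R"
proof -
 assume i: "i < N" "x : space mu"
 have "0 <= R" using R_nonneg i by auto
 moreover have "norm (B i (k div 2) x - B i (k div 2 - 1) x) <= R + R" if "i < k div 2"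
  using that i by (intro order_trans[OF norm_triangle_ineq4] add_mono bdB) auto
 moreover have "norm (B i i x) <= R" using i by (intro bdB) auto
 ultimately show ?thesis by (auto simp: V_def)
qed

lemma sum_V: "i < N ==> (SUM k<=2 * N. V k i x) = a i x"
proof -
 assume i: "i < N"
 have "(SUM j<n. V (2 * j + 1) i x) = (if i < n then B i i x else 0)" for n
  by (simp add: V_def)
 moreover have "(SUM j<=n. V (2 * j) i x) = (if i < n then B i n x - B i i x else 0)" for n
 proof (induction n)
  case (Suc n)
  thus ?case by (auto simp: V_def not_less less_Suc_eq)
 qed (simp add: V_def)
 ultimately show ?thesis unfolding sum_even_odd using i by (simp add: B_def)
qed

text \<open>The sign \<open>+1\<close> on Gaussian stages keeps \<open>b i i\<close>, the sign
  \<open>-1\<close> reverses the refinements; adding the martingale itself then leaves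
  \<open>2 b i i\<close>.\<close>

lemma sum_V_sign: "i < N ==> (SUM k<=2 * N. (if odd k then 1 else -1 :: real) *R V k i x) = 2 *R b i i x - a i x"
proof -
 assume i: "i < N"
 have "(SUM j<N. V (2 * j + 1) i x) = b i i x"
  using i by (simp add: V_def B_def)
 hence "(SUM k<=2 * N. (if odd k then 1 else -1 :: real) *R V k i x) = 2 *R b i i x - (SUM k<=2 * N. V k i x)"
  unfolding sum_even_odd by (simp add: sum_negf scaleR_2)
 thus ?thesis unfolding sum_V[OF i] .
qed


interpretation P: pair_sigma_finite mu gspace ..

lemma sm_comb:
 assumes "!!i. i < N ==> sm mu (f i)"
 shows "sm Om (%z. gsum (snd z) (map (%i. f i (fst z)) [0..<N]))"
proof -
 have "sm Om (%z. SUM i<N. snd z i .* f i (fst z))"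
 proof (intro sm_sum sm_scl)
  fix i assume "i : {..<N}"
  thus "sm Om (%z. f i (fst z))"
   by (intro sm_comp_measurable[OF assms measurable_fst]) auto
  show "sm Om (%z. snd z i)"
   by (intro sm_of_borel measurable_compose[OF measurable_snd measurable_gspace_component])
 qed
 thus ?thesis unfolding sum_eq_gsum .
qed

lemma comb_nn:
 assumes "!!i. i < N ==> sm mu (f i)"
 shows "NI Om (%z. np p (gsum (snd z) (map (%i. f i (fst z)) [0..<N])))
  = NI mu (%x. GE (np p) (map (%i. f i x) [0..<N]))"
proof -
 note [measurable] = sm_norm[OF sm_comb[OF assms]]
 show ?thesis unfolding GE_def
  by (subst gs.nn_integral_fst[symmetric]) (auto simp: case_prod_beta)
qed

lemma comb_finite:
 assumes "!!i. i < N ==> sm mu (f i)" and R: "!!i x. i < N ==> x : space mu ==> norm (f i x) <= R'" "0 <= R'" and p: "0 < p"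
 shows "NI Om (%z. np p (gsum (snd z) (map (%i. f i (fst z)) [0..<N]))) < \<infinity>"
proof -
 obtain C where C: "C > 0" "!!xs. GE (np p) xs <= en C * epowr (GN xs) (p / 2)"
  using kahane_upper[OF p] by blast
 let ?K = "en (real N * real N * R'^2) * gauss_m2"
 have "NI mu (%x. GE (np p) (map (%i. f i x) [0..<N])) <= NI mu (%x. en C * epowr ?K (p / 2))"
 proof (intro nn_integral_mono order_trans[OF C(2)] mult_left_mono epowr_mono)
  fix x assume "x : space mu"
  thus "GN (map (%i. f i x) [0..<N]) <= ?K"
   using R by (intro GN_le_bound[of "map (%i. f i x) [0..<N]" R', simplified]) auto
 qed (use p in auto)
 also have "... = en C * epowr ?K (p / 2)" by (simp add: emeasure_space_1)
 also have "... < \<infinity>" using gauss_m2_finite p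
  by (auto simp: ennreal_mult_less_top epowr_less_top_iff)
 finally show ?thesis by (subst comb_nn[where f=f, OF assms(1)])
qed

lemma sm_dd: "sm Om (dd k)"
 unfolding dd_def by (intro sm_comb smV)

lemma dd_Lp: "0 < p ==> (NI Om (%z. np p (dd k z))) < \<infinity>"
proof (cases "N = 0")
 case False
 assume p: "0 < p"
 show ?thesis unfolding dd_def
  by (rule comb_finite[where R'="2 * R"]) (use smV bdV R_nonneg False p in auto)
next
 case True
 hence "[0..<N] = []" by simp
 hence "dd k z = 0" for z unfolding dd_def by (simp only: list.map gsum_Nil)
 thus ?thesis by simp
qed

lemma dd_inv:
 assumes k: "k <= 2 * N" and z: "z : space Om" "w : space Om" and r: "rel k z w"
 shows "dd k z = dd k w"
proof -
 let ?j = "k div 2"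
 have sp: "fst z : space mu" "fst w : space mu" using z by (auto simp: space_pair_measure)
 have Beq: "B i l (fst z) = B i l (fst w)" if "i <= l" "l <= ?j" for i l
 proof (cases "?j < N")
  case True
  hence "pr ?j (fst z) = pr ?j (fst w)" using r by (auto simp: rel_def)
  hence "pr l (fst z) = pr l (fst w)" using nest[of l ?j] that True sp by blast
  hence "b i l (fst z) = b i l (fst w)" using that True sp by (intro binv[of i l]) auto
  thus ?thesis using that True by (simp add: B_def)
 next
  case False
  thus ?thesis using r by (auto simp: rel_def)
 qed
 have "snd z i .* V k i (fst z) = snd w i .* V k i (fst w)" for i
 proof (cases "odd k")
  case True
  hence "?j < (k + 1) div 2" by (auto elim!: oddE)
  hence "snd z ?j = snd w ?j" using r by (auto simp: rel_def)
  thus ?thesis using True Beq[of ?j ?j] by (auto simp: V_def)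
 next
  case False
  have "snd z i = snd w i" if "i < ?j" using r that by (auto simp: rel_def)
  thus ?thesis using False Beq[of i ?j] Beq[of i "?j - 1"] by (auto simp: V_def)
 qed
 thus ?thesis unfolding dd_def sum_eq_gsum[symmetric] by simp
qed

lemma integrable_bounded_sm:
 assumes f: "sm mu f" "!!x. x : space mu ==> norm (f x) <= R'" and ph: "bounded_linear (ph :: 'x => real)" and A: "A : sets mu"
 shows "integrable mu (%x. ind A x * ph (f x))"
proof -
 obtain K where K: "!!v. norm (ph v) <= norm v * K" "0 <= K" using bounded_linear.nonneg_bounded[OF ph] by blast
 have [measurable]: "(%x. ph (f x)) : bm mu"
  by (intro sm_borel sm_compose[OF f(1)] linear_continuous_on ph)
 show ?thesis
 proof (rule integrable_const_bound[where B="R' * K"])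
  show "AE x in mu. norm (ind A x * ph (f x)) <= R' * K"
  proof (rule AE_I2, goal_cases)
   case x: (1 x)
   have "norm (ph (f x)) <= R' * K" using K(1)[of "f x"] mult_right_mono[OF f(2)[OF x] K(2)] by linarith
   moreover have "0 <= R' * K" using calculation norm_ge_zero order_trans by blast
   ultimately show ?case by (auto simp: indicator_def)
  qed
 qed (use A in measurable)
qed

text \<open>An event that does not split cells is a finite union of cells.\<close>

lemma ce_inv:
 assumes ij: "i <= j" "j < N" and A: "A : sets mu" and ph: "bounded_linear (ph :: 'x => real)"
  and inv: "!!x y. x : space mu ==> y : space mu ==> pr j x = pr j y ==> x : A ==> y : A"
 shows "LI mu (%x. ind A x * ph (b i j x)) = LI mu (%x. ind A x * ph (a i x))"
proof -
 let ?P = "%c. {x:space mu. pr j x = c}"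
 have As: "A <= space mu" using A by (rule sets.sets_into_space)
 have fA: "finite (pr j ` A)" by (rule finite_subset[OF image_mono[OF As] fin[OF ij(2)]])
 have ind: "ind A x = (SUM c:pr j ` A. ind (?P c) x :: real)" if x: "x : space mu" for x
 proof -
  have "(SUM c:pr j ` A. ind (?P c) x :: real) = (SUM c:pr j ` A. if c = pr j x then 1 else 0)"
   using x by (intro sum.cong refl) (auto simp: indicator_def)
  also have "... = (if pr j x : pr j ` A then 1 else 0)" using fA by simp
  also have "pr j x : pr j ` A <-> x : A"
  proof
   assume "pr j x : pr j ` A"
   then obtain y where "y : A" "pr j x = pr j y" by blast
   thus "x : A" using inv[of y x] x As by auto
  qed simp
  finally show ?thesis by (simp add: indicator_def)
 qed
 have *: "LI mu (%x. ind A x * ph (f x)) = (SUM c:pr j ` A. LI mu (%x. ind (?P c) x * ph (f x)))"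
  if "sm mu f" "!!x. x : space mu ==> norm (f x) <= R" for f
 proof -
  have "LI mu (%x. ind A x * ph (f x)) = LI mu (%x. (SUM c:pr j ` A. ind (?P c) x * ph (f x)))"
   by (intro bint_cong) (simp add: ind sum_distrib_right)
  also have "... = (SUM c:pr j ` A. LI mu (%x. ind (?P c) x * ph (f x)))"
   by (intro Bochner_Integration.integral_sum integrable_bounded_sm[OF that ph] ms ij(2))
  finally show ?thesis .
 qed
 have "i < N" using ij by simp
 have "LI mu (%x. ind A x * ph (b i j x)) = (SUM c:pr j ` A. LI mu (%x. ind (?P c) x * ph (b i j x)))"
  by (rule *[of "b i j", OF smb[OF ij] bdb[OF ij]])
 also have "... = (SUM c:pr j ` A. LI mu (%x. ind (?P c) x * ph (a i x)))"
  by (intro sum.cong refl ce[OF ij ph])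
 also have "... = LI mu (%x. ind A x * ph (a i x))"
  by (rule *[of "a i", OF sma[OF `i < N`] bda[OF `i < N`], symmetric])
 finally show ?thesis .
qed

lemma integrable_dd:
 assumes ph: "bounded_linear (ph :: 'x => real)" and A: "A : sets Om"
 shows "integrable Om (%z. ind A z * ph (dd k z))"
proof -
 obtain K where K: "!!v. norm (ph v) <= norm v * K" "0 <= K" using bounded_linear.nonneg_bounded[OF ph] by blast
 have [measurable]: "(%z. ph (dd k z)) : bm Om"
  by (intro sm_borel sm_compose[OF sm_dd] linear_continuous_on ph)
 have [measurable]: "(%z. norm (dd k z)) : bm Om" by (intro sm_norm sm_dd)
 have "integrable Om (%z. norm (dd k z))"
  using dd_Lp[of 1 k] by (intro integrableI_bounded) auto
 thus ?thesis
 proof (rule bint_bound[where f="%z. norm (dd k z) * K", OF integrable_mult_left])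
  show "AE z in Om. norm (ind A z * ph (dd k z)) <= norm (norm (dd k z) * K)"
   using K by (auto simp: indicator_def abs_mult)
 qed (use A in measurable)
qed

end

context stein
begin

interpretation P: pair_sigma_finite mu gspace ..

lemma scl_functional: "bounded_linear ph ==> bounded_linear (%v. ph (c .* v) :: real)"
 by (rule bounded_linear_compose[OF _ bounded_linear_scl])

lemma dd_eq: "dd k (x, om) = (SUM i<N. om i .* V k i x)"
 unfolding dd_def sum_eq_gsum by simp

lemma scl_zero_r: "c .* 0 = 0"
 by (simp add: scaleCJ_def linear_0[OF linJ])

text \<open>At stage \<open>2 j\<close> the Gaussian \<open>j\<close> is still unknown, and the next
  difference is odd in it.\<close>

lemma mean_zero_odd:
 assumes j: "j < N" and A: "A : sets (FF (2 * j))" and ph: "bounded_linear (ph :: 'x => real)"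
 shows "LI Om (%z. ind A z * ph (dd (2 * j + 1) z)) = 0"
proof -
 define fl where "fl om = fun_upd om j (- om j)" for om :: "nat => complex"
 have AO: "A : sets Om" and inv: "!!z w. z : space Om ==> w : space Om ==> rel (2 * j) z w ==> z : A <-> w : A"
  using A unfolding FF_def sets_inv_algebra by blast+
 have int: "integrable Om (%(x, om). ind A (x, om) * ph (dd (2 * j + 1) (x, om)))"
  using integrable_dd[OF ph AO, of "2 * j + 1"] by (simp add: split_beta')
 have flm: "fl : measurable gspace gspace"
  unfolding gspace_def
 proof (rule measurable_PiM_single', goal_cases)
  case (1 i)
  show ?case
   using measurable_gspace_component[of i] measurable_gspace_component[of j]
   unfolding gspace_def fl_def by (cases "i = j") (simp_all cong: measurable_cong_sets)
 qed (auto simp: space_PiM)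
 have "LI gspace (%om. ind A (x, om) * ph (dd (2 * j + 1) (x, om))) = 0" if x: "x : space mu" for x
 proof -
  let ?h = "%om. ind A (x, om) * ph (dd (2 * j + 1) (x, om)) :: real"
  have m: "?h : bm gspace"
   using measurable_Pair2[OF borel_measurable_integrable[OF int] x] by simp
  have "dd (2 * j + 1) (x, om) = om j .* B j j x" for om
  proof -
   have "dd (2 * j + 1) (x, om) = (SUM i<N. if i = j then om j .* B j j x else 0)"
    unfolding dd_eq by (intro sum.cong) (auto simp: V_def scaleCJ_def linear_0[OF linJ])
   thus ?thesis using j by simp
  qed
  hence 1: "dd (2 * j + 1) (x, fl om) = - dd (2 * j + 1) (x, om)" for om
   by (simp add: fl_def scl_minus_left)
  have "(x, fl om) : A <-> (x, om) : A" for om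
   using x by (intro inv) (auto simp: rel_def fl_def space_pair_measure)
  hence odd: "?h (fl om) = - ?h om" for om
   unfolding 1 by (simp add: indicator_def linear_neg[OF bounded_linear.linear[OF ph]])
  have "LI gspace (%om. ?h om) = LI (distr gspace gspace fl) (%om. ?h om)"
   unfolding fl_def gspace_flip ..
  also have "... = LI gspace (%om. ?h (fl om))" by (rule integral_distr[OF flm m])
  also have "... = - (LI gspace (%om. ?h om))" unfolding odd by simp
  finally show ?thesis by simp
 qed
 hence "LI mu (%x. (LI gspace (%om. ind A (x, om) * ph (dd (2 * j + 1) (x, om))))) = LI mu (%x. 0)"
  by (intro bint_cong)
 thus ?thesis unfolding P.integral_fst[OF int] by (simp add: split_beta')
qed

text \<open>For fixed \<open>om\<close> the section of the event is a union of cells of partition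
  \<open>j - 1\<close>, hence of the finer partition \<open>j\<close>, and over it
  \<open>B i j\<close> and \<open>B i (j - 1)\<close> have the same integral as
  \<open>a i\<close>.\<close>

lemma mean_zero_even:
 assumes j: "0 < j" "j <= N" and A: "A : sets (FF (2 * j - 1))" and ph: "bounded_linear (ph :: 'x => real)"
 shows "LI Om (%z. ind A z * ph (dd (2 * j) z)) = 0"
proof -
 have AO: "A : sets Om" and inv: "!!z w. z : space Om ==> w : space Om ==> rel (2 * j - 1) z w ==> z : A <-> w : A"
  using A unfolding FF_def sets_inv_algebra by blast+
 have jN: "j - 1 < N" using j by simp
 have d1: "(2 * j - 1) div 2 = j - 1" "(2 * j - 1 + 1) div 2 = j" using j by auto
 have int: "integrable Om (%(x, om). ind A (x, om) * ph (dd (2 * j) (x, om)))"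
  using integrable_dd[OF ph AO, of "2 * j"] by (simp add: split_beta')
 have "LI mu (%x. ind A (x, om) * ph (dd (2 * j) (x, om))) = 0" for om
 proof -
  define A' where "A' = {x : space mu. (x, om) : A}"
  have A': "A' : sets mu"
  proof -
   have "(%x. (x, om)) -` A Int space mu : sets mu"
    by (rule measurable_sets[OF _ AO]) simp
   also have "(%x. (x, om)) -` A Int space mu = A'" by (auto simp: A'_def)
   finally show ?thesis .
  qed
  have inv1: "y : A'" if "x : space mu" "y : space mu" "pr (j - 1) x = pr (j - 1) y" "x : A'" for x y
  proof -
   have "rel (2 * j - 1) (x, om) (y, om)" unfolding rel_def d1 using jN that(3) by simp
   thus ?thesis using inv[of "(x, om)" "(y, om)"] that by (simp add: A'_def space_pair_measure)
  qed
  have ce': "LI mu (%x. ind A' x * py (B i l x)) = LI mu (%x. ind A' x * py (a i x))"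
   if il: "i <= l" "l = j | l = j - 1" and py: "bounded_linear (py :: 'x => real)" for i l py
  proof (cases "l < N")
   case True
   have "y : A'" if "x : space mu" "y : space mu" "pr l x = pr l y" "x : A'" for x y
   proof (rule inv1[of x y])
    show "pr (j - 1) x = pr (j - 1) y" by (rule nest[of _ l]) (use il True that in auto)
   qed (use that in auto)
   hence "LI mu (%x. ind A' x * py (b i l x)) = LI mu (%x. ind A' x * py (a i x))"
    by (intro ce_inv[OF il(1) True A' py])
   thus ?thesis using True by (simp add: B_def)
  qed (simp add: B_def)
  have eq: "ind A (x, om) * ph (dd (2 * j) (x, om))
   = (SUM i<j. ind A' x * ph (om i .* B i j x) - ind A' x * ph (om i .* B i (j - 1) x))"
   if x: "x : space mu" for x
  proof -
   have "dd (2 * j) (x, om) = (SUM i<N. if i < j then om i .* B i j x - om i .* B i (j - 1) x else 0)"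
    unfolding dd_eq by (intro sum.cong) (auto simp: V_def scl_diff_right scl_zero_r)
   also have "... = (SUM i:{i. i < N & i < j}. om i .* B i j x - om i .* B i (j - 1) x)"
    by (subst sum.inter_filter[symmetric]) auto
   also have "{i. i < N & i < j} = {..<j}" using j by auto
   finally have "ph (dd (2 * j) (x, om)) = (SUM i<j. ph (om i .* B i j x) - ph (om i .* B i (j - 1) x))"
    by (simp add: linear_sum[OF bounded_linear.linear[OF ph]] linear_diff[OF bounded_linear.linear[OF ph]])
   thus ?thesis using x by (simp add: A'_def indicator_def sum_distrib_left right_diff_distrib)
  qed
  have ii: "integrable mu (%x. ind A' x * ph (om i .* B i l x))" if "i < j" "i <= l" for i l
   using that j by (intro integrable_bounded_sm[where R'=R, OF _ _ scl_functional[OF ph] A'] smB bdB) auto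
  have "LI mu (%x. ind A (x, om) * ph (dd (2 * j) (x, om)))
   = LI mu (%x. (SUM i<j. ind A' x * ph (om i .* B i j x) - ind A' x * ph (om i .* B i (j - 1) x)))"
   by (intro bint_cong eq)
  also have "... = (SUM i<j. (LI mu (%x. ind A' x * ph (om i .* B i j x))) - (LI mu (%x. ind A' x * ph (om i .* B i (j - 1) x))))"
   by (subst Bochner_Integration.integral_sum) (auto simp: ii Bochner_Integration.integral_diff intro!: Bochner_Integration.integrable_diff ii)
  also have "... = 0"
   using ce'[OF _ _ scl_functional[OF ph]] by (intro sum.neutral) auto
  finally show ?thesis .
 qed
 hence "LI gspace (%om. (LI mu (%x. ind A (x, om) * ph (dd (2 * j) (x, om))))) = 0" by simp
 thus ?thesis unfolding P.integral_snd[OF int] by (simp add: split_beta')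
qed

lemma mds_dd: "0 < p ==> mds p Om FF dd (2 * N)"
 unfolding mds_def
proof (intro conjI allI impI ballI)
 show "space (FF i) = space Om" "sets (FF i) <= sets Om" for i by (auto simp: FF_def sets_inv_algebra)
 show "sets (FF i) <= sets (FF j)" if "i <= j" for i j
 proof
  fix A assume A: "A : sets (FF i)"
  have "rel i z w" if r: "rel j z w" "z : space Om" "w : space Om" for z w
  proof -
   have d: "i div 2 <= j div 2" "(i + 1) div 2 <= (j + 1) div 2" using `i <= j` by (auto intro!: div_le_mono)
   have sp: "fst z : space mu" "fst w : space mu" using r by (auto simp: space_pair_measure)
   have "ALL l<(i + 1) div 2. snd z l = snd w l" using r(1) d(2) unfolding rel_def by (meson less_le_trans)
   moreover have "if i div 2 < N then pr (i div 2) (fst z) = pr (i div 2) (fst w) else fst z = fst w"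
   proof (cases "j div 2 < N")
    case True
    hence "pr (j div 2) (fst z) = pr (j div 2) (fst w)" using r(1) by (simp add: rel_def)
    hence "pr (i div 2) (fst z) = pr (i div 2) (fst w)" by (rule nest[OF d(1) True sp])
    thus ?thesis using d True by auto
   next
    case False
    hence "fst z = fst w" using r(1) by (simp add: rel_def)
    thus ?thesis by simp
   qed
   ultimately show ?thesis unfolding rel_def by blast
  qed
  thus "A : sets (FF j)" using A unfolding FF_def sets_inv_algebra by blast
 qed
 show "sm (FF k) (dd k)" if "k <= 2 * N" for k
  unfolding FF_def by (rule sm_inv_algebra[OF sm_dd]) (rule dd_inv[OF that])
 show "NI Om (%z. np p (dd k z)) < \<infinity>" if "0 < p" for k by (rule dd_Lp[OF that])
 fix k A and ph :: "'x => real"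
 assume k: "0 < k & k <= 2 * N" and A: "A : sets (FF (k - 1))" and ph: "bounded_linear ph"
 show "LI Om (%z. ind A z * ph (dd k z)) = 0"
 proof (cases "even k")
  case True
  then obtain j where j: "k = 2 * j" by (elim evenE)
  thus ?thesis using k A mean_zero_even[of j A ph] ph by auto
 next
  case False
  then obtain j where j: "k = 2 * j + 1" by (elim oddE)
  thus ?thesis using k A mean_zero_odd[of j A ph] ph by auto
 qed
qed

text \<open>Half the sum of the martingale and its transform is the Gaussian sum of the
  \<open>b i i\<close> (\<open>T\<close>), while the martingale alone adds up to that of the
  \<open>a i\<close> (\<open>S\<close>).\<close>

theorem stein:
 assumes U: "umd_const TYPE('x) p bt" and p: "1 < p" and io: "inj (io :: 'a \<times> (nat => complex) => nat => real)"
 shows "NI mu (%x. GE (np p) (map (%i. b i i x) [0..<N]))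
  <= (en (bt powr p) + 1) * NI mu (%x. GE (np p) (map (%i. a i x) [0..<N]))"
proof -
 let ?I = "NI Om (%z. np p (SUM k<=2 * N. dd k z))"
 define e where "e k = (if odd k then 1 else -1 :: real)" for k :: nat
 interpret Om: pair_prob_space mu gspace ..
 have S: "(SUM k<=2 * N. dd k z) = gsum (snd z) (map (%i. a i (fst z)) [0..<N])" for z
 proof -
  have "(SUM k<=2 * N. dd k z) = (SUM i<N. snd z i .* (SUM k<=2 * N. V k i (fst z)))"
   unfolding scl_sum_right by (subst sum.swap) (simp add: dd_def sum_eq_gsum)
  thus ?thesis by (simp add: sum_V sum_eq_gsum[symmetric])
 qed
 have T: "(SUM k<=2 * N. e k *R dd k z) + (SUM k<=2 * N. dd k z) = 2 *R gsum (snd z) (map (%i. b i i (fst z)) [0..<N])" for z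
 proof -
  have "(SUM k<=2 * N. e k *R dd k z) = (SUM i<N. snd z i .* (SUM k<=2 * N. e k *R V k i (fst z)))"
   unfolding scl_sum_right
   by (subst sum.swap) (simp add: dd_def sum_eq_gsum[symmetric] scaleR_sum_right scl_scaleR)
  also have "... = (SUM i<N. snd z i .* (2 *R b i i (fst z) - a i (fst z)))"
   unfolding e_def by (intro sum.cong refl arg_cong2[where f="scaleCJ J"] sum_V_sign) auto
  finally show ?thesis unfolding S sum_eq_gsum[symmetric]
   by (simp add: sum.distrib[symmetric] scl_diff_right scl_scaleR scaleR_sum_right)
 qed
 note [measurable] = sm_norm[OF sm_sum[OF sm_dd]] sm_norm[OF sm_sum[OF sm_scaleR[OF sm_const sm_dd]]]
 have "NI mu (%x. GE (np p) (map (%i. b i i x) [0..<N]))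
  = NI Om (%z. np p (gsum (snd z) (map (%i. b i i (fst z)) [0..<N])))"
  by (rule comb_nn[where f="%i. b i i", OF smb, symmetric]) auto
 also have "... <= NI Om (%z. np p (SUM k<=2 * N. e k *R dd k z) + np p (SUM k<=2 * N. dd k z))"
 proof (rule nn_integral_mono, goal_cases)
  case (1 z)
  let ?u = "SUM k<=2 * N. e k *R dd k z" and ?v = "SUM k<=2 * N. dd k z"
  let ?w = "gsum (snd z) (map (%i. b i i (fst z)) [0..<N])"
  have "2 * norm ?w <= norm ?u + norm ?v" using norm_triangle_ineq[of ?u ?v] unfolding T by simp
  hence "norm ?w <= max (norm ?u) (norm ?v)" by linarith
  hence "norm ?w powr p <= (max (norm ?u) (norm ?v)) powr p" using p by (intro powr_mono2) auto
  also have "... <= norm ?u powr p + norm ?v powr p" by (auto simp: max_def)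
  finally show ?case
   by (simp add: ennreal_plus[symmetric] ennreal_leI del: ennreal_plus)
 qed
 also have "... = NI Om (%z. np p (SUM k<=2 * N. e k *R dd k z)) + ?I"
  by (rule nn_integral_add) measurable
 also have "... <= en (bt powr p) * ?I + ?I"
  using p by (intro add_right_mono umd_transfer[OF U p io Om.prob_space_axioms mds_dd]) (auto simp: e_def)
 also have "... = (en (bt powr p) + 1) * ?I"
  by (simp add: distrib_right)
 also have "?I = NI mu (%x. GE (np p) (map (%i. a i x) [0..<N]))"
  unfolding S by (rule comb_nn[where f=a, OF sma])
 finally show ?thesis .
qed

end

section \<open>Truncated integral operators\<close>

context complex_banach
begin

text \<open>Bochner integration is unavailable in a nonseparable \<open>'x\<close>; the integral operators are limits of
 these finite rank operators instead.\<close>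
definition fr_limit :: "'a measure => (('a => complex) => 'x) => bool" where
 "fr_limit M T <-> (EX (V :: nat => 'x set) g. (ALL r. finite (V r)) & (ALL r v. sq_int M (g r v)) &
   (ALL h. sq_int M h --> (%r. SUM v:V r. (LI M (%z. h z * g r v z)) .* v) ~~> T h))"

text \<open>A finite rank operator depends on the parameter only through scalar integrals, and the
  limit keeps strong measurability.\<close>

lemma fr_limit_sm:
 fixes N :: "'b measure"
 assumes T: "fr_limit M T" and s: "sigma_finite_measure M"
  and u: "(%(x, z). u x z) : bm (N \<otimes> M)" and u1: "!!x. x : space N ==> sq_int M (u x)"
 shows "sm N (%x. T (u x))"
proof -
 interpret M: sigma_finite_measure M by fact
 obtain V and g :: "nat => 'x => 'a => complex" where V: "!!r. finite (V r)" "!!r v. sq_int M (g r v)"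
  "!!h. sq_int M h ==> (%r. SUM v:V r. (LI M (%z. h z * g r v z)) .* v) ~~> T h"
  using T unfolding fr_limit_def by blast
 note [measurable] = u
 have [measurable]: "g r v : bm M" for r v by (rule sq_int_measurable[OF V(2)])
 show ?thesis
 proof (rule sm_limit)
  show "sm N (%x. SUM v:V r. (LI M (%z. u x z * g r v z)) .* v)" for r
  proof (intro sm_sum sm_scl sm_const sm_of_borel)
   show "(%x. LI M (%z. u x z * g r v z)) : bm N" for v
    by (rule M.borel_measurable_lebesgue_integral) measurable
  qed
  show "(%r. SUM v:V r. (LI M (%z. u x z * g r v z)) .* v) ~~> T (u x)" if "x : space N" for x
   by (rule V(3)[OF u1[OF that]])
 qed
qed

lemma sq_int_indicator: "K : sets M ==> emeasure M K < \<infinity> ==> sq_int M (%z. ind K z)"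
proof -
 assume K: "K : sets M" "emeasure M K < \<infinity>"
 have "NI M (%z. nq (ind K z :: complex)) = NI M (%z. ind K z)"
  by (intro nn_integral_cong) (auto simp: indicator_def)
 thus ?thesis using K by (auto simp: sq_int_nn)
qed

lemma bounded_simple_approx:
 assumes F: "sm M F" and R: "R > 0"
 shows "EX s. (ALL r. simple_function M (s r)) & (ALL r z. norm (s r z) <= 2 * R) &
  (ALL z:space M. norm (F z) <= R --> (%r. s r z) ~~> F z)"
proof -
 obtain s where s: "!!i. simple_function M (s i)" "!!x. x : space M ==> (%i. s i x) ~~> F x"
  using F unfolding strongly_measurable_def by metis
 \<comment> \<open>Cutting at \<open>2 R\<close> rather than \<open>R\<close> retains, from some
   index on, the approximants of values of norm exactly \<open>R\<close>.\<close>
 define s' where "s' r z = (if norm (s r z) <= 2 * R then s r z else 0)" for r z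
 have "simple_function M (s' r)" for r
  unfolding s'_def[abs_def] by (rule simple_function_compose1[OF s(1)[of r], of "%v. if norm v <= 2 * R then v else 0"])
 moreover have "norm (s' r z) <= 2 * R" for r z using R by (simp add: s'_def)
 moreover have "(%r. s' r z) ~~> F z" if z: "z : space M" "norm (F z) <= R" for z
 proof -
  have "norm (F z) < 2 * R" using z R by simp
  hence "\<forall>\<^sub>F r in sequentially. norm (s r z) < 2 * R"
   using order_tendstoD(2)[OF tendsto_norm[OF s(2)[OF z(1)]]] by blast
  hence "\<forall>\<^sub>F r in sequentially. s r z = s' r z" by eventually_elim (simp add: s'_def)
  thus ?thesis using s(2)[OF z(1)] by (rule Lim_transform_eventually[rotated])
 qed
 ultimately show ?thesis by blast
qed

text \<open>The finite rank operators \<open>T' r\<close> integrate simple approximations of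
  \<open>F\<close>. On functionals of norm at most 1 two of them differ by at most
  \<open>de r h + de q h\<close>, which tends to 0 by dominated convergence; so
  \<open>T' r h\<close> is Cauchy in norm.\<close>

theorem integral_operator:
 assumes F: "sm M F" and K: "K : sets M" "emeasure M K < \<infinity>" and R: "!!z. z : K ==> norm (F z) <= R" "0 < R"
 shows "EX T. wrep M (%z. ind K z *R F z) T & bdl M T & fr_limit M T"
proof -
 obtain s where s: "!!r. simple_function M (s r)" "!!r z. norm (s r z) <= 2 * R"
  "!!z. z : space M ==> norm (F z) <= R ==> (%r. s r z) ~~> F z"
  using bounded_simple_approx[OF F R(2)] by blast
  let ?I = "%h ph. LI M (%z. h z * ph (ind K z *R F z))"
  let ?w = "%h r. %z. ind K z * cmod (h z) * norm (s r z - F z)"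
 note [measurable] = K(1) sm_borel[OF F]
 have KM: "z : space M" if "z : K" for z using K(1) that sets.sets_into_space by blast
 define g where "g r v z = (ind (K Int (s r -` {v} Int space M)) z :: complex)" for r v z
 define T' where "T' r h = (SUM v:s r ` space M. (LI M (%z. h z * g r v z)) .* v)" for r h
 have gs: "K Int (s r -` {v} Int space M) : sets M" for r v using simple_functionD(2)[OF s(1)[of r], of "{v}"] by auto
 have "emeasure M (K Int (s r -` {v} Int space M)) < \<infinity>" for r v
  using emeasure_mono[OF Int_lower1 K(1), of "s r -` {v} Int space M"] K(2) by (auto simp: less_top intro: le_less_trans)
 hence sg: "sq_int M (g r v)" for r v unfolding g_def by (intro sq_int_indicator gs)
 have fin: "finite (s r ` space M)" for r by (rule simple_functionD(1)[OF s(1)])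
 have iK: "integrable M (%z. ind K z * cmod (h z))" if h: "sq_int M h" for h
  using integrable_norm[OF sq_int_integrable_mult[OF sq_int_indicator[OF K] h]]
  by (rule Bochner_Integration.integrable_cong[THEN iffD1, rotated 2]) (auto simp: indicator_def)
 define de where "de r h = LI M (?w h r)" for r h
 have smd: "(%z. norm (s r z - F z)) : bm M" for r
  by (intro sm_norm sm_diff sm_simple s F)
 note [measurable] = smd
 have nd: "norm (s r z - F z) <= 3 * R" if "z : K" for r z
  using norm_triangle_ineq4[of "s r z" "F z"] s(2)[of r z] R(1)[OF that] by linarith
 have dei: "integrable M (?w h r)" if h: "sq_int M h" for r h
 proof (rule bint_bound[OF integrable_mult_left[OF iK[OF h], of "3 * R"]])
  note [measurable] = sq_int_measurable[OF h]
  show "(?w h r) : bm M" by measurable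
  show "AE z in M. norm (ind K z * cmod (h z) * norm (s r z - F z)) <= norm (ind K z * cmod (h z) * (3 * R))"
   using nd R(2) by (intro AE_I2) (auto simp: indicator_def intro!: mult_left_mono)
 qed
 have de0: "(%r. de r h) ~~> 0" if h: "sq_int M h" for h
 proof -
  note [measurable] = sq_int_measurable[OF h]
  have "(%r. LI M (?w h r)) ~~> (LI M (%z. 0))"
  proof (rule integral_dominated_convergence[where w="%z. ind K z * cmod (h z) * (3 * R)"])
   show "integrable M (%z. ind K z * cmod (h z) * (3 * R))" by (rule integrable_mult_left[OF iK[OF h]])
   show "AE z in M. (%r. ind K z * cmod (h z) * norm (s r z - F z)) ~~> 0"
   proof (rule AE_I2, goal_cases)
    case z: (1 z)
    show ?case
    proof (cases "z : K")
     case True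
     thus ?thesis using s(3)[OF z R(1)[OF True]]
      by (intro tendsto_mult_right_zero tendsto_norm_zero LIM_zero)
    qed simp
   qed
   show "AE z in M. norm (ind K z * cmod (h z) * norm (s r z - F z)) <= ind K z * cmod (h z) * (3 * R)" for r
    using nd R(2) by (intro AE_I2) (auto simp: indicator_def intro!: mult_left_mono)
  qed measurable
  thus ?thesis by (simp add: de_def)
 qed
 have phF: "integrable M (%z. h z * ph (ind K z *R G z))" if h: "sq_int M h" and ph: "cfunctional J ph"
   and G: "sm M G" "!!z. z : K ==> norm (G z) <= R'" "0 <= R'" for h ph G R'
 proof -
  note [measurable] = sq_int_measurable[OF h]
  obtain C where C: "!!v. cmod (ph v) <= norm v * C" "C >= 0" using bounded_linear.nonneg_bounded[OF cf_bounded_linear[OF ph]] by blast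
  have "sm M (%z. ind K z *R G z)"
   by (intro sm_scaleR[OF sm_of_borel G(1)]) measurable
  hence [measurable]: "(%z. ph (ind K z *R G z)) : bm M"
   by (rule cf_sm[OF ph])
  show ?thesis
  proof (rule bint_bound[OF integrable_mult_left[OF iK[OF h], of "R' * C"]])
   show "AE z in M. cmod (h z * ph (ind K z *R G z)) <= norm (ind K z * cmod (h z) * (R' * C))"
   proof (rule AE_I2, goal_cases)
    case (1 z)
    show ?case
    proof (cases "z : K")
     case True
     have "cmod (ph (G z)) <= R' * C" using C(1)[of "G z"] mult_right_mono[OF G(2)[OF True] C(2)] by linarith
     thus ?thesis using True G(3) C(2) by (simp add: norm_mult mult_left_mono)
    qed (simp add: cf_0[OF ph])
   qed
  qed measurable
 qed
 have phT': "ph (T' r h) = LI M (%z. h z * ph (ind K z *R s r z))" if h: "sq_int M h" and ph: "cfunctional J ph" for r h ph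
 proof -
  have "ph (T' r h) = (SUM v:s r ` space M. (LI M (%z. h z * g r v z)) * ph v)"
   unfolding T'_def by (simp add: linear_sum[OF cf_linear[OF ph]] cf_scl[OF ph])
  also have "... = LI M (%z. (SUM v:s r ` space M. h z * g r v z * ph v))"
   using sq_int_integrable_mult[OF h sg] by (subst Bochner_Integration.integral_sum) auto
  also have "... = LI M (%z. h z * ph (ind K z *R s r z))"
  proof (intro bint_cong, goal_cases)
   case z: (1 z)
   have "(SUM v:s r ` space M. h z * g r v z * ph v) = (SUM v:s r ` space M. if v = s r z then h z * ind K z * ph v else 0)"
    using z by (intro sum.cong refl) (auto simp: g_def indicator_def)
   also have "... = h z * ind K z * ph (s r z)" using z fin by simp
   finally show ?case
    by (auto simp: indicator_def cf_0[OF ph])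
  qed
  finally show ?thesis .
 qed
 have phdiff: "cmod (ph (T' r h) - (?I h ph)) <= de r h * C"
  if h: "sq_int M h" and ph: "cfunctional J ph" and C: "!!v. cmod (ph v) <= norm v * C" for r h ph C
 proof -
  have i1: "integrable M (%z. h z * ph (ind K z *R s r z))" using s(2) R(2) by (intro phF[OF h ph sm_simple[OF s(1)], of _ "2 * R"]) auto
  have i2: "integrable M (%z. h z * ph (ind K z *R F z))" using R by (intro phF[OF h ph F, of R]) auto
  have "cmod (ph (T' r h) - (?I h ph))
   = cmod (LI M (%z. h z * ph (ind K z *R s r z) - h z * ph (ind K z *R F z)))"
   unfolding phT'[OF h ph] using i1 i2 by simp
  also have "... <= LI M (%z. ind K z * cmod (h z) * norm (s r z - F z) * C)"
  proof (rule order_trans[OF Bochner_Integration.integral_norm_bound Bochner_Integration.integral_mono])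
   show "integrable M (%z. ind K z * cmod (h z) * norm (s r z - F z) * C)" by (intro integrable_mult_left dei h)
   fix z
   have "h z * ph (ind K z *R s r z) - h z * ph (ind K z *R F z) = h z * ph (ind K z *R (s r z - F z))"
    by (simp add: linear_diff[OF cf_linear[OF ph]] right_diff_distrib scaleR_diff_right)
   thus "cmod (h z * ph (ind K z *R s r z) - h z * ph (ind K z *R F z)) <= ind K z * cmod (h z) * norm (s r z - F z) * C"
    using mult_left_mono[OF C[of "s r z - F z"], of "cmod (h z)"]
    by (auto simp: norm_mult indicator_def cf_0[OF ph] mult.assoc)
  qed (intro integrable_norm Bochner_Integration.integrable_diff i1 i2)
  also have "... = de r h * C" unfolding de_def by simp
  finally show ?thesis .
 qed
 have denn: "0 <= de r h" for r h unfolding de_def by (intro integral_nonneg_AE) auto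
 have conv: "convergent (%r. T' r h)" if h: "sq_int M h" for h
 proof -
  have diff: "norm (T' r h - T' q h) <= de r h + de q h" for r q
  proof (rule norm_le_functionals)
   fix ph assume ph: "cfunctional J ph" and ph1: "!!v. cmod (ph v) <= norm v"
   have "ph (T' r h - T' q h) = (ph (T' r h) - (?I h ph)) - (ph (T' q h) - (?I h ph))"
    by (simp add: linear_diff[OF cf_linear[OF ph]])
   thus "cmod (ph (T' r h - T' q h)) <= de r h + de q h"
    using phdiff[OF h ph, of 1 r] phdiff[OF h ph, of 1 q] ph1
     norm_triangle_ineq4[of "ph (T' r h) - (?I h ph)" "ph (T' q h) - (?I h ph)"]
    by simp
  qed
  have "Cauchy (%r. T' r h)"
  proof (rule metric_CauchyI, goal_cases)
   case e: (1 e)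
   obtain n where n: "!!r. r >= n ==> de r h < e / 2"
    using order_tendstoD(2)[OF de0[OF h], of "e / 2"] e by (auto simp: eventually_sequentially)
   have "dist (T' r h) (T' q h) < e" if "r >= n" "q >= n" for r q
    using diff[of r q] n[OF that(1)] n[OF that(2)] unfolding dist_norm by linarith
   thus ?case by blast
  qed
  thus ?thesis by (rule Cauchy_convergent)
 qed
 define T where "T h = lim (%r. T' r h)" for h
 have lim: "(%r. T' r h) ~~> T h" if "sq_int M h" for h
  unfolding T_def using conv[OF that] by (simp add: convergent_LIMSEQ_iff)
 have w: "wrep M (%z. ind K z *R F z) T"
  unfolding wrep_def
 proof (intro allI impI conjI)
  fix ph assume ph: "cfunctional J ph"
  obtain C where C: "!!v. cmod (ph v) <= norm v * C" "C >= 0" using bounded_linear.nonneg_bounded[OF cf_bounded_linear[OF ph]] by blast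
  have m: "(%z. ph (ind K z *R F z)) : bm M"
  proof -
   have "sm M (%z. ind K z *R F z)"
    by (intro sm_scaleR[OF sm_of_borel F]) measurable
   thus ?thesis by (rule cf_sm[OF ph])
  qed
  have le: "cmod (ph (ind K z *R F z)) <= cmod (cor (R * C) * ind K z)" for z
  proof (cases "z : K")
   case True
   have "cmod (ph (F z)) <= R * C" using C(1)[of "F z"] mult_right_mono[OF R(1)[OF True] C(2)] by linarith
   thus ?thesis using True R(2) C(2) by (simp add: norm_mult)
  qed (simp add: cf_0[OF ph])
  show "sq_int M (%z. ph (ind K z *R F z))"
   using le by (intro sq_int_mono[OF sq_int_cmult[OF sq_int_indicator[OF K], of "cor (R * C)"] m, of 1]) simp
  fix h assume h: "sq_int M h"
  have "(%r. ph (T' r h)) ~~> ph (T h)"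
   by (rule bounded_linear.tendsto[OF cf_bounded_linear[OF ph] lim[OF h]])
  moreover have "(%r. ph (T' r h)) ~~> (?I h ph)"
  proof (rule LIM_zero_cancel, rule Lim_null_comparison)
   show "\<forall>\<^sub>F r in sequentially. cmod (ph (T' r h) - (?I h ph)) <= de r h * C"
    using phdiff[OF h ph C(1)] by simp
   show "(%r. de r h * C) ~~> 0" using tendsto_mult_left_zero[OF de0[OF h]] by simp
  qed
  ultimately show "ph (T h) = LI M (%z. h z * ph (ind K z *R F z))" by (rule LIMSEQ_unique)
 qed
 have "(norm (T h))^2 <= (R^2 * measure M K) * nsq M h" if h: "sq_int M h" for h
 proof -
  have "norm (T h) <= R * sqrt (measure M K * nsq M h)"
  proof (rule norm_le_functionals)
   fix ph assume ph: "cfunctional J ph" and ph1: "!!v. cmod (ph v) <= norm v"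
   have sF: "sq_int M (%z. cnj (ph (ind K z *R F z)))" using w ph by (auto simp: wrep_def intro: sq_int_cnj)
   have "ph (T h) = ip M h (%z. cnj (ph (ind K z *R F z)))" using w ph h by (simp add: wrep_def ip_def)
   hence "(cmod (ph (T h)))^2 <= nsq M h * nsq M (%z. cnj (ph (ind K z *R F z)))"
    using cauchy_schwarz[OF h sF] by simp
   also have "nsq M (%z. cnj (ph (ind K z *R F z))) <= nsq M (%z. cor R * ind K z)"
   proof (rule nsq_mono)
    show "sq_int M (%z. cor R * ind K z)" by (intro sq_int_cmult sq_int_indicator K)
    show "cmod (cnj (ph (ind K z *R F z))) <= cmod (cor R * ind K z)" if "z : space M" for z
     using order_trans[OF ph1 R(1)] R(2) by (auto simp: indicator_def norm_mult cf_0[OF ph])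
   qed (use sF in auto)
   also have "nsq M (%z. cor R * ind K z) = R^2 * measure M K"
   proof -
    have "(cmod (ind K z))^2 = ind K z" for z by (simp add: indicator_def)
    thus ?thesis using K unfolding nsq_cmult by (simp add: nsq_def)
   qed
   finally have "(cmod (ph (T h)))^2 <= nsq M h * (R^2 * measure M K)" by (simp add: mult_left_mono)
   hence "cmod (ph (T h)) <= sqrt (R^2 * (measure M K * nsq M h))" by (intro real_le_rsqrt) (simp add: ac_simps)
   thus "cmod (ph (T h)) <= R * sqrt (measure M K * nsq M h)" using R(2) by (simp add: real_sqrt_mult)
  qed
  hence "(norm (T h))^2 <= (R * sqrt (measure M K * nsq M h))^2" by (intro power_mono) auto
  thus ?thesis by (simp add: power_mult_distrib ac_simps)
 qed
 hence "bdl M T" unfolding bdl_def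
  by (intro conjI allI impI wrep_lin[OF w] exI[of _ "R^2 * measure M K"]) auto
 moreover have "fr_limit M T"
  unfolding fr_limit_def using fin sg lim
  by (intro exI[of _ "%r. s r ` space M"] exI[of _ g]) (simp add: T'_def)
 ultimately show ?thesis using w by blast
qed

end

section \<open>A Gaussian functional of weights\<close>

definition wt :: "'a measure => ('a => real) => bool" where
 "wt M w <-> w : bm M & (ALL z:space M. \<bar>w z\<bar> <= 1)"

lemma nsq_incseq:
 assumes [measurable]: "!!k. S k : sets M" and S: "incseq S" and h: "sq_int M h"
 shows "(%k. nsq M (%z. cor (ind (UN k. S k) z) * h z - cor (ind (S k) z) * h z)) ~~> 0"
proof -
 let ?d = "%k z. (cmod (cor (ind (UN k. S k) z) * h z - cor (ind (S k) z) * h z))^2"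
 note [measurable] = sq_int_measurable[OF h]
 have "(%k. LI M (?d k)) ~~> LI M (%z. 0)"
 proof (rule integral_dominated_convergence[where w="%z. (cmod (h z))^2"])
  show "integrable M (%z. (cmod (h z))^2)" using h by (simp add: sq_int_def)
  show "AE z in M. (%k. ?d k z) ~~> 0"
  proof (rule AE_I2, rule tendsto_eventually)
   fix z
   show "\<forall>\<^sub>F k in sequentially. ?d k z = 0"
   proof (cases "z : (UN k. S k)")
    case True
    then obtain k0 where "z : S k0" by blast
    hence "z : S k" if "k >= k0" for k using incseqD[OF S that] by blast
    thus ?thesis using True by (auto simp: eventually_sequentially intro!: exI[of _ k0])
   next
    case False
    hence "ind (UN k. S k) z = (0::real)" "ind (S k) z = (0::real)" for k by (auto simp: indicator_def)
    thus ?thesis by simp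
   qed
  qed
  show "AE z in M. norm (?d k z) <= (cmod (h z))^2" for k by (intro AE_I2) (auto simp: indicator_def)
 qed measurable
 thus ?thesis by (simp add: nsq_def)
qed

lemma wt_indicator[simp]: "S : sets M ==> wt M (ind S)"
 by (auto simp: wt_def indicator_def)

lemma wt_measurable[measurable_dest]: "wt M w ==> w : bm M"
 by (simp add: wt_def)

lemma sq_int_wt: "wt M w ==> sq_int M h ==> sq_int M (%z. cor (w z) * h z)"
 by (rule sq_int_times) (auto simp: wt_def)

context complex_banach
begin

lemma measurable_GN:
 assumes "!!i. i < n ==> sm N (f i)"
 shows "(%x. GN (map (%i. f i x) [0..<n])) : bm N"
proof -
 have "sm (N \<otimes> gspace) (%z. SUM i<n. snd z i .* f i (fst z))"
 proof (intro sm_sum sm_scl)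
  fix i assume "i : {..<n}"
  thus "sm (N \<otimes> gspace) (%z. f i (fst z))"
   by (intro sm_comp_measurable[OF assms measurable_fst]) auto
  show "sm (N \<otimes> gspace) (%z. snd z i)"
   by (intro sm_of_borel measurable_compose[OF measurable_snd measurable_gspace_component])
 qed
 note [measurable] = sm_norm[OF this]
 show ?thesis unfolding GN_eq sum_eq_gsum[symmetric]
  by (rule gs.borel_measurable_nn_integral[of "%x om. nq (SUM i<n. om i .* f i x)"])
   (simp add: split_beta')
qed

lemma bdl_mult:
 assumes T: "bdl M T" and w: "wt M w"
 shows "bdl M (%h. T (%z. cor (w z) * h z))"
proof -
 obtain C where C: "C >= 0" "!!f. sq_int M f ==> (norm (T f))^2 <= C * nsq M f" using T by (auto simp: bdl_def)
 have "(norm (T (%z. cor (w z) * h z)))^2 <= C * nsq M h" if "sq_int M h" for h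
 proof -
  have "(norm (T (%z. cor (w z) * h z)))^2 <= C * nsq M (%z. cor (w z) * h z)"
   by (intro C sq_int_wt w that)
  also have "... <= C * nsq M h"
   using C(1) that w sq_int_measurable[OF that] wt_measurable[OF w]
   by (intro mult_left_mono nsq_mono) (auto simp: norm_mult mult_left_le_one_le wt_def)
  finally show ?thesis .
 qed
 moreover have "T (%z. cor (w z) * (a * h z + b * k z)) = a .* T (%z. cor (w z) * h z) + b .* T (%z. cor (w z) * k z)"
  if "sq_int M h" "sq_int M k" for a b h k
  using bdl_lin[OF T sq_int_wt[OF w that(1)] sq_int_wt[OF w that(2)]] by (simp add: algebra_simps)
 ultimately show ?thesis unfolding bdl_def using C(1) by blast
qed

lemma wrep_eq:
 assumes "wrep M Ph T" "wrep M \<Psi> T'" "sq_int M f" "sq_int M g"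
  and "!!z ph. z : space M ==> cfunctional J ph ==> f z * ph (Ph z) = g z * ph (\<Psi> z)"
 shows "T f = T' g"
proof (rule eq_functionals, goal_cases)
 case ph: (1 ph)
 have "ph (T f) = LI M (%z. f z * ph (Ph z))" using assms(1,3) ph by (simp add: wrep_def)
 also have "... = LI M (%z. g z * ph (\<Psi> z))" by (intro bint_cong assms(5) ph)
 also have "... = ph (T' g)" using assms(2,4) ph by (simp add: wrep_def)
 finally show ?case .
qed

end

text \<open>\<open>F\<close> is not assumed to be weakly square integrable: only its restrictions to
  the sets \<open>K m\<close> come with operators \<open>T m\<close>, and \<open>F\<close> is
  studied through these.\<close>

locale nfun = complex_banach J for J :: "'x::banach => 'x" +
 fixes M :: "'a measure" and e :: "nat => 'a => complex" and F :: "'a => 'x" and K :: "nat => 'a set" and T :: "nat => ('a => complex) => 'x"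
 assumes onb: "onb M e" and smF: "sm M F"
  and K: "!!m. K m : sets M" "incseq K" "(UN m. K m) = space M"
  and wrepT: "!!m. wrep M (%z. ind (K m) z *R F z) (T m)" and bdlT: "!!m. bdl M (T m)"
begin

definition Tw :: "nat => ('a => real) => ('a => complex) => 'x" where
 "Tw m w h = T m (%z. cor (w z) * h z)"

definition Qm :: "nat => ('a => real) => ennreal" where "Qm m w = (SUP n. GN (map (Tw m w) (map e [0..<n])))"

text \<open>Comparable to the squared gamma norm of \<open>w F\<close> by \<open>Q_le_gamma\<close>
  and, in UMD spaces, \<open>gamma_le_Q\<close>. Being a supremum of finite Gaussian sums it is
  monotone without loss of a constant and continuous along increasing sets.\<close>

definition Q :: "('a => real) => ennreal" where "Q w = (SUP m. Qm m w)"

lemma bdl_Tw: "wt M w ==> bdl M (Tw m w)"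
 unfolding Tw_def[abs_def] by (rule bdl_mult[OF bdlT])

lemma Qm_bessel: "wt M w ==> bessel M fs ==> GN (map (Tw m w) fs) <= Qm m w"
 unfolding Qm_def by (rule GN_bessel_frame[OF bdl_Tw _ onb_frame[OF onb]])

lemma Qm_le_frame: "wt M w ==> frame M Ls ==> Qm m w <= (SUP n. GN (map (Tw m w) (Ls n)))"
 unfolding Qm_def by (intro SUP_least GN_bessel_frame[OF bdl_Tw onb_bessel[OF onb]])

lemma Qm_ge: "GN (map (Tw m w) (map e [0..<n])) <= Qm m w"
 unfolding Qm_def by (rule SUP_upper) simp

lemma T_cong: "sq_int M f ==> sq_int M g ==> (!!z. z : space M ==> f z = g z) ==> T m f = T m g"
 by (rule wrep_eq[OF wrepT wrepT]) auto

lemma sq_int_we: "wt M w ==> sq_int M (%z. cor (w z) * e j z)"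
 by (intro sq_int_wt onb_sq_int[OF onb])

text \<open>Multiplying the basis by \<open>r\<close> gives a Bessel family, so no constant is lost.
  \<open>Qm_mono\<close> takes for \<open>r\<close> the quotient of the two weights.\<close>

lemma Qm_bessel_mult:
 assumes w: "wt M w" "wt M r" and u: "wt M u" "!!z. z : space M ==> u z = w z * r z"
 shows "Qm m u <= Qm m w"
 unfolding Qm_def[of m u]
proof (rule SUP_least, goal_cases)
 case (1 n)
 have "map (Tw m u) (map e [0..<n]) = map (Tw m w) (map (%f z. cor (r z) * f z) (map e [0..<n]))"
 proof -
  have "Tw m u (e j) = Tw m w (%z. cor (r z) * e j z)" for j
   unfolding Tw_def by (rule T_cong) (auto simp: u sq_int_we sq_int_wt w)
  thus ?thesis by simp
 qed
 also have "GN ... <= Qm m w"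
  using w(2) by (intro Qm_bessel[OF w(1)] bessel_mult onb_bessel onb) (auto simp: wt_def)
 finally show ?case .
qed

lemma Qm_mono:
 assumes w: "wt M w" "wt M u" and le: "!!z. z : space M ==> \<bar>u z\<bar> <= \<bar>w z\<bar>"
 shows "Qm m u <= Qm m w"
proof (rule Qm_bessel_mult[OF w(1) _ w(2)])
 show "wt M (%z. u z / w z)" using w le by (auto simp: wt_def divide_le_eq_1 abs_divide)
 fix z assume "z : space M"
 thus "u z = w z * (u z / w z)" using le by (cases "w z = 0") force+
qed

lemma Q_mono: "wt M w ==> wt M u ==> (!!z. z : space M ==> \<bar>u z\<bar> <= \<bar>w z\<bar>) ==> Q u <= Q w"
 unfolding Q_def by (intro SUP_mono' Qm_mono)

lemma T_level:
 assumes "m <= m'" "sq_int M h"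
 shows "T m h = T m' (%z. cor (ind (K m) z) * h z)"
proof (rule wrep_eq[OF wrepT wrepT assms(2) sq_int_wt[OF wt_indicator[OF K(1)] assms(2)]], goal_cases)
 case ph: (1 z ph)
 show ?case
  using incseqD[OF K(2) assms(1)] by (auto simp: indicator_def cf_0[OF ph(2)])
qed

lemma Qm_level: "m <= m' ==> wt M w ==> Qm m w <= Qm m' w"
 unfolding Qm_def[of m w]
proof (rule SUP_least)
 fix n assume m: "m <= m'" and w: "wt M w"
 have "Tw m w (e j) = Tw m' w (%z. cor (ind (K m) z) * e j z)" for j
  unfolding Tw_def by (subst T_level[OF m sq_int_we[OF w]]) (simp add: ac_simps)
 hence "map (Tw m w) (map e [0..<n]) = map (Tw m' w) (map (%f z. cor (ind (K m) z) * f z) (map e [0..<n]))" by simp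
 also have "GN ... <= Qm m' w"
  using K(1) by (intro Qm_bessel[OF w] bessel_mult onb_bessel onb) (auto simp: indicator_def)
 finally show "GN (map (Tw m w) (map e [0..<n])) <= Qm m' w" .
qed

lemma Q_set_mono: "S <= S' ==> S : sets M ==> S' : sets M ==> Q (ind S) <= Q (ind S')"
 by (rule Q_mono) (auto simp: indicator_def)

text \<open>Each finite sum is lower semicontinuous (\<open>GN_lsc\<close>), and the basis functions
  cut to \<open>S k\<close> converge in square mean.\<close>

lemma Q_continuous:
 assumes S: "!!k. S k : sets M" "incseq S"
 shows "Q (ind (UN k. S k)) <= (SUP k. Q (ind (S k)))"
 unfolding Q_def[of "ind (UN k. S k)"] Qm_def[of _ "ind (UN k. S k)"]
proof (intro SUP_least, goal_cases)
 case (1 m n)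
 let ?U = "UN k. S k"
 have U: "?U : sets M" using S(1) by auto
 have "(%k. Tw m (ind (S k)) (e j)) ~~> Tw m (ind ?U) (e j)" for j
  unfolding Tw_def
  by (rule bdl_tendsto[OF bdlT sq_int_we[OF wt_indicator[OF U]] sq_int_we[OF wt_indicator[OF S(1)]] nsq_incseq[OF S onb_sq_int[OF onb]]])
 hence "GN (map (Tw m (ind ?U)) (map e [0..<n])) <= liminf (%k. GN (map (%j. Tw m (ind (S k)) (e j)) [0..<n]))"
  by (intro GN_lsc) auto
 also have "... <= (SUP k. Q (ind (S k)))"
 proof (intro Liminf_le[of sequentially] always_eventually allI)
  fix k
  have "GN (map (%j. Tw m (ind (S k)) (e j)) [0..<n]) <= Qm m (ind (S k))"
   using Qm_ge[of m "ind (S k)" n] by (simp add: comp_def)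
  also have "... <= Q (ind (S k))" unfolding Q_def by (rule SUP_upper) simp
  also have "... <= (SUP k. Q (ind (S k)))" by (rule SUP_upper) simp
  finally show "GN (map (%j. Tw m (ind (S k)) (e j)) [0..<n]) <= (SUP k. Q (ind (S k)))" .
 qed simp
 finally show ?case .
qed

lemma measurable_Qm:
 fixes N :: "'b measure"
 assumes fr: "fr_limit M (T m)" and s: "sigma_finite_measure M"
  and w: "(%(x, z). w x z) : bm (N \<otimes> M)" "!!x. x : space N ==> wt M (w x)"
 shows "(%x. Qm m (w x)) : bm N"
proof -
 have "sm N (%x. Tw m (w x) (e j))" for j
  unfolding Tw_def
 proof (rule fr_limit_sm[OF fr s])
  note [measurable] = w(1) sq_int_measurable[OF onb_sq_int[OF onb]]
  show "(%(x, z). cor (w x z) * e j z) : bm (N \<otimes> M)" by measurable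
 qed (rule sq_int_we[OF w(2)])
 from measurable_GN[OF this] show ?thesis unfolding Qm_def by (simp add: comp_def)
qed

lemma Q_le_gamma:
 assumes w: "wt M w"
 shows "Q w <= 2 * epowr (gamma_fun J M (%z. w z *R F z)) 2"
proof (cases "gamma_fun J M (%z. w z *R F z) < \<infinity>")
 case True
 let ?Ph = "%z. w z *R F z"
 obtain S e' where S: "wrep M ?Ph S" "bdl M S" and e': "onb M e'"
  and B: "!!n. GN (map S (map e' [0..<n])) <= 2 * epowr (gamma_fun J M ?Ph) 2"
  using gamma_fun_lower[OF True] by blast
 have "GN (map (Tw m w) (map e [0..<n])) <= 2 * epowr (gamma_fun J M ?Ph) 2" for m n
 proof -
  have "Tw m w (e j) = S (%z. cor (ind (K m) z) * e j z)" for j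
   unfolding Tw_def
  proof (rule wrep_eq[OF wrepT S(1) sq_int_we[OF w] sq_int_wt[OF wt_indicator[OF K(1)] onb_sq_int[OF onb]]], goal_cases)
   case ph: (1 z ph)
   show ?case
    by (simp add: linear_scale[OF cf_linear[OF ph(2)]] scaleR_conv_of_real)
  qed
  hence "map (Tw m w) (map e [0..<n]) = map S (map (%f z. cor (ind (K m) z) * f z) (map e [0..<n]))" by simp
  also have "GN ... <= (SUP n. GN (map S (map e' [0..<n])))"
   using K(1) by (intro GN_bessel_frame[OF S(2) _ onb_frame[OF e']] bessel_mult onb_bessel onb) (auto simp: indicator_def)
  also have "... <= 2 * epowr (gamma_fun J M ?Ph) 2" by (intro SUP_least B)
  finally show ?thesis .
 qed
 thus ?thesis unfolding Q_def Qm_def by (intro SUP_least)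
qed (auto simp: less_top[symmetric] ennreal_mult_eq_top_iff epowr_top)

text \<open>A single normalised function is a Bessel family, so \<open>Q\<close> controls the
  operator norm uniformly in \<open>m\<close>. Normalising by \<open>nsq M g + ep\<close> avoids
  division by 0.\<close>

lemma Tw_bound:
 assumes w: "wt M w" and Q: "Q w < \<infinity>" and g: "sq_int M g"
 shows "(norm (Tw m w g))^2 <= enn2real (Q w) / enn2real gauss_m2 * nsq M g"
proof -
 define q where "q = enn2real (Q w)"
 define m2 where "m2 = enn2real gauss_m2"
 have m2: "gauss_m2 = en m2" "m2 > 0"
  using gauss_m2_finite gauss_m2_pos by (auto simp: m2_def enn2real_positive_iff)
 have q: "Q w = en q" "0 <= q" using Q by (auto simp: q_def)
 have *: "(norm (Tw m w g))^2 * m2 <= q * (nsq M g + ep)" if ep: "ep > 0" for ep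
 proof -
  define s where "s = sqrt (nsq M g + ep)"
  have s: "s > 0" "s^2 = nsq M g + ep" using ep nsq_nonneg[of M g] by (auto simp: s_def add_nonneg_pos)
  define u where "u = cor (1 / s)"
  have u: "cmod u = 1 / s" using s by (simp add: u_def norm_divide)
  let ?f = "%z. u * g z"
  have b: "bessel M [?f]"
  proof -
   have "nsq M ?f <= 1" unfolding nsq_cmult u using s ep nsq_nonneg[of M g] add_nonneg_pos[OF nsq_nonneg[of M g] ep]
     by (simp add: power_divide norm_divide divide_le_eq_1)
   hence "nsq M (%z. c * ?f z) <= (cmod c)^2" for c
    using mult_left_mono[of "nsq M ?f" 1 "(cmod c)^2"] by (simp only: nsq_cmult[of M c] mult_1_right zero_le_power2 refl)
   thus ?thesis unfolding bessel_def using sq_int_cmult[OF g] by simp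
  qed
  have "Tw m w ?f = u .* Tw m w g"
   using bdl_sum[OF bdl_Tw[OF w], of "{0::nat}" "%_. g" m "%_. u"] g by simp
  hence "en ((norm (Tw m w g) / s)^2) * gauss_m2 = GN (map (Tw m w) [?f])"
   using s by (simp add: GN_single norm_scl u)
  also have "... <= Qm m w" by (rule Qm_bessel[OF w b])
  also have "... <= en q" unfolding q(1)[symmetric] Q_def by (rule SUP_upper) simp
  finally have "en ((norm (Tw m w g) / s)^2 * m2) <= en q"
   unfolding m2(1) using m2(2) by (subst ennreal_mult) auto
  hence "(norm (Tw m w g) / s)^2 * m2 <= q" using q(2) by simp
  hence "(norm (Tw m w g))^2 / s^2 * m2 <= q" by (simp add: power_divide)
  thus ?thesis unfolding s(2)[symmetric] using s(1) by (simp add: field_simps)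
 qed
 have "(norm (Tw m w g))^2 * m2 <= q * nsq M g"
 proof (rule field_le_epsilon, goal_cases)
  case d: (1 d)
  have "(norm (Tw m w g))^2 * m2 <= q * (nsq M g + d / (q + 1))" using d q(2) by (intro *) simp
  also have "... <= q * nsq M g + d" using d q(2) by (simp add: field_simps)
  finally show ?case .
 qed
 thus ?thesis unfolding q_def[symmetric] m2_def[symmetric] using m2 by (simp add: field_simps)
qed

text \<open>The operators \<open>Tw m w\<close> are uniformly bounded by \<open>Tw_bound\<close> and
  differ only through the part of \<open>h\<close> outside \<open>K m\<close>, so they converge to
  an operator \<open>S\<close>. It represents \<open>w F\<close> and inherits the bound on finite
  sums; its Gaussian series converges by \<open>GN_bounded_gcauchy\<close>.\<close>

theorem gamma_le_Q:
 assumes U: "UMD TYPE('x)" and w: "wt M w"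
 shows "epowr (gamma_fun J M (%z. w z *R F z)) 2 <= 2 * Q w"
proof (cases "Q w < \<infinity>")
 let ?f = "%z ph. cor (w z) * ph (F z)"
 case True
 define A where "A = enn2real (Q w) / enn2real gauss_m2"
 have A0: "0 <= A" by (simp add: A_def)
 note bd = Tw_bound[OF w True, folded A_def]
 note [measurable] = wt_measurable[OF w]
 have wz: "\<bar>w z\<bar> <= 1" if "z : space M" for z using w that by (simp add: wt_def)
 have inK: "\<forall>\<^sub>F m in sequentially. z : K m" if z: "z : space M" for z
 proof -
  obtain m0 where "z : K m0" using z K(3) by blast
  hence "z : K m" if "m >= m0" for m using incseqD[OF K(2) that] by blast
  thus ?thesis by (auto simp: eventually_sequentially)
 qed
 have lv: "Tw m w h = Tw m' w (%z. cor (ind (K m) z) * h z)" if "m <= m'" "sq_int M h" for m m' h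
  unfolding Tw_def by (subst T_level[OF that(1) sq_int_wt[OF w that(2)]]) (simp add: ac_simps)
 have sK: "sq_int M (%z. cor (ind (K m) z) * h z)" if "sq_int M h" for m h
  by (rule sq_int_wt[OF wt_indicator[OF K(1)] that])
 define rh where "rh m h = nsq M (%z. h z - cor (ind (K m) z) * h z)" for m h
 have rh0: "(%m. rh m h) ~~> 0" if h: "sq_int M h" for h
 proof -
  have "nsq M (%z. cor (ind (space M) z) * h z - cor (ind (K m) z) * h z) = rh m h" for m
   unfolding rh_def nsq_def by (intro bint_cong) simp
  thus ?thesis using nsq_incseq[OF K(1,2) h] by (simp add: K(3))
 qed
 have diff: "(norm (Tw m' w h - Tw m w h))^2 <= A * rh m h" if m: "m <= m'" and h: "sq_int M h" for m m' h
 proof -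
  have "Tw m' w h - Tw m w h = Tw m' w (%z. h z - cor (ind (K m) z) * h z)"
   unfolding lv[OF m h] by (rule bdl_diff[OF bdl_Tw[OF w] h sK[OF h], symmetric])
  thus ?thesis unfolding rh_def by (simp add: bd[OF sq_int_diff[OF h sK[OF h]]])
 qed
 define S where "S h = lim (%m. Tw m w h)" for h
 have lim: "(%m. Tw m w h) ~~> S h" if h: "sq_int M h" for h
 proof -
  have "Cauchy (%m. Tw m w h)"
  proof (rule metric_CauchyI, goal_cases)
   case d: (1 d)
   have "(%m. A * rh m h) ~~> 0" using tendsto_mult_right_zero[OF rh0[OF h]] by simp
   then obtain n where n: "!!m. m >= n ==> A * rh m h < (d/2)^2"
    using order_tendstoD(2)[of _ 0 sequentially "(d/2)^2"] d by (auto simp: eventually_sequentially)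
   have *: "dist (Tw m w h) (Tw n w h) < d / 2" if "m >= n" for m
   proof -
    have "(dist (Tw m w h) (Tw n w h))^2 < (d/2)^2" unfolding dist_norm using diff[OF that h] n[of n] by simp
    thus ?thesis by (rule power2_less_imp_less) (use d in simp)
   qed
   have "dist (Tw m w h) (Tw m' w h) < d" if "m >= n" "m' >= n" for m m'
    using *[OF that(1)] *[OF that(2)] dist_triangle2[of "Tw m w h" "Tw m' w h" "Tw n w h"] by linarith
   thus ?case by blast
  qed
  thus ?thesis unfolding S_def using Cauchy_convergent convergent_LIMSEQ_iff by blast
 qed
 have wr: "wrep M (%z. w z *R F z) S"
  unfolding wrep_def
 proof (intro allI impI conjI)
  fix ph assume ph: "cfunctional J ph"
  obtain C where C: "!!v. cmod (ph v) <= norm v * C" "C >= 0" using bounded_linear.nonneg_bounded[OF cf_bounded_linear[OF ph]] by blast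
  have l: "ph (r *R F z) = cor r * ph (F z)" for r z
   by (simp add: linear_scale[OF cf_linear[OF ph]] scaleR_conv_of_real)
  have [measurable]: "(%z. ph (F z)) : bm M"
   by (rule cf_sm[OF ph smF])
  note [measurable] = K(1)
  define f where "f m z = cor (ind (K m) z) * (?f z ph)" for m z
  have sf: "sq_int M (f m)" for m
  proof -
   have "sq_int M (%z. ph (ind (K m) z *R F z))" using wrepT[of m] ph by (simp add: wrep_def)
   from sq_int_wt[OF w this] show ?thesis by (simp add: f_def[abs_def] l ac_simps)
  qed
  have rT: "ph (Tw m w h) = LI M (%z. h z * f m z)" if "sq_int M h" for h m
  proof -
   have "ph (Tw m w h) = LI M (%z. cor (w z) * h z * ph (ind (K m) z *R F z))"
    unfolding Tw_def using wrepT[of m] ph sq_int_wt[OF w that] unfolding wrep_def by blast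
   also have "... = LI M (%z. h z * f m z)" by (simp add: l f_def ac_simps)
   finally show ?thesis .
  qed
  \<comment> \<open>Testing the operator on the conjugate of its own scalar kernel bounds the square
    of \<open>nsq M (f m)\<close> by a multiple of \<open>nsq M (f m)\<close>. The resulting bound
    is uniform in \<open>m\<close>, and Fatou's lemma transfers it to the limit.\<close>
  have If: "nsq M (f m) <= C^2 * A" for m
  proof -
   have "ph (Tw m w (%z. cnj (f m z))) = cor (nsq M (f m))"
    unfolding rT[OF sq_int_cnj[OF sf]] ip_self[symmetric] ip_def by (simp add: mult.commute)
   hence "nsq M (f m) = cmod (ph (Tw m w (%z. cnj (f m z))))" by simp
   also have "... <= norm (Tw m w (%z. cnj (f m z))) * C" by (rule C(1))
   finally have "(nsq M (f m))^2 <= (norm (Tw m w (%z. cnj (f m z))) * C)^2" by (intro power_mono) auto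
   also have "... = (norm (Tw m w (%z. cnj (f m z))))^2 * C^2" by (simp add: power_mult_distrib)
   also have "... <= (A * nsq M (%z. cnj (f m z))) * C^2" by (intro mult_right_mono bd sq_int_cnj sf) auto
   also have "nsq M (%z. cnj (f m z)) = nsq M (f m)" by (simp add: nsq_def)
   finally have *: "nsq M (f m) * nsq M (f m) <= nsq M (f m) * (C^2 * A)" by (simp add: power2_eq_square ac_simps)
   show ?thesis
   proof (cases "nsq M (f m) = 0")
    case False
    thus ?thesis using * nsq_nonneg[of M "f m"] by (simp add: mult_le_cancel_left)
   qed (simp add: A0)
  qed
  have tof: "(%m. f m z) ~~> cor (w z) * ph (F z)" if "z : space M" for z
  proof (rule tendsto_eventually)
   show "\<forall>\<^sub>F m in sequentially. f m z = cor (w z) * ph (F z)"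
    using inK[OF that] by eventually_elim (simp add: f_def)
  qed
  have swF: "sq_int M (%z. cor (w z) * ph (F z))"
   unfolding sq_int_nn
  proof
   have "NI M (%z. nq (?f z ph)) = NI M (%z. liminf (%m. nq (f m z)))"
   proof (rule nn_integral_cong, goal_cases)
    case (1 z)
    hence "(%m. nq (f m z)) ~~> nq (?f z ph)"
     by (intro tendsto_intros tof)
    thus ?case
     using lim_imp_Liminf[OF sequentially_bot] by metis
   qed
   also have "... <= liminf (%m. NI M (%z. nq (f m z)))"
    unfolding f_def by (rule nn_integral_liminf) measurable
   also have "... = liminf (%m. en (nsq M (f m)))" by (simp add: nsq_ennreal[OF sf])
   also have "... <= en (C^2 * A)" by (rule Liminf_le[of sequentially]) (simp_all add: If ennreal_leI)
   finally show "NI M (%z. nq (?f z ph)) < \<infinity>"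
    by (simp add: le_less_trans)
  qed measurable
  show "sq_int M (%z. ph (w z *R F z))" unfolding l by (rule swF)
  fix h assume h: "sq_int M h"
  note [measurable] = sq_int_measurable[OF h]
  have "(%m. ph (Tw m w h)) ~~> ph (S h)"
   by (rule bounded_linear.tendsto[OF cf_bounded_linear[OF ph] lim[OF h]])
  moreover have "(%m. LI M (%z. h z * f m z)) ~~> (LI M (%z. h z * (?f z ph)))"
  proof (rule integral_dominated_convergence[where w="%z. cmod (h z * (?f z ph))"])
   show "integrable M (%z. cmod (h z * (?f z ph)))"
    by (intro integrable_norm sq_int_integrable_mult h swF)
   show "AE z in M. (%m. h z * f m z) ~~> h z * (?f z ph)"
    by (intro AE_I2 tendsto_intros tof)
   show "AE z in M. cmod (h z * f m z) <= cmod (h z * (?f z ph))" for m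
    by (intro AE_I2) (auto simp: f_def indicator_def norm_mult)
  qed (auto simp: f_def)
  ultimately show "ph (S h) = LI M (%z. h z * ph (w z *R F z))"
   unfolding l rT[OF h] by (rule LIMSEQ_unique)
 qed
 have bS: "bdl M S"
  unfolding bdl_def
 proof (intro conjI allI impI wrep_lin[OF wr] exI[of _ A] A0)
  fix h assume h: "sq_int M h"
  show "(norm (S h))^2 <= A * nsq M h"
   by (rule LIMSEQ_le_const2[OF tendsto_power[OF tendsto_norm[OF lim[OF h]]]]) (use bd[OF h] in blast)
 qed
 have GS: "GN (map (%j. S (e j)) [0..<n]) <= Q w" for n
 proof -
  have "GN (map (%j. S (e j)) [0..<n]) <= liminf (%m. GN (map (%j. Tw m w (e j)) [0..<n]))"
   by (intro GN_lsc) (auto intro: lim onb_sq_int onb)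
  also have "... <= Q w"
  proof (intro Liminf_le[of sequentially] always_eventually allI)
   fix m
   have "GN (map (%j. Tw m w (e j)) [0..<n]) <= Qm m w" using Qm_ge[of m w n] by (simp add: comp_def)
   also have "... <= Q w" unfolding Q_def by (rule SUP_upper) simp
   finally show "GN (map (%j. Tw m w (e j)) [0..<n]) <= Q w" .
  qed simp
  finally show ?thesis .
 qed
 have "sm M (%z. w z *R F z)" by (intro sm_scaleR smF sm_of_borel) measurable
 hence "epowr (gamma_fun J M (%z. w z *R F z)) 2 <= 2 * (SUP n. GN (map S (map e [0..<n])))"
  by (intro gamma_fun_upper wr bS onb GN_bounded_gcauchy[OF U GS True])
 also have "(SUP n. GN (map S (map e [0..<n]))) <= Q w"
  using GS by (intro SUP_least) (simp add: comp_def)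
 finally show ?thesis by (simp add: mult_left_mono)
qed (simp add: less_top[symmetric] ennreal_mult_eq_top_iff)

end

section \<open>Conical functionals on the half space\<close>

definition box_uhs :: "nat => ('n::finite) uhs set" where
 "box_uhs m = {z. norm (fst z) <= real m & 1 / (real m + 1) <= snd z & snd z <= real m}"

text \<open>On these sets the measure is finite and \<open>F\<close> is bounded, as
  \<open>integral_operator\<close> asks, and they exhaust the half space.\<close>

definition KF :: "(('n::finite) uhs => 'x::real_normed_vector) => nat => ('n::finite) uhs set" where
 "KF F m = {z : box_uhs m. norm (F z) <= real m}"

lemma box_uhs_pos: "z : box_uhs m ==> 0 < snd z"
proof -
 assume "z : box_uhs m"
 hence "1 / (real m + 1) <= snd z" by (simp add: box_uhs_def)
 moreover have "0 < 1 / (real m + 1)" by simp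
 ultimately show ?thesis by linarith
qed

lemma borel_sets_uhs: "S : sets borel ==> S <= {z. snd z > 0} ==> S : sets (uhs :: ('n::finite) uhs measure)"
proof -
 assume S: "S : sets borel" "S <= {z. snd z > 0}"
 have "open {z :: 'n uhs. 0 < snd z}" by (intro open_Collect_less continuous_intros)
 thus ?thesis using S unfolding sets_uhs by (subst sets_restrict_space_iff) auto
qed

lemma borel_fst_snd[measurable]: "(fst :: ('n::finite) uhs => real ^ 'n) : bm borel"
 "(snd :: ('n::finite) uhs => real) : bm borel"
 by (intro bm_cont)+

lemma compact_box_uhs: "compact (box_uhs m :: ('n::finite) uhs set)"
proof -
 have "box_uhs m = cball (0 :: real ^ 'n) (real m) \<times> {1 / (real m + 1)..real m}" by (auto simp: box_uhs_def)
 thus ?thesis by (simp add: compact_Times)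
qed

lemma box_sets[measurable]: "(box_uhs m :: ('n::finite) uhs set) : sets uhs"
 using box_uhs_pos by (intro borel_sets_uhs borel_compact compact_box_uhs) auto

lemma nn_integral_uhs:
 fixes f :: "('n::finite) uhs => ennreal"
 assumes [measurable]: "f : bm uhs"
 shows "NI uhs (%z. f z) = (LN z. en (1 / snd z ^ (CARD('n) + 1)) * f z * ind {z. snd z > 0} z)"
proof -
 have m: "f : bm uhs_base" using assms by (simp add: uhs_def)
 have [measurable]: "(%z. en (1 / snd z ^ (CARD('n) + 1))) : bm (uhs_base :: 'n uhs measure)"
  unfolding uhs_base_def by (rule measurable_restrict_space1) measurable
 have "NI uhs (%z. f z) = NI uhs_base (%z. en (1 / snd z ^ (CARD('n) + 1)) * f z)"
  unfolding uhs_def by (rule nn_integral_density) (use m in measurable)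
 also have "... = (LN z. en (1 / snd z ^ (CARD('n) + 1)) * f z * ind {z. snd z > 0} z)"
  unfolding uhs_base_def by (rule nn_integral_restrict_space) simp
 finally show ?thesis .
qed

lemma emeasure_box: "emeasure uhs (box_uhs m :: ('n::finite) uhs set) < \<infinity>"
proof -
 have "emeasure uhs (box_uhs m :: 'n uhs set) = NI (uhs :: 'n uhs measure) (%z. ind (box_uhs m) z)" by simp
 also have "... = (LN z. en (1 / snd z ^ (CARD('n) + 1)) * ind (box_uhs m :: 'n uhs set) z * ind {z. snd z > 0} z)"
  by (rule nn_integral_uhs) measurable
 also have "... <= (LN z. en ((real m + 1) ^ (CARD('n) + 1)) * ind (box_uhs m :: 'n uhs set) z)"
 proof (rule nn_integral_mono)
  fix z :: "'n uhs"
  have "1 / snd z ^ (CARD('n) + 1) <= (real m + 1) ^ (CARD('n) + 1)" if z: "z : box_uhs m"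
  proof -
   have "1 / snd z <= real m + 1" using z box_uhs_pos[OF z] by (simp add: box_uhs_def field_simps)
   hence "(1 / snd z) ^ (CARD('n) + 1) <= (real m + 1) ^ (CARD('n) + 1)"
    using box_uhs_pos[OF z] by (intro power_mono) auto
   thus ?thesis by (simp add: power_one_over del: power_Suc)
  qed
  thus "en (1 / snd z ^ (CARD('n) + 1)) * ind (box_uhs m) z * ind {z. snd z > 0} z
   <= en ((real m + 1) ^ (CARD('n) + 1)) * ind (box_uhs m) z"
   by (auto simp: indicator_def ennreal_leI simp del: power_Suc)
 qed
 also have "... = en ((real m + 1) ^ (CARD('n) + 1)) * emeasure lborel (box_uhs m :: 'n uhs set)"
  using borel_compact[OF compact_box_uhs[of m]] by (subst nn_integral_cmult_indicator) auto
 also have "... < \<infinity>"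
  using emeasure_bounded_finite[OF compact_imp_bounded[OF compact_box_uhs[of m]]] by (auto simp: ennreal_mult_less_top)
 finally show ?thesis .
qed

lemma box_uhs_cover: "z : space uhs ==> EX m0. ALL m>=m0. z : (box_uhs m :: ('n::finite) uhs set)"
proof -
 assume "z : space uhs"
 hence t: "snd z > 0" by simp
 obtain m0 where m0: "max (norm (fst z)) (max (snd z) (1 / snd z)) < real m0" using reals_Archimedean2 by blast
 have "z : box_uhs m" if "m >= m0" for m
 proof -
  have m: "norm (fst z) < real m" "snd z < real m" "1 / snd z < real m" using m0 of_nat_mono[OF that, where 'a=real] by auto
  hence "1 < snd z * (real m + 1)" using t by (simp add: field_simps)
  thus ?thesis using m t by (simp add: box_uhs_def divide_le_eq add_nonneg_pos)
 qed
 thus ?thesis by blast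
qed

lemma incseq_box: "incseq (box_uhs :: nat => ('n::finite) uhs set)"
proof (rule incseq_SucI, goal_cases)
 case (1 m)
 have "1 / (real (Suc m) + 1) <= 1 / (real m + 1)" by (intro divide_left_mono) auto
 thus ?case by (auto simp: box_uhs_def)
qed

lemma sigma_finite_uhs: "sigma_finite_measure (uhs :: ('n::finite) uhs measure)"
proof
 show "EX A. countable A & A <= sets (uhs :: 'n uhs measure) & \<Union> A = space uhs & (ALL a:A. emeasure uhs a ~= \<infinity>)"
 proof (intro exI[of _ "range (box_uhs :: nat => 'n uhs set)"] conjI)
  show "\<Union> (range box_uhs) = space (uhs :: 'n uhs measure)"
  proof (intro set_eqI iffI)
   fix z :: "'n uhs" assume "z : space uhs"
   thus "z : \<Union> (range box_uhs)" using box_uhs_cover[of z] by blast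
  qed (auto dest: box_uhs_pos)
  show "ALL a:range box_uhs. emeasure uhs a ~= (\<infinity> :: ennreal)" using emeasure_box by (auto simp: less_top)
 qed auto
qed

lemma cone_borel: "open (cone al (x :: real ^ ('n::finite)))"
proof -
 have "cone al x = {z. 0 < snd z} Int {z. dist (fst z) x < al * snd z}" by (auto simp: cone_def)
 moreover have "open {z :: 'n uhs. 0 < snd z}" by (intro open_Collect_less continuous_intros)
 moreover have "open {z :: 'n uhs. dist (fst z) x < al * snd z}" by (intro open_Collect_less continuous_intros)
 ultimately show ?thesis by (simp only: open_Int)
qed

lemma cone_sets[measurable, simp]: "cone al x : sets uhs"
 by (intro borel_sets_uhs borel_open cone_borel) (auto simp: cone_def)

lemma tcone_sets[measurable, simp]: "tcone al h (x :: real ^ ('n::finite)) : sets uhs"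
proof -
 have "tcone al h x = cone al x Int {z. snd z < h}" by (auto simp: tcone_def)
 moreover have "open {z :: 'n uhs. snd z < h}" by (intro open_Collect_less continuous_intros)
 ultimately have "open (tcone al h x)" by (simp only: open_Int cone_borel)
 thus ?thesis by (intro borel_sets_uhs borel_open) (auto simp: tcone_def cone_def)
qed

lemma measurable_cone_indicator:
 "(%(x, z). ind (cone al x) z :: real) : bm ((borel :: (real ^ 'n) measure) \<otimes> (uhs :: ('n::finite) uhs measure))"
proof -
 have [measurable]: "(%p. snd p) : measurable ((borel :: (real ^ 'n) measure) \<otimes> (uhs :: 'n uhs measure)) (borel :: 'n uhs measure)"
  by (rule measurable_compose[OF measurable_snd measurable_uhs[OF measurable_ident_sets[OF refl]]])
 have [measurable]: "(%p. fst (snd p)) : measurable ((borel :: (real ^ 'n) measure) \<otimes> (uhs :: 'n uhs measure)) borel"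
  "(%p. snd (snd p)) : measurable ((borel :: (real ^ 'n) measure) \<otimes> (uhs :: 'n uhs measure)) borel"
  by (rule measurable_compose[OF measurable_compose[OF measurable_snd measurable_uhs[OF measurable_ident_sets[OF refl]]] borel_fst_snd(1)],
   rule measurable_compose[OF measurable_compose[OF measurable_snd measurable_uhs[OF measurable_ident_sets[OF refl]]] borel_fst_snd(2)])
 have "(%p. if 0 < snd (snd p) & dist (fst (snd p)) (fst p) < al * snd (snd p) then 1 else 0 :: real)
  : bm ((borel :: (real ^ 'n) measure) \<otimes> (uhs :: 'n uhs measure))" by measurable
 thus ?thesis by (simp add: split_beta' cone_def indicator_def)
qed

locale uhsfun = nfun J "uhs :: ('n::finite) uhs measure" e F "KF F" T
 for J :: "'x::banach => 'x" and e :: "nat => ('n::finite) uhs => complex" and F T +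
 assumes fr: "!!m. fr_limit uhs (T m)"

lemma (in complex_banach) uhsfun_exists:
 fixes F :: "('n::finite) uhs => 'x"
 assumes F: "sm uhs F" and e: "onb uhs e"
 shows "EX T. uhsfun J e F T"
proof -
 have [measurable]: "(%z. norm (F z)) : bm uhs" by (rule sm_norm[OF F])
 have K: "KF F m : sets uhs" for m
 proof -
  have "KF F m = box_uhs m Int {z : space uhs. norm (F z) <= real m}"
   using box_uhs_pos by (auto simp: KF_def)
  moreover have "{z : space uhs. norm (F z) <= real m} : sets uhs" by measurable
  ultimately show ?thesis by (simp only: sets.Int box_sets)
 qed
 have "emeasure uhs (KF F m) <= emeasure uhs (box_uhs m :: 'n uhs set)" for m
  by (rule emeasure_mono) (auto simp: KF_def)
 hence fin: "emeasure uhs (KF F m) < \<infinity>" for m using emeasure_box le_less_trans by blast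
 have "EX T. wrep uhs (%z. ind (KF F m) z *R F z) T & bdl uhs T & fr_limit uhs T" for m
  by (rule integral_operator[OF F K fin, of _ "real m + 1"]) (auto simp: KF_def)
 then obtain T where T: "!!m. wrep uhs (%z. ind (KF F m) z *R F z) (T m) & bdl uhs (T m) & fr_limit uhs (T m)" by metis
 have "incseq (KF F)"
  using incseq_box[where 'n='n] unfolding incseq_def KF_def by (auto simp: subset_iff)
 moreover have "(UN m. KF F m) = space uhs"
 proof (intro set_eqI iffI)
  fix z :: "'n uhs" assume z: "z : space uhs"
  obtain m0 where m0: "!!m. m >= m0 ==> z : box_uhs m" using box_uhs_cover[OF z] by blast
  obtain m1 where "norm (F z) < real m1" using reals_Archimedean2 by blast
  hence "z : KF F (max m0 m1)" using m0 by (auto simp: KF_def)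
  thus "z : (UN m. KF F m)" by blast
 qed (auto simp: KF_def dest: box_uhs_pos)
 ultimately have "uhsfun J e F T"
  using F e K by unfold_locales (use T in blast)+
 thus ?thesis by blast
qed

section \<open>The conical functional\<close>

context uhsfun
begin

text \<open>In UMD spaces comparable to the square of \<open>Aop\<close> (\<open>Aop_le_Ac\<close>,
  \<open>Ac_le_Aop\<close>), which is why its powers \<open>p / 2\<close> appear below.\<close>

definition Ac :: "real => real ^ 'n => ennreal" where "Ac al x = Q (ind (cone al x))"

lemma measurable_cone_Int_m:
 assumes [measurable]: "S : sets uhs"
 shows "(%x. Qm m (ind (cone al x Int S))) : bm borel"
proof (rule measurable_Qm[OF fr sigma_finite_uhs])
 note [measurable] = measurable_cone_indicator[of al, unfolded split_beta']
 have "(%p. ind (cone al (fst p)) (snd p) * (ind S (snd p) :: real)) : bm (borel \<otimes> uhs)" by measurable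
 thus "(%(x, z). ind (cone al x Int S) z :: real) : bm (borel \<otimes> uhs)"
  by (simp add: split_beta' indicator_inter_arith)
qed simp

lemma measurable_cone_Int: "S : sets uhs ==> (%x. Q (ind (cone al x Int S))) : bm borel"
 unfolding Q_def by (intro borel_measurable_SUP measurable_cone_Int_m) auto

lemma measurable_tcone: "(%x. Q (ind (tcone al h x))) : bm borel"
proof -
 have "{z :: 'n uhs. 0 < snd z & snd z < h} : sets uhs" by (intro borel_sets_uhs borel_open open_Collect_conj open_Collect_less continuous_intros) auto
 moreover have "tcone al h x = cone al x Int {z. 0 < snd z & snd z < h}" for x :: "real ^ 'n" by (auto simp: tcone_def cone_def)
 ultimately show ?thesis using measurable_cone_Int by simp
qed

lemma measurable_Ac_m: "(%x. Qm m (ind (cone al x))) : bm borel"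
 by (rule measurable_Qm[OF fr sigma_finite_uhs measurable_cone_indicator]) simp

lemma measurable_Ac[measurable]: "Ac al : bm borel"
proof -
 note [measurable] = measurable_Ac_m
 show ?thesis unfolding Ac_def[abs_def] Q_def by measurable
qed

lemma Ac_mono: "al <= al' ==> Ac al x <= Ac al' x"
 unfolding Ac_def
proof (rule Q_set_mono)
 assume "al <= al'"
 thus "cone al x <= cone al' x"
  unfolding cone_def using mult_right_mono[of al al'] by (fastforce intro: less_le_trans)
qed auto

lemma Aop_le_Ac: "UMD TYPE('x) ==> epowr (Aop J al F x) 2 <= 2 * Ac al x"
 and Ac_le_Aop: "Ac al x <= 2 * epowr (Aop J al F x) 2"
proof -
 have eq: "(%z. if z : cone al x then F z else 0) = (%z. ind (cone al x) z *R F z)" by (auto simp: indicator_def)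
 show "epowr (Aop J al F x) 2 <= 2 * Ac al x" if "UMD TYPE('x)"
  unfolding Aop_def eq Ac_def by (rule gamma_le_Q[OF that]) simp
 show "Ac al x <= 2 * epowr (Aop J al F x) 2"
  unfolding Aop_def eq Ac_def by (rule Q_le_gamma) simp
qed

lemma tcone_le_Atr: "Q (ind (tcone al h x)) <= 2 * epowr (Atr J al F h x) 2"
proof -
 have eq: "(%z. if z : tcone al h x then F z else 0) = (%z. ind (tcone al h x) z *R F z)" by (auto simp: indicator_def)
 show ?thesis unfolding Atr_def eq by (rule Q_le_gamma) simp
qed

text \<open>Lower semicontinuity in the vertex. The cone is exhausted by sets \<open>S k\<close> of
  slightly smaller aperture, cut off near the boundary, and each \<open>S k\<close> is contained in
  the cones of all nearby vertices.\<close>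

lemma open_Ac: "open {x. c < Ac al x}"
proof (rule openI, goal_cases)
 let ?d = "%k. al - 1 / real (Suc k)"
 case (1 x)
 hence x: "c < Ac al x" by simp
 define S where "S k = {z. 1 / real (Suc k) < snd z & dist (fst z) x < (?d k) * snd z}" for k :: nat
 have pos: "0 < snd z" if "z : S k" for k z
 proof -
  have "1 / real (Suc k) < snd z" using that by (simp add: S_def del: of_nat_Suc)
  moreover have "0 < 1 / real (Suc k)" by simp
  ultimately show ?thesis by linarith
 qed
 have Ss: "S k : sets (uhs :: 'n uhs measure)" for k
 proof -
  have "S k = {z. 1 / real (Suc k) < snd z} Int {z. dist (fst z) x < (?d k) * snd z}" by (auto simp: S_def)
  moreover have "open {z :: 'n uhs. 1 / real (Suc k) < snd z}" "open {z :: 'n uhs. dist (fst z) x < (?d k) * snd z}"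
   by (intro open_Collect_less continuous_intros)+
  ultimately have "open (S k)" by (simp only: open_Int)
  thus ?thesis using pos by (intro borel_sets_uhs borel_open) auto
 qed
 have inc: "incseq S"
 proof (rule incseq_SucI, rule subsetI)
  fix k z assume z: "z : S k"
  have *: "1 / real (Suc (Suc k)) <= 1 / real (Suc k)" by (intro divide_left_mono) auto
  have "(?d k) * snd z <= (?d (Suc k)) * snd z"
   using * pos[OF z] by (intro mult_right_mono) auto
  thus "z : S (Suc k)" using z * by (auto simp: S_def simp del: of_nat_Suc)
 qed
 have U: "(UN k. S k) = cone al x"
 proof (intro set_eqI iffI)
  fix z assume "z : (UN k. S k)"
  then obtain k where z: "z : S k" by blast
  have "(?d k) * snd z <= al * snd z" using pos[OF z] by (intro mult_right_mono) auto
  moreover have "dist (fst z) x < (?d k) * snd z" using z by (simp add: S_def del: of_nat_Suc)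
  ultimately have "dist (fst z) x < al * snd z" by linarith
  thus "z : cone al x" using pos[OF z] by (simp add: cone_def)
 next
  fix z assume "z : cone al x"
  hence z: "0 < snd z" "0 < al - dist (fst z) x / snd z" by (auto simp: cone_def field_simps)
  hence "0 < min (snd z) (al - dist (fst z) x / snd z)" by simp
  then obtain k where "inverse (real (Suc k)) < min (snd z) (al - dist (fst z) x / snd z)" using reals_Archimedean by blast
  hence "1 / real (Suc k) < snd z" "dist (fst z) x / snd z < al - 1 / real (Suc k)" by (auto simp: inverse_eq_divide)
  hence "z : S k" using z(1) by (simp add: S_def pos_divide_less_eq del: of_nat_Suc)
  thus "z : (UN k. S k)" by blast
 qed
 have "c < (SUP k. Q (ind (S k)))"
  using x Q_continuous[of S] Ss inc unfolding U Ac_def by (meson less_le_trans)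
 then obtain k where k: "c < Q (ind (S k))" by (auto simp: less_SUP_iff)
 show ?case
 \<comment> \<open>In \<open>S k\<close> the aperture leaves a margin of
   \<open>snd z / (k + 1)\<close>, which exceeds \<open>1 / (k + 1)^2\<close> because heights in
   \<open>S k\<close> exceed \<open>1 / (k + 1)\<close>.\<close>
 proof (intro exI[of _ "(1 / real (Suc k))^2"] conjI subsetI)
  fix y assume "y : ball x ((1 / real (Suc k))^2)"
  hence y: "dist x y < (1 / real (Suc k)) * (1 / real (Suc k))" by (simp add: power2_eq_square)
  have "S k <= cone al y"
  proof
   fix z assume z: "z : S k"
   have "(1 / real (Suc k)) * (1 / real (Suc k)) <= (1 / real (Suc k)) * snd z"
    using z by (intro mult_left_mono) (auto simp: S_def)
   moreover have "dist (fst z) x < al * snd z - (1 / real (Suc k)) * snd z"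
    using z by (auto simp: S_def left_diff_distrib)
   ultimately have "dist (fst z) y < al * snd z" using y dist_triangle[of "fst z" y x] by linarith
   thus "z : cone al y" using pos[OF z] by (simp add: cone_def)
  qed
  hence "Q (ind (S k)) <= Ac al y" unfolding Ac_def by (intro Q_set_mono Ss) auto
  thus "y : {x. c < Ac al x}" using k by auto
 qed simp
qed

end

section \<open>Stein's inequality for averages of weights\<close>

lemma sm_cong: "(!!x. x : space M ==> f x = g x) ==> sm M f ==> sm M g"
 unfolding strongly_measurable_def by (auto intro!: exI)

context complex_banach
begin

text \<open>Complexification \<open>ph v - i ph (J v)\<close>: identities for complex functionals
  carry over to the real ones of the locale \<open>stein\<close>.\<close>

lemma real_functional_cf:
 assumes ph: "bounded_linear (ph :: 'x => real)"
 shows "EX py. cfunctional J py & (ALL v. Re (py v) = ph v)"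
proof -
 have bJ: "bounded_linear J" using bounded_linear_scl[of \<i>] by (simp add: scaleCJ_def)
 define py where "py v = cor (ph v) - \<i> * cor (ph (J v))" for v
 have "bounded_linear py"
  unfolding py_def[abs_def]
  by (intro bounded_linear_sub bounded_linear_const_mult bounded_linear_compose[OF bounded_linear_of_real] ph bounded_linear_compose[OF ph bJ])
 moreover have "py (J v) = \<i> * py v" for v
  by (simp add: py_def linear_neg[OF bounded_linear.linear[OF ph]] algebra_simps)
 ultimately show ?thesis unfolding cfunctional_def by (intro exI[of _ py]) (simp add: py_def)
qed

text \<open>Conditional expectation acts on the weight only: averaging \<open>T\<close> of
  \<open>u x\<close> times \<open>f i\<close> over a cell gives \<open>T\<close> of the averaged
  weight \<open>W j x\<close> times \<open>f i\<close>. Without a vector-valued integral this is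
  checked on functionals by Fubini.\<close>

theorem stein_avg:
 fixes mu :: "'b measure" and pr :: "nat => 'b => 'q" and u :: "'b => 'a => real"
 assumes w: "wrep M Ph T" and bT: "bdl M T" and fr: "fr_limit M T" and sM: "sigma_finite_measure M" and pm: "prob_space mu"
  and fin: "!!k. k < N ==> finite (pr k ` space mu)"
  and ms: "!!k c. k < N ==> {x:space mu. pr k x = c} : sets mu"
  and nest: "!!i j x y. i <= j ==> j < N ==> x : space mu ==> y : space mu ==> pr j x = pr j y ==> pr i x = pr i y"
  and u: "(%(x, z). u x z) : bm (mu \<otimes> M)" "!!x z. 0 <= u x z" "!!x z. u x z <= 1"
  and f: "!!i. i < N ==> sq_int M (f i)"
  and W: "!!j x z. W j x z = LI mu (%y. ind {y:space mu. pr j y = pr j x} y * u y z) / measure mu {y:space mu. pr j y = pr j x}"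
  and U: "umd_const TYPE('x) p bt" and p: "1 < p" and io: "inj (io :: 'b \<times> (nat => complex) => nat => real)"
 shows "NI mu (%x. GE (np p) (map (%i. T (%z. cor (W i x z) * f i z)) [0..<N]))
  <= (en (bt powr p) + 1) * NI mu (%x. GE (np p) (map (%i. T (%z. cor (u x z) * f i z)) [0..<N]))"
  and "k < N ==> wt M (W k x)"
  and "k < N ==> sm mu (%x. T (%z. cor (W k x z) * f k z))"
proof -
 let ?c = "%j c. {x:space mu. pr j x = c}"
 interpret prob_space mu by fact
 interpret M: sigma_finite_measure M by fact
 interpret P: pair_sigma_finite mu M ..
 note [measurable] = u(1)
 have mP: "(%(z, y). g y * u y z) : bm (M \<otimes> mu)" if [measurable]: "g : bm mu" for g
 proof -
  have "(%p. g (fst p) * (case p of (x, z) => u x z)) : bm (mu \<otimes> M)" by measurable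
  from measurable_compose[OF measurable_pair_swap' this] show ?thesis by (simp add: split_beta')
 qed
 have wW: "wt M (W k x)" if k: "k < N" for k x
 proof -
  let ?C = "{y:space mu. pr k y = pr k x}"
  have [measurable]: "?C : sets mu" by (rule ms[OF k])
  have "(%z. LI mu (%y. ind ?C y * u y z)) : bm M"
   by (rule borel_measurable_lebesgue_integral[OF mP]) measurable
  hence "W k x : bm M" unfolding W[abs_def] by measurable
  moreover have "\<bar>W k x z\<bar> <= 1" if z: "z : space M" for z
  proof -
   have [measurable]: "(%y. u y z) : bm mu" using measurable_Pair1[OF u(1) z] by simp
   have "0 <= LI mu (%y. ind ?C y * u y z)" using u(2) by (intro integral_nonneg_AE) auto
   moreover have "LI mu (%y. ind ?C y * u y z) <= LI mu (%y. ind ?C y)"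
   proof (rule Bochner_Integration.integral_mono)
    show "integrable mu (%y. ind ?C y * u y z)"
     using u(2,3) by (intro integrable_const_bound[where B=1]) (auto simp: indicator_def)
    show "integrable mu (%y. ind ?C y :: real)" by (intro integrable_const_bound[where B=1]) (auto simp: indicator_def)
    show "ind ?C y * u y z <= ind ?C y" for y using u(3) by (auto simp: indicator_def)
   qed
   moreover have "LI mu (%y. ind ?C y) = measure mu ?C" by simp
   ultimately show ?thesis unfolding W
    by (auto simp: divide_le_eq_1 abs_of_nonneg zero_less_measure_iff measure_nonneg not_less)
  qed
  ultimately show ?thesis by (simp add: wt_def)
 qed
 show "wt M (W k x)" if "k < N" by (rule wW[OF that])
 have wu: "wt M (u x)" if "x : space mu" for x
  using measurable_Pair2[OF u(1) that] u(2,3) by (auto simp: wt_def)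
 obtain C where C: "C >= 0" "!!f. sq_int M f ==> (norm (T f))^2 <= C * nsq M f" using bT by (auto simp: bdl_def)
 define a where "a i x = T (%z. cor (u x z) * f i z)" for i x
 define b where "b i j x = T (%z. cor (W j x z) * f i z)" for i j x
 define R where "R = (SUM i<N. sqrt (C * nsq M (f i)))"
 have bd: "norm (T (%z. cor (v z) * f i z)) <= R" if i: "i < N" and v: "wt M v" for i v
 proof -
  have [measurable]: "f i : bm M" "v : bm M" using f[OF i] v by (auto intro: sq_int_measurable wt_measurable)
  have "(norm (T (%z. cor (v z) * f i z)))^2 <= C * nsq M (%z. cor (v z) * f i z)"
   by (intro C sq_int_wt v f i)
  also have "... <= C * nsq M (f i)"
   using v C(1) f[OF i] by (intro mult_left_mono nsq_mono) (auto simp: norm_mult mult_left_le_one_le wt_def)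
  finally have "norm (T (%z. cor (v z) * f i z)) <= sqrt (C * nsq M (f i))" by (rule real_le_rsqrt)
  also have "... <= R" unfolding R_def using i C(1) by (intro member_le_sum) auto
  finally show ?thesis .
 qed
 interpret S: stein J mu pr N a b R
 proof (unfold_locales, fact fin, fact ms, fact nest)
  show "sm mu (a i)" if "i < N" for i
   unfolding a_def
  proof (rule fr_limit_sm[OF fr sM])
   note [measurable] = sq_int_measurable[OF f[OF that]]
   show "(%(x, z). cor (u x z) * f i z) : bm (mu \<otimes> M)" by measurable
  qed (rule sq_int_wt[OF wu f[OF that]])
  show "sm mu (b i j)" if ij: "i <= j" "j < N" for i j
  proof (rule sm_cong)
   let ?V = "%c. b i j (SOME x. x : space mu & pr j x = c)"
   show "sm mu (%x. SUM c:pr j ` space mu. ind (?c j c) x *R ?V c)"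
    using ms[OF ij(2)] by (intro sm_sum sm_scaleR sm_const sm_of_borel) simp
   fix x assume x: "x : space mu"
   have "(SUM c:pr j ` space mu. ind (?c j c) x *R ?V c) = (SUM c:pr j ` space mu. if c = pr j x then ?V (pr j x) else 0)"
    using x by (intro sum.cong refl) (auto simp: indicator_def)
   also have "... = ?V (pr j x)" using x fin[OF ij(2)] by simp
   also have "... = b i j x"
   proof -
    have "pr j (SOME y. y : space mu & pr j y = pr j x) = pr j x"
     using someI[of "%y. y : space mu & pr j y = pr j x" x] x by blast
    thus ?thesis unfolding b_def W by simp
   qed
   finally show "(SUM c:pr j ` space mu. ind (?c j c) x *R ?V c) = b i j x" .
  qed
  show "b i j x = b i j y" if "pr j x = pr j y" for i j x y
   unfolding b_def W that ..
  show "norm (a i x) <= R" if "i < N" "x : space mu" for i x unfolding a_def by (rule bd[OF that(1) wu[OF that(2)]])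
  show "norm (b i j x) <= R" if "i <= j" "j < N" for i j x
   unfolding b_def using that by (intro bd wW) auto
  show "LI mu (%x. ind (?c j c) x * ph (b i j x)) = LI mu (%x. ind (?c j c) x * ph (a i x))"
   if ij: "i <= j" "j < N" and ph: "bounded_linear (ph :: 'x => real)" for i j c ph
  proof (cases "EX x0:space mu. pr j x0 = c")
   case False
   hence "ind (?c j c) x = (0::real)" for x by (auto simp: indicator_def)
   thus ?thesis by simp
  next
   case True
   then obtain x0 where x0: "x0 : space mu" "pr j x0 = c" by blast
   let ?C = "(?c j c)"
   have [measurable]: "?C : sets mu" by (rule ms[OF ij(2)])
   have i: "i < N" using ij by simp
   obtain py where py: "cfunctional J py" "!!v. Re (py v) = ph v" using real_functional_cf[OF ph] by blast
   have spy: "sq_int M (%z. py (Ph z))" and r: "!!h. sq_int M h ==> py (T h) = LI M (%z. h z * py (Ph z))"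
    using w py(1) unfolding wrep_def by blast+
   note [measurable] = sq_int_measurable[OF spy] sq_int_measurable[OF f[OF i]]
   let ?g = "%x z. cor (ind ?C x * u x z) * (f i z * py (Ph z))"
   have int: "integrable (mu \<otimes> M) (%(x, z). ?g x z)"
   proof (rule integrableI_bounded)
    have "NI (mu \<otimes> M) (%q. en (norm (case q of (x, z) => ?g x z))) <= NI (mu \<otimes> M) (%q. en (norm (f i (snd q) * py (Ph (snd q)))))"
     using u(2,3) by (intro nn_integral_mono ennreal_leI) (auto simp: indicator_def norm_mult mult_left_le_one_le)
    also have "... = NI mu (%x. NI M (%z. en (norm (f i z * py (Ph z)))))"
     by (subst M.nn_integral_fst[symmetric]) simp_all
    also have "... = NI M (%z. en (norm (f i z * py (Ph z))))" by (simp add: emeasure_space_1)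
    also have "... < \<infinity>" using sq_int_integrable_mult[OF f[OF i] spy] unfolding integrable_iff_bounded by blast
    finally show "NI (mu \<otimes> M) (%q. en (norm (case q of (x, z) => ?g x z))) < \<infinity>" .
   qed measurable
   \<comment> \<open>On a null cell \<open>W\<close> is a quotient by 0, hence 0, and the integral
     vanishes as well.\<close>
   have meas0: "LI mu (%y. ind ?C y * u y z) = measure mu ?C * W j x0 z" for z
   proof (cases "measure mu ?C = 0")
    case True
    have "AE y in mu. ind ?C y * u y z = 0"
     using True by (intro AE_I[where N="?C"]) (auto simp: indicator_def emeasure_eq_measure)
    hence "LI mu (%y. ind ?C y * u y z) = 0" by (rule integral_eq_zero_AE)
    thus ?thesis using True by simp
   qed (simp add: W x0)
   have "LI mu (%x. ind ?C x * ph (b i j x)) = LI mu (%x. ind ?C x * ph (b i j x0))"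
    by (intro bint_cong) (auto simp: indicator_def b_def W x0)
   also have "... = Re (cor (measure mu ?C) * py (b i j x0))" by (simp add: py(2))
   also have "cor (measure mu ?C) * py (b i j x0) = LI M (%z. LI mu (%x. ?g x z))"
   proof -
    have "cor (measure mu ?C) * py (b i j x0) = LI M (%z. cor (measure mu ?C * W j x0 z) * (f i z * py (Ph z)))"
     unfolding b_def r[OF sq_int_wt[OF wW[OF ij(2)] f[OF i]]] by (simp add: mult.assoc flip: integral_mult_right_zero)
    also have "... = LI M (%z. LI mu (%x. ?g x z))"
    proof (intro bint_cong, goal_cases)
     case (1 z)
     have "LI mu (%x. ?g x z) = LI mu (%x. cor (ind ?C x * u x z)) * (f i z * py (Ph z))"
      by (rule integral_mult_left_zero)
     also have "LI mu (%x. cor (ind ?C x * u x z)) = cor (measure mu ?C * W j x0 z)"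
      unfolding meas0[of z, symmetric] by (rule integral_complex_of_real)
     finally show ?case ..
    qed
    finally show ?thesis .
   qed
   also have "... = LI mu (%x. LI M (%z. ?g x z))" by (rule P.Fubini_integral[OF int])
   also have "... = LI mu (%x. cor (ind ?C x) * py (a i x))"
   proof (intro bint_cong, goal_cases)
    case x: (1 x)
    show ?case
     unfolding a_def r[OF sq_int_wt[OF wu[OF x] f[OF i]]] by (simp add: mult.assoc flip: integral_mult_right_zero)
   qed
   also have "Re ... = LI mu (%x. Re (cor (ind ?C x) * py (a i x)))"
   proof (rule integral_Re[symmetric])
    have "integrable mu (%x. LI M (%z. ?g x z))" using P.integrable_fst[OF int] .
    thus "integrable mu (%x. cor (ind ?C x) * py (a i x))"
    proof (rule Bochner_Integration.integrable_cong[THEN iffD1, OF refl, rotated], goal_cases)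
     case x: (1 x)
     show ?case
      unfolding a_def r[OF sq_int_wt[OF wu[OF x] f[OF i]]] by (simp add: mult.assoc flip: integral_mult_right_zero)
    qed
   qed
   also have "... = LI mu (%x. ind ?C x * ph (a i x))" by (simp add: py(2))
   finally show ?thesis .
  qed
 qed
 show "NI mu (%x. GE (np p) (map (%i. T (%z. cor (W i x z) * f i z)) [0..<N]))
  <= (en (bt powr p) + 1) * NI mu (%x. GE (np p) (map (%i. T (%z. cor (u x z) * f i z)) [0..<N]))"
  using S.stein[OF U p io] unfolding a_def b_def .
 show "sm mu (%x. T (%z. cor (W k x z) * f k z))" if "k < N"
  using S.smb[OF order_refl that] unfolding b_def .
qed

end

section \<open>Change of aperture\<close>

lemma sum_div_mod: "(SUM i<L * n. g (i div n) (i mod n)) = (SUM k<L. SUM j<n. g k j)"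
 for g :: "nat => nat => 'b::comm_monoid_add"
proof -
 have "(SUM i<L * n. g (i div n) (i mod n)) = (SUM (k, j):{..<L} \<times> {..<n}. g k j)"
 proof (rule sum.reindex_bij_witness[of _ "%(k, j). k * n + j" "%i. (i div n, i mod n)"])
  fix i assume i: "i : {..<L * n}"
  hence "n > 0" by (cases n) auto
  thus "(i div n, i mod n) : {..<L} \<times> {..<n}" using i by (auto simp: less_mult_imp_div_less)
 next
  fix p assume "p : {..<L} \<times> {..<n}"
  then obtain k j where p: "p = (k, j)" "k < L" "j < n" by auto
  have "k * n + j < Suc k * n" using p by simp
  also have "... <= L * n" using p by (intro mult_le_mono1) simp
  finally show "(case p of (k, j) => k * n + j) : {..<L * n}" using p by simp
  show "((case p of (k, j) => k * n + j) div n, (case p of (k, j) => k * n + j) mod n) = p" using p by simp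
 qed auto
 thus ?thesis by (simp add: sum.cartesian_product)
qed

text \<open>Averages will be taken over cubes whose size depends on the height of the point, whereas
  Stein's inequality assigns one partition to each vector. Cutting the basis functions along levels
  gives each piece a single scale.\<close>

locale level_split =
 fixes M :: "'a measure" and e :: "nat => 'a => complex" and lev :: "'a => nat" and L :: nat
 assumes onb: "onb M e" and lev: "!!k. {z:space M. lev z = k} : sets M" and levL: "!!z. z : space M ==> lev z < L"
begin

definition D :: "nat => 'a => complex" where "D k z = cor (ind {z:space M. lev z = k} z)"

text \<open>The index \<open>i\<close> encodes the level \<open>i div n\<close> and the basis
  function \<open>i mod n\<close>; sorting by level makes the partitions finer as \<open>i\<close>
  grows.\<close>

definition fsp :: "nat => nat => 'a => complex" where "fsp n i = (%z. D (i div n) z * e (i mod n) z)"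

lemma sq_D: "sq_int M h ==> sq_int M (%z. D k z * h z)"
 unfolding D_def by (rule sq_int_wt[OF wt_indicator[OF lev]])

lemma sq_fsp: "sq_int M (fsp n i)"
 unfolding fsp_def by (intro sq_D onb_sq_int[OF onb])

lemma sum_D: "z : space M ==> (SUM k<L. D k z * c k) = c (lev z)"
proof -
 assume z: "z : space M"
 have "(SUM k<L. D k z * c k) = (SUM k<L. if k = lev z then c k else 0)"
  using z by (intro sum.cong refl) (auto simp: D_def indicator_def)
 thus ?thesis using levL[OF z] by simp
qed

lemma nsq_split:
 assumes h: "!!k. sq_int M (h k)"
 shows "nsq M (%z. SUM k<L. D k z * h k z) = (SUM k<L. nsq M (%z. D k z * h k z))"
proof -
 have "nsq M (%z. SUM k<L. D k z * h k z) = LI M (%z. (SUM k<L. (cmod (D k z * h k z))^2))"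
  unfolding nsq_def
 proof (intro bint_cong, goal_cases)
  case z: (1 z)
  have "(SUM k<L. (cmod (D k z * h k z))^2) = (SUM k<L. if k = lev z then (cmod (h k z))^2 else 0)"
   using z by (intro sum.cong refl) (auto simp: D_def indicator_def)
  thus ?case
   using levL[OF z] sum_D[OF z, of "%k. h k z"] by simp
 qed
 also have "... = (SUM k<L. nsq M (%z. D k z * h k z))"
  unfolding nsq_def by (rule Bochner_Integration.integral_sum) (use sq_D[OF h] in "simp add: sq_int_def")
 finally show ?thesis .
qed

lemma nsq_D_le: "sq_int M h ==> nsq M (%z. D k z * h z) <= nsq M h"
proof -
 assume h: "sq_int M h"
 show ?thesis using sq_int_measurable[OF sq_D[OF h]]
  by (intro nsq_mono h) (auto simp: D_def indicator_def norm_mult)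
qed

lemma ip_fsp: "ip M h (fsp n i) = ip M (%z. D (i div n) z * h z) (e (i mod n))"
 unfolding ip_def fsp_def by (simp add: D_def ac_simps)

lemma bessel_fsp: "bessel M (map (fsp n) [0..<L * n])"
 unfolding bessel_def
proof (intro conjI ballI allI)
 show "sq_int M f" if "f : set (map (fsp n) [0..<L * n])" for f using that sq_fsp by auto
 fix c :: "nat => complex"
 define c' where "c' k j = c (k * n + j)" for k j
 have cc: "c i = c' (i div n) (i mod n)" for i unfolding c'_def by simp
 have "(SUM j<length (map (fsp n) [0..<L * n]). c j * (map (fsp n) [0..<L * n] ! j) z) = (SUM k<L. D k z * (SUM j<n. c' k j * e j z))" for z
 proof -
  have "(SUM j<length (map (fsp n) [0..<L * n]). c j * (map (fsp n) [0..<L * n] ! j) z) = (SUM i<L * n. c' (i div n) (i mod n) * (D (i div n) z * e (i mod n) z))"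
   by (intro sum.cong) (auto simp: fsp_def cc)
  also have "... = (SUM k<L. SUM j<n. c' k j * (D k z * e j z))" by (rule sum_div_mod[of "%k j. c' k j * (D k z * e j z)"])
  finally show ?thesis by (simp add: sum_distrib_left ac_simps)
 qed
 hence "nsq M (%z. SUM j<length (map (fsp n) [0..<L * n]). c j * (map (fsp n) [0..<L * n] ! j) z)
  = (SUM k<L. nsq M (%z. D k z * (SUM j<n. c' k j * e j z)))"
  by (simp only: nsq_split sq_int_sum onb_sq_int[OF onb])
 also have "... <= (SUM k<L. nsq M (%z. SUM j<n. c' k j * e j z))"
  by (intro sum_mono nsq_D_le sq_int_sum onb_sq_int[OF onb])
 also have "... = (SUM k<L. SUM j<n. (cmod (c' k j))^2)" by (simp add: onb_nsq_sum[OF onb])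
 also have "... = (SUM i<L * n. (cmod (c i))^2)" unfolding cc by (rule sum_div_mod[symmetric])
 finally show "nsq M (%z. SUM j<length (map (fsp n) [0..<L * n]). c j * (map (fsp n) [0..<L * n] ! j) z)
  <= (SUM j<length (map (fsp n) [0..<L * n]). (cmod (c j))^2)" by simp
qed

text \<open>The error of the cut expansion is the sum over the levels of the restricted errors of
  the expansions of \<open>D k f\<close>.\<close>

lemma frame_fsp: "frame M (%n. map (fsp n) [0..<L * n])"
 unfolding frame_def
proof (intro conjI allI ballI impI)
 let ?L = "%n. map (fsp n) [0..<L * n]"
 show "sq_int M g" if "g : set ((?L n))" for g n using that sq_fsp by auto
 show "(SUM k<length ((?L n)). (cmod (ip M f ((?L n) ! k)))^2) <= nsq M f" if f: "sq_int M f" for f n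
  using bessel_dual[OF bessel_fsp f, of n] .
 fix f assume f: "sq_int M f"
 let ?g = "%k z. D k z * f z"
 let ?S = "%n z. SUM i<length ((?L n)). ip M f ((?L n) ! i) * ((?L n) ! i) z"
 let ?r = "%k n. %z. ?g k z - (SUM j<n. ip M (?g k) (e j) * e j z)"
 have eq: "nsq M (%z. f z - (?S n z))
   <= (SUM k<L. nsq M (?r k n))" for n
 proof -
  let ?r = "%k z. ?g k z - (SUM j<n. ip M (?g k) (e j) * e j z)"
  have sr: "sq_int M (?r k)" for k by (intro sq_int_diff sq_D f sq_int_sum onb_sq_int[OF onb])
  have "f z - (?S n z)
   = (SUM k<L. D k z * ?r k z)" if z: "z : space M" for z
  proof -
   have "(?S n z)
    = (SUM i<L * n. ip M (?g (i div n)) (e (i mod n)) * (D (i div n) z * e (i mod n) z))"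
   proof (rule sum.cong)
    fix i assume "i : {..<L * n}"
    hence "(?L n) ! i = fsp n i" by simp
    thus "ip M f ((?L n) ! i) * ((?L n) ! i) z = ip M (?g (i div n)) (e (i mod n)) * (D (i div n) z * e (i mod n) z)"
     by (simp only: ip_fsp) (simp add: fsp_def)
   qed simp
   also have "... = (SUM k<L. SUM j<n. ip M (?g k) (e j) * (D k z * e j z))"
    by (rule sum_div_mod[of "%k j. ip M (?g k) (e j) * (D k z * e j z)"])
   also have "... = (SUM k<L. D k z * (SUM j<n. ip M (?g k) (e j) * e j z))" by (simp add: sum_distrib_left ac_simps)
   finally have 1: "(?S n z)
    = (SUM k<L. D k z * (SUM j<n. ip M (?g k) (e j) * e j z))" .
   have "D (lev z) z = 1" using z by (simp add: D_def)
   hence "(SUM k<L. D k z * ?g k z) = f z" unfolding sum_D[OF z] by simp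
   thus ?thesis unfolding 1 by (simp add: right_diff_distrib sum_subtractf)
  qed
  hence "nsq M (%z. f z - (?S n z))
   = nsq M (%z. SUM k<L. D k z * ?r k z)"
   unfolding nsq_def by (intro bint_cong) simp
  also have "... = (SUM k<L. nsq M (%z. D k z * ?r k z))" by (rule nsq_split[OF sr])
  also have "... <= (SUM k<L. nsq M (?r k))" by (intro sum_mono nsq_D_le sr)
  finally show ?thesis .
 qed
 have "(%n. SUM k<L. nsq M (?r k n)) ~~> (SUM k<L. 0)"
  by (intro tendsto_sum onb_expansion[OF onb] sq_D f)
 hence lim: "(%n. SUM k<L. nsq M (?r k n)) ~~> 0" by simp
 show "(%n. nsq M (%z. f z - (?S n z))) ~~> 0"
  by (rule tendsto_sandwich[OF _ _ tendsto_const lim]) (use eq in "auto intro!: always_eventually")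
qed

end

lemma (in complex_banach) GN_reindex:
 assumes inj: "inj_on r {..<m}" and r: "!!i. i < m ==> r i < length ys"
 shows "GN (map (%i. ys ! r i) [0..<m]) <= GN ys"
proof -
 define a where "a k i = (if k = r i then 1 else 0 :: complex)" for k i
 have "GN (map (%i. SUM k<length ys. a k i .* ys ! k) [0..<m]) <= GN ys"
 proof (rule GN_contraction, goal_cases)
  case (1 c)
  have "(SUM k<length ys. (cmod (SUM j<m. a k j * c j))^2) = (SUM k:r ` {..<m}. (cmod (SUM j<m. a k j * c j))^2)"
  proof (rule sum.mono_neutral_right)
   show "ALL k:{..<length ys} - r ` {..<m}. (cmod (SUM j<m. a k j * c j))^2 = 0"
    by (auto simp: a_def intro!: sum.neutral)
  qed (use r in auto)
  also have "... = (SUM i<m. (cmod (SUM j<m. a (r i) j * c j))^2)" by (simp add: sum.reindex[OF inj])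
  also have "... = (SUM i<m. (cmod (c i))^2)"
  proof (rule sum.cong[OF refl], goal_cases)
   case i: (1 i)
   have "(SUM j<m. a (r i) j * c j) = (SUM j<m. if i = j then c j else 0)"
    using i inj by (intro sum.cong refl) (auto simp: a_def dest: inj_onD)
   thus ?case using i by simp
  qed
  finally show ?case by simp
 qed
 also have "map (%i. SUM k<length ys. a k i .* ys ! k) [0..<m] = map (%i. ys ! r i) [0..<m]"
 proof (intro map_cong refl, goal_cases)
  case i: (1 i)
  have "(SUM k<length ys. a k i .* ys ! k) = (SUM k<length ys. if k = r i then ys ! k else 0)"
   by (intro sum.cong) (auto simp: a_def scaleCJ_def)
  thus ?case using r i by simp
 qed
 finally show ?thesis .
qed

text \<open>Passing from \<open>n\<close> to \<open>n'\<close> renumbers the vectors and adds new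
  ones; the order of the Gaussians is immaterial.\<close>

lemma (in level_split) GN_fsp_mono:
 assumes "complex_banach J" "n <= n'"
 shows "complex_banach.GN J (map (%i. S (i div n) (fsp n i)) [0..<L * n]) <= complex_banach.GN J (map (%i. S (i div n') (fsp n' i)) [0..<L * n'])"
proof -
 interpret complex_banach J by fact
 let ?ys = "map (%i. S (i div n') (fsp n' i)) [0..<L * n']"
 define r where "r i = (i div n) * n' + i mod n" for i
 show ?thesis
 proof (cases "n = 0")
  case False
  hence n: "0 < n" "0 < n'" using assms by auto
  have mn: "i mod n < n'" for i using n assms(2) mod_less_divisor[of n i] by linarith
  have dm: "r i div n' = i div n" "r i mod n' = i mod n" for i using mn[of i] by (auto simp: r_def)
  have rl: "r i < L * n'" if "i < L * n" for i
  proof -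
   have "i div n < L" using that by (simp add: less_mult_imp_div_less)
   hence "r i div n' < L" unfolding dm .
   thus ?thesis using n by (simp add: div_less_iff_less_mult)
  qed
  have "inj_on r {..<L * n}"
  proof (rule inj_onI)
   fix i j assume "r i = r j"
   hence "i div n = j div n" "i mod n = j mod n" using dm by metis+
   thus "i = j" by (metis div_mult_mod_eq)
  qed
  hence "GN (map (%i. ?ys ! r i) [0..<L * n]) <= GN ?ys" using rl by (intro GN_reindex) auto
  also have "map (%i. ?ys ! r i) [0..<L * n] = map (%i. S (i div n) (fsp n i)) [0..<L * n]"
   using rl by (auto simp: dm fsp_def)
  finally show ?thesis .
 qed (simp add: GN_Nil)
qed

section \<open>Shifted dyadic grids\<close>

lemma floor_gap:
 fixes u d :: real
 assumes far: "!!j::int. \<bar>u - of_int j\<bar> >= 1 / 6" and d: "\<bar>d\<bar> < 1 / 6"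
 shows "\<lfloor>u + d\<rfloor> = \<lfloor>u\<rfloor>"
 using far[of "\<lfloor>u\<rfloor>"] far[of "\<lfloor>u\<rfloor> + 1"] d by (intro floor_unique) linarith+

text \<open>The grids \<open>\<int>\<close> and \<open>\<int> + 2\<^sup>k / 3\<close> stay at distance \<open>1/3\<close> from each other.\<close>
lemma floor_gap_shift:
 fixes u d :: real and j :: int
 assumes near: "\<bar>u - of_int j\<bar> < 1 / 6" and d: "\<bar>d\<bar> < 1 / 6"
 shows "\<lfloor>u - 2 ^ k / 3 + d\<rfloor> = \<lfloor>u - 2 ^ k / 3\<rfloor>"
proof (rule floor_gap[OF _ d], goal_cases)
 case (1 l)
 have "~ (3::int) dvd 2 ^ k"
 proof
  assume "(3::int) dvd 2 ^ k"
  hence "(3::int) dvd 2" by (intro prime_dvd_power[of 3 2 k]) (simp_all add: prime_int_numeral_eq)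
  thus False by presburger
 qed
 hence "3 * (j - l) - 2 ^ k ~= 0" by (metis dvd_triv_left eq_iff_diff_eq_0)
 hence "1 <= \<bar>3 * (j - l) - 2 ^ k\<bar>" by linarith
 hence "real_of_int 1 <= real_of_int \<bar>3 * (j - l) - 2 ^ k\<bar>" by (rule of_int_le_iff[THEN iffD2])
 hence "1 / 3 <= \<bar>of_int j - of_int l - 2 ^ k / (3::real)\<bar>" 
 proof -
  assume "real_of_int 1 <= real_of_int \<bar>3 * (j - l) - 2 ^ k\<bar>"
  hence "1 <= \<bar>3 * (real_of_int j - real_of_int l) - 2 ^ k\<bar>" by simp
  moreover have "3 * (real_of_int j - real_of_int l) - 2 ^ k = 3 * (of_int j - of_int l - 2 ^ k / (3::real))" by simp
  ultimately have "1 <= \<bar>3 * (of_int j - of_int l - 2 ^ k / (3::real))\<bar>" by (simp only:)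
  moreover have "1 / 3 <= Y" if "1 <= 3 * Y" for Y :: real using that by simp
  ultimately show ?thesis unfolding abs_mult abs_numeral by blast
 qed
 thus ?case using near by linarith
qed

text \<open>Both offsets keep the interval from \<open>- S/3\<close> to \<open>S/3\<close> inside
  the top cell from 0 to \<open>S\<close> (\<open>ball_Top\<close>), and they differ by a third of
  the top side.\<close>

definition off :: "real => ('n => bool) => 'n => real" where
 "off S s i = 2 * S / 3 - (if s i then S / 3 else 0)"

text \<open>Index of the cube of side \<open>S / 2\<^sup>k\<close> containing \<open>x\<close> in the dyadic grid shifted by a third of the
 top side length along the coordinates selected by \<open>s\<close>.\<close>
definition pq :: "real => ('n => bool) => nat => real ^ ('n::finite) => 'n => int" where
 "pq S s k x = (%i. \<lfloor>(x $ i + off S s i) * 2 ^ k / S\<rfloor>)"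

definition Top :: "real => ('n => bool) => (real ^ ('n::finite)) set" where
 "Top S s = {x. pq S s 0 x = (%_. 0)}"

text \<open>The coordinate comes within a sixth of a cell of a wall of the unshifted grid; exactly
  then the shifted grid will be chosen.\<close>

definition near :: "real => nat => real ^ ('n::finite) => 'n => bool" where
 "near S k y i <-> (EX j::int. \<bar>(y $ i + 2 * S / 3) * 2 ^ k / S - of_int j\<bar> < 1 / 6)"

text \<open>One third trick, coordinate by coordinate: a point near a wall of one grid is far from
  all walls of the other, so a ball whose radius is a sixth of the side stays inside one
  cell.\<close>

lemma pq_ball:
 fixes x y :: "real ^ ('n::finite)"
 assumes S: "0 < S" and s: "!!i. s i = near S k y i" and d: "dist x y < S / 2 ^ k / 6"
 shows "pq S s k x = pq S s k y"
proof (rule ext)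
 fix i
 define u where "u = (y $ i + 2 * S / 3) * 2 ^ k / S"
 define de where "de = (x $ i - y $ i) * 2 ^ k / S"
 have "\<bar>x $ i - y $ i\<bar> <= dist x y" using component_le_norm_cart[of "x - y" i] by (simp add: dist_norm)
 hence "\<bar>x $ i - y $ i\<bar> < S / 2 ^ k / 6" using d by linarith
 hence "\<bar>x $ i - y $ i\<bar> * (2 ^ k / S) < S / 2 ^ k / 6 * (2 ^ k / S)" using S by (intro mult_strict_right_mono) auto
 hence de: "\<bar>de\<bar> < 1 / 6" using S by (simp add: de_def abs_mult)
 show "pq S s k x i = pq S s k y i"
 proof (cases "s i")
  case True
  then obtain j :: int where j: "\<bar>u - of_int j\<bar> < 1 / 6" using s by (auto simp: near_def u_def)
  have "(x $ i + off S s i) * 2 ^ k / S = u - 2 ^ k / 3 + de" "(y $ i + off S s i) * 2 ^ k / S = u - 2 ^ k / 3"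
   using True S by (auto simp: off_def u_def de_def field_simps)
  thus ?thesis unfolding pq_def using floor_gap_shift[OF j de, of k] by simp
 next
  case False
  hence j: "!!j::int. 1 / 6 <= \<bar>u - of_int j\<bar>" using s[of i] by (auto simp: near_def u_def not_less)
  have "(x $ i + off S s i) * 2 ^ k / S = u + de" "(y $ i + off S s i) * 2 ^ k / S = u"
   using False S by (auto simp: off_def u_def de_def field_simps)
  thus ?thesis unfolding pq_def using floor_gap[OF j de] by simp
 qed
qed

lemma pq_nest: "i <= j ==> pq S s j x = pq S s j y ==> pq S s i x = pq S s i y"
proof (rule ext)
 fix l assume ij: "i <= j" and e: "pq S s j x = pq S s j y"
 have "pq S s i x l = pq S s j x l div 2 ^ (j - i)" for x
 proof -
  obtain d where d: "j = i + d" using le_Suc_ex[OF ij] by blast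
  have "(x $ l + off S s l) * 2 ^ i / S = (x $ l + off S s l) * 2 ^ j / S / real_of_int (2 ^ (j - i))"
   unfolding d by (simp add: power_add)
  thus ?thesis unfolding pq_def using floor_divide_real_eq_div[of "2 ^ (j - i)" "(x $ l + off S s l) * 2 ^ j / S"] by simp
 qed
 thus "pq S s i x l = pq S s i y l" using e by simp
qed

lemma Top_range:
 assumes S: "0 < S" and x: "x : Top S s"
 shows "0 <= pq S s k x i" "pq S s k x i < 2 ^ k"
proof -
 have "pq S s 0 x i = 0" using x by (simp add: Top_def)
 hence "\<lfloor>(x $ i + off S s i) / S\<rfloor> = 0" by (simp add: pq_def)
 hence "0 <= (x $ i + off S s i) / S" "(x $ i + off S s i) / S < 1" by (auto simp: floor_eq_iff)
 hence "0 <= (x $ i + off S s i) / S * 2 ^ k" "(x $ i + off S s i) / S * 2 ^ k < 1 * 2 ^ k"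
  by (intro mult_nonneg_nonneg mult_strict_right_mono; simp)+
 hence "0 <= (x $ i + off S s i) * 2 ^ k / S" "(x $ i + off S s i) * 2 ^ k / S < of_int (2 ^ k)" by (auto simp: field_simps)
 thus "0 <= pq S s k x i" "pq S s k x i < 2 ^ k" unfolding pq_def by (simp, subst floor_less_iff)
qed

lemma finite_pq_Top: "0 < S ==> finite (pq S s k ` Top S s)" for s :: "'n::finite => bool"
proof (rule finite_subset)
 assume S: "0 < S"
 show "pq S s k ` Top S s <= (UNIV \<rightarrow>\<^sub>E {0..<2 ^ k})" using Top_range[OF S, of _ s k] by (auto simp: PiE_iff)
qed (auto intro!: finite_PiE)

lemma cell_sets: "{x. pq S s k x = c} : sets borel" for s :: "'n::finite => bool"
proof -
 have "{x. pq S s k x = c} = (\<Inter>i. {x. \<lfloor>(x $ i + off S s i) * 2 ^ k / S\<rfloor> = c i})" by (auto simp: pq_def fun_eq_iff)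
 moreover have "{x :: real ^ 'n. \<lfloor>(x $ i + off S s i) * 2 ^ k / S\<rfloor> = c i} : sets borel" for i
 proof -
  have [measurable]: "(%x :: real ^ 'n. x $ i) : bm borel" by (intro bm_cont)
  have "{x : space borel. \<lfloor>(x $ i + off S s i) * 2 ^ k / S\<rfloor> = c i} : sets (borel :: (real ^ 'n) measure)" by measurable
  thus ?thesis by simp
 qed
 ultimately show ?thesis by (auto intro!: sets.countable_INT'' )
qed

lemma Top_sets: "Top S s : sets borel"
 unfolding Top_def by (rule cell_sets)

lemma cell_measure:
 fixes s :: "'n::finite => bool"
 assumes S: "0 < S"
 shows "emeasure lborel {x. pq S s k x = c} <= en ((S / 2 ^ k) ^ CARD('n))"
proof -
 define si where "si = S / 2 ^ k"
 have si: "si > 0" using S by (simp add: si_def)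
 define a :: "real ^ 'n" where "a = (\<chi> i. of_int (c i) * si - off S s i)"
 define b :: "real ^ 'n" where "b = (\<chi> i. of_int (c i) * si - off S s i + si)"
 have "{x. pq S s k x = c} <= cbox a b"
 proof
  fix x assume x: "x : {x. pq S s k x = c}"
  have "a $ i <= x $ i & x $ i <= b $ i" for i
  proof -
   have "\<lfloor>(x $ i + off S s i) / si\<rfloor> = c i" using x by (auto simp: pq_def si_def)
   hence "of_int (c i) <= (x $ i + off S s i) / si" "(x $ i + off S s i) / si < of_int (c i) + 1" by (auto simp: floor_eq_iff)
   thus ?thesis using si by (simp add: a_def b_def field_simps)
  qed
  thus "x : cbox a b" by (simp add: mem_box_cart)
 qed
 hence "emeasure lborel {x. pq S s k x = c} <= emeasure lborel (cbox a b)" by (rule emeasure_mono) simp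
 also have "... = en (PROD j:Basis. (b - a) \<bullet> j)"
  using si by (intro emeasure_lborel_cbox) (auto simp: Basis_vec_def inner_axis a_def b_def)
 also have "(PROD j:Basis. (b - a) \<bullet> j) = (PROD j:(Basis :: (real ^ 'n) set). si)"
  by (intro prod.cong) (auto simp: Basis_vec_def inner_axis a_def b_def)
 finally show ?thesis by (simp add: si_def)
qed

lemma ball_Top: "ball 0 (S / 3) <= Top S s" for s :: "'n::finite => bool"
proof
 fix x :: "real ^ 'n" assume x: "x : ball 0 (S / 3)"
 hence "norm x < S / 3" by simp
 moreover have "0 <= norm x" by simp
 ultimately have S: "0 < S" by linarith
 have "pq S s 0 x i = 0" for i
 proof -
  have "\<bar>x $ i\<bar> < S / 3" using component_le_norm_cart[of x i] `norm x < S / 3` by linarith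
  thus ?thesis using S unfolding pq_def by (auto simp: floor_eq_iff off_def field_simps)
 qed
 thus "x : Top S s" by (auto simp: Top_def)
qed

text \<open>The scale at height \<open>t\<close> has \<open>S / 2^k <= 12 bt t < 2 S / 2^k\<close>
  (\<open>lev_bounds\<close>). The 12 puts the radius \<open>bt t\<close> below a sixth of the side,
  as \<open>pq_ball\<close> asks; the minimum keeps the number of levels finite.\<close>

definition lev :: "real => real => nat => ('n::finite) uhs => nat" where
 "lev S bt L z = min (L - 1) (LEAST k. S / 2 ^ k <= 12 * bt * snd z)"

lemma lev_bounds:
 assumes "0 < S" and top: "12 * bt * snd z < S" and bot: "S / 2 ^ (L - 1) <= 12 * bt * snd z"
 shows "S / 2 ^ lev S bt L z <= 12 * bt * snd z" "12 * bt * snd z < 2 * (S / 2 ^ lev S bt L z)"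
proof -
 define k where "k = (LEAST k. S / 2 ^ k <= 12 * bt * snd z)"
 have kL: "k <= L - 1" unfolding k_def by (rule Least_le[of "%k. S / 2 ^ k <= 12 * bt * snd z", OF bot])
 have k: "S / 2 ^ k <= 12 * bt * snd z" unfolding k_def by (rule LeastI[of "%k. S / 2 ^ k <= 12 * bt * snd z", OF bot])
 have "k ~= 0" using k top by (intro notI) simp
 then obtain k' where k': "k = Suc k'" by (cases k) auto
 have "~ S / 2 ^ k' <= 12 * bt * snd z" using not_less_Least[of k' "%k. S / 2 ^ k <= 12 * bt * snd z"] k' by (simp add: k_def)
 moreover have "lev S bt L z = k" using kL by (simp add: lev_def k_def[symmetric])
 ultimately show "S / 2 ^ lev S bt L z <= 12 * bt * snd z" "12 * bt * snd z < 2 * (S / 2 ^ lev S bt L z)"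
  using k k' by (auto simp: not_le)
qed

lemma measurable_snd_uhs[measurable]: "snd : bm (uhs :: ('n::finite) uhs measure)"
 and measurable_fst_uhs[measurable]: "fst : bm (uhs :: ('n::finite) uhs measure)"
 by (rule measurable_uhs[OF borel_fst_snd(2)], rule measurable_uhs[OF borel_fst_snd(1)])

lemma lev_sets: "{z : space uhs. lev S bt L z = k} : sets (uhs :: ('n::finite) uhs measure)"
 unfolding lev_def by measurable

lemma lev_less: "0 < L ==> lev S bt L z < L"
 using min.cobounded1[of "L - 1" "LEAST k. S / 2 ^ k <= 12 * bt * snd z"] unfolding lev_def by linarith

text \<open>The points for which the shift pattern \<open>s\<close> is the right one; the finitely
  many patterns partition the half space.\<close>

definition Zs :: "real => real => nat => ('n => bool) => ('n::finite) uhs set" where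
 "Zs S bt L s = {z : space uhs. ALL i. s i = near S (lev S bt L z) (fst z) i}"

lemma Zs_sets[measurable]: "Zs S bt L s : sets (uhs :: ('n::finite) uhs measure)"
proof -
 have [measurable]: "(%y :: real ^ 'n. y $ i) : bm borel" for i by (intro bm_cont)
 have [measurable]: "(%z :: 'n uhs. fst z $ i) : bm uhs" for i by (rule measurable_compose[OF measurable_fst_uhs]) measurable
 have n: "{z : space uhs. s i = near S k (fst z) i} : sets (uhs :: 'n uhs measure)" for k i
  unfolding near_def by measurable
 have eq: "Zs S bt L s = (UN k. {z : space uhs. lev S bt L z = k} Int (\<Inter>i. {z : space uhs. s i = near S k (fst z) i}))"
  by (auto simp: Zs_def)
 moreover have "(\<Inter>i. {z : space uhs. s i = near S k (fst z) i}) : sets (uhs :: 'n uhs measure)" for k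
  by (intro sets.finite_INT n) auto
 ultimately show ?thesis unfolding eq by (intro sets.countable_UN'' sets.Int lev_sets) auto
qed

text \<open>Supplies the embedding that \<open>umd_transfer\<close> asks for: indices modulo 3 store
  the coordinates of the vector and the real and imaginary parts of the Gaussians.\<close>

lemma inj_cart_seq: "EX io :: (real ^ ('n::finite)) \<times> (nat => complex) => nat => real. inj io"
proof -
 obtain g :: "'n => nat" where g: "inj g" using finite_imp_inj_to_nat_seg[OF finite_class.finite_UNIV] by blast
 define io where "io p = (%k. if k mod 3 = 0 then fst p $ inv g (k div 3) else if k mod 3 = 1 then Re (snd p (k div 3)) else Im (snd p (k div 3)))"
  for p :: "(real ^ 'n) \<times> (nat => complex)"
 have "inj io"
 proof (rule injI)
  fix p q assume e: "io p = io q"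
  have "fst p $ i = fst q $ i" for i
   using fun_cong[OF e, of "3 * g i"] g by (simp add: io_def inv_f_f)
  moreover have "snd p k = snd q k" for k
  proof -
   have dm: "(3 * k + 1) div 3 = k" "(3 * k + 1) mod 3 = 1" "(3 * k + 2) div 3 = k" "(3 * k + 2) mod 3 = 2"
    by presburger+
   show ?thesis
    using fun_cong[OF e, of "3 * k + 1"] fun_cong[OF e, of "3 * k + 2"] unfolding io_def dm by (simp add: complex_eq_iff)
  qed
  ultimately show "p = q" by (auto simp: prod_eq_iff vec_eq_iff)
 qed
 thus ?thesis by blast
qed

lemma epowr_sum_le:
 assumes "finite A" "0 <= r"
 shows "epowr (SUM a:A. f a) r <= en ((2 powr r) ^ card A) * (SUM a:A. epowr (f a) r)"
 using assms(1)
proof (induction A)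
 case (insert a A)
 have two: "1 <= (2::real) powr r" using assms(2) by (simp add: ge_one_powr_ge_zero)
 hence c1: "1 <= (2 powr r) ^ card A" by simp
 have "epowr (SUM a:insert a A. f a) r <= en (2 powr r) * (epowr (f a) r + epowr (SUM a:A. f a) r)"
  using insert epowr_add_le[OF assms(2), of "f a" "SUM a:A. f a"] by simp
 also have "... <= en (2 powr r) * (en ((2 powr r) ^ card A) * epowr (f a) r + en ((2 powr r) ^ card A) * (SUM a:A. epowr (f a) r))"
 proof (intro mult_left_mono add_mono insert.IH)
  show "epowr (f a) r <= en ((2 powr r) ^ card A) * epowr (f a) r"
   using mult_right_mono[OF ennreal_leI[OF c1], of "epowr (f a) r"] by simp
 qed simp
 also have "... = en ((2 powr r) ^ card (insert a A)) * (SUM a:insert a A. epowr (f a) r)"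
  using insert two by (simp add: ennreal_mult distrib_left mult.assoc)
 finally show ?case .
qed simp

lemma (in complex_banach) measurable_GE:
 assumes f: "!!i. i < n ==> sm N (f i)" and [measurable]: "ph : bm borel"
 shows "(%x. GE (%v. ph (norm v)) (map (%i. f i x) [0..<n])) : bm N"
proof -
 have "sm (N \<otimes> gspace) (%z. SUM i<n. snd z i .* f i (fst z))"
 proof (intro sm_sum sm_scl)
  fix i assume "i : {..<n}"
  thus "sm (N \<otimes> gspace) (%z. f i (fst z))"
   by (intro sm_comp_measurable[OF f measurable_fst]) auto
  show "sm (N \<otimes> gspace) (%z. snd z i)"
   by (intro sm_of_borel measurable_compose[OF measurable_snd measurable_gspace_component])
 qed
 note [measurable] = sm_norm[OF this]
 show ?thesis unfolding GE_def sum_eq_gsum[symmetric]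
  by (rule gs.borel_measurable_nn_integral[of "%x om. ph (norm (SUM i<n. om i .* f i x))"])
   (simp add: split_beta')
qed

section \<open>Unions of sets and weights bounded below\<close>

context nfun
begin

lemma Qm_Un:
 assumes S: "S : sets M" "S' : sets M"
 shows "Qm m (ind (S Un S')) <= 2 * Qm m (ind S) + 2 * Qm m (ind S')"
proof -
 have eq: "ind (S Un S') = (%z. ind S z + ind (S' - S) z :: real)" by (auto simp: indicator_def)
 have w: "wt M (ind S)" "wt M (ind (S' - S))" using S by auto
 have "Qm m (ind (S Un S')) <= 2 * Qm m (ind S) + 2 * Qm m (ind (S' - S))"
  unfolding eq Qm_def[of m "%z. ind S z + ind (S' - S) z"]
 proof (rule SUP_least, goal_cases)
  case (1 n)
  have "Tw m (%z. ind S z + ind (S' - S) z) (e j) = Tw m (ind S) (e j) + Tw m (ind (S' - S)) (e j)" for j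
   unfolding Tw_def using bdl_lin[OF bdlT sq_int_we[OF w(1)] sq_int_we[OF w(2)], of m 1 j 1 j] by (simp add: algebra_simps)
  hence "GN (map (Tw m (%z. ind S z + ind (S' - S) z)) (map e [0..<n])) = GN (map (%j. Tw m (ind S) (e j) + Tw m (ind (S' - S)) (e j)) [0..<n])"
   by (simp add: comp_def)
  also have "... <= 2 * GN (map (Tw m (ind S)) (map e [0..<n])) + 2 * GN (map (Tw m (ind (S' - S))) (map e [0..<n]))"
   using GN_add_le[of "%j. Tw m (ind S) (e j)" "%j. Tw m (ind (S' - S)) (e j)"] by (simp add: comp_def)
  also have "... <= 2 * Qm m (ind S) + 2 * Qm m (ind (S' - S))"
   by (intro add_mono mult_left_mono Qm_ge) auto
  finally show ?case .
 qed
 also have "... <= 2 * Qm m (ind S) + 2 * Qm m (ind S')"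
  using S by (intro add_left_mono mult_left_mono Qm_mono) (auto simp: indicator_def)
 finally show ?thesis .
qed

lemma Q_Un: "S : sets M ==> S' : sets M ==> Q (ind (S Un S')) <= 2 * Q (ind S) + 2 * Q (ind S')"
 unfolding Q_def[of "ind (S Un S')"]
 by (intro SUP_least order_trans[OF Qm_Un] add_mono mult_left_mono) (auto simp: Q_def intro: SUP_upper)

lemma Qm_zero: "S : sets M ==> S Int K m = {} ==> Qm m (ind S) = 0"
proof -
 assume S: "S : sets M" "S Int K m = {}"
 have "Tw m (ind S) (e j) = 0" for j
 proof -
  have "Tw m (ind S) (e j) = T m (%_. 0)"
   unfolding Tw_def
  proof (rule wrep_eq[OF wrepT wrepT sq_int_we[OF wt_indicator[OF S(1)]] sq_int_zero], goal_cases)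
   case ph: (1 z ph)
   show ?case
    using S(2) by (auto simp: indicator_def cf_0[OF ph(2)])
  qed
  thus ?thesis by (simp add: bdl_zero[OF bdlT])
 qed
 hence "map (Tw m (ind S)) (map e [0..<n]) = replicate n 0 @ []" for n by (intro nth_equalityI) auto
 hence "GN (map (Tw m (ind S)) (map e [0..<n])) = 0" for n by (simp only: GN_zeros GN_Nil)
 thus ?thesis by (simp add: Qm_def)
qed

lemma Qm_UN:
 assumes "finite A" "!!a. a : A ==> S a : sets M"
 shows "Qm m (ind (UN a:A. S a)) <= 2 ^ card A * (SUM a:A. Qm m (ind (S a)))"
 using assms
proof (induction A)
 case empty
 have z: "Qm m (ind {}) = 0" by (rule Qm_zero) auto
 show ?case unfolding UN_empty z by simp
next
 case (insert a A)
 have "Qm m (ind (UN a:insert a A. S a)) <= 2 * Qm m (ind (S a)) + 2 * Qm m (ind (UN a:A. S a))"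
 proof -
  have "S a : sets M" "(UN a:A. S a) : sets M" using insert by (auto intro!: sets.finite_UN)
  from Qm_Un[OF this, of m] show ?thesis by simp
 qed
 also have "... <= 2 * (2 ^ card A * Qm m (ind (S a))) + 2 * (2 ^ card A * (SUM a:A. Qm m (ind (S a))))"
 proof (intro add_mono mult_left_mono insert.IH)
  have "1 * Qm m (ind (S a)) <= 2 ^ card A * Qm m (ind (S a))"
   by (intro mult_right_mono one_le_power) auto
  thus "Qm m (ind (S a)) <= 2 ^ card A * Qm m (ind (S a))" by simp
 qed (use insert in auto)
 also have "... = 2 ^ card (insert a A) * (SUM a:insert a A. Qm m (ind (S a)))"
  using insert by (simp add: distrib_left mult.assoc)
 finally show ?case .
qed

text \<open>The functions \<open>r e\<^sub>j\<close> with \<open>c u = v r\<close> on the support of the operator form a Bessel family.\<close>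
lemma Qm_lower_weight:
 assumes S: "S : sets M" and v: "wt M v" and c: "0 < c" and le: "!!z. z : S Int K m ==> c <= v z"
 shows "en (c^2) * Qm m (ind S) <= Qm m v"
proof -
 define r where "r z = ind (S Int K m) z * (c / v z)" for z
 have [measurable]: "S Int K m : sets M" "v : bm M" using S K(1) v by (auto intro: wt_measurable)
 have r: "wt M r"
  unfolding wt_def
 proof
  show "r : bm M" unfolding r_def[abs_def] by measurable
  have "\<bar>r z\<bar> <= 1" for z
  proof (cases "z : S Int K m")
   case True
   hence "c <= v z" "0 < v z" using le[of z] c by auto
   thus ?thesis using c True by (simp add: r_def)
  qed (simp add: r_def)
  thus "ALL z:space M. \<bar>r z\<bar> <= 1" by blast
 qed
 have "en (c^2) * GN (map (Tw m (ind S)) (map e [0..<n])) <= Qm m v" for n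
 proof -
  have "cor c .* Tw m (ind S) (e j) = Tw m v (%z. cor (r z) * e j z)" for j
  proof -
   have "cor c .* Tw m (ind S) (e j) = T m (%z. cor c * (cor (ind S z) * e j z))"
    unfolding Tw_def using bdl_sum[OF bdlT, of "{0::nat}" "%_ z. cor (ind S z) * e j z" m "%_. cor c"] sq_int_we[OF wt_indicator[OF S], of j] by simp
   also have "... = Tw m v (%z. cor (r z) * e j z)"
    unfolding Tw_def
   proof (rule wrep_eq[OF wrepT wrepT sq_int_cmult[OF sq_int_we[OF wt_indicator[OF S]]] sq_int_wt[OF v sq_int_we[OF r]]])
    fix z and ph :: "'x => complex" assume ph: "cfunctional J ph"
    show "cor c * (cor (ind S z) * e j z) * ph (ind (K m) z *R F z)
     = cor (v z) * (cor (r z) * e j z) * ph (ind (K m) z *R F z)"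
    proof (cases "z : K m")
     case True
     show ?thesis
     proof (cases "z : S")
      case s: True
      hence "v z * r z = c" using True le[of z] c by (simp add: r_def)
      hence "cor (v z) * cor (r z) = cor c" by (metis of_real_mult)
      thus ?thesis using s by (simp add: mult.assoc[symmetric])
     qed (simp add: r_def)
    qed (simp add: cf_0[OF ph])
   qed
   finally show ?thesis .
  qed
  hence "map (%x. cor c .* x) (map (Tw m (ind S)) (map e [0..<n])) = map (Tw m v) (map (%f z. cor (r z) * f z) (map e [0..<n]))"
   by simp
  moreover have "GN (map (Tw m v) (map (%f z. cor (r z) * f z) (map e [0..<n]))) <= Qm m v"
   using r by (intro Qm_bessel[OF v] bessel_mult onb_bessel onb) (auto simp: wt_def)
  ultimately have "GN (map (%x. cor c .* x) (map (Tw m (ind S)) (map e [0..<n]))) <= Qm m v" by metis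
  thus ?thesis unfolding GN_scale by simp
 qed
 thus ?thesis unfolding Qm_def[of m "ind S"] by (simp add: SUP_mult_left_ennreal SUP_least)
qed

end

context uhsfun
begin

text \<open>Stein's inequality on the normalised top cube for the indicators of cones of aperture
  \<open>al\<close>. At a point of height \<open>t\<close> in the wide cone and in
  \<open>Zs S bt L s\<close>, the averaging cube contains both \<open>x\<close> and a ball of radius
  \<open>al t\<close>. Its side is at most \<open>12 bt t\<close>, so the average is at least
  \<open>c\<close>. \<open>S\<close> is large enough for all heights in \<open>KF F m\<close> and
  all vertices whose cones meet it; \<open>L\<close> reaches the smallest scale.\<close>

lemma aperture_grid:
 fixes s :: "'n => bool"
 assumes U: "umd_const TYPE('x) p b" and p: "1 < p" and al: "0 < al" "al <= bt"
  and C1: "!!xs. GE (np p) xs <= en C1 * epowr (GN xs) (p / 2)"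
  and C2: "!!xs. epowr (GN xs) (p / 2) <= en C2 * GE (np p) xs"
  and c_def: "c = unit_ball_vol (real CARD('n)) * (al / (12 * bt)) ^ CARD('n)"
  and S_def: "S = 12 * (1 + bt) * (real m + 1)" and L: "0 < L" "S / 2 ^ (L - 1) <= 12 * bt / (real m + 1)"
 shows "(LN x. epowr (en (c^2) * Qm m (ind (cone bt x Int Zs S bt L s))) (p / 2))
  <= en C2 * (en (b powr p) + 1) * en C1 * (LN x. epowr (Qm m (ind (cone al x))) (p / 2))"
proof -
 let ?q = "%x. epowr (Qm m (ind (cone al x))) (p / 2)"
 have bt: "0 < bt" using al by simp
 have S0: "0 < S" unfolding S_def using bt by (intro mult_pos_pos) auto
 have c0: "0 < c" unfolding c_def using al bt by (intro mult_pos_pos) auto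
 let ?T = "Top S s :: (real ^ 'n) set"
 let ?lev = "lev S bt L :: 'n uhs => nat"
 interpret LS: level_split uhs e ?lev L
  by unfold_locales (use onb lev_sets lev_less[OF L(1)] in auto)
 have Tb[measurable]: "?T : sets borel" by (rule Top_sets)
 have T0: "emeasure lborel ?T ~= 0"
 proof -
  have "0 < emeasure lborel (ball (0 :: real ^ 'n) (S / 3))" using S0 by (intro emeasure_ball_pos) auto
  also have "... <= emeasure lborel ?T" by (intro emeasure_mono ball_Top) simp
  finally show ?thesis by simp
 qed
 have Tfin: "emeasure lborel ?T ~= \<infinity>"
  using cell_measure[OF S0, of s 0 "%_. 0"] unfolding Top_def by (auto simp: top_unique)
 define mu where "mu = uniform_measure lborel ?T"
 interpret mu: prob_space mu unfolding mu_def by (rule prob_space_uniform_measure[OF T0 Tfin])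
 have sp[simp]: "space mu = UNIV" and se[measurable_cong]: "sets mu = sets borel" by (auto simp: mu_def)
 \<comment> \<open>The complement of the top cube, which has mass 0, becomes one extra cell, so that
   there are finitely many labels on the whole space. By \<open>Top_range\<close> the label -1 does
   not occur inside.\<close>
 define Pi where "Pi k x = (if x : ?T then pq S s k x else (%_. -1))" for k x
 have Pi_T: "Pi k y = Pi k x <-> pq S s k y = pq S s k x" if x: "x : ?T" for x y k
 proof
  assume e: "Pi k y = Pi k x"
  have "y : ?T"
  proof (rule ccontr)
   assume "y ~: ?T"
   hence "pq S s k x = (%_. -1)" using e x by (simp add: Pi_def)
   hence "pq S s k x undefined = -1" by simp
   thus False using Top_range(1)[OF S0 x, of k undefined] by simp
  qed
  thus "pq S s k y = pq S s k x" using e x by (simp add: Pi_def)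
 next
  assume e: "pq S s k y = pq S s k x"
  hence "pq S s 0 y = pq S s 0 x" by (rule pq_nest[rotated]) simp
  hence "y : ?T" using x by (simp add: Top_def)
  thus "Pi k y = Pi k x" using e x by (simp add: Pi_def)
 qed
 have Pi_fin: "finite (Pi k ` space mu)" for k
  by (rule finite_subset[of _ "insert (%_. -1) (pq S s k ` ?T)"]) (auto simp: Pi_def finite_pq_Top[OF S0])
 have Pi_sets: "{x:space mu. Pi k x = d} : sets mu" for k d
 proof -
  have "{x:space mu. Pi k x = d} = ?T Int {x. pq S s k x = d} Un (if d = (%_. -1) then - ?T else {})"
   by (auto simp: Pi_def)
  moreover have "?T Int {x. pq S s k x = d} Un (if d = (%_. -1) then - ?T else {}) : sets borel"
   using cell_sets[of S s k d] Tb by (auto intro!: sets.Un borel_comp)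
  ultimately show ?thesis by (simp add: se)
 qed
 have Pi_nest: "Pi i x = Pi i y" if "i <= j" "Pi j x = Pi j y" for i j x y
 proof (cases "x : ?T")
  case True
  thus ?thesis using Pi_T[OF True, of _ y] pq_nest[OF that(1), of S s y x] that(2) by metis
 next
  case False
  hence "y ~: ?T" using Pi_T[of y j x] that(2) Pi_T[of y 0 x] pq_nest[of 0 j S s x y] by (auto simp: Top_def)
  thus ?thesis using False by (simp add: Pi_def)
 qed
 define u where "u x z = (ind (cone al x) z :: real)" for x :: "real ^ 'n" and z
 have um: "(%(x, z). u x z) : bm (mu \<otimes> uhs)"
  unfolding u_def measurable_cong_sets[OF sets_pair_measure_cong[OF se refl] refl] by (rule measurable_cone_indicator)
 define W where "W k x z = LI mu (%y. ind {y:space mu. Pi k y = Pi k x} y * u y z) / measure mu {y:space mu. Pi k y = Pi k x}" for k x z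
 let ?bb = "%n x. map (%i. T m (%z. cor (W (i div n) x z) * LS.fsp n i z)) [0..<L * n]"
 obtain io :: "(real ^ 'n) \<times> (nat => complex) => nat => real" where io: "inj io" using inj_cart_seq by blast
 let ?E = "%v. np p v"
 have SA: "NI mu (%x. GE ?E ((?bb n x)))
  <= (en (b powr p) + 1) * NI mu (%x. GE ?E (map (%i. T m (%z. cor (u x z) * LS.fsp n i z)) [0..<L * n]))"
  and SW: "k < L * n ==> wt uhs (W (k div n) x)"
  and SM: "k < L * n ==> sm mu (%x. T m (%z. cor (W (k div n) x z) * LS.fsp n k z))" for n k x
  \<comment> \<open>Vector \<open>i\<close> is averaged over the partition of its level
    \<open>i div n\<close>, which is monotone in \<open>i\<close>.\<close>
  by (rule stein_avg[OF wrepT bdlT fr sigma_finite_uhs mu.prob_space_axioms Pi_fin Pi_sets Pi_nest um _ _ LS.sq_fsp W_def U p io];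
   (simp add: u_def div_le_mono)?)+
 have wW: "wt uhs (W k x)" if "k < L" for k x using SW[of k 1 x] that by simp
 define Wx where "Wx x z = W (?lev z) x z" for x z
 have wWx: "wt uhs (Wx x)" for x
  unfolding wt_def
 proof
  note [measurable] = lev_sets
  have ms: "(%z. SUM k<L. ind {z:space uhs. ?lev z = k} z * W k x z) : bm uhs"
   by (intro borel_measurable_sum borel_measurable_times borel_measurable_indicator lev_sets wt_measurable[OF wW]) auto
  have eq: "(SUM k<L. ind {z:space uhs. ?lev z = k} z * W k x z) = Wx x z" if z: "z : space uhs" for z
  proof -
   have "(SUM k<L. ind {z:space uhs. ?lev z = k} z * W k x z) = (SUM k<L. if k = ?lev z then W k x z else 0)"
    using z by (intro sum.cong refl) (auto simp: indicator_def)
   also have "... = Wx x z" using lev_less[OF L(1), of S bt z] by (simp add: Wx_def)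
   finally show ?thesis .
  qed
  show "Wx x : bm uhs"
   by (rule measurable_cong[THEN iffD1, OF eq ms])
  show "ALL z:space uhs. \<bar>Wx x z\<bar> <= 1"
  proof
   fix z :: "'n uhs" assume z: "z : space uhs"
   have "wt uhs (W (?lev z) x)" by (rule wW[OF lev_less[OF L(1)]])
   thus "\<bar>Wx x z\<bar> <= 1" using z unfolding Wx_def wt_def by blast
  qed
 qed
 define B where "B n x = GN ((?bb n x))" for n x
 let ?M = "%x. SUP n. epowr (B n x) (p / 2)"
 \<comment> \<open>The piece \<open>LS.fsp n i\<close> lives on level \<open>i div n\<close>, where
   \<open>Wx\<close> agrees with \<open>W (i div n)\<close>: the averages at different scales merge
   into one weight.\<close>
 have B_eq: "B n x = GN (map (Tw m (Wx x)) (map (LS.fsp n) [0..<L * n]))" for n x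
 proof -
  have "T m (%z. cor (W (i div n) x z) * LS.fsp n i z) = Tw m (Wx x) (LS.fsp n i)" if i: "i < L * n" for i
   unfolding Tw_def
  proof (rule T_cong[OF sq_int_wt[OF wW LS.sq_fsp] sq_int_wt[OF wWx LS.sq_fsp]])
   show "i div n < L" using i by (simp add: less_mult_imp_div_less)
   show "cor (W (i div n) x z) * LS.fsp n i z = cor (Wx x z) * LS.fsp n i z" for z
    by (cases "?lev z = i div n") (auto simp: Wx_def LS.fsp_def LS.D_def)
  qed
  hence "(?bb n x) = map (Tw m (Wx x)) (map (LS.fsp n) [0..<L * n])" by simp
  thus ?thesis unfolding B_def by (rule arg_cong)
 qed
 have Bm[measurable]: "B n : bm mu" for n
  unfolding B_def[abs_def] by (rule measurable_GN) (rule SM)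
 have Binc: "incseq B"
  unfolding incseq_def le_fun_def B_def
  using LS.GN_fsp_mono[OF complex_banach_axioms, of _ _ "%k f. T m (%z. cor (W k x z) * f z)" for x] by blast
 have KF: "norm (fst z) <= real m" "1 / (real m + 1) <= snd z" "snd z <= real m" "0 < snd z" if "z : KF F m" for z
  using that box_uhs_pos[of z m] by (auto simp: KF_def box_uhs_def)
 have lower: "c <= Wx x z" if x: "x : ?T" and z: "z : cone bt x Int Zs S bt L s Int KF F m" for x z
 proof -
  define k where "k = ?lev z"
  let ?D = "ball (fst z) (al * snd z)"
  define si where "si = S / 2 ^ k"
  have si: "si > 0" using S0 by (simp add: si_def)
  note zK = KF[of z]
  have zt: "0 < snd z" using z zK by blast
  have lb: "si <= 12 * bt * snd z" "12 * bt * snd z < 2 * si"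
  proof -
   have "12 * bt * snd z <= 12 * bt * (real m + 1)" using zK(3) z bt by (intro mult_left_mono) auto
   also have "... < S" unfolding S_def by (intro mult_strict_right_mono) auto
   finally have 1: "12 * bt * snd z < S" .
   have "12 * bt / (real m + 1) = 12 * bt * (1 / (real m + 1))" by simp
   also have "... <= 12 * bt * snd z" using zK(2) z bt by (intro mult_left_mono) auto
   finally have 2: "S / 2 ^ (L - 1) <= 12 * bt * snd z" using L(2) by linarith
   show "si <= 12 * bt * snd z" "12 * bt * snd z < 2 * si"
    unfolding si_def k_def by (rule lev_bounds[OF S0 1 2])+
  qed
  have b6: "bt * snd z < si / 6" using lb(2) by simp
  have a6: "al * snd z <= bt * snd z" using al(2) zt by (intro mult_right_mono) auto
  have near: "s i = near S k (fst z) i" for i using z by (auto simp: Zs_def k_def)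
  have cellz: "pq S s k y = pq S s k (fst z)" if "dist y (fst z) < bt * snd z" for y
   using b6 that by (intro pq_ball[OF S0 near]) (simp add: si_def)
  have xz: "pq S s k x = pq S s k (fst z)" using z by (intro cellz) (auto simp: cone_def dist_commute)
  define C where "C = {y. pq S s k y = pq S s k x}"
  have CC: "{y:space mu. Pi k y = Pi k x} = C" using Pi_T[OF x, of k] by (auto simp: C_def)
  have Cb[measurable]: "C : sets borel" unfolding C_def by (rule cell_sets)
  have CT: "C <= ?T"
  proof
   fix y assume "y : C"
   hence "pq S s 0 y = pq S s 0 x" unfolding C_def by (intro pq_nest[of 0 k]) auto
   thus "y : ?T" using x by (simp add: Top_def)
  qed
  have bC: "?D <= C"
   using a6 cellz xz by (auto simp: C_def dist_commute)
  have num: "LI mu (%y. ind {y:space mu. Pi k y = Pi k x} y * u y z) = measure mu (?D)"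
  proof -
   have "LI mu (%y. ind {y:space mu. Pi k y = Pi k x} y * u y z) = LI mu (%y. ind (?D) y)"
    unfolding CC using bC zt by (intro bint_cong) (auto simp: indicator_def u_def cone_def)
   thus ?thesis by (simp add: se)
  qed
  have ml: "measure mu A = measure lborel A / measure lborel ?T" if "A <= C" "A : sets borel" for A
  proof -
   have "?T Int A = A" using that CT by auto
   thus ?thesis unfolding mu_def using that(2) T0 Tfin by (subst measure_uniform_measure) auto
  qed
  have mT: "0 < measure lborel ?T" using T0 Tfin by (simp add: measure_def enn2real_positive_iff less_top zero_less_iff_neq_zero)
  have "Wx x z = measure lborel (?D) / measure lborel C"
   unfolding Wx_def k_def[symmetric] W_def num unfolding CC ml[OF bC borel_open[OF open_ball]] ml[OF order_refl Cb] using mT by simp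
  moreover have vol: "measure lborel (?D) = unit_ball_vol (real CARD('n)) * (al * snd z) ^ CARD('n)"
   using al(1) zt by (subst content_ball) auto
  moreover have Cle: "measure lborel C <= si ^ CARD('n)"
   using cell_measure[OF S0, of s k "pq S s k x"] si unfolding measure_def C_def si_def by (intro enn2real_leI) auto
  moreover have Cpos: "0 < measure lborel C"
  proof -
   have "measure lborel (?D) <= measure lborel C"
   proof (intro measure_mono_fmeasurable bC)
    have "emeasure lborel C < \<infinity>"
     using cell_measure[OF S0, of s k "pq S s k x"] unfolding C_def by (rule le_less_trans) simp
    thus "C : fmeasurable lborel" by (simp add: fmeasurable_def)
   qed simp
   moreover have "0 < measure lborel (?D)" unfolding vol using al(1) zt by (intro mult_pos_pos) auto
   ultimately show ?thesis by linarith
  qed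
  moreover have "c * si ^ CARD('n) <= unit_ball_vol (real CARD('n)) * (al * snd z) ^ CARD('n)"
  proof -
   have "al / (12 * bt) * si <= al / (12 * bt) * (12 * bt * snd z)" using lb(1) al(1) bt by (intro mult_left_mono) auto
   also have "... = al * snd z" using bt by simp
   finally have "(al / (12 * bt) * si) ^ CARD('n) <= (al * snd z) ^ CARD('n)"
    using al(1) bt si by (intro power_mono) auto
   hence "(al / (12 * bt)) ^ CARD('n) * si ^ CARD('n) <= (al * snd z) ^ CARD('n)"
    by (simp only: power_mult_distrib[of "al / (12 * bt)" si])
   thus ?thesis unfolding c_def mult.assoc by (rule mult_left_mono) simp
  qed
  moreover have "c * measure lborel C <= c * si ^ CARD('n)" using Cle c0 by (intro mult_left_mono) auto
  ultimately show "c <= Wx x z" by (simp add: pos_le_divide_eq)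
 qed
 have mQ: "(%x. (?q x)) : bm lborel"
  using measurable_epowr[OF measurable_Ac_m[of m al]] by simp
 have int_eq: "(LN x. f x * ind ?T x) = emeasure lborel ?T * NI mu (%x. f x)" if [measurable]: "f : bm borel" for f
  unfolding mu_def using T0 Tfin by (subst nn_integral_uniform_measure) (auto simp: ennreal_mult_divide_eq ennreal_times_divide mult.commute[of "emeasure lborel ?T"] ennreal_divide_times)
 let ?g = "%x. epowr (en (c^2) * Qm m (ind (cone bt x Int Zs S bt L s))) (p / 2)"
 have gB: "?g x * ind ?T x <= (?M x) * ind ?T x" for x
 proof (cases "x : ?T")
  case True
  have "en (c^2) * Qm m (ind (cone bt x Int Zs S bt L s)) <= Qm m (Wx x)"
   by (rule Qm_lower_weight[OF _ wWx c0 lower[OF True]]) auto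
  also have "... <= (SUP n. B n x)" unfolding B_eq by (rule Qm_le_frame[OF wWx LS.frame_fsp])
  finally have "?g x <= epowr (SUP n. B n x) (p / 2)" using p by (intro epowr_mono) auto
  also have "... = (?M x)" using p by (intro epowr_SUP) simp
  finally show ?thesis using True by simp
 qed simp
 \<comment> \<open>Outside the top cube \<open>norm x >= S / 3 >= (1 + bt) m\<close>, so the cone at
   \<open>x\<close> misses \<open>KF F m\<close>.\<close>
 have g0: "?g x = 0" if x: "x ~: ?T" for x
 proof -
  have nx: "S / 3 <= norm x" using x ball_Top[of S s] by (auto simp: not_less dest!: subsetD[of _ _ x])
  have "cone bt x Int Zs S bt L s Int KF F m = {}"
  proof (rule ccontr)
   assume "cone bt x Int Zs S bt L s Int KF F m ~= {}"
   then obtain z where z: "z : cone bt x" "z : KF F m" by blast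
   have "norm x <= norm (fst z) + dist (fst z) x" using norm_triangle_sub[of x "fst z"] by (simp add: dist_norm norm_minus_commute)
   also have "... < real m + bt * snd z" using z(1) KF(1)[OF z(2)] by (intro add_le_less_mono) (auto simp: cone_def)
   also have "... <= real m + bt * real m" using KF(3)[OF z(2)] bt by (intro add_left_mono mult_left_mono) auto
   also have "... <= S / 3" unfolding S_def using bt by (simp add: algebra_simps)
   finally show False using nx by simp
  qed
  thus ?thesis using Qm_zero[of "cone bt x Int Zs S bt L s" m] by simp
 qed
 have "(LN x. ?g x) = (LN x. ?g x * ind ?T x)"
  by (intro nn_integral_cong) (auto simp: indicator_def g0)
 also have "... <= (LN x. (?M x) * ind ?T x)" by (intro nn_integral_mono gB)
 also have "... = emeasure lborel ?T * NI mu (%x. (?M x))"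
  by (rule int_eq) (use Bm in "measurable")
 also have "NI mu (%x. (?M x)) = (SUP n. NI mu (%x. epowr (B n x) (p / 2)))"
 proof (rule nn_integral_monotone_convergence_SUP)
  show "incseq (%n x. epowr (B n x) (p / 2))"
   using Binc p unfolding incseq_def le_fun_def by (auto intro!: epowr_mono)
 qed measurable
 also have "... <= en C2 * (en (b powr p) + 1) * en C1 * NI mu (%x. (?q x))"
 proof (rule SUP_least, goal_cases)
  case (1 n)
  let ?b = "%x. (?bb n x)"
  let ?a = "%x. map (%i. T m (%z. cor (u x z) * LS.fsp n i z)) [0..<L * n]"
  have "NI mu (%x. epowr (B n x) (p / 2)) <= NI mu (%x. en C2 * GE ?E (?b x))"
   unfolding B_def by (intro nn_integral_mono C2)
  also have "... <= en C2 * NI mu (%x. GE ?E (?b x))"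
   by (subst nn_integral_cmult) (auto intro!: measurable_GE[where ph="%t. en (t powr p)"] SM)
  also have "... <= en C2 * ((en (b powr p) + 1) * NI mu (%x. GE ?E (?a x)))" by (intro mult_left_mono SA) simp
  also have "... <= en C2 * ((en (b powr p) + 1) * NI mu (%x. en C1 * (?q x)))"
  proof (intro mult_left_mono nn_integral_mono order_trans[OF C1] epowr_mono, goal_cases)
   case (1 x)
   have "?a x = map (Tw m (ind (cone al x))) (map (LS.fsp n) [0..<L * n])" by (simp add: Tw_def u_def)
   thus ?case
    using Qm_bessel[OF wt_indicator[OF cone_sets] LS.bessel_fsp, of m al x n] by (simp only:)
  qed (use p in auto)
  also have "NI mu (%x. en C1 * (?q x)) = en C1 * NI mu (%x. (?q x))"
   using mQ by (intro nn_integral_cmult) (simp add: measurable_cong_sets[OF se refl])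
  finally show ?case
   by (simp only: mult.assoc)
 qed
 also have "emeasure lborel ?T * (en C2 * (en (b powr p) + 1) * en C1 * NI mu (%x. (?q x)))
  = en C2 * (en (b powr p) + 1) * en C1 * (emeasure lborel ?T * NI mu (%x. (?q x)))"
  by (rule mult.left_commute)
 also have "emeasure lborel ?T * NI mu (%x. (?q x)) = (LN x. (?q x) * ind ?T x)"
  using mQ by (intro int_eq[symmetric]) simp
 also have "... <= (LN x. (?q x))"
  by (intro nn_integral_mono) (auto simp: indicator_def)
 finally show ?thesis by (simp add: mult_left_mono)
qed

text \<open>The factors of \<open>K\<close> come from the union over the shift patterns, from the
  loss \<open>c^2\<close> of \<open>Qm_lower_weight\<close>, and from Kahane's inequalities on both
  sides of Stein's. The estimate holds for each \<open>m\<close> and passes to the supremum by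
  monotone convergence.\<close>

lemma aperture:
 assumes U: "umd_const TYPE('x) p b" and p: "1 < p" and al: "0 < al" "al <= bt"
  and C1: "!!xs. GE (np p) xs <= en C1 * epowr (GN xs) (p / 2)" "0 < C1"
  and C2: "!!xs. epowr (GN xs) (p / 2) <= en C2 * GE (np p) xs" "0 < C2"
  and c_def: "c = unit_ball_vol (real CARD('n)) * (al / (12 * bt)) ^ CARD('n)"
  and N_def: "N = card (UNIV :: ('n => bool) set)"
  and K_def: "K = (2 ^ N * inverse (c^2)) powr (p / 2) * (2 powr (p / 2)) ^ N * real N * (C2 * (b powr p + 1) * C1)"
 shows "(LN x. epowr (Ac bt x) (p / 2)) <= en K * (LN x. epowr (Ac al x) (p / 2))"
proof -
 have m: "(LN x. epowr (Qm m (ind (cone bt x))) (p / 2)) <= en K * (LN x. epowr (Qm m (ind (cone al x))) (p / 2))" for m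
 proof -
  have bt: "0 < bt" using al by simp
  have c0: "0 < c" unfolding c_def using al bt by (intro mult_pos_pos) auto
  define S where "S = 12 * (1 + bt) * (real m + 1)"
  have "0 < 12 * bt / (real m + 1)" using bt by simp
  obtain L' where L': "S / (12 * bt / (real m + 1)) < 2 ^ L'" using real_arch_pow[of 2] by auto
  define L where "L = Suc L'"
  have L: "0 < L" "S / 2 ^ (L - 1) <= 12 * bt / (real m + 1)"
   using L' `0 < 12 * bt / (real m + 1)` by (auto simp: L_def pos_divide_less_eq divide_le_eq mult.commute less_imp_le simp del: divide_divide_eq_right)
  let ?S = "UNIV :: ('n => bool) set"
  let ?q = "%s x. Qm m (ind (cone bt x Int Zs S bt L s))"
  let ?g = "%s x. epowr (en (c^2) * ?q s x) (p / 2)"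
  let ?I = "(LN x. epowr (Qm m (ind (cone al x))) (p / 2))"
  let ?k = "2 ^ N * inverse (c^2)"
  let ?e = "?k powr (p / 2) * (2 powr (p / 2)) ^ N"
  have k0: "0 <= ?k" by simp
  have pt: "epowr (Qm m (ind (cone bt x))) (p / 2) <= en ?e * (SUM s:?S. ?g s x)" for x
  proof -
   have Un: "(UN s:?S. cone bt x Int Zs S bt L s) = cone bt x"
    by (auto simp: Zs_def cone_def)
   have "Qm m (ind (cone bt x)) <= 2 ^ N * (SUM s:?S. ?q s x)"
    using Qm_UN[of ?S "%s. cone bt x Int Zs S bt L s" m] unfolding Un N_def by simp
   also have "... = en ?k * (SUM s:?S. en (c^2) * ?q s x)"
   proof -
    have "en ?k * en (c^2) = en (2 ^ N)" using c0 by (simp add: ennreal_mult[symmetric])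
    moreover have "en (2 ^ N) = (2 ^ N :: ennreal)" by (simp flip: ennreal_power)
    ultimately show ?thesis unfolding sum_distrib_left[symmetric] mult.assoc[symmetric] by simp
   qed
   finally have "epowr (Qm m (ind (cone bt x))) (p / 2) <= epowr (en ?k * (SUM s:?S. en (c^2) * ?q s x)) (p / 2)"
    using p by (intro epowr_mono) auto
   also have "... = en (?k powr (p / 2)) * epowr (SUM s:?S. en (c^2) * ?q s x) (p / 2)"
    unfolding epowr_mult epowr_ennreal[OF k0] ..
   also have "... <= en (?k powr (p / 2)) * (en ((2 powr (p / 2)) ^ N) * (SUM s:?S. ?g s x))"
    unfolding N_def using p by (intro mult_left_mono epowr_sum_le) auto
   also have "... = en ?e * (SUM s:?S. ?g s x)"
    by (simp add: ennreal_mult mult.assoc)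
   finally show ?thesis .
  qed
  have mq[measurable]: "(%x. ?q s x) : bm borel" for s by (rule measurable_cone_Int_m) measurable
  have "(LN x. epowr (Qm m (ind (cone bt x))) (p / 2))
   <= (LN x. en ?e * (SUM s:?S. ?g s x))"
   by (intro nn_integral_mono pt)
  also have "... = en ?e * (SUM s:?S. LN x. ?g s x)"
   by (subst nn_integral_cmult, measurable) (subst nn_integral_sum, auto)
  also have "... <= en ?e * (SUM s:?S. en C2 * (en (b powr p) + 1) * en C1 * ?I)"
   by (intro mult_left_mono sum_mono aperture_grid[OF U p al C1(1) C2(1) c_def S_def L]) auto
  also have "... = en K * ?I"
  proof -
   have 1: "en (b powr p) + 1 = en (b powr p + 1)" by simp
   have "en C2 * (en (b powr p) + 1) * en C1 = en (C2 * (b powr p + 1) * C1)"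
    unfolding 1 using C1(2) C2(2) by (simp add: ennreal_mult)
   hence "(SUM s:?S. en C2 * (en (b powr p) + 1) * en C1 * ?I) = en (real N) * (en (C2 * (b powr p + 1) * C1) * ?I)"
    by (simp add: N_def ennreal_of_nat_eq_real_of_nat)
   moreover have "en K = en ?e * (en (real N) * en (C2 * (b powr p + 1) * C1))"
    unfolding K_def using C1(2) C2(2) by (simp add: ennreal_mult mult.assoc)
   ultimately show ?thesis by (simp only: mult.assoc)
  qed
  finally show ?thesis .
 qed
 have "(LN x. epowr (Ac bt x) (p / 2)) = (LN x. (SUP m. epowr (Qm m (ind (cone bt x))) (p / 2)))"
  unfolding Ac_def Q_def using p by (intro nn_integral_cong epowr_SUP) auto
 also have "... = (SUP m. LN x. epowr (Qm m (ind (cone bt x))) (p / 2))"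
 proof (rule nn_integral_monotone_convergence_SUP)
  show "incseq (%m x. epowr (Qm m (ind (cone bt x))) (p / 2))"
   unfolding incseq_def le_fun_def using p by (auto intro!: epowr_mono Qm_level)
  show "(%x. epowr (Qm m (ind (cone bt x))) (p / 2)) : bm lborel" for m
   using measurable_epowr[OF measurable_Ac_m[of m bt]] by simp
 qed
 also have "... <= en K * (LN x. epowr (Ac al x) (p / 2))"
  unfolding Ac_def Q_def using p
  by (intro SUP_least order_trans[OF m] mult_left_mono nn_integral_mono epowr_mono SUP_upper) auto
 finally show ?thesis .
qed

end

text \<open>\<open>aperture\<close> names all its constants as hypotheses, so that the
  \<open>K\<close> obtained here is common to all \<open>F\<close>, \<open>e\<close> and
  \<open>T\<close>.\<close>

theorem (in complex_banach) aperture_change: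
 assumes U: "UMD TYPE('x)" and p: "1 < p" and al: "0 < al" "0 < bt"
 shows "EX K::real>0. ALL (F :: ('n::finite) uhs => 'x) e T. uhsfun J e F T -->
  (LN x. epowr (uhsfun.Ac J e T bt x) (p / 2)) <= en K * (LN x. epowr (uhsfun.Ac J e T al x) (p / 2))"
proof (cases "bt <= al")
 case True
 have "(LN x. epowr (uhsfun.Ac J e T bt x) (p / 2)) <= en 1 * (LN x. epowr (uhsfun.Ac J e T al x) (p / 2))"
  if "uhsfun J e F T" for F :: "'n uhs => 'x" and e T
  using p uhsfun.Ac_mono[OF that True] by (auto intro!: nn_integral_mono epowr_mono)
 thus ?thesis by (intro exI[of _ 1]) auto
next
 case False
 obtain b where b: "umd_const TYPE('x) p b" using UMD_const[OF U p] by blast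
 obtain C1 where C1: "0 < C1" "!!xs. GE (np p) xs <= en C1 * epowr (GN xs) (p / 2)"
  using kahane_upper[of p] p by auto
 obtain C2 where C2: "0 < C2" "!!xs. epowr (GN xs) (p / 2) <= en C2 * GE (np p) xs"
  using kahane_lower[of p] p by auto
 define c where "c = unit_ball_vol (real CARD('n)) * (al / (12 * bt)) ^ CARD('n)"
 define N where "N = card (UNIV :: ('n => bool) set)"
 define K where "K = (2 ^ N * inverse (c^2)) powr (p / 2) * (2 powr (p / 2)) ^ N * real N * (C2 * (b powr p + 1) * C1)"
 have "0 < c" unfolding c_def using al by (intro mult_pos_pos) auto
 moreover have "0 < N" by (simp add: N_def card_gt_0_iff)
 ultimately have "0 < K" unfolding K_def using C1 C2
  by (intro mult_pos_pos add_nonneg_pos zero_less_power) auto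
 moreover have "al <= bt" using False by simp
 note uhsfun.aperture[OF _ b p al(1) this C1(2,1) C2(2,1) c_def N_def K_def]
 ultimately show ?thesis by blast
qed

section \<open>The good lambda inequality\<close>

context uhsfun
begin

text \<open>In the application \<open>F\<close> of the locale is a truncation of \<open>G\<close>,
  and the Carleson functional of \<open>G\<close> must appear. The 8 pays for returning from
  truncated cones of \<open>F\<close> to \<open>Atr\<close> of \<open>G\<close>: 2 from
  \<open>tcone_le_Atr\<close>, 4 from \<open>gamma_fun_mult_le\<close>. The \<open>1/4\<close> comes
  from \<open>Q_Un\<close> with both parts at most \<open>t\<close>.\<close>

lemma good_lambda:
 assumes q: "0 < q" and g: "0 < g" and t: "0 < t" and fin: "emeasure lborel {x. en t < Ac (al + 3) x} < \<infinity>"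
  and G: "!!h y. Q (ind (tcone al h y)) <= 8 * epowr (Atr J al G h y) 2"
 shows "emeasure lborel {x. en t < en (1 / 4) * Ac al x}
  <= en ((8 * g) powr (q / 2) * 5 ^ CARD('n)) * emeasure lborel {x. en t < Ac (al + 3) x}
   + emeasure lborel {x. en t < en (1 / g) * epowr (Cq J al q G x) 2}"
proof -
 let ?k0 = "(8 * g) powr (q / 2) * 5 ^ CARD('n)"
 let ?gt = "(g * t) powr (q / 2)"
 define U where "U = {x. en t < Ac (al + 3) x}"
 \<comment> \<open>Half the distance keeps the ball of radius \<open>r x\<close> inside
   \<open>U\<close>, while the nearest point \<open>z x\<close> off \<open>U\<close> is at distance
   \<open>2 r x\<close>.\<close>
 define r where "r x = infdist x (- U) / 2" for x
 let ?i = "%x y. ind (tcone al (5 * r x) y)"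
 define H where "H x = en (1 / g) * epowr (Cq J al q G x) 2" for x
 have oU: "open U" unfolding U_def by (rule open_Ac)
 have Un: "U ~= UNIV" using fin by (auto simp: U_def)
 have "- U ~= {}" using Un by auto
 hence "ALL x. EX y. y : - U & infdist x (- U) = dist x y" using infdist_attains_inf[OF closed_Compl[OF oU]] by blast
 then obtain z where "!!x. z x : - U & infdist x (- U) = dist x (z x)" by metis
 hence z: "!!x. z x : - U" "!!x. dist x (z x) = 2 * r x" by (auto simp: r_def)
 have r0: "0 < r x" if "x : U" for x
  using z[of x] that dist_pos_lt[of x "z x"] by (cases "x = z x") auto
 have rU: "ball x (r x) <= U" if "x : U" for x
 proof (rule subsetI, rule ccontr)
  fix y assume "y : ball x (r x)" "y ~: U"
  thus False using infdist_le[of y "- U" x] r0[OF that] by (simp add: r_def)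
 qed
 define V where "V = unit_ball_vol (real CARD('n))"
 obtain I where I: "emeasure lborel U = en I" "0 <= I" using fin by (cases "emeasure lborel U") (auto simp: U_def)
 \<comment> \<open>The volume of \<open>U\<close> bounds the radii: a radius above 1 is at most its
   power of exponent the dimension.\<close>
 have rB: "0 < r x & r x <= max 1 (I / V)" if x: "x : U" for x
 proof -
  have V: "0 < V" by (simp add: V_def)
  have "emeasure lborel (ball x (r x)) <= en I"
   unfolding I(1)[symmetric] using oU by (intro emeasure_mono rU x) auto
  hence "V * r x ^ CARD('n) <= I" using r0[OF x] I by (simp add: emeasure_ball V_def)
  hence "r x ^ CARD('n) <= I / V" using V by (simp add: field_simps)
  moreover have "r x <= r x ^ CARD('n)" if "1 < r x" using that self_le_power[of "r x" "CARD('n)"] by simp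
  ultimately show ?thesis using r0[OF x] by (force simp: le_max_iff_disj not_less)
 qed
 have "U <= (UN x:U. ball x (r x))" using r0 by auto
 note vc = Vitali_covering_lemma_balls[OF this rB]
 obtain C where C: "countable C" "C <= U" "pairwise (%i j. disjnt (ball i (r i)) (ball j (r j))) C"
  "U <= (UN i:C. ball i (5 * r i))"
  by (rule vc)
 \<comment> \<open>If \<open>H\<close> exceeds \<open>t\<close> on the whole dilated ball, that ball
   is already inside the second set of the cover.\<close>
 define P where "P x <-> (EX y:ball x (5 * r x). H y <= en t)" for x
 define X where "X x = (if P x then {y : ball x (5 * r x). en t < Q (?i x y)} else {})" for x
 have Xm: "X x : sets borel" for x
 proof -
  note [measurable] = measurable_tcone
  have "ball x (5 * r x) Int {y : space borel. en t < Q (?i x y)} : sets borel"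
   by (intro sets.Int) measurable
  thus ?thesis by (simp add: X_def Int_def)
 qed
 have cover: "{y. en t < en (1 / 4) * Ac al y} <= (UN i:C. X i) Un {y. en t < H y}"
 proof
  fix y assume "y : {y. en t < en (1 / 4) * Ac al y}"
  hence y: "en t < en (1 / 4) * Ac al y" by simp
  have "en (1 / 4) * Ac al y <= 1 * Ac (al + 3) y"
   using ennreal_leI[of "1/4" 1] by (intro mult_mono Ac_mono) auto
  hence "y : U" using y by (simp add: U_def)
  then obtain x where x: "x : C" "y : ball x (5 * r x)" using C(4) by blast
  have "en t < Q (?i x y)"
  proof (rule ccontr)
   assume n: "~ en t < Q (?i x y)"
   have "cone al y <= tcone al (5 * r x) y Un cone (al + 3) (z x)"
   proof
    fix w assume w: "w : cone al y"
    have "dist (fst w) (z x) <= dist (fst w) y + dist x y + dist x (z x)"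
     using dist_triangle[of "fst w" "z x" y] dist_triangle3[of y "z x" x] by linarith
    hence "dist (fst w) (z x) < al * snd w + 5 * r x + 2 * r x" using w x(2) z(2)[of x] by (simp add: cone_def)
    \<comment> \<open>From \<open>y\<close> to \<open>z x\<close> the distance is below
      \<open>7 r x\<close>, which is at most 3 times any height of at least \<open>5 r x\<close>;
      hence the aperture \<open>al + 3\<close>.\<close>
    moreover have "5 * r x + 2 * r x <= 3 * snd w" if "5 * r x <= snd w" using that r0[of x] x(1) C(2) by auto
    ultimately show "w : tcone al (5 * r x) y Un cone (al + 3) (z x)"
     using w by (cases "5 * r x <= snd w") (auto simp: tcone_def cone_def distrib_right)
   qed
   hence "Ac al y <= Q (ind (tcone al (5 * r x) y Un cone (al + 3) (z x)))"
    unfolding Ac_def by (intro Q_set_mono) auto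
   also have "... <= 2 * Q (?i x y) + 2 * Ac (al + 3) (z x)"
    unfolding Ac_def by (intro Q_Un) auto
   also have "... <= 2 * en t + 2 * en t"
    using n z(1)[of x] by (intro add_mono mult_left_mono) (auto simp: U_def not_less)
   also have "... = en (4 * t)" using t by (simp add: ennreal_mult flip: distrib_right)
   finally have "en (1 / 4) * Ac al y <= en (1 / 4) * en (4 * t)" by (rule mult_left_mono) simp
   also have "... = en t" using t by (simp flip: ennreal_mult)
   finally show False using y by simp
  qed
  hence "y : X x" if "~ en t < H y" using x that by (auto simp: X_def P_def not_less)
  thus "y : (UN i:C. X i) Un {y. en t < H y}" using x(1) by blast
 qed
 have XB: "emeasure lborel (X x) <= en ?k0 * (LN y. ind (ball x (r x)) y * 1)" if "x : C" for x
 proof (cases "P x")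
  case True
  have rx: "0 < r x" using r0 that C(2) by blast
  let ?B = "ball x (5 * r x)"
  obtain y0 where y0: "y0 : ?B" "H y0 <= en t" using True by (auto simp: P_def)
  let ?I = "(LN y. ind ?B y * epowr (Atr J al G (5 * r x) y) q)"
  have gt: "0 < (g * t) powr (q / 2)" "0 < (t / 8) powr (q / 2)" using g t by auto
  have "epowr (Cq J al q G y0) 2 = en g * H y0"
   using g by (simp add: H_def mult.assoc[symmetric] flip: ennreal_mult)
  also have "... <= en (g * t)" using y0(2) g t by (simp add: ennreal_mult mult_left_mono)
  finally have "epowr (epowr (Cq J al q G y0) 2) (q / 2) <= epowr (en (g * t)) (q / 2)"
   using q by (intro epowr_mono) auto
  hence c1: "epowr (Cq J al q G y0) q <= en ?gt"
   using g t by (simp add: epowr_epowr epowr_ennreal)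
  \<comment> \<open>The dilated ball itself competes in the supremum defining \<open>Cq\<close> at
    \<open>y0\<close>, where \<open>H y0 <= t\<close>; Chebyshev's inequality then measures
    \<open>X x\<close>.\<close>
  have "epowr (?I / emeasure lborel ?B) (1 / q) <= Cq J al q G y0"
   unfolding Cq_def using y0 rx by (intro SUP_upper2[of "(x, 5 * r x)"]) auto
  hence "?I / emeasure lborel ?B <= en ?gt"
   using c1 q by (simp add: epowr_le_iff order_trans[OF _ c1])
  hence "?I / emeasure lborel ?B * emeasure lborel ?B <= en ?gt * emeasure lborel ?B"
   by (rule mult_right_mono) simp
  hence 1: "?I <= en ?gt * emeasure lborel ?B"
   using emeasure_ball_pos[of "5 * r x" x] rx by (simp add: ennreal_divide_times ennreal_divide_self)
  have "en ((t / 8) powr (q / 2)) * emeasure lborel (X x) = (LN y. en ((t / 8) powr (q / 2)) * ind (X x) y)"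
   using Xm by (subst nn_integral_cmult_indicator) auto
  also have "... <= ?I"
  proof (rule nn_integral_mono, goal_cases)
   case (1 y)
   have "en ((t / 8) powr (q / 2)) <= epowr (Atr J al G (5 * r x) y) q" if "y : X x"
   proof -
    have "en t <= 8 * epowr (Atr J al G (5 * r x) y) 2"
     using that order_trans[OF less_imp_le G] by (auto simp: X_def split: if_splits)
    moreover have "en t = 8 * en (t / 8)" using t by (simp add: ennreal_mult'[symmetric] flip: ennreal_numeral)
    ultimately have "en (t / 8) <= epowr (Atr J al G (5 * r x) y) 2" by (simp add: ennreal_mult_le_mult_iff)
    hence "epowr (en (t / 8)) (q / 2) <= epowr (epowr (Atr J al G (5 * r x) y) 2) (q / 2)" using q by (intro epowr_mono) auto
    thus ?thesis using t by (simp add: epowr_epowr epowr_ennreal)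
   qed
   thus ?case
    by (auto simp: indicator_def X_def)
  qed
  finally have 2: "en ((t / 8) powr (q / 2)) * emeasure lborel (X x) <= en ?gt * emeasure lborel ?B"
   using 1 by (rule order_trans)
  have "emeasure lborel (X x) = en (1 / (t / 8) powr (q / 2)) * (en ((t / 8) powr (q / 2)) * emeasure lborel (X x))"
   using gt by (simp add: mult.assoc[symmetric] flip: ennreal_mult)
  also have "... <= en (1 / (t / 8) powr (q / 2)) * (en ?gt * emeasure lborel ?B)"
   by (intro mult_left_mono 2) simp
  also have "... = en ((8 * g) powr (q / 2)) * emeasure lborel ?B"
   using g t by (simp add: mult.assoc[symmetric] powr_mult powr_divide flip: ennreal_mult)
  also have "... = en ?k0 * emeasure lborel (ball x (r x))"
   using emeasure_ball_scale[of "r x" 5 x x] rx by (simp add: ennreal_mult mult.assoc)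
  finally show ?thesis by simp
 qed (simp add: X_def)
 have UX: "(UN i:C. X i) : sets lborel" using C(1) Xm by (auto intro!: sets.countable_UN')
 have [measurable]: "Cq J al q G : bm borel" unfolding Cq_def[abs_def] by (rule measurable_SUP_balls)
 have Hm: "{y. en t < H y} : sets lborel" unfolding H_def by measurable
 have "emeasure lborel {y. en t < en (1 / 4) * Ac al y} <= emeasure lborel ((UN i:C. X i) Un {y. en t < H y})"
  using UX Hm by (intro emeasure_mono[OF cover] sets.Un)
 also have "... <= emeasure lborel (UN i:C. X i) + emeasure lborel {y. en t < H y}"
  by (rule emeasure_subadditive[OF UX Hm])
 also have "emeasure lborel (UN i:C. X i) <= en ?k0 * (LN y. ind (UN i:C. ball i (r i)) y * 1)"
  by (rule vitali_sum[OF C(1) Xm _ _ _ _ XB]) (use C(3) in "auto simp: disjoint_family_on_def pairwise_def disjnt_def")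
 also have "(LN y. ind (UN i:C. ball i (r i)) y * 1) <= emeasure lborel U"
 proof -
  have "(UN i:C. ball i (r i)) <= U" using rU C(2) by blast
  thus ?thesis using oU by (simp add: emeasure_mono open_UN)
 qed
 finally show ?thesis unfolding H_def U_def by (simp add: add_mono mult_left_mono)
qed

end

text \<open>The level estimate is integrated by the layer cake formula.
  \<open>aperture_change\<close> brings \<open>al + 3\<close> back to \<open>al\<close>, and the
  finiteness hypothesis allows the resulting term to be subtracted.\<close>

theorem (in complex_banach) good_lambda_Lp:
 assumes U: "UMD TYPE('x)" and p: "1 < p" and q: "0 < q" and al: "0 < al"
 shows "EX K::real>0. ALL (F :: ('n::finite) uhs => 'x) e T G. uhsfun J e F T &
  (LN x. epowr (uhsfun.Ac J e T al x) (p / 2)) < \<infinity> &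
  (ALL h y. nfun.Q J e T (ind (tcone al h y)) <= 8 * epowr (Atr J al G h y) 2) -->
  (LN x. epowr (uhsfun.Ac J e T al x) (p / 2)) <= en K * (LN x. epowr (Cq J al q G x) p)"
proof -
 let ?s = "p / 2"
 obtain K0 where K0: "0 < K0" "!!(F :: 'n uhs => 'x) e T. uhsfun J e F T ==>
   (LN x. epowr (uhsfun.Ac J e T (al + 3) x) ?s) <= en K0 * (LN x. epowr (uhsfun.Ac J e T al x) ?s)"
  using aperture_change[OF U p al, of "al + 3", where 'n='n] al by auto
 \<comment> \<open>The left side carries the factor \<open>2 d\<close>; \<open>ka\<close> makes the
   term of aperture \<open>al + 3\<close> cost only \<open>d\<close>; and \<open>g\<close> is tuned
   so that the constant of \<open>good_lambda\<close> equals \<open>ka\<close>.\<close>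
 define d where "d = (1 / 4) powr ?s / 2"
 define ka where "ka = d / K0"
 define g where "g = (ka / 5 ^ CARD('n)) powr (2 / q) / 8"
 have d: "0 < d" "(1 / 4) powr ?s = d + d" by (auto simp: d_def)
 hence ka: "0 < ka" "ka * K0 = d" using K0(1) by (auto simp: ka_def)
 have g: "0 < g" "(8 * g) powr (q / 2) * 5 ^ CARD('n) = ka" using q ka(1) by (auto simp: g_def powr_powr)
 have "(LN x. epowr (uhsfun.Ac J e T al x) ?s) <= en ((1 / g) powr ?s / d) * (LN x. epowr (Cq J al q G x) p)"
  if u: "uhsfun J e F T" and fin: "(LN x. epowr (uhsfun.Ac J e T al x) ?s) < \<infinity>"
  and G: "!!h y. nfun.Q J e T (ind (tcone al h y)) <= 8 * epowr (Atr J al G h y) 2"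
  for F :: "'n uhs => 'x" and e T G
 proof -
  interpret uhsfun J e F T by (rule u)
  let ?A = "LN x. epowr (Ac al x) ?s" and ?C = "LN x. epowr (Cq J al q G x) p"
  let ?B = "LN x. epowr (Ac (al + 3) x) ?s"
  have [measurable]: "Cq J al q G : bm borel" unfolding Cq_def[abs_def] by (rule measurable_SUP_balls)
  let ?H = "%x. en (1 / g) * epowr (Cq J al q G x) 2"
  have B: "?B <= en K0 * ?A" by (rule K0(2)[OF u])
  also have "... < \<infinity>" using fin by (simp add: ennreal_mult_less_top)
  finally have fin3: "?B < \<infinity>" .
  note [measurable] = measurable_Ac
  have lc: "(LN x. epowr (f x) ?s) = (LN t. lw ?s t * emeasure lborel {x. en t < f x})" if "f : bm borel" for f
   using layer_cake[OF sigma_finite_lborel, of f ?s] that p by simp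
  have "en ((1 / 4) powr ?s) * ?A = (LN x. epowr (en (1 / 4) * Ac al x) ?s)"
   using epowr_ennreal[of "1/4" ?s] by (simp add: epowr_mult nn_integral_cmult)
  also have "... = (LN t. lw ?s t * emeasure lborel {x. en t < en (1 / 4) * Ac al x})" by (rule lc) measurable
  also have "... <= (LN t. en ka * (lw ?s t * emeasure lborel {x. en t < Ac (al + 3) x}) + lw ?s t * emeasure lborel {x. en t < ?H x})"
  proof (rule nn_integral_mono)
   fix t :: real
   have "emeasure lborel {x. en t < en (1 / 4) * Ac al x}
     <= en ka * emeasure lborel {x. en t < Ac (al + 3) x} + emeasure lborel {x. en t < ?H x}" if t: "0 < t"
    unfolding g(2)[symmetric]
   proof (rule good_lambda[OF q g(1) t _ G])
    have m: "{x. en t < Ac (al + 3) x} : sets borel" by measurable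
    have "en (t powr ?s) * emeasure lborel {x. en t < Ac (al + 3) x} = (LN x. en (t powr ?s) * ind {x. en t < Ac (al + 3) x} x)"
     using m by (subst nn_integral_cmult_indicator) auto
    also have "... <= ?B"
    proof (rule nn_integral_mono, goal_cases)
     case (1 x)
     show ?case
      using epowr_mono[of "en t" "Ac (al + 3) x" ?s] p t by (auto simp: indicator_def epowr_ennreal)
    qed
    finally have "en (t powr ?s) * emeasure lborel {x. en t < Ac (al + 3) x} < \<infinity>" using fin3 by (rule le_less_trans)
    thus "emeasure lborel {x. en t < Ac (al + 3) x} < \<infinity>" using t by (auto simp: ennreal_mult_less_top)
   qed
   from mult_left_mono[OF this, of "lw ?s t"]
   show "lw ?s t * emeasure lborel {x. en t < en (1 / 4) * Ac al x}
     <= en ka * (lw ?s t * emeasure lborel {x. en t < Ac (al + 3) x}) + lw ?s t * emeasure lborel {x. en t < ?H x}"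
    by (cases "0 < t") (auto simp: distrib_left mult.left_commute lw_def)
  qed
  also have "... = en ka * (LN t. lw ?s t * emeasure lborel {x. en t < Ac (al + 3) x}) + (LN t. lw ?s t * emeasure lborel {x. en t < ?H x})"
   by (subst nn_integral_add) (auto intro!: nn_integral_cmult)
  also have "... = en ka * ?B + (LN x. epowr (?H x) ?s)" by (subst (1 2) lc) auto
  also have "(LN x. epowr (?H x) ?s) = en ((1 / g) powr ?s) * ?C"
   using epowr_ennreal[of "1/g" ?s] g(1) by (simp add: epowr_mult epowr_epowr nn_integral_cmult)
  also have "en ka * ?B <= en ka * (en K0 * ?A)" by (intro mult_left_mono B) simp
  also have "... = en d * ?A" using ka K0(1) by (simp add: mult.assoc[symmetric] flip: ennreal_mult)
  finally have main: "en (d + d) * ?A <= en d * ?A + en ((1 / g) powr ?s) * ?C" by (simp add: d(2) add_right_mono)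
  obtain a where a: "?A = en a" "0 <= a" using fin by (cases ?A) auto
  show ?thesis
  proof (cases ?C)
   case (real c)
   have "(d + d) * a <= d * a + (1 / g) powr ?s * c"
    using main d(1) a real by (simp add: ennreal_mult[symmetric] ennreal_plus[symmetric] del: ennreal_plus)
   hence "a <= (1 / g) powr ?s / d * c" using d(1) by (simp add: field_simps)
   thus ?thesis using real a d(1) by (simp add: ennreal_mult[symmetric] ennreal_leI)
  qed (use d(1) g(1) in "simp add: ennreal_mult_top")
 qed
 moreover have "0 < (1 / g) powr ?s / d" using d(1) g(1) by simp
 ultimately show ?thesis by blast
qed

section \<open>Finiteness on compact boxes\<close>

context uhsfun
begin

text \<open>Finiteness of \<open>Cq\<close> at one point makes the functional of cones truncated at
  \<open>r\<close> finite at almost every vertex in a large ball. The box is compact, so finitely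
  many open cones with such vertices cover it, and their truncations still do because the box lies
  below height \<open>r\<close>.\<close>

lemma Q_box_finite:
 assumes al: "0 < al" and q: "0 < q" and fin: "Cq J al q F x0 < \<infinity>"
 shows "Q (ind (box_uhs k)) < \<infinity>"
proof -
 define r where "r = real k + norm x0 + 1"
 have r: "real k < r" "0 < r" "x0 : ball 0 r" using norm_ge_zero[of x0] by (auto simp: r_def simp del: norm_ge_zero)
 let ?B = "ball (0 :: real ^ 'n) r"
 let ?Q = "%y. Q (ind (tcone al r y))"
 note [measurable] = measurable_tcone
 have [measurable]: "?B : sets borel" by simp
 let ?I = "LN y. ind ?B y * epowr (Atr J al F r y) q"
 have "epowr (?I / emeasure lborel ?B) (1 / q) <= Cq J al q F x0"
  unfolding Cq_def using r by (intro SUP_upper2[of "(0, r)"]) auto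
 from le_less_trans[OF this fin] have "?I / emeasure lborel ?B < \<infinity>" by simp
 hence I: "?I < \<infinity>"
  using emeasure_ball_pos[OF r(2), of "0 :: real ^ 'n"] by (auto simp: less_top[symmetric] ennreal_divide_eq_top_iff ennreal_top_divide)
 have "(LN y. ind ?B y * epowr (?Q y / 2) (q / 2)) <= ?I"
 proof (intro nn_integral_mono mult_left_mono, goal_cases)
  case (1 y)
  have "?Q y / 2 <= epowr (Atr J al F r y) 2" using tcone_le_Atr[of al r y] by (intro divide_le_posI_ennreal) auto
  hence "epowr (?Q y / 2) (q / 2) <= epowr (epowr (Atr J al F r y) 2) (q / 2)" using q by (intro epowr_mono) auto
  thus ?case by (simp add: epowr_epowr)
 qed simp
 hence "(LN y. ind ?B y * epowr (?Q y / 2) (q / 2)) ~= \<infinity>" using I by auto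
 hence AE: "AE y in lborel. ind ?B y * epowr (?Q y / 2) (q / 2) ~= \<infinity>" by (intro nn_integral_PInf_AE) auto
 define D where "D = {y : ?B. ?Q y < \<infinity>}"
 have cov: "box_uhs k <= (UN y:D. cone al y)"
 proof
  fix z :: "'n uhs" assume z: "z : box_uhs k"
  let ?U = "?B Int ball (fst z) (al * snd z)"
  have t: "0 < snd z" using box_uhs_pos[OF z] .
  have "fst z : ?U" using z al t r(1) by (simp add: box_uhs_def)
  then obtain ep where ep: "0 < ep" "ball (fst z) ep <= ?U" using open_contains_ball[of ?U] by blast
  have "EX y:?U. ?Q y < \<infinity>"
  proof (rule ccontr)
   assume n: "~ (EX y:?U. ?Q y < \<infinity>)"
   have "AE y in lborel. y ~: ball (fst z) ep"
    using AE
   proof eventually_elim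
    case (elim y)
    have "?Q y < \<infinity>" if "y : ?B"
     using elim that by (auto simp: less_top[symmetric] ennreal_divide_eq_top_iff ennreal_top_divide)
    thus ?case using ep(2) n by blast
   qed
   hence "emeasure lborel (ball (fst z) ep) = 0" by (subst (asm) AE_iff_measurable[of "ball (fst z) ep"]) auto
   thus False using emeasure_ball_pos(1)[OF ep(1), of "fst z"] by simp
  qed
  then obtain y where "y : ?U" "?Q y < \<infinity>" by blast
  thus "z : (UN y:D. cone al y)" using t by (auto simp: D_def cone_def)
 qed
 obtain D' where D': "D' <= D" "finite D'" "box_uhs k <= (UN y:D'. cone al y)"
  using compactE_image[OF compact_box_uhs cone_borel cov] by blast
 have "box_uhs k <= (UN y:D'. tcone al r y)"
 proof
  fix z :: "'n uhs" assume z: "z : box_uhs k"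
  then obtain y where "y : D'" "z : cone al y" using D'(3) by blast
  moreover have "snd z < r" using z r(1) by (simp add: box_uhs_def)
  ultimately show "z : (UN y:D'. tcone al r y)" by (auto simp: tcone_def)
 qed
 hence "Q (ind (box_uhs k)) <= Q (ind (UN y:D'. tcone al r y))"
  by (rule Q_set_mono[OF _ box_sets sets.finite_UN[OF D'(2)]]) simp
 also have "... <= 2 ^ card D' * (SUM y:D'. ?Q y)"
  unfolding Q_def[of "ind (UN y:D'. tcone al r y)"]
 proof (rule SUP_least, goal_cases)
  case (1 m)
  have "Qm m (ind (UN y:D'. tcone al r y)) <= 2 ^ card D' * (SUM y:D'. Qm m (ind (tcone al r y)))"
   by (rule Qm_UN[OF D'(2)]) simp
  also have "... <= 2 ^ card D' * (SUM y:D'. ?Q y)"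
   by (intro mult_left_mono sum_mono) (auto simp: Q_def intro: SUP_upper)
  finally show ?case .
 qed
 also have "... < \<infinity>" using D'(1,2) by (auto simp: D_def ennreal_mult_less_top power_less_top_ennreal)
 finally show ?thesis .
qed

end

context complex_banach
begin

lemma gamma_fun_no_onb: "~ (EX e. onb M e) ==> gamma_fun J M Ph = \<infinity>"
 by (auto simp: gamma_fun_def gamma_op_def)

text \<open>For \<open>F\<close> cut to \<open>box_uhs k\<close> the finiteness needed for
  absorption is available. The bounds are uniform in \<open>k\<close>, so monotone convergence and
  \<open>Q_continuous\<close> recover the full cones.\<close>

theorem Aop_le_Cq:
 assumes U: "UMD TYPE('x)" and p: "1 < p" and q: "0 < q" and al: "0 < al"
 shows "EX K::real>0. ALL F :: ('n::finite) uhs => 'x. sm uhs F --> Lpn (en p) (Aop J al F) <= en K * Lpn (en p) (Cq J al q F)"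
proof -
 let ?Q = "%F. LN x. epowr (Cq J al q F x) p"
 let ?s = "p / 2"
 obtain K1 where K1: "0 < K1" "!!(F :: 'n uhs => 'x) e T G. uhsfun J e F T ==>
  (LN x. epowr (uhsfun.Ac J e T al x) ?s) < \<infinity> ==>
  (!!h y. nfun.Q J e T (ind (tcone al h y)) <= 8 * epowr (Atr J al G h y) 2) ==>
  (LN x. epowr (uhsfun.Ac J e T al x) ?s) <= en K1 * (?Q G)"
  using good_lambda_Lp[OF U p q al, where 'n='n] by blast
 have main: "(LN x. epowr (Aop J al F x) p) <= en (8 powr ?s * K1) * (?Q F)"
  if F: "sm uhs F" for F :: "'n uhs => 'x"
 proof (cases "(EX e. onb (uhs :: 'n uhs measure) e) & (EX x. Cq J al q F x < \<infinity>)")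
  \<comment> \<open>If \<open>Cq\<close> is infinite everywhere, so is the right side. This includes
    the case without an orthonormal basis, in which every gamma norm is infinite by
    definition.\<close>
  case False
  have "Cq J al q F x = \<infinity>" for x
  proof (cases "EX e. onb (uhs :: 'n uhs measure) e")
   case no: False
   have "epowr ((LN y. ind (ball x 1) y * \<infinity>) / emeasure lborel (ball x 1)) (1 / q) <= Cq J al q F x"
    unfolding Cq_def by (intro SUP_upper2[of "(x, 1)"]) (auto simp: Atr_def gamma_fun_no_onb[OF no])
   moreover have "(LN y. ind (ball x 1) y * \<infinity>) = (\<infinity> :: ennreal)"
    using emeasure_ball_pos(1)[of 1 x] by (subst nn_integral_multc) (auto simp: ennreal_mult_top intro!: borel_measurable_indicator)
   ultimately show ?thesis using emeasure_ball_pos(2)[of 1 x, THEN less_imp_neq] by (simp add: ennreal_top_divide top_unique)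
  qed (use False in "auto simp: less_top[symmetric]")
  thus ?thesis using K1(1) by (simp add: ennreal_mult_top)
 next
  case True
  then obtain e x0 where e: "onb (uhs :: 'n uhs measure) e" and x0: "Cq J al q F x0 < \<infinity>" by blast
  obtain T where "uhsfun J e F T" using uhsfun_exists[OF F e] by blast
  then interpret uhsfun J e F T .
  define B where "B k x = Q (ind (cone al x Int box_uhs k))" for k x
  have Bm[measurable]: "B k : bm borel" for k unfolding B_def by (rule measurable_cone_Int) simp
  have LB: "(LN x. epowr (B k x) ?s) <= en (4 powr ?s * K1) * (?Q F)" for k
  proof -
   define G where "G z = ind (box_uhs k) z *R F z" for z
   have G: "sm uhs G" unfolding G_def by (intro sm_scaleR F sm_of_borel) auto
   obtain T' where u: "uhsfun J e G T'" using uhsfun_exists[OF G e] by blast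
   interpret G: uhsfun J e G T' by (rule u)
   have eq: "Aop J al G x = gamma_fun J uhs (%z. ind (cone al x Int box_uhs k) z *R F z)" for x
    unfolding Aop_def G_def by (rule arg_cong[of _ _ "gamma_fun J uhs"]) (auto simp: indicator_def)
   \<comment> \<open>\<open>G.Ac\<close> is built from operators of \<open>G\<close> and
     \<open>B k\<close> from those of \<open>F\<close>; the gamma norm of their common kernel links
     them, at the price of 4 each way.\<close>
   have "G.Ac al x <= 2 * (2 * B k x)" for x
    by (rule order_trans[OF G.Ac_le_Aop]) (unfold eq B_def, intro mult_left_mono gamma_le_Q U, auto)
   hence GB: "G.Ac al x <= 4 * B k x" for x by (simp add: mult.assoc[symmetric])
   have "B k x <= 2 * (2 * G.Ac al x)" for x
    unfolding B_def by (rule order_trans[OF Q_le_gamma]) (simp, unfold eq[symmetric], intro mult_left_mono G.Aop_le_Ac U, simp)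
   hence BG: "B k x <= 4 * G.Ac al x" for x by (simp add: mult.assoc[symmetric])
   define b where "b = Q (ind (box_uhs k))"
   have b: "b < \<infinity>" unfolding b_def by (rule Q_box_finite[OF al q x0])
   \<comment> \<open>Only vertices in a fixed ball see the box, and there the functional is bounded
     by its finite value on the whole box.\<close>
   have "(LN x. epowr (G.Ac al x) ?s) <= (LN x. epowr (4 * b) ?s * ind (cball (0 :: real ^ 'n) (real k + al * real k)) x)"
   proof (rule nn_integral_mono, goal_cases)
    case (1 x)
    show ?case
    proof (cases "cone al x Int box_uhs k = {}")
     case True
     have "B k x = 0" unfolding B_def True Q_def by (simp add: Qm_zero)
     thus ?thesis using GB[of x] by simp
    next
     case False
     then obtain z where z: "z : cone al x" "z : box_uhs k" by blast
     have "norm x <= norm (fst z) + dist (fst z) x" by (metis dist_norm norm_minus_commute norm_triangle_sub)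
     also have "... <= real k + al * real k"
      using z al by (intro add_mono) (auto simp: cone_def box_uhs_def intro: order_trans[OF less_imp_le] mult_left_mono)
     finally have "x : cball 0 (real k + al * real k)" by simp
     moreover have "B k x <= b" unfolding B_def b_def by (intro Q_set_mono) auto
     hence "epowr (G.Ac al x) ?s <= epowr (4 * b) ?s"
      using p by (intro epowr_mono order_trans[OF GB] mult_left_mono) auto
     ultimately show ?thesis by simp
    qed
   qed
   also have "... = epowr (4 * b) ?s * emeasure lborel (cball (0 :: real ^ 'n) (real k + al * real k))"
    by (rule nn_integral_cmult_indicator) simp
   also have "... < \<infinity>" using b al by (auto simp: ennreal_mult_less_top emeasure_cball)
   finally have fin: "(LN x. epowr (G.Ac al x) ?s) < \<infinity>" .
   have "(LN x. epowr (B k x) ?s) <= (LN x. en (4 powr ?s) * epowr (G.Ac al x) ?s)"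
   proof (rule nn_integral_mono, goal_cases)
    case (1 x)
    show ?case
     using epowr_mono[OF BG[of x], of ?s] p epowr_ennreal[of 4 ?s] by (simp add: epowr_mult)
   qed
   also have "... = en (4 powr ?s) * (LN x. epowr (G.Ac al x) ?s)" by (rule nn_integral_cmult) measurable
   also have "... <= en (4 powr ?s) * (en K1 * (?Q F))"
   proof (intro mult_left_mono K1(2)[OF u fin], goal_cases)
    case (1 h y)
    have "(%z. if z : tcone al h y then G z else 0) = (%z. ind (box_uhs k) z *R (if z : tcone al h y then F z else 0))"
     by (auto simp: G_def)
    hence "epowr (Atr J al G h y) 2 <= 4 * epowr (Atr J al F h y) 2"
     unfolding Atr_def by (auto intro!: gamma_fun_mult_le simp: indicator_def)
    from order_trans[OF G.tcone_le_Atr mult_left_mono[OF this, of 2]]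
    show ?case by (simp add: mult.assoc[symmetric])
   qed simp
   also have "... = en (4 powr ?s * K1) * (?Q F)"
    using K1(1) by (simp add: ennreal_mult mult.assoc)
   finally show ?thesis .
  qed
  have A: "epowr (Aop J al F x) p <= en (2 powr ?s) * (SUP k. epowr (B k x) ?s)" for x
  proof -
   have "cone al x = (UN k. cone al x Int box_uhs k)"
    using box_uhs_cover by (fastforce simp: cone_def)
   hence "Ac al x <= (SUP k. B k x)"
    using Q_continuous[of "%k. cone al x Int box_uhs k"] incseq_box[where 'n='n]
    unfolding Ac_def B_def by (auto simp: incseq_def)
   hence "epowr (Aop J al F x) 2 <= 2 * (SUP k. B k x)"
    by (intro order_trans[OF Aop_le_Ac[OF U]] mult_left_mono) auto
   hence "epowr (epowr (Aop J al F x) 2) ?s <= epowr (2 * (SUP k. B k x)) ?s" using p by (intro epowr_mono) auto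
   thus ?thesis using p epowr_ennreal[of 2 ?s] by (simp add: epowr_mult epowr_epowr epowr_SUP)
  qed
  have "(LN x. epowr (Aop J al F x) p) <= (LN x. en (2 powr ?s) * (SUP k. epowr (B k x) ?s))"
   by (intro nn_integral_mono A)
  also have "... = en (2 powr ?s) * (LN x. SUP k. epowr (B k x) ?s)" by (rule nn_integral_cmult) measurable
  also have "(LN x. SUP k. epowr (B k x) ?s) = (SUP k. LN x. epowr (B k x) ?s)"
  proof (rule nn_integral_monotone_convergence_SUP)
   show "incseq (%k x. epowr (B k x) ?s)"
    using incseqD[OF incseq_box[where 'n='n]] p unfolding incseq_def le_fun_def B_def
    by (intro allI impI epowr_mono Q_set_mono) auto
  qed simp
  also have "en (2 powr ?s) * ... <= en (2 powr ?s) * (en (4 powr ?s * K1) * (?Q F))"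
   by (intro mult_left_mono SUP_least LB) simp
  also have "... = en (8 powr ?s * K1) * (?Q F)"
  proof -
   have "8 powr ?s * K1 = 2 powr ?s * (4 powr ?s * K1)" using powr_mult[of 2 4 ?s] by simp
   thus ?thesis using K1(1) by (simp add: ennreal_mult mult.assoc)
  qed
  finally show ?thesis .
 qed
 define K where "K = (8 powr ?s * K1) powr (1 / p)"
 have "Lpn (en p) (Aop J al F) <= en K * Lpn (en p) (Cq J al q F)" if "sm uhs F" for F :: "'n uhs => 'x"
  using epowr_mono[OF main[OF that], of "1 / p"] p K1(1) by (simp add: Lpn_def K_def epowr_mult epowr_ennreal)
 moreover have "0 < K" using K1(1) by (simp add: K_def)
 ultimately show ?thesis by blast
qed

text \<open>\<open>aperture_change\<close> read for \<open>Aop\<close>. As \<open>Aop\<close> need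
  not be measurable, its integrals are compared pointwise with those of the measurable
  \<open>Ac\<close>; \<open>Aop_le_Ac\<close> and \<open>Ac_le_Aop\<close> contribute a factor 2
  each.\<close>

theorem Aop_aperture:
 assumes U: "UMD TYPE('x)" and p: "1 < p" and al: "0 < al" "0 < bt"
 shows "EX K::real>0. ALL F :: ('n::finite) uhs => 'x. sm uhs F --> Lpn (en p) (Aop J bt F) <= en K * Lpn (en p) (Aop J al F)"
proof -
 let ?s = "p / 2"
 obtain K0 where K0: "0 < K0" "!!(F :: 'n uhs => 'x) e T. uhsfun J e F T ==>
   (LN x. epowr (uhsfun.Ac J e T bt x) ?s) <= en K0 * (LN x. epowr (uhsfun.Ac J e T al x) ?s)"
  using aperture_change[OF U p al, where 'n='n] by auto
 define K where "K = (4 powr ?s * K0) powr (1 / p)"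
 have "Lpn (en p) (Aop J bt F) <= en K * Lpn (en p) (Aop J al F)" if F: "sm uhs F" for F :: "'n uhs => 'x"
 proof (cases "EX e. onb (uhs :: 'n uhs measure) e")
  case False
  have "0 < K" using K0 by (simp add: K_def)
  thus ?thesis using p by (simp add: Lpn_def Aop_def gamma_fun_no_onb[OF False] ennreal_mult_top)
 next
  case True
  then obtain e T where u: "uhsfun J e F T" using uhsfun_exists[OF F] by blast
  then interpret uhsfun J e F T .
  have 2: "epowr 2 ?s = en (2 powr ?s)" using epowr_ennreal[of 2 ?s] by simp
  let ?I = "LN x. epowr (Aop J al F x) p"
  have "(LN x. epowr (Ac al x) ?s) = (LN x. en (2 powr ?s) * epowr (Ac al x / 2) ?s)"
  proof (rule nn_integral_cong, goal_cases)
   case (1 x)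
   show ?case
    unfolding 2[symmetric] epowr_mult[symmetric] ennreal_two_times_half ..
  qed
  also have "... = en (2 powr ?s) * (LN x. epowr (Ac al x / 2) ?s)" by (rule nn_integral_cmult) measurable
  also have "... <= en (2 powr ?s) * ?I"
  proof (intro mult_left_mono nn_integral_mono)
   fix x
   have "Ac al x / 2 <= epowr (Aop J al F x) 2" by (intro divide_le_posI_ennreal Ac_le_Aop) simp
   from epowr_mono[OF this, of ?s] show "epowr (Ac al x / 2) ?s <= epowr (Aop J al F x) p" using p by (simp add: epowr_epowr)
  qed simp
  finally have C: "(LN x. epowr (Ac al x) ?s) <= en (2 powr ?s) * ?I" .
  have "(LN x. epowr (Aop J bt F x) p) <= (LN x. en (2 powr ?s) * epowr (Ac bt x) ?s)"
   using epowr_mono[OF Aop_le_Ac[OF U], of ?s] p by (intro nn_integral_mono) (simp add: epowr_epowr epowr_mult 2)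
  also have "... = en (2 powr ?s) * (LN x. epowr (Ac bt x) ?s)" by (rule nn_integral_cmult) measurable
  also have "... <= en (2 powr ?s) * (en K0 * (LN x. epowr (Ac al x) ?s))" by (intro mult_left_mono K0(2)[OF u]) simp
  also have "... <= en (2 powr ?s) * (en K0 * (en (2 powr ?s) * ?I))" by (intro mult_left_mono C) auto
  also have "... = en (4 powr ?s * K0) * ?I"
  proof -
   have "4 powr ?s * K0 = 2 powr ?s * (K0 * 2 powr ?s)" using powr_mult[of 2 2 ?s] by simp
   thus ?thesis using K0(1) by (simp add: ennreal_mult mult.assoc mult.left_commute)
  qed
  finally have "(LN x. epowr (Aop J bt F x) p) <= en (4 powr ?s * K0) * ?I" .
  from epowr_mono[OF this, of "1 / p"] show ?thesis using p K0(1) by (simp add: Lpn_def K_def epowr_mult epowr_ennreal)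
 qed
 moreover have "0 < K" using K0(1) by (simp add: K_def)
 ultimately show ?thesis by blast
qed

end

theorem theorem4p4:
  fixes J :: "'x::banach \<Rightarrow> 'x"
  assumes "complex_structure J"
  shows
   "(UMD TYPE('x) \<longrightarrow>
      (\<forall>p q \<alpha>. 1 < p \<and> 0 < q \<and> 0 < \<alpha> \<longrightarrow>
        (\<exists>C::real. C > 0 \<and> (\<forall>F :: ('n::finite) uhs \<Rightarrow> 'x. strongly_measurable uhs F \<longrightarrow>
           Lpn (ennreal p) (Aop J \<alpha> F) \<le> ennreal C * Lpn (ennreal p) (Cq J \<alpha> q F)))))
    \<and>
    (\<forall>(p::ennreal) q \<alpha>. 0 < q \<and> ennreal q < p \<and> 0 < \<alpha> \<longrightarrow>
        (\<exists>C::real. C > 0 \<and> (\<forall>F :: ('n::finite) uhs \<Rightarrow> 'x. strongly_measurable uhs F \<longrightarrow>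
           Lpn p (Cq J \<alpha> q F) \<le> ennreal C * Lpn p (Aop J \<alpha> F))))
    \<and>
    (UMD TYPE('x) \<longrightarrow>
      (\<forall>p q \<alpha> \<beta>. 0 < q \<and> q \<le> 1 \<and> 1 < p \<and> 0 < \<alpha> \<and> 0 < \<beta> \<longrightarrow>
        (\<exists>C::real. C > 0 \<and> (\<forall>F :: ('n::finite) uhs \<Rightarrow> 'x. strongly_measurable uhs F \<longrightarrow>
           Lpn (ennreal p) (Aop J \<alpha> F) \<le> ennreal C * Lpn (ennreal p) (Cq J \<beta> q F) \<and>
           Lpn (ennreal p) (Cq J \<beta> q F) \<le> ennreal C * Lpn (ennreal p) (Aop J \<alpha> F)))))"
proof (intro conjI impI allI)
 interpret complex_banach J by unfold_locales (rule assms)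
 fix p q \<alpha> :: real assume "UMD TYPE('x)" "1 < p & 0 < q & 0 < \<alpha>"
 thus "EX C::real. C > 0 & (ALL F :: 'n uhs => 'x. sm uhs F --> Lpn (en p) (Aop J \<alpha> F) <= en C * Lpn (en p) (Cq J \<alpha> q F))"
  using Aop_le_Cq[of p q \<alpha>, where 'n='n] by blast
next
 interpret complex_banach J by unfold_locales (rule assms)
 fix p :: ennreal and q \<alpha> :: real assume "0 < q & en q < p & 0 < \<alpha>"
 thus "EX C::real. C > 0 & (ALL F :: 'n uhs => 'x. sm uhs F --> Lpn p (Cq J \<alpha> q F) <= en C * Lpn p (Aop J \<alpha> F))"
  using Lpn_Cq_le_Aop[of q p \<alpha>, where 'n='n] by blast
next
 interpret complex_banach J by unfold_locales (rule assms)
 fix p q \<alpha> \<beta> :: real assume U: "UMD TYPE('x)" and a: "0 < q & q <= 1 & 1 < p & 0 < \<alpha> & 0 < \<beta>"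
 \<comment> \<open>Both inequalities pass through \<open>Aop\<close> at the aperture \<beta> of
   \<open>Cq\<close>, where the bounds for equal apertures apply.\<close>
 obtain A where A: "0 < A" "!!F :: 'n uhs => 'x. sm uhs F ==> Lpn (en p) (Aop J \<alpha> F) <= en A * Lpn (en p) (Aop J \<beta> F)"
  using Aop_aperture[OF U, of p \<beta> \<alpha>, where 'n='n] a by auto
 obtain B where B: "0 < B" "!!F :: 'n uhs => 'x. sm uhs F ==> Lpn (en p) (Aop J \<beta> F) <= en B * Lpn (en p) (Aop J \<alpha> F)"
  using Aop_aperture[OF U, of p \<alpha> \<beta>, where 'n='n] a by auto
 obtain D where D: "0 < D" "!!F :: 'n uhs => 'x. sm uhs F ==> Lpn (en p) (Aop J \<beta> F) <= en D * Lpn (en p) (Cq J \<beta> q F)"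
  using Aop_le_Cq[OF U, of p q \<beta>, where 'n='n] a by auto
 have "en q < en p" using a by (simp add: ennreal_less_iff)
 then obtain E where E: "0 < E" "!!F :: 'n uhs => 'x. Lpn (en p) (Cq J \<beta> q F) <= en E * Lpn (en p) (Aop J \<beta> F)"
  using Lpn_Cq_le_Aop[of q "en p" \<beta>, where 'n='n] a by auto
 show "EX C::real. C > 0 & (ALL F :: 'n uhs => 'x. sm uhs F -->
   Lpn (en p) (Aop J \<alpha> F) <= en C * Lpn (en p) (Cq J \<beta> q F) & Lpn (en p) (Cq J \<beta> q F) <= en C * Lpn (en p) (Aop J \<alpha> F))"
 proof (intro exI[of _ "max (A * D) (E * B)"] conjI allI impI)
  fix F :: "'n uhs => 'x" assume F: "sm uhs F"
  have "Lpn (en p) (Aop J \<alpha> F) <= en A * (en D * Lpn (en p) (Cq J \<beta> q F))"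
   by (rule order_trans[OF A(2)[OF F] mult_left_mono[OF D(2)[OF F]]]) simp
  also have "... <= en (max (A * D) (E * B)) * Lpn (en p) (Cq J \<beta> q F)"
   unfolding mult.assoc[symmetric] using A(1) D(1) by (intro mult_right_mono) (auto simp: ennreal_leI simp flip: ennreal_mult)
  finally show "Lpn (en p) (Aop J \<alpha> F) <= en (max (A * D) (E * B)) * Lpn (en p) (Cq J \<beta> q F)" .
  have "Lpn (en p) (Cq J \<beta> q F) <= en E * (en B * Lpn (en p) (Aop J \<alpha> F))"
   by (rule order_trans[OF E(2) mult_left_mono[OF B(2)[OF F]]]) simp
  also have "... <= en (max (A * D) (E * B)) * Lpn (en p) (Aop J \<alpha> F)"
   unfolding mult.assoc[symmetric] using E(1) B(1) by (intro mult_right_mono) (auto simp: ennreal_leI simp flip: ennreal_mult)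
  finally show "Lpn (en p) (Cq J \<beta> q F) <= en (max (A * D) (E * B)) * Lpn (en p) (Aop J \<alpha> F)" .
 qed (use A(1) D(1) in \<open>simp add: less_max_iff_disj\<close>)
qed

end
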